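(* Let $q\in\{0,1\}$, and let $\pm=-$ if $q=0$ and $\pm=+$ if $q=1$. The following assignments define algebra isomorphisms: $$\varphi_q:\ \widetilde X(\mathfrak{so}_3,\mathfrak{so}_{3-q})^{tw}\to\widetilde{\mathcal B}(2,q),\qquad \widetilde S(u)\mapsto\tfrac{4u}{4u-1}\,\tfrac12R^\circ(-1)\,\widetilde B^\circ_1(2u-\tfrac12)\,R^\circ(4u)\,\widetilde B^\circ_2(2u+\tfrac12),$$ $$\varphi_q':\ \widetilde X(\mathfrak{so}_3,\mathfrak{so}_{3-q})^{tw}\to\widetilde Y^\pm(2),\qquad \widetilde S(u)\mapsto\tfrac12R^\circ(-1)\,\widetilde S^\circ_1(2u-1)\,R^\circ(-4u+1)^{t_\pm}\,\widetilde S^\circ_2(2u)\,(K_1K_2)^q.$$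
   Context: All algebras are unital associative over $\mathbb C$. Subscripts $1,2$ on matrices denote tensor factors; $P=\sum E_{ij}\otimes E_{ji}$. $2\times2$ notation: indices in $\{-1,1\}$, $K=E_{11}-E_{-1,-1}$, $(E_{ij})^{t_+}=E_{-j,-i}$, $(E_{ij})^{t_-}=\mathrm{sign}(i)\,\mathrm{sign}(j)E_{-j,-i}$, $Q^\pm$ the partial transpose of $P$ under $t_\pm$, $R^\circ(u)=I-\frac Pu$, $R^\circ(u)^{t_\pm}=I-\frac{Q^\pm}{u}$. - $\widetilde{\mathcal B}(2,q)$ is generated by the coefficients of the $2\times 2$ matrix $\widetilde B^\circ(u)=E_{-1,-1}+(-1)^qE_{11}+O(u^{-1})$ with the only relation $R^\circ(u-v)\widetilde B^\circ_1(u)R^\circ(u+v)\widetilde B^\circ_2(v)=\widetilde B^\circ_2(v)R^\circ(u+v)\widetilde B^\circ_1(u)R^\circ(u-v)$. - $\widetilde Y^\pm(2)$ is generated by the coefficients of the $2\times2$ matrix $\widetilde S^\circ(u)=I+O(u^{-1})$ with the only relation $R^\circ(u-v)\widetilde S^\circ_1(u)R^\circ(-u-v)^{t_\pm}\widetilde S^\circ_2(v)=\widetilde S^\circ_2(v)R^\circ(-u-v)^{t_\pm}\widetilde S^\circ_1(u)R^\circ(u-v)$. - $\widetilde X(\mathfrak{so}_3,\mathfrak{so}_{3-q})^{tw}$: $3\times3$ matrices are indexed by $\{-1,0,1\}$, $Q=\sum E_{ij}\otimes E_{-i,-j}$, $R(u)=I-\frac Pu+\frac Q{u-1/2}$. It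 is generated by the coefficients of the $3\times3$ matrix $\widetilde S(u)=\mathcal G+O(u^{-1})$, where $\mathcal G=I$ if $q=0$ and $\mathcal G=\mathrm{diag}(1,-1,1)$ if $q=1$, with the only relation $R(u-v)\widetilde S_1(u)R(u+v)\widetilde S_2(v)=\widetilde S_2(v)R(u+v)\widetilde S_1(u)R(u-v)$. Identification: let $e_{-1},e_1$ be the standard basis of $\mathbb C^2$ and $V\subset\mathbb C^2\otimes\mathbb C^2$ be spanned by $v_{-1}=e_{-1}\otimes e_{-1}$, $v_0=\frac1{\sqrt2}(e_{-1}\otimes e_1+e_1\otimes e_{-1})$, $v_1=-e_1\otimes e_1$; $\frac12R^\circ(-1)=\frac12(I+P)$ is the projector onto $V$. With $\langle e_a\otimes e_b\,|\,e_c\otimes e_d\rangle=\delta_{ac}\delta_{bd}$, a formula $\widetilde S(u)\mapsto A^\circ(u)$, with $A^\circ(u)$ an operator on $\mathbb C^2\otimes\mathbb C^2$ with entries in the target algebra, means $\widetilde s_{ij}(u)\mapsto\langle v_i\,|\,A^\circ(u)v_j\rangle$ for $i,j\in\{-1,0,1\}$. *)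

theory Defs
  imports
    "HOL-Analysis.Analysis"
    "HOL-Library.Poly_Mapping"
    "HOL-Computational_Algebra.Formal_Laurent_Series"
    "HOL-Algebra.QuotRing"
    "HOL-Algebra.Algebraic_Closure_Type"
begin

unbundle no fps_syntax

section \<open>Associative algebras given by generators and relations\<close>

text \<open>The free monoid: lists under concatenation.\<close>

instantiation list :: (type) monoid_add
begin
definition zero_list :: "'a list" where "zero_list = []"
definition plus_list :: "'a list \<Rightarrow> 'a list \<Rightarrow> 'a list" where "plus_list = append"
instance by standard (simp_all add: zero_list_def plus_list_def)
end

text \<open>The free unital associative algebra over the complex numbers on the set of all elements of
  a type is the monoid algebra of the free monoid.\<close>

type_synonym 'g free_alg = "'g list \<Rightarrow>\<^sub>0 complex"

definition scal :: "complex \<Rightarrow> 'g free_alg"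
  where "scal c = Poly_Mapping.single [] c"

definition gen :: "'g \<Rightarrow> 'g free_alg"
  where "gen g = Poly_Mapping.single [g] 1"

text \<open>\<open>Idl\<close> is the two-sided ideal generated by a set.\<close>

definition rel_ideal :: "'g free_alg set \<Rightarrow> 'g free_alg set"
  where "rel_ideal rels = Idl\<^bsub>ring_of_type_algebra\<^esub> rels"

definition presented_alg :: "'g free_alg set \<Rightarrow> 'g free_alg set ring"
  where "presented_alg rels = ring_of_type_algebra Quot rel_ideal rels"

definition cls :: "'g free_alg set \<Rightarrow> 'g free_alg \<Rightarrow> 'g free_alg set"
  where "cls rels a = rel_ideal rels +>\<^bsub>ring_of_type_algebra\<^esub> a"

text \<open>The scalar \<open>c\<close> acts on a presented algebra as multiplication by the class of \<open>scal c\<close>.\<close>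

definition algebra_iso ::
    "'g free_alg set \<Rightarrow> 'h free_alg set \<Rightarrow> ('g free_alg set \<Rightarrow> 'h free_alg set) \<Rightarrow> bool"
  where "algebra_iso rels rels' \<phi> \<longleftrightarrow>
    \<phi> \<in> ring_iso (presented_alg rels) (presented_alg rels') \<and>
    (\<forall>c. \<forall>x\<in>carrier (presented_alg rels).
       \<phi> (cls rels (scal c) \<otimes>\<^bsub>presented_alg rels\<^esub> x) =
       cls rels' (scal c) \<otimes>\<^bsub>presented_alg rels'\<^esub> \<phi> x)"

section \<open>Index sets and matrices\<close>

text \<open>The index sets \<open>{-1, 1}\<close> and \<open>{-1, 0, 1}\<close>.\<close>

datatype ix2 = Neg2 | Pos2
datatype ix3 = Neg3 | Zero3 | Pos3

lemma UNIV_ix2: "UNIV = {Neg2, Pos2}"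
  using ix2.exhaust by auto

lemma UNIV_ix3: "UNIV = {Neg3, Zero3, Pos3}"
  using ix3.exhaust by auto

instance ix2 :: finite by standard (simp add: UNIV_ix2)
instance ix3 :: finite by standard (simp add: UNIV_ix3)

instantiation ix2 :: uminus
begin
fun uminus_ix2 :: "ix2 \<Rightarrow> ix2" where "- Neg2 = Pos2" | "- Pos2 = Neg2"
instance ..
end

instantiation ix3 :: uminus
begin
fun uminus_ix3 :: "ix3 \<Rightarrow> ix3" where "- Neg3 = Pos3" | "- Zero3 = Zero3" | "- Pos3 = Neg3"
instance ..
end

definition map_mat :: "('a \<Rightarrow> 'b) \<Rightarrow> 'a^'n^'m \<Rightarrow> 'b^'n^'m"
  where "map_mat f A = (\<chi> i j. f (A $ i $ j))"

definition scale :: "'a::times \<Rightarrow> 'a^'n^'m \<Rightarrow> 'a^'n^'m"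
  where "scale c = map_mat ((*) c)"

definition munit :: "'n \<Rightarrow> 'n \<Rightarrow> 'a::zero_neq_one^'n^'n"
  where "munit i j = (\<chi> k l. if k = i \<and> l = j then 1 else 0)"

definition diag_mat :: "('n \<Rightarrow> 'a::zero) \<Rightarrow> 'a^'n^'n"
  where "diag_mat d = (\<chi> i j. if i = j then d i else 0)"

text \<open>Operators on \<open>\<complex>\<^sup>n \<otimes> \<complex>\<^sup>n\<close> are matrices indexed by pairs; \<open>tens1 A\<close> and \<open>tens2 A\<close> are
  \<open>A\<^sub>1\<close> and \<open>A\<^sub>2\<close>.\<close>

definition tens :: "'a::times^'n^'n \<Rightarrow> 'a^'n^'n \<Rightarrow> 'a^('n \<times> 'n)^('n \<times> 'n)"
  where "tens A B = (\<chi> \<alpha> \<beta>. A $ fst \<alpha> $ fst \<beta> * B $ snd \<alpha> $ snd \<beta>)"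

definition tens1 :: "'a::semiring_1^'n^'n \<Rightarrow> 'a^('n \<times> 'n)^('n \<times> 'n)"
  where "tens1 A = tens A (mat 1)"

definition tens2 :: "'a::semiring_1^'n^'n \<Rightarrow> 'a^('n \<times> 'n)^('n \<times> 'n)"
  where "tens2 A = tens (mat 1) A"

definition Pmat :: "'a::ring_1^('n::finite \<times> 'n)^('n \<times> 'n)"
  where "Pmat = (\<Sum>i\<in>UNIV. \<Sum>j\<in>UNIV. tens (munit i j) (munit j i))"

section \<open>The transpositions and R-matrices\<close>

datatype tsign = TPlus | TMinus

fun ix2_sign :: "ix2 \<Rightarrow> 'a::ring_1" where
  "ix2_sign Neg2 = -1"
| "ix2_sign Pos2 = 1"

definition tr_coeff :: "tsign \<Rightarrow> ix2 \<Rightarrow> ix2 \<Rightarrow> 'a::ring_1"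
  where "tr_coeff \<epsilon> i j = (case \<epsilon> of TPlus \<Rightarrow> 1 | TMinus \<Rightarrow> ix2_sign i * ix2_sign j)"

text \<open>The partial transposition, applied to the second tensor factor; see \<open>ptrans_tens_munit\<close>.
  On \<open>P\<close>, and hence on \<open>R\<^sup>\<circ>(u)\<close>, transposing the first factor gives the same result.\<close>

definition ptrans :: "tsign \<Rightarrow> 'a::ring_1^(ix2 \<times> ix2)^(ix2 \<times> ix2) \<Rightarrow> 'a^(ix2 \<times> ix2)^(ix2 \<times> ix2)"
  where "ptrans \<epsilon> M = (\<chi> \<alpha> \<beta>.
    tr_coeff \<epsilon> (- snd \<beta>) (- snd \<alpha>) * M $ (fst \<alpha>, - snd \<beta>) $ (fst \<beta>, - snd \<alpha>))"

lemma ptrans_tens_munit: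
  fixes A :: "'a::comm_ring_1^ix2^ix2"
  shows "ptrans \<epsilon> (tens A (munit i j)) = tens A (scale (tr_coeff \<epsilon> i j) (munit (- j) (- i)))"
proof -
  have neg: "- (- k) = k" "- k = l \<longleftrightarrow> k = - l" for k l :: ix2
    by (cases k; cases l; simp)+
  show ?thesis
    by (auto simp: vec_eq_iff ptrans_def tens_def munit_def scale_def map_mat_def neg)
qed

definition R2 :: "'k::field \<Rightarrow> 'k^(ix2 \<times> ix2)^(ix2 \<times> ix2)"
  where "R2 u = mat 1 - scale (1 / u) Pmat"

definition Qmat3 :: "'a::ring_1^(ix3 \<times> ix3)^(ix3 \<times> ix3)"
  where "Qmat3 = (\<Sum>i\<in>UNIV. \<Sum>j\<in>UNIV. tens (munit i j) (munit (- i) (- j)))"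

definition R3 :: "'k::field \<Rightarrow> 'k^(ix3 \<times> ix3)^(ix3 \<times> ix3)"
  where "R3 u = mat 1 - scale (1 / u) Pmat + scale (1 / (u - 1/2)) Qmat3"

section \<open>Formal series in the inverse spectral parameters\<close>

text \<open>Applied only to \<open>f\<close> with \<open>f 0 = 0\<close>, so that the result is again a Laurent series.\<close>

definition fls_map :: "('a::zero \<Rightarrow> 'b::zero) \<Rightarrow> 'a fls \<Rightarrow> 'b fls"
  where "fls_map f F = Abs_fls (\<lambda>n. f (fls_nth F n))"

text \<open>The series variable is \<open>u\<^sup>-\<^sup>1\<close>, that is, \<open>u\<close> is \<open>fls_X_inv\<close>. The generator \<open>(i, j, r)\<close> stands
  for the coefficient of \<open>u\<close> to the power \<open>-(r + 1)\<close> in entry \<open>(i, j)\<close>; the constant term is the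
  given matrix.\<close>

definition gen_mat :: "complex^'n^'n \<Rightarrow> ('n \<times> 'n \<times> nat) free_alg fps^'n^'n"
  where "gen_mat G =
    (\<chi> i j. Abs_fps (\<lambda>r. case r of 0 \<Rightarrow> scal (G $ i $ j) | Suc k \<Rightarrow> gen (i, j, k)))"

text \<open>Substitution of \<open>w = a u + b\<close> (\<open>a \<noteq> 0\<close>) for the spectral parameter of a series in its inverse:
  \<open>1 / w\<close> is a power series in \<open>u\<^sup>-\<^sup>1\<close> without constant term.\<close>

definition subst_param :: "'g free_alg fps \<Rightarrow> complex fls \<Rightarrow> 'g free_alg fls"
  where "subst_param F w = fps_to_fls (fps_compose F (fls_regpart (fls_map scal (1 / w))))"

text \<open>Relations in \<open>u\<close> and \<open>v\<close> are read in Laurent series in \<open>u\<^sup>-\<^sup>1\<close> whose coefficients are Laurent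
  series in \<open>v\<^sup>-\<^sup>1\<close>. Rational functions of \<open>u\<close> and \<open>v\<close> lie in the field \<open>complex fls fls\<close> and are
  embedded coefficientwise. As \<open>u \<plusminus> v\<close> and the other denominators are central units
  there, the relations are equivalent to those obtained by clearing denominators, and do not
  depend on the direction of expansion.\<close>

definition par_u :: "complex fls fls" where "par_u = fls_X_inv"
definition par_v :: "complex fls fls" where "par_v = fls_const fls_X_inv"

definition in_u :: "'g free_alg fps \<Rightarrow> 'g free_alg fls fls"
  where "in_u F = fls_map fls_const (fps_to_fls F)"

definition in_v :: "'g free_alg fps \<Rightarrow> 'g free_alg fls fls"
  where "in_v F = fls_const (fps_to_fls F)"

definition refl_rels ::
    "complex fls fls^('n \<times> 'n)^('n \<times> 'n) \<Rightarrow> complex fls fls^('n \<times> 'n)^('n \<times> 'n) \<Rightarrow>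
     complex^'n^'n \<Rightarrow> ('n::finite \<times> 'n \<times> nat) free_alg set"
  where "refl_rels Rm Rp G =
    (let emb = map_mat (fls_map (fls_map scal));
         S1 = tens1 (map_mat in_u (gen_mat G));
         S2 = tens2 (map_mat in_v (gen_mat G));
         D = emb Rm ** S1 ** emb Rp ** S2 - S2 ** emb Rp ** S1 ** emb Rm
     in {fls_nth (fls_nth (D $ \<alpha> $ \<beta>) m) n | \<alpha> \<beta> m n. True})"

section \<open>The three algebras\<close>

definition B_lead :: "nat \<Rightarrow> complex^ix2^ix2"
  where "B_lead q = munit Neg2 Neg2 + scale ((-1) ^ q) (munit Pos2 Pos2)"

definition B_rels :: "nat \<Rightarrow> (ix2 \<times> ix2 \<times> nat) free_alg set"
  where "B_rels q = refl_rels (R2 (par_u - par_v)) (R2 (par_u + par_v)) (B_lead q)"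

definition Y_rels :: "tsign \<Rightarrow> (ix2 \<times> ix2 \<times> nat) free_alg set"
  where "Y_rels \<epsilon> = refl_rels (R2 (par_u - par_v)) (ptrans \<epsilon> (R2 (- par_u - par_v))) (mat 1)"

definition X_lead :: "nat \<Rightarrow> complex^ix3^ix3"
  where "X_lead q =
    (if q = 0 then mat 1 else diag_mat (\<lambda>i. case i of Neg3 \<Rightarrow> 1 | Zero3 \<Rightarrow> -1 | Pos3 \<Rightarrow> 1))"

definition X_rels :: "nat \<Rightarrow> (ix3 \<times> ix3 \<times> nat) free_alg set"
  where "X_rels q = refl_rels (R3 (par_u - par_v)) (R3 (par_u + par_v)) (X_lead q)"

definition X_gen_mat :: "nat \<Rightarrow> (ix3 \<times> ix3 \<times> nat) free_alg fls^ix3^ix3"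
  where "X_gen_mat q = map_mat fps_to_fls (gen_mat (X_lead q))"

section \<open>The assignments\<close>

text \<open>The vectors \<open>v\<^sub>i\<close> have real coordinates, so no conjugation occurs in \<open>\<langle>v\<^sub>i | A v\<^sub>j\<rangle>\<close>.\<close>

fun vvec :: "ix3 \<Rightarrow> complex^(ix2 \<times> ix2)" where
  "vvec Neg3 = axis (Neg2, Neg2) 1"
| "vvec Zero3 = (1 / of_real (sqrt 2)) *s (axis (Neg2, Pos2) 1 + axis (Pos2, Neg2) 1)"
| "vvec Pos3 = - axis (Pos2, Pos2) 1"

definition compress ::
    "'g free_alg fls^(ix2 \<times> ix2)^(ix2 \<times> ix2) \<Rightarrow> 'g free_alg fls^ix3^ix3"
  where "compress A = (\<chi> i j. \<Sum>\<alpha>\<in>UNIV. \<Sum>\<beta>\<in>UNIV.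
    fls_const (scal (vvec i $ \<alpha>)) * A $ \<alpha> $ \<beta> * fls_const (scal (vvec j $ \<beta>)))"

definition emb1 :: "complex fls^'n^'m \<Rightarrow> 'g free_alg fls^'n^'m"
  where "emb1 = map_mat (fls_map scal)"

definition at_param :: "'g free_alg fps^'n^'m \<Rightarrow> complex fls \<Rightarrow> 'g free_alg fls^'n^'m"
  where "at_param A w = map_mat (\<lambda>F. subst_param F w) A"

definition K1K2 :: "complex fls^(ix2 \<times> ix2)^(ix2 \<times> ix2)"
  where "K1K2 = (let K = munit Pos2 Pos2 - munit Neg2 Neg2 in tens1 K ** tens2 K)"

definition phi_B :: "nat \<Rightarrow> (ix2 \<times> ix2 \<times> nat) free_alg fls^ix3^ix3"
  where "phi_B q =
    (let u = fls_X_inv; B = gen_mat (B_lead q)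
     in compress
          (emb1 (scale (4 * u / (4 * u - 1)) (scale (1/2) (R2 (-1))))
           ** tens1 (at_param B (2 * u - 1/2))
           ** emb1 (R2 (4 * u))
           ** tens2 (at_param B (2 * u + 1/2))))"

definition phi_Y :: "nat \<Rightarrow> tsign \<Rightarrow> (ix2 \<times> ix2 \<times> nat) free_alg fls^ix3^ix3"
  where "phi_Y q \<epsilon> =
    (let u = fls_X_inv; S = gen_mat (mat 1)
     in compress
          (emb1 (scale (1/2) (R2 (-1)))
           ** tens1 (at_param S (2 * u - 1))
           ** emb1 (ptrans \<epsilon> (R2 (- 4 * u + 1)))
           ** tens2 (at_param S (2 * u))
           ** emb1 (((\<lambda>M. M ** K1K2) ^^ q) (mat 1))))"

text \<open>\<open>\<phi>\<close> is an algebra isomorphism between presented algebras carrying the matrix of series \<open>S\<close>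
  to the matrix of series \<open>A\<close>.\<close>

definition iso_with_values ::
    "'g free_alg set \<Rightarrow> 'h free_alg set \<Rightarrow> 'g free_alg fls^'n^'n \<Rightarrow> 'h free_alg fls^'n^'n \<Rightarrow>
     ('g free_alg set \<Rightarrow> 'h free_alg set) \<Rightarrow> bool"
  where "iso_with_values rels rels' S A \<phi> \<longleftrightarrow>
    algebra_iso rels rels' \<phi> \<and>
    (\<forall>i j n. \<phi> (cls rels (fls_nth (S $ i $ j) n)) = cls rels' (fls_nth (A $ i $ j) n))"

end

theory Submission imports Defs "HOL-Combinatorics.Transposition" begin

unbundle no fps_syntax

text \<open>
  Fusion: the product \<open>B\<^sub>1(2u - 1/2) R(4u) B\<^sub>2(2u + 1/2)\<close> preserves the symmetric square up to a multiple
  of the reflection defect of \<open>B\<close>, so Yang--Baxter moves on four tensor factors turn the reflection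
  equation of \<open>B\<close> into that of the fused matrix. For the converse let \<open>S\<close> be the generating matrix of the
  orthogonal algebra. Four entries of the fused matrix depend triangularly on the coefficients of \<open>B\<close>,
  hence there is a unique matrix \<open>\<beta>\<close> over the free algebra whose fusion \<open>S\<^sup>0\<close> agrees with \<open>S\<close>
  in these entries. Modulo the relations of \<open>S\<close>, both \<open>E = S - S\<^sup>0\<close> and the reflection defect \<open>D\<close> of
  \<open>\<beta>\<close> vanish by descent along the degree filtration: the leading term of the \<open>S\<close>-relation, restricted
  to \<open>v = u\<close> after clearing denominators, no longer involves \<open>D\<close> and kills the leading term of \<open>E\<close>; then
  its leading term is that of \<open>D\<close>. Finally \<open>S(u) = B(u + 1/2) diag(1, (-1)\<^sup>q)\<close> identifies the twisted
  Yangian with the reflection algebra and \<open>\<phi>'\<close> with \<open>\<phi>\<close>.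
\<close>

text \<open>No basis theorem is used, so nothing is compared by size: two explicit substitutions are
  composed in both orders and evaluated on generators. Starting from \<open>B\<close> the composite
  is the identity already in the free algebra, as the triangular system has one solution only; from
  \<open>S\<close> it is so modulo the ideal, which takes the descent. The generator at u^-(r+1) has
  degree r. Modulo lower terms every matrix is then constant diagonal and every R-matrix is 1, so
  leading terms are linear in the two defects. Both defects enter the \<open>S\<close>-relation
  together, which is the obstacle. They separate because the reflection equation, multiplied by u^2
  - v^2, holds identically at v = u: there R(u - v) becomes a multiple of P and merely exchanges the
  two factors. Each round gains one degree, so a given coefficient finally lies in the ideal plus a
  negative degree, that is, in the ideal. Estimates refer to a filtration \<open>F\<close> of the
  ring and one \<open>W\<close> of bimodules. The same framework thus serves congruences modulo the
  ideal (\<open>W\<close> constant), the descent (\<open>W\<close> the ideal plus \<open>F\<close>)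
  and the triangular system (filtration by order).\<close>

section \<open>The free algebra and its universal property\<close>

lemma zero_list_eq [simp]: "(0 :: 'g list) = []"
  by (simp add: zero_list_def)

lemma plus_list_eq [simp]: "(v :: 'g list) + w = v @ w"
  by (simp add: plus_list_def)

lemma scal_0 [simp]: "scal 0 = 0"
  and scal_1 [simp]: "scal 1 = 1"
  and scal_add: "scal (a + b) = scal a + scal b"
  and scal_mult: "scal (a * b) = scal a * scal b"
  and scal_uminus: "scal (- a) = - scal a"
  by (simp_all add: scal_def single_add mult_single single_uminus flip: single_one)

lemma free_alg_induct [case_names add word]:
  assumes "\<And>p q. P p \<Longrightarrow> P q \<Longrightarrow> P (p + q)"
    and "\<And>c w. P (Poly_Mapping.single w c)"
  shows "P (p :: 'g free_alg)"
proof -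
  have 0: "P 0" using assms(2)[of undefined 0] by simp
  have "P (\<Sum>w\<in>A. Poly_Mapping.single w (Poly_Mapping.lookup p w))" if "finite A" for A
    using that by induction (use 0 assms in auto)
  moreover have "(\<Sum>w\<in>Poly_Mapping.keys p. Poly_Mapping.single w (Poly_Mapping.lookup p w)) = p"
    by (rule poly_mapping_eqI) (simp add: lookup_sum lookup_single when_def in_keys_iff)
  ultimately show ?thesis
    by (metis finite_keys)
qed

lemma scal_central: "scal c * (p :: 'g free_alg) = p * scal c"
proof (induction p rule: free_alg_induct)
  case (add p q)
  then show ?case by (simp add: algebra_simps)
next
  case (word a w)
  then show ?case by (simp add: scal_def mult_single mult.commute)
qed

lemma single_word: "Poly_Mapping.single w c = scal c * prod_list (map gen w)"
proof -
  have "prod_list (map gen w) = Poly_Mapping.single w 1"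
  proof (induction w)
    case (Cons a w)
    then show ?case by (simp add: gen_def mult_single)
  qed (simp flip: single_one)
  then show ?thesis by (simp add: scal_def mult_single)
qed

lemma free_alg_induct' [case_names add mult scal gen]:
  assumes "\<And>p q. P p \<Longrightarrow> P q \<Longrightarrow> P (p + q)" "\<And>p q. P p \<Longrightarrow> P q \<Longrightarrow> P (p * q)"
    and "\<And>c. P (scal c)" "\<And>g. P (gen g)"
  shows "P (p :: 'g free_alg)"
proof (induction p rule: free_alg_induct)
  case (word c w)
  have "P (prod_list (map gen w))"
    by (induction w) (use assms(3)[of 1] assms in auto)
  then show ?case
    unfolding single_word by (intro assms)
qed (rule assms)

text \<open>The homomorphism provided by the universal property of the free algebra; on a word the
  images of the letters are multiplied in order.\<close>

definition fext :: "('g \<Rightarrow> 'h free_alg) \<Rightarrow> 'g free_alg \<Rightarrow> 'h free_alg"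
  where "fext f p = (\<Sum>w\<in>Poly_Mapping.keys p. scal (Poly_Mapping.lookup p w) * prod_list (map f w))"

lemma fext_superset:
  "finite A \<Longrightarrow> Poly_Mapping.keys p \<subseteq> A \<Longrightarrow>
    fext f p = (\<Sum>w\<in>A. scal (Poly_Mapping.lookup p w) * prod_list (map f w))"
  unfolding fext_def by (intro sum.mono_neutral_left) (auto simp: in_keys_iff)

lemma fext_add: "fext f (p + q) = fext f p + fext f q"
proof -
  let ?A = "Poly_Mapping.keys p \<union> Poly_Mapping.keys q"
  have "finite ?A" "Poly_Mapping.keys (p + q) \<subseteq> ?A"
    using Poly_Mapping.keys_add[of p q] by auto
  then show ?thesis
    by (simp add: fext_superset[of ?A] lookup_add scal_add distrib_right sum.distrib)
qed

lemma fext_single: "fext f (Poly_Mapping.single w c) = scal c * prod_list (map f w)"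
  by (cases "c = 0") (simp_all add: fext_def)

lemma fext_scal [simp]: "fext f (scal c) = scal c"
  by (simp add: scal_def fext_single)

lemma fext_gen [simp]: "fext f (gen g) = f g"
  by (simp add: gen_def fext_single)

lemma fext_0 [simp]: "fext f 0 = 0" and fext_1 [simp]: "fext f 1 = 1"
  using fext_scal[of f 0] fext_scal[of f 1] by simp_all

lemma fext_mult: "fext f (p * q) = fext f p * fext f q"
proof (induction p rule: free_alg_induct)
  case (add p p')
  then show ?case by (simp add: fext_add algebra_simps)
next
  case (word a v)
  show ?case
  proof (induction q rule: free_alg_induct)
    case (add q q')
    then show ?case by (simp add: fext_add algebra_simps)
  next
    case (word b w)
    have "scal a * scal b * (prod_list (map f v) * prod_list (map f w)) =
      scal a * prod_list (map f v) * (scal b * prod_list (map f w))"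
      by (metis mult.assoc scal_central)
    then show ?case by (simp add: mult_single fext_single scal_mult)
  qed
qed

lemma fext_uminus: "fext f (- p) = - fext f p"
  by (metis add.right_inverse fext_0 fext_add add_eq_0_iff)

lemma fext_diff: "fext f (p - q) = fext f p - fext f q"
  using fext_add[of f p "- q"] by (simp add: fext_uminus)

section \<open>Ideals of relations and presented algebras\<close>

lemma ring_of_type_algebra_simps [simp]:
  "carrier (ring_of_type_algebra :: 'a::ring_1 ring) = UNIV"
  "x \<oplus>\<^bsub>ring_of_type_algebra :: 'a::ring_1 ring\<^esub> y = x + y"
  "x \<otimes>\<^bsub>ring_of_type_algebra :: 'a::ring_1 ring\<^esub> y = x * y"
  "\<zero>\<^bsub>ring_of_type_algebra :: 'a::ring_1 ring\<^esub> = 0"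
  "\<one>\<^bsub>ring_of_type_algebra :: 'a::ring_1 ring\<^esub> = 1"
  by (simp_all add: ring_of_type_algebra_def)

lemma ring_type_algebra: "ring (ring_of_type_algebra :: 'a::ring_1 ring)"
proof -
  have "\<exists>y. x + y = 0" for x :: 'a
    using add.right_inverse by blast
  then show ?thesis
    unfolding ring_of_type_algebra_def
    by unfold_locales (use add.right_inverse in \<open>auto simp: algebra_simps Units_def\<close>)
qed

lemma ideal_ring_of_type_algebraI:
  assumes "0 \<in> (J :: 'a::ring_1 set)" "\<And>x y. x \<in> J \<Longrightarrow> y \<in> J \<Longrightarrow> x + y \<in> J"
    and "\<And>a x. x \<in> J \<Longrightarrow> a * x \<in> J" "\<And>a x. x \<in> J \<Longrightarrow> x * a \<in> J"
  shows "ideal J ring_of_type_algebra"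
proof (intro idealI ring_type_algebra group.subgroupI)
  interpret ring "ring_of_type_algebra :: 'a ring"
    by (rule ring_type_algebra)
  show "Group.group (add_monoid (ring_of_type_algebra :: 'a ring))"
    by (rule a_group)
  fix a assume a: "a \<in> J"
  have "inv\<^bsub>add_monoid (ring_of_type_algebra :: 'a ring)\<^esub> a = - a"
    by (rule group.inv_equality[OF a_group]) (simp_all add: ring_of_type_algebra_simps)
  with assms(3)[OF a, of "- 1"] show "inv\<^bsub>add_monoid ring_of_type_algebra\<^esub> a \<in> J"
    by simp
qed (use assms in auto)

lemma rel_ideal_ideal: "ideal (rel_ideal rels) ring_of_type_algebra"
  unfolding rel_ideal_def
  by (intro ring.genideal_ideal ring_type_algebra) simp

lemma rel_ideal_zero [simp]: "0 \<in> rel_ideal rels"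
  and rel_ideal_add: "x \<in> rel_ideal rels \<Longrightarrow> y \<in> rel_ideal rels \<Longrightarrow> x + y \<in> rel_ideal rels"
  and rel_ideal_mult_left: "x \<in> rel_ideal rels \<Longrightarrow> a * x \<in> rel_ideal rels"
  and rel_ideal_mult_right: "x \<in> rel_ideal rels \<Longrightarrow> x * a \<in> rel_ideal rels"
  and rel_ideal_base: "x \<in> rels \<Longrightarrow> x \<in> rel_ideal rels"
proof -
  interpret ideal "rel_ideal rels" ring_of_type_algebra
    by (rule rel_ideal_ideal)
  show "0 \<in> rel_ideal rels"
    using additive_subgroup.zero_closed[OF is_additive_subgroup] by simp
  show "x \<in> rel_ideal rels \<Longrightarrow> y \<in> rel_ideal rels \<Longrightarrow> x + y \<in> rel_ideal rels"
    using additive_subgroup.a_closed[OF is_additive_subgroup] by simp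
  show "x \<in> rel_ideal rels \<Longrightarrow> a * x \<in> rel_ideal rels" "x \<in> rel_ideal rels \<Longrightarrow> x * a \<in> rel_ideal rels"
    using I_l_closed[of x a] I_r_closed[of x a] by simp_all
  show "x \<in> rels \<Longrightarrow> x \<in> rel_ideal rels"
    using ring.genideal_self[OF ring_type_algebra, of rels] by (auto simp: rel_ideal_def)
qed

lemma rel_ideal_uminus: "x \<in> rel_ideal rels \<Longrightarrow> - x \<in> rel_ideal rels"
  using rel_ideal_mult_left[of x rels "- 1"] by simp

lemma rel_ideal_diff: "x \<in> rel_ideal rels \<Longrightarrow> y \<in> rel_ideal rels \<Longrightarrow> x - y \<in> rel_ideal rels"
  using rel_ideal_add[of x rels "- y"] rel_ideal_uminus[of y] by simp

text \<open>The preimage of an ideal under a homomorphism is an ideal, and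
  \<open>rel_ideal rels\<close> is the least ideal containing \<open>rels\<close>.\<close>

lemma fext_rel_ideal:
  assumes "\<And>x. x \<in> rels \<Longrightarrow> fext f x \<in> rel_ideal rels'" "x \<in> rel_ideal rels"
  shows "fext f x \<in> rel_ideal rels'"
proof -
  have "ideal {x. fext f x \<in> rel_ideal rels'} ring_of_type_algebra"
    by (rule ideal_ring_of_type_algebraI)
       (auto simp: fext_add fext_mult rel_ideal_add rel_ideal_mult_left rel_ideal_mult_right)
  from ring.genideal_minimal[OF ring_type_algebra this, of rels] assms
  show ?thesis by (auto simp: rel_ideal_def)
qed

lemma mem_cls: "y \<in> cls rels a \<longleftrightarrow> y - a \<in> rel_ideal rels"
proof -
  have "y \<in> cls rels a \<longleftrightarrow> (\<exists>x\<in>rel_ideal rels. y = x + a)"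
    by (auto simp: cls_def a_r_coset_def r_coset_def)
  also have "\<dots> \<longleftrightarrow> y - a \<in> rel_ideal rels"
    by (auto simp: algebra_simps intro!: bexI[of _ "y - a"])
  finally show ?thesis .
qed

lemma cls_eq_iff: "cls rels a = cls rels b \<longleftrightarrow> a - b \<in> rel_ideal rels"
proof
  assume "cls rels a = cls rels b"
  then show "a - b \<in> rel_ideal rels" using mem_cls[of a rels a] mem_cls[of a rels b] by simp
next
  assume *: "a - b \<in> rel_ideal rels"
  have "y - a \<in> rel_ideal rels \<longleftrightarrow> y - b \<in> rel_ideal rels" for y
    using rel_ideal_add[OF _ *, of "y - a"] rel_ideal_diff[OF _ *, of "y - b"] by auto
  then show "cls rels a = cls rels b" by (auto simp: mem_cls)
qed

lemma presented_alg_simps: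
  shows carrier_presented_alg: "carrier (presented_alg rels) = range (cls rels)"
    and cls_mult: "cls rels a \<otimes>\<^bsub>presented_alg rels\<^esub> cls rels b = cls rels (a * b)"
    and cls_add: "cls rels a \<oplus>\<^bsub>presented_alg rels\<^esub> cls rels b = cls rels (a + b)"
    and one_presented_alg: "\<one>\<^bsub>presented_alg rels\<^esub> = cls rels 1"
proof -
  interpret ideal "rel_ideal rels" ring_of_type_algebra
    by (rule rel_ideal_ideal)
  show "carrier (presented_alg rels) = range (cls rels)"
    by (auto simp: presented_alg_def FactRing_def A_RCOSETS_def' cls_def)
  show "cls rels a \<otimes>\<^bsub>presented_alg rels\<^esub> cls rels b = cls rels (a * b)"
    by (simp add: presented_alg_def FactRing_def cls_def rcoset_mult_add)
  show "cls rels a \<oplus>\<^bsub>presented_alg rels\<^esub> cls rels b = cls rels (a + b)"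
    by (simp add: presented_alg_def FactRing_def cls_def a_rcos_sum)
  show "\<one>\<^bsub>presented_alg rels\<^esub> = cls rels 1"
    by (simp add: presented_alg_def FactRing_def cls_def)
qed

text \<open>Substitutions that respect the relations descend to the quotients. That they are
  mutually inverse needs checking on generators only, since the elements that a composite fixes
  modulo an ideal are closed under sums and products and contain the scalars.\<close>

lemma algebra_iso_from_substitutions:
  fixes f :: "'g \<Rightarrow> 'h free_alg" and g :: "'h \<Rightarrow> 'g free_alg"
  assumes f: "\<And>x. x \<in> rels \<Longrightarrow> fext f x \<in> rel_ideal rels'"
    and g: "\<And>x. x \<in> rels' \<Longrightarrow> fext g x \<in> rel_ideal rels"
    and gf: "\<And>x. fext g (f x) - gen x \<in> rel_ideal rels"
    and fg: "\<And>x. fext f (g x) - gen x \<in> rel_ideal rels'"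
  shows "\<exists>\<phi>. algebra_iso rels rels' \<phi> \<and> (\<forall>a. \<phi> (cls rels a) = cls rels' (fext f a))"
proof -
  have f': "fext f x \<in> rel_ideal rels'" if "x \<in> rel_ideal rels" for x
    using f that by (rule fext_rel_ideal)
  have g': "fext g x \<in> rel_ideal rels" if "x \<in> rel_ideal rels'" for x
    using g that by (rule fext_rel_ideal)
  have fg_id: "fext k (fext h x) - x \<in> rel_ideal r"
    if "\<And>x. fext k (h x) - gen x \<in> rel_ideal r" for x r and h :: "'a \<Rightarrow> 'b free_alg" and k
  proof (induction x rule: free_alg_induct')
    case (mult p q)
    have "fext k (fext h (p * q)) - p * q =
      (fext k (fext h p) - p) * fext k (fext h q) + p * (fext k (fext h q) - q)"
      by (simp add: fext_mult algebra_simps)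
    also have "\<dots> \<in> rel_ideal r"
      using mult by (intro rel_ideal_add rel_ideal_mult_left rel_ideal_mult_right)
    finally show ?case .
  next
    case (add p q)
    have "fext k (fext h (p + q)) - (p + q) = (fext k (fext h p) - p) + (fext k (fext h q) - q)"
      by (simp add: fext_add algebra_simps)
    then show ?case using rel_ideal_add[OF add] by (simp only:)
  qed (use that in auto)
  \<comment> \<open>A class is mapped by way of an arbitrary representative; \<open>f'\<close> makes
    the choice immaterial.\<close>
  define F where "F Y = cls rels' (fext f (SOME a. cls rels a = Y))" for Y
  have F: "F (cls rels a) = cls rels' (fext f a)" for a
  proof -
    have "cls rels (SOME b. cls rels b = cls rels a) = cls rels a"
      by (rule someI[of _ a]) (rule refl)
    then show ?thesis
      unfolding F_def cls_eq_iff fext_diff[symmetric] by (rule f')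
  qed
  have "inj_on F (range (cls rels))"
  proof (rule inj_onI, clarsimp simp: F)
    fix a b assume "cls rels' (fext f a) = cls rels' (fext f b)"
    then have "fext g (fext f (a - b)) \<in> rel_ideal rels"
      by (intro g') (simp add: cls_eq_iff fext_diff)
    from rel_ideal_diff[OF this fg_id[OF gf, of "a - b"]] show "cls rels a = cls rels b"
      by (simp add: cls_eq_iff)
  qed
  moreover have "F ` range (cls rels) = range (cls rels')"
  proof (intro equalityI subsetI)
    fix y assume "y \<in> range (cls rels')"
    then obtain b where "y = cls rels' b" by auto
    also have "\<dots> = F (cls rels (fext g b))"
      using rel_ideal_uminus[OF fg_id[OF fg, of b]] by (simp add: F cls_eq_iff)
    finally show "y \<in> F ` range (cls rels)" by auto
  qed (auto simp: F)
  ultimately have "F \<in> ring_iso (presented_alg rels) (presented_alg rels')"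
    unfolding ring_iso_def ring_hom_def bij_betw_def
    by (auto simp: carrier_presented_alg cls_mult cls_add one_presented_alg F fext_mult fext_add)
  then have "algebra_iso rels rels' F"
    unfolding algebra_iso_def
    by (auto simp: carrier_presented_alg cls_mult F fext_mult)
  with F show ?thesis by blast
qed

section \<open>The Yang--Baxter equation and the fusion of reflection equations\<close>

text \<open>The relations \<open>braid\<close> are those of the three transpositions of S_3, and
  \<open>abc\<close> says 1/b = 1/a + 1/c without division in a noncommutative ring. All quadratic
  words reduce to the two 3-cycles, whose coefficients agree by \<open>abc\<close>; the cubic words
  agree by \<open>e3\<close>.\<close>

lemma yang_baxter:
  fixes x y z :: "'r::ring_1"
  assumes sq: "x * x = 1" "y * y = 1" "z * z = 1"
    and braid: "x * y = z * x" "x * z = y * x" "y * x = z * y" "z * x = y * z" "y * z = x * y" "z * y = x * z"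
    and central: "\<And>w. a * w = w * a" "\<And>w. b * w = w * b" "\<And>w. c * w = w * c"
    and abc: "a * c = b * (a + c)"
  shows "(1 - a * x) * (1 - b * y) * (1 - c * z) = (1 - c * z) * (1 - b * y) * (1 - a * x)"
proof -
  have comm: "c1 * w1 * (c2 * w2) = c1 * c2 * (w1 * w2)" if "\<And>w. c2 * w = w * c2" for c1 c2 w1 w2 :: 'r
    by (metis mult.assoc that)
  have e3: "x * y * z = z * y * x"
    by (metis braid mult.assoc sq)
  have expand: "(1 - u) * (1 - v) * (1 - w) = 1 - u - v - w + (u * v + u * w + v * w) - u * v * w" for u v w :: 'r
    by (simp add: algebra_simps)
  have l: "(1 - a * x) * (1 - b * y) * (1 - c * z) =
    1 - a * x - b * y - c * z + (a * b * (x * y) + a * c * (x * z) + b * c * (y * z)) - a * b * c * (x * y * z)"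
    unfolding expand by (simp only: comm[OF central(2)] comm[OF central(3)])
  have r: "(1 - c * z) * (1 - b * y) * (1 - a * x) =
    1 - c * z - b * y - a * x + (c * b * (z * y) + c * a * (z * x) + b * a * (y * x)) - c * b * a * (z * y * x)"
    unfolding expand by (simp only: comm[OF central(2)] comm[OF central(1)])
  have cc: "c * b = b * c" "c * a = a * c" "b * a = a * b" "b * c * a = a * b * c"
    by (rule central)+ (metis central mult.assoc)
  have yz: "y * z = x * y" and zy: "z * y = x * z" and zx: "z * x = x * y" and yx: "y * x = x * z"
    using braid by simp_all
  have "a * b + b * c = a * c"
    using abc cc by (simp add: algebra_simps)
  then have "a * b * (x * y) + a * c * (x * z) + b * c * (x * y) =
    b * c * (x * z) + a * c * (x * y) + a * b * (x * z)"
    by (metis (no_types, opaque_lifting) add.commute add.left_commute distrib_right)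
  then show ?thesis
    unfolding l r e3[symmetric] unfolding cc yz zy zx yx by simp
qed

text \<open>One exchange: \<open>r\<close> passes the outer words exactly and the middle word up to
  \<open>\<Delta>\<close>, so the whole word changes at the cost of a single extra term.\<close>

lemma braid_move:
  fixes r :: "'r::ring_1"
  assumes "r * L = L' * r" "r * w = w' * r + \<Delta>" "r * M = M' * r"
  shows "r * (L * w * M) = L' * w' * M' * r + L' * \<Delta> * M"
  by (metis assms distrib_left distrib_right mult.assoc)

text \<open>Legs 1, 2 carry u and legs 3, 4 carry v; \<open>b1 * p12 * b2\<close> and
  \<open>b3 * p34 * b4\<close> are the two fused matrices. The factors \<open>r23\<close>,
  \<open>r13\<close>, \<open>r24\<close>, \<open>r14\<close> are taken through the word one after
  the other. Each of them meets just one pair of matrices on its own two legs, where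
  \<open>\<Delta>\<close> records the failure of the reflection equation; all else that it crosses
  is a Yang--Baxter triple or acts on other legs.\<close>

lemma reflection_fusion:
  fixes b1 b2 b3 b4 p12 p13 p14 p23 p24 p34 r13 r14 r23 r24 :: "'r::ring_1"
  assumes disj: "p23 * p14 = p14 * p23" "p12 * p34 = p34 * p12" "r23 * p14 = p14 * r23"
      "r14 * p23 = p23 * r14"  "r13 * p24 = p24 * r13"  "r24 * p13 = p13 * r24"
    and bp: "b1 * p23 = p23 * b1" "b1 * p34 = p34 * b1" "b2 * p13 = p13 * b2"
      "b2 * p14 = p14 * b2" "b2 * p34 = p34 * b2" "b3 * p12 = p12 * b3" "b3 * p14 = p14 * b3"
      "b3 * p24 = p24 * b3" "b4 * p12 = p12 * b4" "b4 * p13 = p13 * b4" "b4 * p23 = p23 * b4" "b1 * p24 = p24 * b1"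
    and br: "b1 * r23 = r23 * b1" "b1 * r24 = r24 * b1" "b2 * r13 = r13 * b2" "b2 * r14 = r14 * b2"
      "b3 * r24 = r24 * b3" "b3 * r14 = r14 * b3" "b4 * r13 = r13 * b4" "b4 * r23 = r23 * b4"
    and yb: "r23 * p12 * p13 = p13 * p12 * r23" "r23 * p24 * p34 = p34 * p24 * r23"
      "r13 * p12 * p23 = p23 * p12 * r13" "r13 * p14 * p34 = p34 * p14 * r13"
      "r24 * p23 * p34 = p34 * p23 * r24" "r24 * p12 * p14 = p14 * p12 * r24"
      "r14 * p13 * p34 = p34 * p13 * r14" "r14 * p12 * p24 = p24 * p12 * r14"
    and \<Delta>: "r23 * (b2 * p23 * b3) = b3 * p23 * b2 * r23 + \<Delta>23"
      "r13 * (b1 * p13 * b3) = b3 * p13 * b1 * r13 + \<Delta>13"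
      "r24 * (b2 * p24 * b4) = b4 * p24 * b2 * r24 + \<Delta>24"
      "r14 * (b1 * p14 * b4) = b4 * p14 * b1 * r14 + \<Delta>14"
  shows "r14 * r24 * r13 * r23 * (b1 * p12 * b2 * (p13 * p23 * p14 * p24) * (b3 * p34 * b4)) =
      b3 * p34 * b4 * (p13 * p23 * p14 * p24) * (b1 * p12 * b2) * (r14 * r24 * r13 * r23)
      + (r14 * r24 * r13 * (b1 * p13 * p12 * p14 * \<Delta>23 * (p24 * p34 * b4))
       + r14 * r24 * (\<Delta>13 * (p12 * p14 * p23 * p34 * b2 * p24 * b4)) * r23
       + r14 * (b3 * p13 * b1 * p34 * p23 * p14 * p12 * \<Delta>24) * r13 * r23
       + b3 * p34 * p13 * p23 * \<Delta>14 * (p12 * p24 * b2) * r24 * r13 * r23)"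
proof -
  have ass: "x * y = z \<Longrightarrow> x * (y * w) = z * w" for x y z w :: 'r
    by (simp add: mult.assoc[symmetric])
  note a = mult.assoc
  \<comment> \<open>The words before the four exchanges, regrouped by commutations on disjoint legs
    so that the pair to be exchanged stands in the middle; a factor 1 fills an empty outer
    block.\<close>
  define W1 where "W1 = b1 * p12 * p13 * p14 * (b2 * p23 * b3) * (p24 * p34 * b4)"
  define W2 where "W2 = 1 * (b1 * p13 * b3) * (p12 * p14 * p23 * p34 * b2 * p24 * b4)"
  define W3 where "W3 = b3 * p13 * b1 * p23 * p34 * p12 * p14 * (b2 * p24 * b4) * 1"
  define W4 where "W4 = b3 * p13 * p34 * p23 * (b1 * p14 * b4) * (p12 * p24 * b2)"
  have 0: "b1 * p12 * b2 * (p13 * p23 * p14 * p24) * (b3 * p34 * b4) = W1"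
    unfolding W1_def a
    by (simp only: a ass[OF bp(3)] ass[OF bp(4)] ass[OF disj(1)] ass[OF bp(8)[symmetric]])
  have 1: "r23 * W1 = b1 * p13 * p12 * p14 * (b3 * p23 * b2) * (p34 * p24 * b4) * r23
     + b1 * p13 * p12 * p14 * \<Delta>23 * (p24 * p34 * b4)"
    unfolding W1_def
  proof (rule braid_move[OF _ \<Delta>(1)])
    show "r23 * (b1 * p12 * p13 * p14) = b1 * p13 * p12 * p14 * r23"
      by (metis br(1) yb(1) disj(3) mult.assoc)
    show "r23 * (p24 * p34 * b4) = p34 * p24 * b4 * r23"
      by (metis br(8) yb(2) mult.assoc)
  qed
  have 12: "b1 * p13 * p12 * p14 * (b3 * p23 * b2) * (p34 * p24 * b4) = W2"
    unfolding W2_def a mult_1_left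
    by (simp only: a ass[OF bp(6)] ass[OF bp(7)] ass[OF bp(5)])
  have 2: "r13 * W2 = 1 * (b3 * p13 * b1) * (p23 * p12 * p34 * p14 * b2 * p24 * b4) * r13
     + 1 * \<Delta>13 * (p12 * p14 * p23 * p34 * b2 * p24 * b4)"
    unfolding W2_def
  proof (rule braid_move[OF _ \<Delta>(2)])
    have "p12 * p14 * p23 * p34 = p12 * p23 * p14 * p34"
      by (metis disj(1) mult.assoc)
    then have "r13 * (p12 * p14 * p23 * p34) = p23 * p12 * p34 * p14 * r13"
      by (metis yb(3,4) mult.assoc)
    then show "r13 * (p12 * p14 * p23 * p34 * b2 * p24 * b4) = p23 * p12 * p34 * p14 * b2 * p24 * b4 * r13"
      by (metis br(3,7) disj(5) mult.assoc)
  qed simp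
  have 23: "1 * (b3 * p13 * b1) * (p23 * p12 * p34 * p14 * b2 * p24 * b4) = W3"
    unfolding W3_def a mult_1_left mult_1_right by (simp only: ass[OF disj(2)] a)
  have 3: "r24 * W3 = b3 * p13 * b1 * p34 * p23 * p14 * p12 * (b4 * p24 * b2) * 1 * r24
     + b3 * p13 * b1 * p34 * p23 * p14 * p12 * \<Delta>24 * 1"
    unfolding W3_def
  proof (rule braid_move[OF _ \<Delta>(3)])
    have 1: "r24 * (p23 * p34 * p12 * p14) = p34 * p23 * p14 * p12 * r24"
      by (metis yb(5,6) mult.assoc)
    have 2: "r24 * (b3 * p13 * b1) = b3 * p13 * b1 * r24"
      by (metis br(2,5) disj(6) mult.assoc)
    have "r24 * (b3 * p13 * b1 * p23 * p34 * p12 * p14) = r24 * (b3 * p13 * b1) * (p23 * p34 * p12 * p14)"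
      by (simp only: a)
    also have "\<dots> = b3 * p13 * b1 * (r24 * (p23 * p34 * p12 * p14))"
      unfolding 2 by (simp only: a)
    also have "\<dots> = b3 * p13 * b1 * p34 * p23 * p14 * p12 * r24"
      unfolding 1 by (simp only: a)
    finally show "r24 * (b3 * p13 * b1 * p23 * p34 * p12 * p14) = \<dots>" .
  qed simp
  have 34: "b3 * p13 * b1 * p34 * p23 * p14 * p12 * (b4 * p24 * b2) * 1 = W4"
    unfolding W4_def a mult_1_left mult_1_right
    by (simp only: ass[OF bp(1)] ass[OF bp(2)] ass[OF bp(9)] a)
  have 4: "r14 * W4 = b3 * p34 * p13 * p23 * (b4 * p14 * b1) * (p24 * p12 * b2) * r14
     + b3 * p34 * p13 * p23 * \<Delta>14 * (p12 * p24 * b2)"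
    unfolding W4_def
  proof (rule braid_move[OF _ \<Delta>(4)])
    show "r14 * (b3 * p13 * p34 * p23) = b3 * p34 * p13 * p23 * r14"
      by (metis br(6) yb(7) disj(4) mult.assoc)
    show "r14 * (p12 * p24 * b2) = p24 * p12 * b2 * r14"
      by (metis br(4) yb(8) mult.assoc)
  qed
  have 40: "b3 * p34 * p13 * p23 * (b4 * p14 * b1) * (p24 * p12 * b2)
      = b3 * p34 * b4 * (p13 * p23 * p14 * p24) * (b1 * p12 * b2)"
    by (simp only: a ass[OF bp(10)] ass[OF bp(11)] ass[OF bp(12)])
  have "r14 * r24 * r13 * r23 * W1 = r14 * (r24 * (r13 * (r23 * W1)))"
    by (simp only: a)
  also have "\<dots> = r14 * (r24 * (r13 * W2)) * r23 + r14 * r24 * r13 * (b1 * p13 * p12 * p14 * \<Delta>23 * (p24 * p34 * b4))"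
    unfolding 1 12 by (simp only: a distrib_left)
  also have "r14 * (r24 * (r13 * W2)) * r23 = r14 * (r24 * W3) * r13 * r23 +
     r14 * r24 * (\<Delta>13 * (p12 * p14 * p23 * p34 * b2 * p24 * b4)) * r23"
    unfolding 2 23 by (simp only: a distrib_left distrib_right mult_1_left)
  also have "r14 * (r24 * W3) * r13 * r23 = r14 * W4 * r24 * r13 * r23 +
     r14 * (b3 * p13 * b1 * p34 * p23 * p14 * p12 * \<Delta>24) * r13 * r23"
    unfolding 3 34 by (simp only: a distrib_left distrib_right mult_1_right)
  also have "r14 * W4 * r24 * r13 * r23 =
     b3 * p34 * b4 * (p13 * p23 * p14 * p24) * (b1 * p12 * b2) * (r14 * r24 * r13 * r23) +
     b3 * p34 * p13 * p23 * \<Delta>14 * (p12 * p24 * b2) * r24 * r13 * r23"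
    unfolding 4 40 by (simp only: a distrib_right)
  finally show ?thesis
    unfolding 0 by (simp only: ac_simps)
qed

section \<open>Unital ring homomorphisms\<close>

locale unital_hom =
  fixes h :: "'a::ring_1 \<Rightarrow> 'b::ring_1"
  assumes hom_add: "h (x + y) = h x + h y" and hom_mult: "h (x * y) = h x * h y" and hom_1 [simp]: "h 1 = 1"
begin

lemma hom_0 [simp]: "h 0 = 0"
  using hom_add[of 0 0] by simp

lemma hom_uminus: "h (- x) = - h x"
  by (metis add.right_inverse hom_0 hom_add add_eq_0_iff)

lemma hom_diff: "h (x - y) = h x - h y"
  using hom_add[of x "- y"] by (simp add: hom_uminus)

lemma hom_sum: "h (sum f A) = (\<Sum>x\<in>A. h (f x))"
  by (induction A rule: infinite_finite_induct) (simp_all add: hom_add)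

lemma hom_power: "h (x ^ n) = h x ^ n"
  by (induction n) (simp_all add: hom_mult)

end

lemma unital_hom_compose: "unital_hom f \<Longrightarrow> unital_hom g \<Longrightarrow> unital_hom (\<lambda>x. f (g x))"
  by (simp add: unital_hom_def)

subsection \<open>The ring of square matrices\<close>

text \<open>The multiplication of this type is the matrix product, so matrices over a noncommutative
  ring form a \<open>ring_1\<close> again and the abstract ring lemmas apply to them. Index types
  may be pairs or functions.\<close>

typedef ('a, 'n) sqm = "UNIV :: ('n \<Rightarrow> 'n \<Rightarrow> 'a) set"
  morphisms ent Mk ..

lemma ent_Mk [simp]: "ent (Mk f) = f"
  by (simp add: Mk_inverse)

lemma sqm_eqI: "(\<And>i j. ent A i j = ent B i j) \<Longrightarrow> A = B"
  by (metis ent_inject ext)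

instantiation sqm :: (ring_1, finite) ring_1
begin

definition zero_sqm :: "('a, 'b) sqm" where "0 = Mk (\<lambda>i j. 0)"
definition one_sqm :: "('a, 'b) sqm" where "1 = Mk (\<lambda>i j. if i = j then 1 else 0)"
definition plus_sqm :: "('a, 'b) sqm \<Rightarrow> ('a, 'b) sqm \<Rightarrow> ('a, 'b) sqm"
  where "A + B = Mk (\<lambda>i j. ent A i j + ent B i j)"
definition minus_sqm :: "('a, 'b) sqm \<Rightarrow> ('a, 'b) sqm \<Rightarrow> ('a, 'b) sqm"
  where "A - B = Mk (\<lambda>i j. ent A i j - ent B i j)"
definition uminus_sqm :: "('a, 'b) sqm \<Rightarrow> ('a, 'b) sqm"
  where "- A = Mk (\<lambda>i j. - ent A i j)"
definition times_sqm :: "('a, 'b) sqm \<Rightarrow> ('a, 'b) sqm \<Rightarrow> ('a, 'b) sqm"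
  where "A * B = Mk (\<lambda>i j. \<Sum>k\<in>UNIV. ent A i k * ent B k j)"

lemma ent_simps [simp]:
  fixes A B :: "('a, 'b) sqm"
  shows "ent 0 i j = (0 :: 'a)" "ent (A + B) i j = ent A i j + ent B i j" "ent (A - B) i j = ent A i j - ent B i j"
    "ent (- A) i j = - ent A i j"
  by (simp_all add: zero_sqm_def plus_sqm_def minus_sqm_def uminus_sqm_def)

lemma ent_one: "ent (1 :: ('a, 'b) sqm) i j = (if i = j then 1 else 0)"
  by (simp add: one_sqm_def)

lemma ent_mult: "ent (A * B :: ('a, 'b) sqm) i j = (\<Sum>k\<in>UNIV. ent A i k * ent B k j)"
  by (simp add: times_sqm_def)

instance
proof
  fix A B C :: "('a, 'b) sqm"
  show "A * B * C = A * (B * C)"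
    by (rule sqm_eqI) (simp add: ent_mult sum_distrib_left sum_distrib_right mult.assoc, rule sum.swap)
  show "(A + B) * C = A * C + B * C" "A * (B + C) = A * B + A * C"
    by (rule sqm_eqI, simp add: ent_mult algebra_simps sum.distrib)+
  show "1 * A = A"
    by (rule sqm_eqI) (simp add: ent_mult ent_one if_distrib[of "\<lambda>x. x * _"] cong: if_cong)
  show "A * 1 = A"
    by (rule sqm_eqI) (simp add: ent_mult ent_one if_distrib[of "\<lambda>x. _ * x"] cong: if_cong)
  show "(0 :: ('a, 'b) sqm) \<noteq> 1"
    using ent_simps(1) ent_one by (metis zero_neq_one)
qed (auto intro!: sqm_eqI simp: algebra_simps)

end

definition cst :: "'a::ring_1 \<Rightarrow> ('a, 'n::finite) sqm"
  where "cst c = Mk (\<lambda>i j. if i = j then c else 0)"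

lemma ent_cst: "ent (cst c) i j = (if i = j then c else 0)"
  by (simp add: cst_def)

lemma ent_cst_mult [simp]: "ent (cst c * A) i j = c * ent A i j"
  by (simp add: ent_mult ent_cst if_distrib[of "\<lambda>x. x * _"] cong: if_cong)

lemma ent_mult_cst [simp]: "ent (A * cst c) i j = ent A i j * c"
  by (simp add: ent_mult ent_cst if_distrib[of "\<lambda>x. _ * x"] cong: if_cong)

lemma unital_hom_cst: "unital_hom (cst :: 'a::ring_1 \<Rightarrow> ('a, 'n::finite) sqm)"
proof
  show "cst (x * y) = (cst x * cst y :: ('a, 'n) sqm)" for x y :: 'a
    by (rule sqm_eqI) (simp only: ent_cst_mult, simp add: ent_cst)
qed (auto intro!: sqm_eqI simp: ent_cst ent_one)

interpretation cst: unital_hom "cst :: 'a::ring_1 \<Rightarrow> ('a, 'n::finite) sqm"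
  by (rule unital_hom_cst)

definition central :: "'a::ring_1 \<Rightarrow> bool"
  where "central c \<longleftrightarrow> (\<forall>x. c * x = x * c)"

lemma centralD: "central c \<Longrightarrow> c * x = x * c"
  by (simp add: central_def)

lemma central_left_commute: "central c \<Longrightarrow> x * (c * y) = c * (x * y)"
  by (metis central_def mult.assoc)

lemma central_cst: "central c \<Longrightarrow> central (cst c)"
  unfolding central_def by (auto intro!: sqm_eqI)

definition map_sq :: "('a \<Rightarrow> 'b) \<Rightarrow> ('a, 'n) sqm \<Rightarrow> ('b, 'n) sqm"
  where "map_sq h A = Mk (\<lambda>i j. h (ent A i j))"

lemma ent_map_sq [simp]: "ent (map_sq h A) i j = h (ent A i j)"
  by (simp add: map_sq_def)

lemma unital_hom_map_sq:
  assumes "unital_hom h" shows "unital_hom (map_sq h :: ('a::ring_1, 'n::finite) sqm \<Rightarrow> ('b::ring_1, 'n) sqm)"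
proof -
  interpret unital_hom h by fact
  show ?thesis
    by standard (auto intro!: sqm_eqI simp: ent_mult hom_add hom_sum hom_mult ent_one)
qed

definition sq :: "'a^'n^'n \<Rightarrow> ('a, 'n) sqm"
  where "sq A = Mk (\<lambda>i j. A $ i $ j)"

lemma ent_sq [simp]: "ent (sq A) i j = A $ i $ j"
  by (simp add: sq_def)

lemma sq_simps:
  fixes A B :: "'a::ring_1^'n::finite^'n"
  shows sq_mult: "sq (A ** B) = sq A * sq B" and sq_add: "sq (A + B) = sq A + sq B"
    and sq_diff: "sq (A - B) = sq A - sq B" and sq_mat_1: "sq (mat 1 :: 'a^'n^'n) = 1"
  by (auto intro!: sqm_eqI simp: ent_mult matrix_matrix_mult_def ent_one mat_def)

lemma sq_map_mat: "sq (map_mat h A) = map_sq h (sq A)"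
  by (auto intro!: sqm_eqI simp: map_mat_def)

definition tn1 :: "('a::ring_1, 'n) sqm \<Rightarrow> ('a, 'n \<times> 'n) sqm"
  where "tn1 A = Mk (\<lambda>p q. if snd p = snd q then ent A (fst p) (fst q) else 0)"

definition tn2 :: "('a::ring_1, 'n) sqm \<Rightarrow> ('a, 'n \<times> 'n) sqm"
  where "tn2 A = Mk (\<lambda>p q. if fst p = fst q then ent A (snd p) (snd q) else 0)"

definition flip_sq :: "('a::ring_1, 'n \<times> 'n) sqm"
  where "flip_sq = Mk (\<lambda>p q. if q = prod.swap p then 1 else 0)"

lemma sq_tens1: "sq (tens1 A) = tn1 (sq A)" and sq_tens2: "sq (tens2 A) = tn2 (sq A)"
  by (auto intro!: sqm_eqI simp: tens1_def tens2_def tens_def tn1_def tn2_def mat_def)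

lemma sq_Pmat: "sq (Pmat :: 'a::ring_1^('n::finite \<times> 'n)^('n \<times> 'n)) = flip_sq"
proof (rule sqm_eqI)
  fix p q :: "'n \<times> 'n"
  have "tens (munit i j) (munit j i) $ p $ q =
      (if j = snd p then if i = fst p then ent flip_sq p q else 0 else (0 :: 'a))" for i j
    by (cases p; cases q) (auto simp: tens_def munit_def flip_sq_def)
  then show "ent (sq (Pmat :: 'a^('n \<times> 'n)^('n \<times> 'n))) p q = ent flip_sq p q"
    by (simp add: Pmat_def)
qed

subsection \<open>Operators on four tensor factors\<close>

text \<open>A basis vector of the fourfold tensor power of C^2 is a function from \<open>leg\<close>
  to \<open>ix2\<close>: operators on one or two legs are then defined uniformly in the position,
  and permutations of the legs act by composition.\<close>

datatype leg = L1 | L2 | L3 | L4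

lemma UNIV_leg: "UNIV = {L1, L2, L3, L4}"
  using leg.exhaust by auto

instance leg :: finite by standard (simp add: UNIV_leg)

definition lift1 :: "leg \<Rightarrow> ('a::ring_1, ix2) sqm \<Rightarrow> ('a, leg \<Rightarrow> ix2) sqm"
  where "lift1 i A = Mk (\<lambda>f g. if \<forall>k. k \<noteq> i \<longrightarrow> f k = g k then ent A (f i) (g i) else 0)"

definition lift2 :: "leg \<Rightarrow> leg \<Rightarrow> ('a::ring_1, ix2 \<times> ix2) sqm \<Rightarrow> ('a, leg \<Rightarrow> ix2) sqm"
  where "lift2 i j A = Mk (\<lambda>f g. if \<forall>k. k \<noteq> i \<longrightarrow> k \<noteq> j \<longrightarrow> f k = g k
    then ent A (f i, f j) (g i, g j) else 0)"

definition permop :: "(leg \<Rightarrow> leg) \<Rightarrow> ('a::ring_1, leg \<Rightarrow> ix2) sqm"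
  where "permop \<sigma> = Mk (\<lambda>f g. if g = f \<circ> \<sigma> then 1 else 0)"

abbreviation swp :: "leg \<Rightarrow> leg \<Rightarrow> ('a::ring_1, leg \<Rightarrow> ix2) sqm"
  where "swp i j \<equiv> permop (Transposition.transpose i j)"

text \<open>In a product of two lifts only those intermediate indices contribute that agree with
  \<open>f\<close> off \<open>i\<close> and \<open>j\<close>, so the sum over leg functions becomes
  one over pairs.\<close>

lemma unital_hom_lift2:
  assumes "i \<noteq> j"
  shows "unital_hom (lift2 i j :: ('a::ring_1, ix2 \<times> ix2) sqm \<Rightarrow> _)"
proof
  fix A B :: "('a, ix2 \<times> ix2) sqm"
  show "lift2 i j (A * B) = lift2 i j A * lift2 i j B"
  proof (rule sqm_eqI)
    fix f g :: "leg \<Rightarrow> ix2"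
    let ?eq = "\<lambda>f g :: leg \<Rightarrow> ix2. \<forall>k. k \<noteq> i \<longrightarrow> k \<noteq> j \<longrightarrow> f k = g k"
    have "ent (lift2 i j A * lift2 i j B) f g =
        (\<Sum>h\<in>{h. ?eq f h}. if ?eq f g then ent A (f i, f j) (h i, h j) * ent B (h i, h j) (g i, g j) else 0)"
      unfolding ent_mult by (rule sum.mono_neutral_cong_right) (auto simp: lift2_def)
    also have "\<dots> = (\<Sum>p\<in>UNIV. if ?eq f g then ent A (f i, f j) p * ent B p (g i, g j) else 0)"
    proof (rule sum.reindex_bij_witness[where i = "\<lambda>p. f(i := fst p, j := snd p)" and j = "\<lambda>h. (h i, h j)"])
      show "f(i := fst (h i, h j), j := snd (h i, h j)) = h" if "h \<in> {h. ?eq f h}" for h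
        using that by (auto simp: fun_eq_iff)
    qed (use assms in auto)
    also have "\<dots> = ent (lift2 i j (A * B)) f g"
      by (auto simp: lift2_def ent_mult intro!: sum.neutral)
    finally show "ent (lift2 i j (A * B)) f g = ent (lift2 i j A * lift2 i j B) f g" ..
  qed
  show "lift2 i j 1 = (1 :: ('a, leg \<Rightarrow> ix2) sqm)"
    by (rule sqm_eqI) (auto simp: lift2_def ent_one fun_eq_iff; metis)
qed (auto intro!: sqm_eqI simp: lift2_def)

lemma if_if_conj: "(if A then if B then x else y else y) = (if A \<and> B then x else y)"
  by simp

lemma lift2_tn1:
  assumes "i \<noteq> j" shows "lift2 i j (tn1 A) = lift1 i A"
proof (rule sqm_eqI)
  fix f g :: "leg \<Rightarrow> ix2"
  have "(\<forall>k. k \<noteq> i \<longrightarrow> k \<noteq> j \<longrightarrow> f k = g k) \<and> f j = g j \<longleftrightarrow> (\<forall>k. k \<noteq> i \<longrightarrow> f k = g k)"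
    using assms by metis
  then show "ent (lift2 i j (tn1 A)) f g = ent (lift1 i A) f g"
    by (simp only: lift2_def tn1_def lift1_def ent_Mk fst_conv snd_conv if_if_conj)
qed

lemma lift2_tn2:
  assumes "i \<noteq> j" shows "lift2 i j (tn2 A) = lift1 j A"
proof (rule sqm_eqI)
  fix f g :: "leg \<Rightarrow> ix2"
  have "(\<forall>k. k \<noteq> i \<longrightarrow> k \<noteq> j \<longrightarrow> f k = g k) \<and> f i = g i \<longleftrightarrow> (\<forall>k. k \<noteq> j \<longrightarrow> f k = g k)"
    using assms by metis
  then show "ent (lift2 i j (tn2 A)) f g = ent (lift1 j A) f g"
    by (simp only: lift2_def tn2_def lift1_def ent_Mk fst_conv snd_conv if_if_conj)
qed

lemma lift2_flip:
  assumes "i \<noteq> j" shows "lift2 i j flip_sq = swp i j"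
proof (rule sqm_eqI)
  fix f g :: "leg \<Rightarrow> ix2"
  have "(\<forall>k. k \<noteq> i \<longrightarrow> k \<noteq> j \<longrightarrow> f k = g k) \<and> (g i, g j) = prod.swap (f i, f j) \<longleftrightarrow>
      g = f \<circ> Transposition.transpose i j"
    by (auto simp: fun_eq_iff Transposition.transpose_def)
  then show "ent (lift2 i j flip_sq) f g = ent (swp i j) f g"
    by (simp only: lift2_def flip_sq_def permop_def ent_Mk if_if_conj)
qed

lemma lift2_cst:
  assumes "i \<noteq> j" shows "lift2 i j (cst c) = cst c"
proof (rule sqm_eqI)
  fix f g :: "leg \<Rightarrow> ix2"
  have "(\<forall>k. k \<noteq> i \<longrightarrow> k \<noteq> j \<longrightarrow> f k = g k) \<and> (f i, f j) = (g i, g j) \<longleftrightarrow> f = g"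
    by (auto simp: fun_eq_iff)
  then show "ent (lift2 i j (cst c)) f g = ent (cst c) f g"
    by (simp only: lift2_def cst_def ent_Mk if_if_conj)
qed

lemma ent_permop_mult: "ent (permop \<sigma> * A) f g = ent A (f \<circ> \<sigma>) g"
  by (simp add: ent_mult permop_def if_distrib[of "\<lambda>x. x * _"] cong: if_cong)

lemma ent_mult_permop:
  assumes "\<sigma> \<circ> \<sigma> = id"
  shows "ent (A * permop \<sigma>) f g = ent A f (g \<circ> \<sigma>)"
proof -
  have "g = h \<circ> \<sigma> \<longleftrightarrow> h = g \<circ> \<sigma>" for h :: "leg \<Rightarrow> ix2"
    by (metis assms comp_assoc comp_id)
  then show ?thesis
    by (simp add: ent_mult permop_def if_distrib[of "\<lambda>x. _ * x"] cong: if_cong)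
qed

lemma transpose_comp_self: "Transposition.transpose i j \<circ> Transposition.transpose i j = id"
  by (simp add: fun_eq_iff)

lemma permop_mult: "permop \<sigma> * permop \<tau> = (permop (\<sigma> \<circ> \<tau>) :: ('a::ring_1, leg \<Rightarrow> ix2) sqm)"
  by (rule sqm_eqI) (simp only: ent_permop_mult, simp add: permop_def comp_assoc)

lemma permop_id: "permop id = 1"
  by (rule sqm_eqI) (auto simp: permop_def ent_one)

lemma swp_commute_lift1:
  assumes "k \<noteq> i" "k \<noteq> j"
  shows "lift1 k A * swp i j = swp i j * lift1 k A"
proof (rule sqm_eqI)
  fix f g :: "leg \<Rightarrow> ix2"
  let ?t = "Transposition.transpose i j"
  have t: "?t k = k" "?t l \<noteq> k \<longleftrightarrow> l \<noteq> k" "?t (?t l) = l" for l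
    using assms by (auto simp: Transposition.transpose_def)
  have "(\<forall>l. l \<noteq> k \<longrightarrow> f l = (g \<circ> ?t) l) \<longleftrightarrow> (\<forall>l. l \<noteq> k \<longrightarrow> (f \<circ> ?t) l = g l)"
    by (metis comp_apply t(2,3))
  then show "ent (lift1 k A * swp i j) f g = ent (swp i j * lift1 k A) f g"
    by (simp only: ent_permop_mult ent_mult_permop[OF transpose_comp_self] lift1_def ent_Mk comp_apply t(1))
qed

lemma swp_sym: "swp i j = swp j i"
  by (simp add: transpose_commute)

subsection \<open>Laurent series over a noncommutative ring\<close>

lemma fls_nth_fls_map:
  assumes "h 0 = 0" shows "fls_nth (fls_map h f) n = h (fls_nth f n)"
  unfolding fls_map_def
  by (rule nth_Abs_fls_lower_bound[of "fls_subdegree f"]) (simp add: assms)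

text \<open>The bounds \<open>a\<close>, \<open>b\<close> may lie below the subdegrees; several
  products can therefore be summed over one common range.\<close>

lemma fls_mult_nth:
  fixes f g :: "'a::ring_1 fls"
  assumes "\<And>i. i < a \<Longrightarrow> fls_nth f i = 0" "\<And>i. i < b \<Longrightarrow> fls_nth g i = 0"
  shows "fls_nth (f * g) n = (\<Sum>i=a..n - b. fls_nth f i * fls_nth g (n - i))"
proof -
  have "(\<Sum>i=fls_subdegree f..n - fls_subdegree g. fls_nth f i * fls_nth g (n - i)) =
    (\<Sum>i=min a (fls_subdegree f)..n - min b (fls_subdegree g). fls_nth f i * fls_nth g (n - i))"
    by (intro sum.mono_neutral_left) auto
  also have "\<dots> = (\<Sum>i=a..n - b. fls_nth f i * fls_nth g (n - i))"
    using assms by (intro sum.mono_neutral_right) (auto simp: not_le)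
  finally show ?thesis
    by (simp add: fls_times_nth(2))
qed

lemma unital_hom_fls_map:
  assumes "unital_hom h" shows "unital_hom (fls_map h)"
proof -
  interpret unital_hom h by fact
  note [simp] = fls_nth_fls_map[of h, OF hom_0]
  show ?thesis
  proof
    fix f g
    show "fls_map h (f * g) = fls_map h f * fls_map h g"
      by (rule fls_eqI)
         (simp add: fls_mult_nth[of "fls_subdegree f" _ "fls_subdegree g"] hom_sum hom_mult)
  qed (auto intro!: fls_eqI simp: hom_add)
qed

lemma unital_hom_fls_const: "unital_hom fls_const"
  by standard (simp_all add: fls_plus_const)

lemma fls_map_fls_const: "h 0 = 0 \<Longrightarrow> fls_map h (fls_const c) = fls_const (h c)"
  by (rule fls_eqI) (simp add: fls_nth_fls_map)

lemma fls_map_fls_X_inv: "h 0 = 0 \<Longrightarrow> h 1 = 1 \<Longrightarrow> fls_map h fls_X_inv = fls_X_inv"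
  by (rule fls_eqI) (simp add: fls_nth_fls_map)

lemma central_fls:
  assumes "\<And>n. central (fls_nth c n)" shows "central c"
  unfolding central_def
proof (intro allI fls_eqI)
  fix x n
  have "(\<Sum>i=fls_subdegree c..n - fls_subdegree x. fls_nth c i * fls_nth x (n - i)) =
     (\<Sum>i=fls_subdegree x..n - fls_subdegree c. fls_nth x i * fls_nth c (n - i))"
    by (rule sum.reindex_bij_witness[of _ "\<lambda>i. n - i" "\<lambda>i. n - i"]) (auto simp: centralD[OF assms])
  then show "fls_nth (c * x) n = fls_nth (x * c) n"
    by (simp add: fls_times_nth(2))
qed

lemma central_arith:
  assumes "central a" "central b"
  shows central_add: "central (a + b)" and central_diff: "central (a - b)" and central_mult: "central (a * b)"
proof -
  show "central (a * b)"
    using assms unfolding central_def by (metis mult.assoc)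
qed (use assms in \<open>auto simp: central_def algebra_simps\<close>)

lemma central_0 [simp]: "central 0" and central_1 [simp]: "central 1"
  by (simp_all add: central_def)

subsection \<open>Filtrations\<close>

text \<open>\<open>F\<close> filters the ring and \<open>W\<close> filters a family of additive
  subgroups on which \<open>F\<close> acts from both sides. In the descent \<open>W k\<close> is an
  ideal plus \<open>F k\<close>: a bound in \<open>W\<close> is then a degree bound modulo the
  relations, obtained without passing to the quotient.\<close>

locale filtered_pair =
  fixes F W :: "int \<Rightarrow> 'a::ring_1 set"
  assumes F_0: "0 \<in> F k" and F_add: "x \<in> F k \<Longrightarrow> y \<in> F k \<Longrightarrow> x + y \<in> F k"
    and F_uminus: "x \<in> F k \<Longrightarrow> - x \<in> F k"
    and F_mono: "i \<le> j \<Longrightarrow> x \<in> F i \<Longrightarrow> x \<in> F j"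
    and W_0: "0 \<in> W k" and W_add: "x \<in> W k \<Longrightarrow> y \<in> W k \<Longrightarrow> x + y \<in> W k"
    and W_uminus: "x \<in> W k \<Longrightarrow> - x \<in> W k"
    and W_mono: "i \<le> j \<Longrightarrow> x \<in> W i \<Longrightarrow> x \<in> W j"
    and F_one: "1 \<in> F 0"
    and FF: "x \<in> F i \<Longrightarrow> y \<in> F j \<Longrightarrow> x * y \<in> F (i + j)"
    and FW: "x \<in> F i \<Longrightarrow> y \<in> W j \<Longrightarrow> x * y \<in> W (i + j)"
    and WF: "x \<in> W i \<Longrightarrow> y \<in> F j \<Longrightarrow> x * y \<in> W (i + j)"
begin

lemma F_diff: "x \<in> F k \<Longrightarrow> y \<in> F k \<Longrightarrow> x - y \<in> F k"
  using F_add[of x k "- y"] F_uminus[of y k] by simp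

lemma W_diff: "x \<in> W k \<Longrightarrow> y \<in> W k \<Longrightarrow> x - y \<in> W k"
  using W_add[of x k "- y"] W_uminus[of y k] by simp

lemma F_sum: "(\<And>x. x \<in> A \<Longrightarrow> f x \<in> F k) \<Longrightarrow> sum f A \<in> F k"
  by (induction A rule: infinite_finite_induct) (auto intro: F_0 F_add)

lemma W_sum: "(\<And>x. x \<in> A \<Longrightarrow> f x \<in> W k) \<Longrightarrow> sum f A \<in> W k"
  by (induction A rule: infinite_finite_induct) (auto intro: W_0 W_add)

lemma FF': "x \<in> F i \<Longrightarrow> y \<in> F j \<Longrightarrow> i + j \<le> k \<Longrightarrow> x * y \<in> F k"
  and FW': "x \<in> F i \<Longrightarrow> y \<in> W j \<Longrightarrow> i + j \<le> k \<Longrightarrow> x * y \<in> W k"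
  and WF': "x \<in> W i \<Longrightarrow> y \<in> F j \<Longrightarrow> i + j \<le> k \<Longrightarrow> x * y \<in> W k"
  using FF F_mono FW W_mono WF by blast+

lemma F_cong_mult:
  assumes "x - x' \<in> F (i - 1)" "y - y' \<in> F (j - 1)" "x' \<in> F i" "y \<in> F j"
  shows "x * y - x' * y' \<in> F (i + j - 1)"
proof -
  have "x * y - x' * y' = (x - x') * y + x' * (y - y')"
    by (simp add: algebra_simps)
  also have "\<dots> \<in> F (i + j - 1)"
    by (intro F_add FF'[OF assms(1,4)] FF'[OF assms(3,2)]) simp_all
  finally show ?thesis .
qed

lemma F_of_cong: "x - y \<in> F (i - 1) \<Longrightarrow> y \<in> F i \<Longrightarrow> x \<in> F i"
  using F_add[of "x - y" i y] F_mono[of "i - 1" i "x - y"] by simp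

text \<open>Outer factors that are known only modulo level -1 may be replaced by their leading parts
  at the cost of one level. In this way R-matrices become 1 and generating matrices become their
  constant terms.\<close>

lemma W_lead:
  assumes "w \<in> W j" "x - x' \<in> F (- 1)" "x' \<in> F 0" "y - y' \<in> F (- 1)" "y' \<in> F 0"
  shows "x * w * y - x' * w * y' \<in> W (j - 1)"
proof -
  have x: "x \<in> F 0" and y: "y \<in> F 0"
    using F_of_cong[of x x' 0] F_of_cong[of y y' 0] assms by simp_all
  have "x * w * y - x' * w * y' = (x - x') * w * y + x' * w * (y - y')"
    by (simp add: algebra_simps)
  also have "\<dots> \<in> W (j - 1)"
    by (intro W_add WF'[OF FW'[OF assms(2,1) order_refl] y] WF'[OF FW'[OF assms(3,1) order_refl] assms(4)])
       simp_all
  finally show ?thesis .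
qed

end

text \<open>Level k: the coefficient of u^-n has degree at most n + k. Thus u has level 1 and 1/u
  level -1, and iterating \<open>lev\<close> counts both parameters together.\<close>

definition lev :: "(int \<Rightarrow> 'a::zero set) \<Rightarrow> int \<Rightarrow> 'a fls set"
  where "lev W k = {f. \<forall>n. fls_nth f n \<in> W (n + k)}"

definition ents :: "(int \<Rightarrow> 'a set) \<Rightarrow> int \<Rightarrow> ('a, 'n) sqm set"
  where "ents W k = {A. \<forall>i j. ent A i j \<in> W k}"

context filtered_pair
begin

lemma filtered_pair_lev: "filtered_pair (lev F) (lev W)"
proof
  fix i j :: int and x y :: "'a fls"
  show "x * y \<in> lev F (i + j)" if "x \<in> lev F i" "y \<in> lev F j"
    unfolding lev_def
  proof clarify
    fix n
    show "fls_nth (x * y) n \<in> F (n + (i + j))"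
      unfolding fls_times_nth(2) by (intro F_sum FF'[of _ "_ + i" _ "_ + j"]) (use that in \<open>auto simp: lev_def\<close>)
  qed
  show "x * y \<in> lev W (i + j)" if "x \<in> lev F i" "y \<in> lev W j"
    unfolding lev_def
  proof clarify
    fix n
    show "fls_nth (x * y) n \<in> W (n + (i + j))"
      unfolding fls_times_nth(2) by (intro W_sum FW'[of _ "_ + i" _ "_ + j"]) (use that in \<open>auto simp: lev_def\<close>)
  qed
  show "x * y \<in> lev W (i + j)" if "x \<in> lev W i" "y \<in> lev F j"
    unfolding lev_def
  proof clarify
    fix n
    show "fls_nth (x * y) n \<in> W (n + (i + j))"
      unfolding fls_times_nth(2) by (intro W_sum WF'[of _ "_ + i" _ "_ + j"]) (use that in \<open>auto simp: lev_def\<close>)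
  qed
  show "x \<in> lev F j" if "i \<le> j" "x \<in> lev F i"
    unfolding lev_def
  proof clarify
    fix n show "fls_nth x n \<in> F (n + j)"
      by (rule F_mono[of "n + i"]) (use that in \<open>auto simp: lev_def\<close>)
  qed
  show "x \<in> lev W j" if "i \<le> j" "x \<in> lev W i"
    unfolding lev_def
  proof clarify
    fix n show "fls_nth x n \<in> W (n + j)"
      by (rule W_mono[of "n + i"]) (use that in \<open>auto simp: lev_def\<close>)
  qed
qed (auto simp: lev_def F_0 W_0 F_add W_add F_uminus W_uminus F_one)

lemma filtered_pair_ents:
  "filtered_pair (ents F) (ents W :: int \<Rightarrow> ('a, 'n::finite) sqm set)"
proof
  fix i j :: int and A B :: "('a, 'n) sqm"
  show "A * B \<in> ents F (i + j)" if "A \<in> ents F i" "B \<in> ents F j"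
    using that by (auto simp: ents_def ent_mult intro!: F_sum FF)
  show "A * B \<in> ents W (i + j)" if "A \<in> ents F i" "B \<in> ents W j"
    using that by (auto simp: ents_def ent_mult intro!: W_sum intro: FW)
  show "A * B \<in> ents W (i + j)" if "A \<in> ents W i" "B \<in> ents F j"
    using that by (auto simp: ents_def ent_mult intro!: W_sum intro: WF)
  show "A \<in> ents F j" if "i \<le> j" "A \<in> ents F i"
    using that F_mono by (auto simp: ents_def)
  show "A \<in> ents W j" if "i \<le> j" "A \<in> ents W i"
    using that W_mono by (auto simp: ents_def)
  have "1 \<in> F 0" "0 \<in> F 0" by (rule F_one F_0)+
  then show "(1 :: ('a, 'n) sqm) \<in> ents F 0"
    by (simp add: ents_def ent_one)
qed (auto simp: ents_def F_0 W_0 F_add W_add F_uminus W_uminus)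

end

subsection \<open>Substitution for the spectral parameter\<close>

text \<open>The coefficient of u^-l in w^-m. Subdegree -1 means that \<open>w\<close> has degree
  exactly one in u; the array is then triangular, and substitution of \<open>w\<close> needs finite
  sums only.\<close>

definition kap :: "complex fls \<Rightarrow> int \<Rightarrow> int \<Rightarrow> complex"
  where "kap w m l = fls_nth (w powi (- m)) l"

text \<open>Substitution of \<open>w\<close> for the parameter. The embedding \<open>e\<close> of
  scalars is a parameter because the coefficients may lie in the free algebra (\<open>scal\<close>),
  in series over it (\<open>kc\<close>) or in the complex numbers (\<open>id\<close>).\<close>

definition sbst :: "(complex \<Rightarrow> 'a::ring_1) \<Rightarrow> complex fls \<Rightarrow> 'a fls \<Rightarrow> 'a fls"
  where "sbst e w F = Abs_fls (\<lambda>l. \<Sum>m=fls_subdegree F..l. e (kap w m l) * fls_nth F m)"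

locale scalar_embedding = unital_hom e for e :: "complex \<Rightarrow> 'a::ring_1" +
  assumes central_e: "central (e c)"

lemma kap_eq_0: "fls_subdegree w = -1 \<Longrightarrow> l < m \<Longrightarrow> kap w m l = 0"
  by (simp add: kap_def)

lemma kap_add:
  assumes "fls_subdegree w = -1" "a \<le> m" "b \<le> n"
  shows "kap w (m + n) l = (\<Sum>i=a..l - b. kap w m i * kap w n (l - i))"
proof -
  have "w \<noteq> 0" using assms by auto
  then have "w powi (- (m + n)) = w powi (- m) * w powi (- n)"
    by (simp flip: power_int_add)
  then show ?thesis
    using assms by (simp add: kap_def fls_mult_nth[of a _ b])
qed

context scalar_embedding
begin

lemma sbst_nth:
  assumes w: "fls_subdegree w = -1" and a: "\<And>m. m < a \<Longrightarrow> fls_nth F m = 0"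
  shows "fls_nth (sbst e w F) l = (\<Sum>m=a..l. e (kap w m l) * fls_nth F m)"
proof -
  have "fls_nth (sbst e w F) l = (\<Sum>m=fls_subdegree F..l. e (kap w m l) * fls_nth F m)"
    unfolding sbst_def by (rule nth_Abs_fls_lower_bound[of "fls_subdegree F"]) auto
  also have "\<dots> = (\<Sum>m=min a (fls_subdegree F)..l. e (kap w m l) * fls_nth F m)"
    by (intro sum.mono_neutral_left) auto
  also have "\<dots> = (\<Sum>m=a..l. e (kap w m l) * fls_nth F m)"
    using a by (intro sum.mono_neutral_right) (auto simp: not_le)
  finally show ?thesis .
qed

text \<open>Multiplicativity is w^-(m+n) = w^-m w^-n read coefficientwise, as in
  \<open>kap_add\<close>, once the central scalars are pulled to the front; what remains is to
  reorder finite sums.\<close>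

lemma unital_hom_sbst:
  assumes w: "fls_subdegree w = -1" shows "unital_hom (sbst e w)"
proof
  fix F G :: "'a fls"
  show "sbst e w (F + G) = sbst e w F + sbst e w G"
    by (rule fls_eqI)
       (simp add: sbst_nth[OF w, of "min (fls_subdegree F) (fls_subdegree G)"] distrib_left sum.distrib)
  show "sbst e w 1 = 1"
  proof (rule fls_eqI)
    fix l
    show "fls_nth (sbst e w 1) l = fls_nth 1 l"
      by (simp add: sbst_nth[OF w, of 0] if_distrib[of "(*) _"] kap_def cong: if_cong)
  qed
  show "sbst e w (F * G) = sbst e w F * sbst e w G"
  proof (rule fls_eqI)
    fix l
    define a b where "a = fls_subdegree F" and "b = fls_subdegree G"
    have F0: "fls_nth F i = 0" if "i < a" for i using that by (simp add: a_def)
    have G0: "fls_nth G i = 0" if "i < b" for i using that by (simp add: b_def)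
    have FG0: "fls_nth (F * G) i = 0" if "i < a + b" for i
      using that by (simp add: a_def b_def fls_times_nth_eq0)
    have sF0: "fls_nth (sbst e w F) i = (\<Sum>m=a..i. e (kap w m i) * fls_nth F m)" for i
      by (rule sbst_nth[OF w F0])
    have sG0: "fls_nth (sbst e w G) i = (\<Sum>m=b..i. e (kap w m i) * fls_nth G m)" for i
      by (rule sbst_nth[OF w G0])
    have sFG0: "fls_nth (sbst e w (F * G)) i = (\<Sum>m=a + b..i. e (kap w m i) * fls_nth (F * G) m)" for i
      by (rule sbst_nth[OF w FG0])
    \<comment> \<open>The upper limit may be chosen independently of \<open>i\<close>, since
      \<open>kap w m i\<close> vanishes for m > i; this makes the ranges of the multiple sums
      rectangular.\<close>
    have sF: "fls_nth (sbst e w F) i = (\<Sum>m=a..l - b. e (kap w m i) * fls_nth F m)" if "i \<le> l - b" for i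
      unfolding sF0
      by (rule sum.mono_neutral_left) (use that kap_eq_0[OF w] in auto)
    have sG: "fls_nth (sbst e w G) i = (\<Sum>n=b..l - a. e (kap w n i) * fls_nth G n)" if "i \<le> l - a" for i
      unfolding sG0
      by (rule sum.mono_neutral_left) (use that kap_eq_0[OF w] in auto)
    have comm: "e c * x * (e d * y) = e (c * d) * (x * y)" for c d x y
      unfolding mult.assoc hom_mult central_left_commute[OF central_e, of x d y] ..
    have "fls_nth (sbst e w F * sbst e w G) l =
        (\<Sum>i=a..l - b. fls_nth (sbst e w F) i * fls_nth (sbst e w G) (l - i))"
      by (rule fls_mult_nth) (simp_all add: sF0 sG0)
    also have "\<dots> = (\<Sum>i=a..l - b. \<Sum>m=a..l - b. \<Sum>n=b..l - a.
        e (kap w m i * kap w n (l - i)) * (fls_nth F m * fls_nth G n))"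
      by (intro sum.cong refl) (simp add: sF sG sum_product comm)
    also have "\<dots> = (\<Sum>m=a..l - b. \<Sum>i=a..l - b. \<Sum>n=b..l - a.
        e (kap w m i * kap w n (l - i)) * (fls_nth F m * fls_nth G n))"
      by (rule sum.swap)
    also have "\<dots> = (\<Sum>m=a..l - b. \<Sum>n=b..l - a. \<Sum>i=a..l - b.
        e (kap w m i * kap w n (l - i)) * (fls_nth F m * fls_nth G n))"
      by (intro sum.cong refl sum.swap)
    also have "\<dots> = (\<Sum>m=a..l - b. \<Sum>n=b..l - a. e (kap w (m + n) l) * (fls_nth F m * fls_nth G n))"
      by (intro sum.cong refl) (simp add: kap_add[OF w, of a _ b] hom_sum sum_distrib_right)
    also have "\<dots> = (\<Sum>m=a..l - b. \<Sum>k=a + b..l. e (kap w k l) * (fls_nth F m * fls_nth G (k - m)))"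
    proof (rule sum.cong[OF refl])
      fix m assume m: "m \<in> {a..l - b}"
      have "(\<Sum>n=b..l - a. e (kap w (m + n) l) * (fls_nth F m * fls_nth G n)) =
         (\<Sum>n=b..l - m. e (kap w (m + n) l) * (fls_nth F m * fls_nth G n))"
        by (rule sum.mono_neutral_right) (use m kap_eq_0[OF w] in auto)
      also have "\<dots> = (\<Sum>k=m + b..l. e (kap w k l) * (fls_nth F m * fls_nth G (k - m)))"
        by (rule sum.reindex_bij_witness[of _ "\<lambda>k. k - m" "\<lambda>n. m + n"]) auto
      also have "\<dots> = (\<Sum>k=a + b..l. e (kap w k l) * (fls_nth F m * fls_nth G (k - m)))"
        by (rule sum.mono_neutral_left) (use m G0 in auto)
      finally show "(\<Sum>n=b..l - a. e (kap w (m + n) l) * (fls_nth F m * fls_nth G n)) = \<dots>" .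
    qed
    also have "\<dots> = (\<Sum>k=a + b..l. \<Sum>m=a..l - b. e (kap w k l) * (fls_nth F m * fls_nth G (k - m)))"
      by (rule sum.swap)
    also have "\<dots> = (\<Sum>k=a + b..l. e (kap w k l) * fls_nth (F * G) k)"
    proof (rule sum.cong[OF refl])
      fix k assume k: "k \<in> {a + b..l}"
      have "fls_nth (F * G) k = (\<Sum>m=a..k - b. fls_nth F m * fls_nth G (k - m))"
        by (rule fls_mult_nth) (simp_all add: F0 G0)
      also have "\<dots> = (\<Sum>m=a..l - b. fls_nth F m * fls_nth G (k - m))"
        by (rule sum.mono_neutral_left) (use k G0 in auto)
      finally show "(\<Sum>m=a..l - b. e (kap w k l) * (fls_nth F m * fls_nth G (k - m))) =
          e (kap w k l) * fls_nth (F * G) k"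
        by (simp add: sum_distrib_left)
    qed
    also have "\<dots> = fls_nth (sbst e w (F * G)) l"
      by (simp add: sFG0)
    finally show "fls_nth (sbst e w (F * G)) l = fls_nth (sbst e w F * sbst e w G) l" ..
  qed
qed

lemma sbst_fls_const:
  assumes w: "fls_subdegree w = -1" shows "sbst e w (fls_const c) = fls_const c"
proof (rule fls_eqI)
  fix l
  show "fls_nth (sbst e w (fls_const c)) l = fls_nth (fls_const c) l"
    by (simp add: sbst_nth[OF w, of 0] if_distrib[of "(*) _"] kap_def cong: if_cong)
qed

lemma sbst_fls_X_inv:
  assumes w: "fls_subdegree w = -1" shows "sbst e w fls_X_inv = fls_map e w"
proof (rule fls_eqI)
  fix l
  show "fls_nth (sbst e w fls_X_inv) l = fls_nth (fls_map e w) l"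
    using w by (simp add: sbst_nth[OF w, of "-1"] if_distrib[of "(*) _"] kap_def fls_nth_fls_map cong: if_cong)
qed

end

lemma fls_map_sbst:
  assumes "scalar_embedding e" "unital_hom h" "fls_subdegree w = -1" "\<And>c. h (e c) = e' c" "scalar_embedding e'"
  shows "fls_map h (sbst e w F) = sbst e' w (fls_map h F)"
proof (rule fls_eqI)
  fix l
  interpret unital_hom h by fact
  show "fls_nth (fls_map h (sbst e w F)) l = fls_nth (sbst e' w (fls_map h F)) l"
    using assms(3) scalar_embedding.sbst_nth[OF assms(1,3), of "fls_subdegree F" F]
      scalar_embedding.sbst_nth[OF assms(5,3), of "fls_subdegree F" "fls_map h F"]
    by (simp add: fls_nth_fls_map hom_sum hom_mult assms(4))
qed

subsection \<open>Restriction to the diagonal\<close>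

text \<open>The bound \<open>5\<close> is an arbitrary cut-off: \<open>diag\<close> restricts \<open>f(u, v)\<close> to \<open>v = u\<close> when both
  degrees of \<open>f\<close> are at most \<open>5\<close>.\<close>

definition diag :: "'a::ring_1 fls fls \<Rightarrow> 'a fls"
  where "diag f = Abs_fls (\<lambda>k. \<Sum>m=-5..k + 5. fls_nth (fls_nth f m) (k - m))"

lemma diag_nth: "fls_nth (diag f) k = (\<Sum>m=-5..k + 5. fls_nth (fls_nth f m) (k - m))"
  unfolding diag_def by (rule nth_Abs_fls_lower_bound[of "-10"]) simp

lemma diag_add: "diag (f + g) = diag f + diag g" and diag_diff: "diag (f - g) = diag f - diag g"
  by (rule fls_eqI, simp add: diag_nth sum.distrib sum_subtractf)+

lemma diag_0 [simp]: "diag 0 = 0"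
  by (rule fls_eqI) (simp add: diag_nth)

lemma diag_sum: "diag (sum f A) = (\<Sum>x\<in>A. diag (f x))"
  by (induction A rule: infinite_finite_induct) (simp_all add: diag_add)

text \<open>Restriction to v = u respects a product of one series in u by one series in v, in either
  order. No coefficients change places, so noncommutativity does no harm in this case.\<close>

lemma diag_mult:
  assumes F: "\<And>i. i < -5 \<Longrightarrow> fls_nth F i = 0" and G: "\<And>i. i < -5 \<Longrightarrow> fls_nth G i = 0"
  shows "diag (fls_map fls_const F * fls_const G) = F * G"
    and "diag (fls_const G * fls_map fls_const F) = G * F"
proof -
  show "diag (fls_map fls_const F * fls_const G) = F * G"
    by (rule fls_eqI) (simp add: diag_nth fls_nth_fls_map fls_mult_nth[OF F G])
  show "diag (fls_const G * fls_map fls_const F) = G * F"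
  proof (rule fls_eqI)
    fix k
    have "(\<Sum>m=-5..k + 5. fls_nth G (k - m) * fls_nth F m) = (\<Sum>m=-5..k + 5. fls_nth G m * fls_nth F (k - m))"
      by (rule sum.reindex_bij_witness[of _ "\<lambda>m. k - m" "\<lambda>m. k - m"]) auto
    then show "fls_nth (diag (fls_const G * fls_map fls_const F)) k = fls_nth (G * F) k"
      by (simp add: diag_nth fls_nth_fls_map fls_mult_nth[OF G F])
  qed
qed

text \<open>All summands of the coefficient at n come from pairs of indices with sum n, so
  identifying the parameters keeps the total degree.\<close>

lemma (in filtered_pair) diag_lev:
  "f \<in> lev (lev W) k \<Longrightarrow> diag f \<in> lev W k"
proof -
  assume f: "f \<in> lev (lev W) k"
  have "fls_nth (fls_nth f m) (n - m) \<in> W (n + k)" for m n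
  proof -
    have "fls_nth (fls_nth f m) (n - m) \<in> W (n - m + (m + k))"
      using f unfolding lev_def mem_Collect_eq by blast
    then show ?thesis by (simp add: algebra_simps)
  qed
  then show ?thesis
    unfolding lev_def mem_Collect_eq diag_nth by (blast intro: W_sum)
qed

subsection \<open>Compression to the symmetric square\<close>

definition jv :: "ix3 \<Rightarrow> ix2 \<Rightarrow> ix2 \<Rightarrow> complex"
  where "jv a p q = vvec a $ (p, q)"

lemma jv_simps:
  "jv Neg3 Neg2 Neg2 = 1" "jv Neg3 Neg2 Pos2 = 0" "jv Neg3 Pos2 Neg2 = 0" "jv Neg3 Pos2 Pos2 = 0"
  "jv Pos3 Neg2 Neg2 = 0" "jv Pos3 Neg2 Pos2 = 0" "jv Pos3 Pos2 Neg2 = 0" "jv Pos3 Pos2 Pos2 = - 1"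
  "jv Zero3 Neg2 Neg2 = 0" "jv Zero3 Neg2 Pos2 = 1 / of_real (sqrt 2)"
  "jv Zero3 Pos2 Neg2 = 1 / of_real (sqrt 2)" "jv Zero3 Pos2 Pos2 = 0"
  by (simp_all add: jv_def axis_def)

lemma jv_sym: "jv a q p = jv a p q"
  by (cases a; cases p; cases q) (simp_all add: jv_simps)

lemma sqrt2_simps [simp]:
  "complex_of_real (sqrt 2) * complex_of_real (sqrt 2) = 2"
  "complex_of_real (sqrt 2) * (complex_of_real (sqrt 2) * z) = 2 * z"
  by (simp_all flip: of_real_mult mult.assoc)

text \<open>The v_c form an orthonormal basis of the symmetric tensors, so their projections add up
  to (1 + P)/2.\<close>

lemma jv_resolution:
  "(\<Sum>c\<in>UNIV. jv c p q * jv c p' q') =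
    (if p = p' \<and> q = q' then 1/2 else 0) + (if p = q' \<and> q = p' then 1/2 else 0)"
  by (cases p; cases q; cases p'; cases q') (simp_all add: UNIV_ix3 jv_simps)

lemma jv_orthonormal:
  "(\<Sum>p\<in>UNIV. \<Sum>q\<in>UNIV. jv a p q * jv b p q) = (if a = b then 1 else 0)"
  by (cases a; cases b) (simp_all add: UNIV_ix2 jv_simps)

definition Jv :: "(leg \<Rightarrow> ix2) \<Rightarrow> ix3 \<times> ix3 \<Rightarrow> complex"
  where "Jv f a = jv (fst a) (f L1) (f L2) * jv (snd a) (f L3) (f L4)"

definition legs :: "ix2 \<times> ix2 \<Rightarrow> ix2 \<times> ix2 \<Rightarrow> leg \<Rightarrow> ix2"
  where "legs p q i = (case i of L1 \<Rightarrow> fst p | L2 \<Rightarrow> snd p | L3 \<Rightarrow> fst q | L4 \<Rightarrow> snd q)"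

lemma legs_simps [simp]: "legs p q L1 = fst p" "legs p q L2 = snd p" "legs p q L3 = fst q" "legs p q L4 = snd q"
  by (simp_all add: legs_def)

lemma leg_fun_eq_iff: "f = g \<longleftrightarrow> f L1 = g L1 \<and> f L2 = g L2 \<and> f L3 = g L3 \<and> f L4 = g L4"
  by (auto simp: fun_eq_iff) (metis leg.exhaust)

lemma legs_collapse [simp]: "legs (f L1, f L2) (f L3, f L4) = f"
  by (simp add: leg_fun_eq_iff)

lemma sum_legs: "(\<Sum>f\<in>UNIV. h f) = (\<Sum>p\<in>UNIV. \<Sum>q\<in>UNIV. h (legs p q))"
proof -
  have "(\<Sum>f\<in>UNIV. h f) = (\<Sum>pq\<in>UNIV. h (legs (fst pq) (snd pq)))"
    by (rule sum.reindex_bij_witness[of _ "\<lambda>pq. legs (fst pq) (snd pq)" "\<lambda>f. ((f L1, f L2), (f L3, f L4))"])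
       auto
  then show ?thesis
    by (simp add: sum.cartesian_product case_prod_unfold flip: UNIV_Times_UNIV)
qed

lemma sum_UNIV_prod: "(\<Sum>p\<in>UNIV. h p) = (\<Sum>a\<in>UNIV. \<Sum>b\<in>UNIV. h (a, b))"
  by (simp add: sum.cartesian_product flip: UNIV_Times_UNIV)

definition Qs :: "('a::ring_1, ix3 \<times> ix3) sqm"
  where "Qs = Mk (\<lambda>p q. if snd p = - fst p \<and> snd q = - fst q then 1 else 0)"

lemma sq_Qmat3: "sq (Qmat3 :: 'a::ring_1^(ix3 \<times> ix3)^(ix3 \<times> ix3)) = Qs"
proof (rule sqm_eqI)
  fix p q :: "ix3 \<times> ix3"
  have "tens (munit i j) (munit (- i) (- j)) $ p $ q =
      (if j = fst q then if i = fst p then ent Qs p q else 0 else (0 :: 'a))" for i j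
    by (cases p; cases q) (auto simp: tens_def munit_def Qs_def)
  then show "ent (sq (Qmat3 :: 'a^(ix3 \<times> ix3)^(ix3 \<times> ix3))) p q = ent Qs p q"
    by (simp add: Qmat3_def)
qed

context scalar_embedding
begin

text \<open>J* N J for the isometry J of V (x) V into the four legs; legs 1, 2 form the first copy
  of V and legs 3, 4 the second.\<close>

definition psi :: "('a, leg \<Rightarrow> ix2) sqm \<Rightarrow> ('a, ix3 \<times> ix3) sqm"
  where "psi N = Mk (\<lambda>a b. \<Sum>f\<in>UNIV. \<Sum>g\<in>UNIV. e (Jv f a * Jv g b) * ent N f g)"

definition Pi12 :: "('a, leg \<Rightarrow> ix2) sqm" where "Pi12 = cst (e (1/2)) * (1 + swp L1 L2)"
definition Pi34 :: "('a, leg \<Rightarrow> ix2) sqm" where "Pi34 = cst (e (1/2)) * (1 + swp L3 L4)"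

lemma psi_add: "psi (M + N) = psi M + psi N" and psi_diff: "psi (M - N) = psi M - psi N"
  by (rule sqm_eqI, simp add: psi_def distrib_left right_diff_distrib sum.distrib sum_subtractf)+

lemma psi_0 [simp]: "psi 0 = 0"
  by (rule sqm_eqI) (simp add: psi_def)

lemma psi_cst: "central c \<Longrightarrow> psi (cst c * N) = cst c * psi N"
  by (rule sqm_eqI) (simp add: psi_def sum_distrib_left central_left_commute)

lemma Jv_swp: "Jv (f \<circ> Transposition.transpose L1 L2) a = Jv f a"
  "Jv (f \<circ> Transposition.transpose L3 L4) a = Jv f a"
  by (simp_all add: Jv_def jv_sym[of _ "f L2"] jv_sym[of _ "f L4"] Transposition.transpose_def)

lemma sum_comp_transpose:
  "(\<Sum>f\<in>UNIV. h (f \<circ> Transposition.transpose i j :: leg \<Rightarrow> ix2)) = (\<Sum>f\<in>UNIV. h f)"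
  by (rule sum.reindex_bij_witness[of _ "\<lambda>f. f \<circ> Transposition.transpose i j" "\<lambda>f. f \<circ> Transposition.transpose i j"])
     (simp_all add: comp_assoc transpose_comp_self)

lemma psi_swp_left:
  assumes "\<And>f a. Jv (f \<circ> Transposition.transpose i j) a = Jv f a"
  shows "psi (swp i j * N) = psi N"
proof (rule sqm_eqI)
  fix a b
  show "ent (psi (swp i j * N)) a b = ent (psi N) a b"
    using sum_comp_transpose[of "\<lambda>f. \<Sum>g\<in>UNIV. e (Jv f a * Jv g b) * ent N f g" i j]
    by (simp add: psi_def ent_permop_mult assms)
qed

lemma psi_swp_right:
  assumes "\<And>f a. Jv (f \<circ> Transposition.transpose i j) a = Jv f a"
  shows "psi (N * swp i j) = psi N"
proof (rule sqm_eqI)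
  fix a b
  have "(\<Sum>g\<in>UNIV. e (Jv f a * Jv g b) * ent N f (g \<circ> Transposition.transpose i j)) =
    (\<Sum>g\<in>UNIV. e (Jv f a * Jv g b) * ent N f g)" for f
    using sum_comp_transpose[of "\<lambda>g. e (Jv f a * Jv g b) * ent N f g" i j]
    by (simp add: assms)
  then show "ent (psi (N * swp i j)) a b = ent (psi N) a b"
    by (simp add: psi_def ent_mult_permop[OF transpose_comp_self])
qed

lemma psi_swp [simp]:
  "psi (swp L1 L2 * N) = psi N" "psi (swp L3 L4 * N) = psi N"
  "psi (N * swp L1 L2) = psi N" "psi (N * swp L3 L4) = psi N"
  by (simp_all add: psi_swp_left psi_swp_right Jv_swp)

lemma psi_swp_1 [simp]: "psi (swp L1 L2) = psi 1" "psi (swp L3 L4) = psi 1"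
  using psi_swp(1,2)[of 1] by simp_all

lemma e_if: "e (if b then 1 else 0) = (if b then 1 else 0)"
  by simp

lemma half_half: "cst (e (1/2)) * x + cst (e (1/2)) * x = (x :: ('a, 'n::finite) sqm)"
proof -
  have "cst (e (1/2)) * x + cst (e (1/2)) * x = cst (e (1/2) + e (1/2)) * x"
    by (simp add: cst.hom_add distrib_right)
  also have "e (1/2) + e (1/2) = 1"
    using hom_add[of "1/2" "1/2"] by simp
  finally show ?thesis by (simp add: cst.hom_1)
qed

lemma psi_Pi [simp]: "psi (Pi12 * N) = psi N" "psi (N * Pi12) = psi N" "psi (Pi34 * N) = psi N" "psi (N * Pi34) = psi N"
proof -
  have c: "central (cst (e (1/2)) :: ('a, leg \<Rightarrow> ix2) sqm)"
    by (rule central_cst[OF central_e])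
  show "psi (Pi12 * N) = psi N" "psi (Pi34 * N) = psi N"
    by (simp_all add: Pi12_def Pi34_def mult.assoc psi_cst central_e distrib_right psi_add distrib_left half_half)
  show "psi (N * Pi12) = psi N" "psi (N * Pi34) = psi N"
    unfolding Pi12_def Pi34_def central_left_commute[OF c]
    by (simp_all add: psi_cst central_e distrib_left psi_add half_half)
qed

text \<open>J J* is the projector onto the tensors symmetric in legs 1, 2 and in legs 3, 4; each
  pair of legs contributes one \<open>jv_resolution\<close>.\<close>

lemma ent_Pi_Pi: "ent (Pi12 * Pi34) f g = e (\<Sum>c\<in>UNIV. Jv f c * Jv g c)"
proof -
  have *: "Pi12 * Pi34 = cst (e (1/2)) * (cst (e (1/2)) * (1 + swp L1 L2 + swp L3 L4 + permop (Transposition.transpose L1 L2 \<circ> Transposition.transpose L3 L4)))"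
    unfolding Pi12_def Pi34_def mult.assoc central_left_commute[OF central_cst[OF central_e], of "1 + swp L1 L2"]
    by (simp add: distrib_left distrib_right permop_mult add_ac)
  have "(\<Sum>c\<in>UNIV. Jv f c * Jv g c) =
      (\<Sum>a\<in>UNIV. jv a (f L1) (f L2) * jv a (g L1) (g L2)) * (\<Sum>a\<in>UNIV. jv a (f L3) (f L4) * jv a (g L3) (g L4))"
    by (simp add: sum_UNIV_prod Jv_def sum_product mult_ac)
  also have "\<dots> = (1/2) * ((1/2) * ((if f = g then 1 else 0) + (if g = f \<circ> Transposition.transpose L1 L2 then 1 else 0)
      + (if g = f \<circ> Transposition.transpose L3 L4 then 1 else 0)
      + (if g = f \<circ> (Transposition.transpose L1 L2 \<circ> Transposition.transpose L3 L4) then 1 else 0)))"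
  proof -
    have prod: "((if A then 1/2 else 0) + (if B then 1/2 else 0)) * ((if C then 1/2 else 0) + (if D then 1/2 else 0)) =
       (1/2) * ((1/2) * ((if A \<and> C then 1 else 0) + (if B \<and> C then 1 else 0) + (if A \<and> D then 1 else 0)
       + (if B \<and> D then 1 else (0 :: complex))))" for A B C D
      by simp
    have iffs: "f = g \<longleftrightarrow> (f L1 = g L1 \<and> f L2 = g L2) \<and> (f L3 = g L3 \<and> f L4 = g L4)"
      "g = f \<circ> Transposition.transpose L1 L2 \<longleftrightarrow> (f L1 = g L2 \<and> f L2 = g L1) \<and> (f L3 = g L3 \<and> f L4 = g L4)"
      "g = f \<circ> Transposition.transpose L3 L4 \<longleftrightarrow> (f L1 = g L1 \<and> f L2 = g L2) \<and> (f L3 = g L4 \<and> f L4 = g L3)"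
      "g = f \<circ> (Transposition.transpose L1 L2 \<circ> Transposition.transpose L3 L4) \<longleftrightarrow>
        (f L1 = g L2 \<and> f L2 = g L1) \<and> (f L3 = g L4 \<and> f L4 = g L3)"
      unfolding leg_fun_eq_iff[of _ "f \<circ> _"] leg_fun_eq_iff[of f g] by (auto simp: Transposition.transpose_def)
    show ?thesis
      unfolding jv_resolution iffs prod ..
  qed
  finally show ?thesis
    unfolding * by (simp only: ent_cst_mult ent_simps ent_one permop_def ent_Mk hom_mult hom_add e_if)
qed

text \<open>J* M J J* N J with J J* equal to \<open>Pi12 * Pi34\<close>. Compression is
  multiplicative only up to this projector, which is why the projectors are tracked in the exchange
  relations.\<close>

lemma psi_mult: "psi M * psi N = psi (M * (Pi12 * Pi34) * N)"
proof (rule sqm_eqI)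
  fix a b
  have comm: "e c * x * (e d * y) = e (c * d) * (x * y)" for c d x y
    unfolding mult.assoc hom_mult central_left_commute[OF central_e, of x d y] ..
  have swap: "(\<Sum>h\<in>UNIV. \<Sum>g\<in>UNIV. \<Sum>k\<in>UNIV. T h g k) = (\<Sum>k\<in>UNIV. \<Sum>h\<in>UNIV. \<Sum>g\<in>UNIV. T h g k)"
    for T :: "(leg \<Rightarrow> ix2) \<Rightarrow> (leg \<Rightarrow> ix2) \<Rightarrow> (leg \<Rightarrow> ix2) \<Rightarrow> 'a"
  proof -
    have "(\<Sum>h\<in>UNIV. \<Sum>g\<in>UNIV. \<Sum>k\<in>UNIV. T h g k) = (\<Sum>h\<in>UNIV. \<Sum>k\<in>UNIV. \<Sum>g\<in>UNIV. T h g k)"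
      by (rule sum.cong[OF refl], rule sum.swap)
    also have "\<dots> = (\<Sum>k\<in>UNIV. \<Sum>h\<in>UNIV. \<Sum>g\<in>UNIV. T h g k)"
      by (rule sum.swap)
    finally show ?thesis .
  qed
  have "ent (psi M * psi N) a b = (\<Sum>c\<in>UNIV. \<Sum>f\<in>UNIV. \<Sum>h\<in>UNIV. \<Sum>g\<in>UNIV. \<Sum>k\<in>UNIV.
     e (Jv f a * Jv g c * (Jv h c * Jv k b)) * (ent M f g * ent N h k))"
    unfolding ent_mult psi_def ent_Mk sum_product comm ..
  also have "\<dots> = (\<Sum>f\<in>UNIV. \<Sum>h\<in>UNIV. \<Sum>g\<in>UNIV. \<Sum>k\<in>UNIV. \<Sum>c\<in>UNIV.
     e (Jv f a * Jv g c * (Jv h c * Jv k b)) * (ent M f g * ent N h k))"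
    by (simp only: sum.swap[where A = "UNIV :: (ix3 \<times> ix3) set"])
  also have "\<dots> = (\<Sum>f\<in>UNIV. \<Sum>h\<in>UNIV. \<Sum>g\<in>UNIV. \<Sum>k\<in>UNIV.
     e (Jv f a * Jv k b) * (ent M f g * ent (Pi12 * Pi34) g h * ent N h k))"
  proof (intro sum.cong refl)
    fix f g h k
    have "(\<Sum>c\<in>UNIV. e (Jv f a * Jv g c * (Jv h c * Jv k b)) * (ent M f g * ent N h k)) =
       e (Jv f a * Jv k b * (\<Sum>c\<in>UNIV. Jv g c * Jv h c)) * (ent M f g * ent N h k)"
      by (simp add: hom_sum sum_distrib_left sum_distrib_right mult_ac)
    also have "\<dots> = e (Jv f a * Jv k b) * (ent M f g * ent (Pi12 * Pi34) g h * ent N h k)"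
      unfolding ent_Pi_Pi
      by (simp only: hom_mult mult.assoc central_left_commute[OF central_e, of "ent M f g"])
    finally show "(\<Sum>c\<in>UNIV. e (Jv f a * Jv g c * (Jv h c * Jv k b)) * (ent M f g * ent N h k)) = \<dots>" .
  qed
  also have "\<dots> = (\<Sum>f\<in>UNIV. \<Sum>k\<in>UNIV. \<Sum>h\<in>UNIV. \<Sum>g\<in>UNIV.
     e (Jv f a * Jv k b) * (ent M f g * ent (Pi12 * Pi34) g h * ent N h k))"
    by (rule sum.cong[OF refl], rule swap)
  also have "\<dots> = (\<Sum>f\<in>UNIV. \<Sum>k\<in>UNIV. e (Jv f a * Jv k b) *
     (\<Sum>h\<in>UNIV. (\<Sum>g\<in>UNIV. ent M f g * ent (Pi12 * Pi34) g h) * ent N h k))"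
    unfolding sum_distrib_right sum_distrib_left ..
  also have "\<dots> = ent (psi (M * (Pi12 * Pi34) * N)) a b"
    unfolding psi_def ent_mult[of "M * _"] ent_mult[of M] ent_Mk ..
  finally show "ent (psi M * psi N) a b = ent (psi (M * (Pi12 * Pi34) * N)) a b" .
qed

lemma Jv_orthonormal: "(\<Sum>f\<in>UNIV. Jv f a * Jv f b) = (if a = b then 1 else 0)"
proof -
  have "(\<Sum>f\<in>UNIV. Jv f a * Jv f b) = (\<Sum>p\<in>UNIV. \<Sum>q\<in>UNIV. jv (fst a) p q * jv (fst b) p q) *
     (\<Sum>p\<in>UNIV. \<Sum>q\<in>UNIV. jv (snd a) p q * jv (snd b) p q)"
    by (simp add: sum_legs Jv_def flip: sum_UNIV_prod[where h = "\<lambda>p. jv _ (fst p) (snd p) * jv _ (fst p) (snd p)", simplified])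
       (simp add: sum_product mult_ac)
  then show ?thesis
    by (simp add: jv_orthonormal prod_eq_iff)
qed

lemma psi_permop: "ent (psi (permop \<sigma>)) a b = e (\<Sum>f\<in>UNIV. Jv f a * Jv (f \<circ> \<sigma>) b)"
  by (simp add: psi_def permop_def hom_sum if_distrib[of "\<lambda>x. _ * x"] cong: if_cong)

lemma psi_1: "psi 1 = 1"
  using psi_permop[of id] by (intro sqm_eqI) (simp add: permop_id Jv_orthonormal ent_one)

lemma psi_swp_13_24: "psi (swp L1 L3 * swp L2 L4) = flip_sq"
proof (rule sqm_eqI)
  fix a b :: "ix3 \<times> ix3"
  have "Jv (f \<circ> (Transposition.transpose L1 L3 \<circ> Transposition.transpose L2 L4)) b = Jv f (prod.swap b)" for f
    by (simp add: Jv_def Transposition.transpose_def)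
  then show "ent (psi (swp L1 L3 * swp L2 L4)) a b = ent flip_sq a b"
    unfolding permop_mult psi_permop by (auto simp: Jv_orthonormal flip_sq_def)
qed

text \<open>This is where Q comes from: exchanging one leg of each pair compresses to (1 + P - Q)/2.
  The minus sign in v_1 makes the vector that spans the image of Q, the sum of the v_i (x) v_-i,
  invariant under sl_2. Both sides are compared entry by entry.\<close>

lemma psi_swp_13: "psi (swp L1 L3) = cst (e (1/2)) * (1 + flip_sq - Qs)"
proof (rule sqm_eqI)
  fix a b :: "ix3 \<times> ix3"
  obtain a1 a2 b1 b2 where ab: "a = (a1, a2)" "b = (b1, b2)"
    by (cases a; cases b)
  have "(\<Sum>f\<in>UNIV. Jv f a * Jv (f \<circ> Transposition.transpose L1 L3) b) =
     (\<Sum>p\<in>UNIV. \<Sum>q\<in>UNIV. \<Sum>r\<in>UNIV. \<Sum>s\<in>UNIV. jv a1 p q * jv a2 r s * (jv b1 r q * jv b2 p s))"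
    by (simp add: sum_legs sum_UNIV_prod Jv_def ab Transposition.transpose_def)
  also have "\<dots> = (1/2) * ((if a = b then 1 else 0) + (if b = prod.swap a then 1 else 0)
      - (if a2 = - a1 \<and> b2 = - b1 then 1 else 0))"
    unfolding ab by (cases a1; cases a2; cases b1; cases b2) (simp_all add: UNIV_ix2 jv_simps)
  finally show "ent (psi (swp L1 L3)) a b = ent (cst (e (1/2)) * (1 + flip_sq - Qs)) a b"
    unfolding psi_permop ent_cst_mult ent_simps ent_one flip_sq_def Qs_def ent_Mk
    by (simp only: hom_mult hom_add hom_diff e_if ab fst_conv snd_conv)
qed

section \<open>Double cosets of permutations and the fused R-matrix\<close>

lemma expand4:
  fixes x y z t :: "'r::ring_1"
  assumes "central a" "central b" "central c" "central d"
  shows "(1 - a * x) * (1 - b * y) * (1 - c * z) * (1 - d * t) =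
    1 - (a * x + b * y + c * z + d * t)
    + (a * b * (x * y) + a * c * (x * z) + a * d * (x * t) + b * c * (y * z) + b * d * (y * t) + c * d * (z * t))
    - (a * b * c * (x * y * z) + a * b * d * (x * y * t) + a * c * d * (x * z * t) + b * c * d * (y * z * t))
    + a * b * c * d * (x * y * z * t)"
proof -
  have expand: "(1 - X1) * (1 - X2) * (1 - X3) * (1 - X4) =
    1 - (X1 + X2 + X3 + X4) + (X1 * X2 + X1 * X3 + X1 * X4 + X2 * X3 + X2 * X4 + X3 * X4)
    - (X1 * X2 * X3 + X1 * X2 * X4 + X1 * X3 * X4 + X2 * X3 * X4) + X1 * X2 * X3 * X4" for X1 X2 X3 X4 :: 'r
    by (simp add: algebra_simps)
  have comm: "c1 * w1 * (c2 * w2) = c1 * c2 * (w1 * w2)" if "central c2" for c1 c2 w1 w2 :: 'r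
    by (metis mult.assoc centralD that)
  show ?thesis
    unfolding expand by (simp only: assms comm)
qed

lemma leg_eqI: "s L1 = t L1 \<Longrightarrow> s L2 = t L2 \<Longrightarrow> s L3 = t L3 \<Longrightarrow> s L4 = t L4 \<Longrightarrow> s = t"
  for s t :: "leg \<Rightarrow> 'x"
  by (rule ext, rename_tac k, case_tac k) auto

text \<open>For the subgroup generated by (12) and (34), S_4 has three double cosets, represented by
  1, (13) and (13)(24). Each word that occurs in the fused R-matrix is written as a representative
  with subgroup elements on its sides, because \<open>psi\<close> does not see the latter.\<close>

lemma swp_word1: "swp L1 L4 = swp L3 L4 * swp L1 L3 * swp L3 L4"
  unfolding permop_mult
  by (rule arg_cong[of _ _ permop], rule leg_eqI) (simp_all add: Transposition.transpose_def)

lemma swp_word2: "swp L2 L4 = swp L1 L2 * (swp L3 L4 * (swp L1 L3 * swp L1 L2 * swp L3 L4))"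
  unfolding permop_mult
  by (rule arg_cong[of _ _ permop], rule leg_eqI) (simp_all add: Transposition.transpose_def)

lemma swp_word3: "swp L2 L3 = swp L1 L2 * (swp L1 L3 * swp L1 L2)"
  unfolding permop_mult
  by (rule arg_cong[of _ _ permop], rule leg_eqI) (simp_all add: Transposition.transpose_def)

lemma swp_word4: "swp L1 L4 * swp L2 L4 = swp L1 L2 * (swp L3 L4 * (swp L1 L3 * swp L3 L4))"
  unfolding permop_mult
  by (rule arg_cong[of _ _ permop], rule leg_eqI) (simp_all add: Transposition.transpose_def)

lemma swp_word5: "swp L1 L4 * swp L1 L3 = swp L1 L3 * swp L3 L4"
  unfolding permop_mult
  by (rule arg_cong[of _ _ permop], rule leg_eqI) (simp_all add: Transposition.transpose_def)

lemma swp_word6: "swp L1 L4 * swp L2 L3 = swp L1 L2 * (swp L1 L3 * swp L2 L4 * swp L1 L2)"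
  unfolding permop_mult
  by (rule arg_cong[of _ _ permop], rule leg_eqI) (simp_all add: Transposition.transpose_def)

lemma swp_word7: "swp L2 L4 * swp L1 L3 = swp L1 L3 * swp L2 L4"
  unfolding permop_mult
  by (rule arg_cong[of _ _ permop], rule leg_eqI) (simp_all add: Transposition.transpose_def)

lemma swp_word8: "swp L2 L4 * swp L2 L3 = swp L1 L2 * (swp L1 L3 * swp L1 L2 * swp L3 L4)"
  unfolding permop_mult
  by (rule arg_cong[of _ _ permop], rule leg_eqI) (simp_all add: Transposition.transpose_def)

lemma swp_word9: "swp L1 L3 * swp L2 L3 = swp L1 L2 * swp L1 L3"
  unfolding permop_mult
  by (rule arg_cong[of _ _ permop], rule leg_eqI) (simp_all add: Transposition.transpose_def)

lemma swp_word10: "swp L1 L4 * swp L2 L4 * swp L1 L3 = swp L1 L2 * (swp L1 L3 * swp L3 L4)"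
  unfolding permop_mult
  by (rule arg_cong[of _ _ permop], rule leg_eqI) (simp_all add: Transposition.transpose_def)

lemma swp_word11: "swp L1 L4 * swp L2 L4 * swp L2 L3 = swp L1 L3 * swp L2 L4 * swp L1 L2"
  unfolding permop_mult
  by (rule arg_cong[of _ _ permop], rule leg_eqI) (simp_all add: Transposition.transpose_def)

lemma swp_word12: "swp L1 L4 * swp L1 L3 * swp L2 L3 = swp L1 L3 * swp L2 L4 * swp L3 L4"
  unfolding permop_mult
  by (rule arg_cong[of _ _ permop], rule leg_eqI) (simp_all add: Transposition.transpose_def)

lemma swp_word13: "swp L2 L4 * swp L1 L3 * swp L2 L3 = swp L1 L2 * (swp L1 L3 * swp L3 L4)"
  unfolding permop_mult
  by (rule arg_cong[of _ _ permop], rule leg_eqI) (simp_all add: Transposition.transpose_def)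

lemma swp_word14: "swp L1 L4 * swp L2 L4 * swp L1 L3 * swp L2 L3 = swp L1 L3 * swp L2 L4"
  unfolding permop_mult
  by (rule arg_cong[of _ _ permop], rule leg_eqI) (simp_all add: Transposition.transpose_def)

lemmas swp_words = swp_word1 swp_word2 swp_word3 swp_word4 swp_word5 swp_word6 swp_word7 swp_word8 swp_word9 swp_word10 swp_word11 swp_word12 swp_word13 swp_word14

lemma psi_words:
  "psi (swp L1 L4) = psi (swp L1 L3)"
  "psi (swp L2 L4) = psi (swp L1 L3)"
  "psi (swp L2 L3) = psi (swp L1 L3)"
  "psi (swp L1 L4 * swp L2 L4) = psi (swp L1 L3)"
  "psi (swp L1 L4 * swp L1 L3) = psi (swp L1 L3)"
  "psi (swp L1 L4 * swp L2 L3) = psi (swp L1 L3 * swp L2 L4)"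
  "psi (swp L2 L4 * swp L1 L3) = psi (swp L1 L3 * swp L2 L4)"
  "psi (swp L2 L4 * swp L2 L3) = psi (swp L1 L3)"
  "psi (swp L1 L3 * swp L2 L3) = psi (swp L1 L3)"
  "psi (swp L1 L4 * swp L2 L4 * swp L1 L3) = psi (swp L1 L3)"
  "psi (swp L1 L4 * swp L2 L4 * swp L2 L3) = psi (swp L1 L3 * swp L2 L4)"
  "psi (swp L1 L4 * swp L1 L3 * swp L2 L3) = psi (swp L1 L3 * swp L2 L4)"
  "psi (swp L2 L4 * swp L1 L3 * swp L2 L3) = psi (swp L1 L3)"
  "psi (swp L1 L4 * swp L2 L4 * swp L1 L3 * swp L2 L3) = psi (swp L1 L3 * swp L2 L4)"
proof -
  show "psi (swp L1 L4) = psi (swp L1 L3)"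
    by (subst swp_word1, simp)
  show "psi (swp L2 L4) = psi (swp L1 L3)"
    by (subst swp_word2, simp)
  show "psi (swp L2 L3) = psi (swp L1 L3)"
    by (subst swp_word3, simp)
  show "psi (swp L1 L4 * swp L2 L4) = psi (swp L1 L3)"
    by (subst swp_word4, simp)
  show "psi (swp L1 L4 * swp L1 L3) = psi (swp L1 L3)"
    by (subst swp_word5, simp)
  show "psi (swp L1 L4 * swp L2 L3) = psi (swp L1 L3 * swp L2 L4)"
    by (subst swp_word6, simp)
  show "psi (swp L2 L4 * swp L1 L3) = psi (swp L1 L3 * swp L2 L4)"
    by (subst swp_word7, simp)
  show "psi (swp L2 L4 * swp L2 L3) = psi (swp L1 L3)"
    by (subst swp_word8, simp)
  show "psi (swp L1 L3 * swp L2 L3) = psi (swp L1 L3)"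
    by (subst swp_word9, simp)
  show "psi (swp L1 L4 * swp L2 L4 * swp L1 L3) = psi (swp L1 L3)"
    by (subst swp_word10, simp)
  show "psi (swp L1 L4 * swp L2 L4 * swp L2 L3) = psi (swp L1 L3 * swp L2 L4)"
    by (subst swp_word11, simp)
  show "psi (swp L1 L4 * swp L1 L3 * swp L2 L3) = psi (swp L1 L3 * swp L2 L4)"
    by (subst swp_word12, simp)
  show "psi (swp L2 L4 * swp L1 L3 * swp L2 L3) = psi (swp L1 L3)"
    by (subst swp_word13, simp)
  show "psi (swp L1 L4 * swp L2 L4 * swp L1 L3 * swp L2 L3) = psi (swp L1 L3 * swp L2 L4)"
    by (subst swp_word14, simp)
qed

text \<open>Each of the fifteen nonempty subwords of the four factors falls into the double coset of
  (13) or of (13)(24); the two scalars collect them with the sign given by the length.\<close>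

lemma psi_fused:
  assumes "central a" "central b" "central c"
  shows "psi ((1 - cst a * swp L1 L4) * (1 - cst b * swp L2 L4) * (1 - cst b * swp L1 L3) * (1 - cst c * swp L2 L3)) =
    1 - cst ((a + b + b + c) - (a * b + a * b + b * c + b * c) + (a * b * b + b * b * c)) * psi (swp L1 L3)
      + cst (a * c + b * b - (a * b * c + a * b * c) + a * b * b * c) * flip_sq"
proof -
  note c = assms[THEN central_cst]
  have [simp]: "psi (cst d * N) = cst d * psi N" if "central d" for d N
    using that by (rule psi_cst)
  note [simp] = central_mult assms psi_add psi_diff psi_1 psi_words psi_swp_13_24
  show ?thesis
    unfolding expand4[OF c(1) c(2) c(2) c(3)] cst.hom_mult[symmetric] psi_add psi_diff
    by (simp, simp add: cst.hom_add cst.hom_diff algebra_simps)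
qed

end

subsection \<open>Rational functions of the spectral parameters\<close>

text \<open>\<open>iu\<close> and \<open>iv\<close> place a series in one parameter among the series
  in two: the outer variable is u^-1, the inner one v^-1. \<open>e1\<close> and \<open>e2\<close>
  embed complex series with one and with two parameters.\<close>

definition iu :: "'a::ring_1 fls \<Rightarrow> 'a fls fls" where "iu = fls_map fls_const"
definition iv :: "'a::ring_1 fls \<Rightarrow> 'a fls fls" where "iv = fls_const"
definition e1 :: "complex fls \<Rightarrow> 'g free_alg fls" where "e1 = fls_map scal"
definition e2 :: "complex fls fls \<Rightarrow> 'g free_alg fls fls" where "e2 = fls_map e1"

lemma unital_hom_scal: "unital_hom scal"
  by standard (simp_all add: scal_add scal_mult)

lemma unital_hom_iu: "unital_hom iu" and unital_hom_iv: "unital_hom iv"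
  and unital_hom_e1: "unital_hom e1" and unital_hom_e2: "unital_hom e2"
  unfolding iu_def iv_def e1_def e2_def
  by (intro unital_hom_fls_map unital_hom_fls_const unital_hom_scal)+

interpretation iu: unital_hom iu by (rule unital_hom_iu)
interpretation iv: unital_hom iv by (rule unital_hom_iv)
interpretation e1: unital_hom e1 by (rule unital_hom_e1)
interpretation e2: unital_hom e2 by (rule unital_hom_e2)
interpretation scal: scalar_embedding scal
  by (intro scalar_embedding.intro unital_hom_scal scalar_embedding_axioms.intro)
     (simp add: central_def scal_central)

lemma nth_iu [simp]: "fls_nth (iu f) n = fls_const (fls_nth f n)"
  and nth_iv [simp]: "fls_nth (iv f) n = (if n = 0 then f else 0)"
  and nth_e1 [simp]: "fls_nth (e1 x) n = scal (fls_nth x n)"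
  and nth_e2 [simp]: "fls_nth (e2 y) n = e1 (fls_nth y n)"
  unfolding e2_def fls_nth_fls_map[of e1, OF e1.hom_0]
  by (simp_all add: iu_def iv_def e1_def fls_nth_fls_map)

lemma central_scal: "central (scal c)"
  by (rule scal.central_e)

lemma central_e1: "central (e1 x)"
  by (rule central_fls) (simp add: central_scal)

lemma central_e2: "central (e2 x)"
  by (rule central_fls) (simp add: central_e1)

lemma central_fls_const: "central c \<Longrightarrow> central (fls_const c)"
  by (rule central_fls) simp

lemma scalar_embedding_fls_const:
  assumes "scalar_embedding e" shows "scalar_embedding (\<lambda>c. fls_const (e c))"
proof (intro scalar_embedding.intro scalar_embedding_axioms.intro)
  show "unital_hom (\<lambda>c. fls_const (e c))"
    by (rule unital_hom_compose[OF unital_hom_fls_const scalar_embedding.axioms(1)[OF assms]])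
  show "central (fls_const (e c))" for c
    by (rule central_fls_const[OF scalar_embedding.central_e[OF assms]])
qed

definition kc :: "complex \<Rightarrow> 'g free_alg fls" where "kc c = fls_const (scal c)"
definition kc2 :: "complex \<Rightarrow> 'g free_alg fls fls" where "kc2 c = fls_const (kc c)"

interpretation kc: scalar_embedding kc
  using scalar_embedding_fls_const[OF scal.scalar_embedding_axioms] by (simp add: kc_def[abs_def])

interpretation kc2: scalar_embedding kc2
  using scalar_embedding_fls_const[OF kc.scalar_embedding_axioms] by (simp add: kc2_def[abs_def])

interpretation idc: scalar_embedding "id :: complex \<Rightarrow> complex"
  by standard (simp_all add: central_def)

interpretation kcc: scalar_embedding "fls_const :: complex \<Rightarrow> complex fls"
  using scalar_embedding_fls_const[OF idc.scalar_embedding_axioms] by simp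

lemma e1_fls_const [simp]: "e1 (fls_const c) = fls_const (scal c)"
  by (simp add: e1_def fls_map_fls_const)

definition pu :: "complex fls \<Rightarrow> complex fls fls" where "pu w = iu w"
definition pv :: "complex fls \<Rightarrow> complex fls fls" where "pv w = iv w"

lemma e2_pu: "e2 (pu w) = iu (e1 w)" and e2_pv: "e2 (pv w) = iv (e1 w)"
  by (rule fls_eqI, simp add: pu_def pv_def)+

lemma pu_add: "pu (w + w') = pu w + pu w'" and pv_add: "pv (w + w') = pv w + pv w'"
  and pu_diff: "pu (w - w') = pu w - pu w'" and pv_diff: "pv (w - w') = pv w - pv w'"
  by (simp_all add: pu_def pv_def iu.hom_add iv.hom_add iu.hom_diff iv.hom_diff)

lemma par_u_eq: "par_u = pu fls_X_inv" and par_v_eq: "par_v = pv fls_X_inv"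
  by (simp_all add: par_u_def par_v_def pu_def pv_def iu_def iv_def fls_map_fls_X_inv)

definition aff :: "complex \<Rightarrow> complex \<Rightarrow> complex fls"
  where "aff a c = fls_const a * fls_X_inv + fls_const c"

lemma aff_nth: "fls_nth (aff a c) n = (if n = -1 then a else if n = 0 then c else 0)"
  by (simp add: aff_def)

lemma subdegree_aff [simp]: "a \<noteq> 0 \<Longrightarrow> fls_subdegree (aff a c) = -1"
  by (rule fls_subdegree_eqI) (simp_all add: aff_nth)

lemma aff_add: "aff a c + aff b d = aff (a + b) (c + d)" and aff_diff: "aff a c - aff b d = aff (a - b) (c - d)"
  by (rule fls_eqI, simp add: aff_nth)+

lemma X_inv_aff: "fls_X_inv = aff 1 0"
  by (rule fls_eqI) (simp add: aff_nth)

text \<open>The complex numbers in degree 0: levels over this filtration are degree bounds in u, or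
  bounds of the total degree in u and v.\<close>

definition FC :: "int \<Rightarrow> complex set"
  where "FC k = (if 0 \<le> k then UNIV else {0})"

interpretation FC: filtered_pair FC FC
  by standard (auto simp: FC_def split: if_splits)

interpretation FC1: filtered_pair "lev FC" "lev FC"
  by (rule FC.filtered_pair_lev)

interpretation FC2: filtered_pair "lev (lev FC)" "lev (lev FC)"
  by (rule FC1.filtered_pair_lev)

lemma lev_FC: "x \<in> lev FC k \<longleftrightarrow> (\<forall>n. n < - k \<longrightarrow> fls_nth x n = 0)"
  by (auto simp: lev_def FC_def)

lemma aff_lev: "aff a c \<in> lev FC 1"
  by (auto simp: lev_FC aff_nth)

lemma pu_lev: "w \<in> lev FC k \<Longrightarrow> pu w \<in> lev (lev FC) k" and pv_lev: "w \<in> lev FC k \<Longrightarrow> pv w \<in> lev (lev FC) k"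
  unfolding pu_def pv_def lev_def[of "lev FC"] by (auto simp: lev_FC)

lemma inverse_aff_lev: "a \<noteq> 0 \<Longrightarrow> 1 / aff a c \<in> lev FC (-1)"
  by (simp add: lev_FC fls_divide_def)

text \<open>Expanded in u^-1, the inverse of a u + f_0 is a geometric series in f_0/u. Each step
  trades a power of u for at most one power of v, so the total degree stays -1 although the powers
  of v are unbounded.\<close>

lemma inverse_lev_aux:
  fixes f :: "complex fls fls"
  assumes f: "fls_nth f (-1) = fls_const a" "fls_nth f 0 \<in> lev FC 1" "\<And>n. n \<notin> {-1, 0} \<Longrightarrow> fls_nth f n = 0"
    and a: "a \<noteq> 0"
  shows "f \<noteq> 0" "1 / f \<in> lev (lev FC) (-1)"
proof -
  have sub: "fls_subdegree f = -1"
    by (rule fls_subdegree_eqI) (use f a in auto)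
  then show f0: "f \<noteq> 0" by auto
  define g where "g = 1 / f"
  have sg: "fls_nth g n = 0" if "n < 1" for n
    using f0 sub that by (simp add: g_def fls_divide_def fls_inverse_subdegree)
  have fg: "f * g = 1" using f0 by (simp add: g_def)
  \<comment> \<open>The coefficients of \<open>f * g = 1\<close>: only two coefficients of
    \<open>f\<close> are nonzero, which leaves a recursion for those of \<open>g\<close>.\<close>
  have rec: "fls_const a * fls_nth g (n + 1) + fls_nth f 0 * fls_nth g n = (if n = 0 then 1 else 0)" for n
  proof -
    have "fls_nth (f * g) n = (\<Sum>i=-1..n - 1. fls_nth f i * fls_nth g (n - i))"
      by (rule fls_mult_nth) (use f sg in auto)
    also have "\<dots> = (\<Sum>i\<in>{-1, 0}. fls_nth f i * fls_nth g (n - i))"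
      by (rule sum.mono_neutral_cong) (use f sg in auto)
    finally show ?thesis using fg f(1) by simp
  qed
  have c: "fls_const b \<in> lev FC 0" for b
    by (auto simp: lev_FC)
  have nat: "fls_nth g (int n) \<in> lev FC (int n - 1)" for n
  proof (induction n)
    case 0
    then show ?case using sg by (simp add: FC1.F_0)
  next
    case (Suc n)
    have "fls_nth g (int n + 1) = fls_const (1/a) * (fls_const a * fls_nth g (int n + 1))"
      using a by (simp flip: mult.assoc)
    also have "fls_const a * fls_nth g (int n + 1) = (if n = 0 then 1 else 0) - fls_nth f 0 * fls_nth g (int n)"
      using rec[of "int n"] by (simp add: eq_diff_eq split: if_splits)
    finally have "fls_nth g (int n + 1) =
      fls_const (1/a) * ((if n = 0 then 1 else 0) - fls_nth f 0 * fls_nth g (int n))" .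
    moreover have "\<dots> \<in> lev FC (int n)"
      by (rule FC1.FF'[OF c, where j = "int n"], rule FC1.F_diff)
         (use c[of 1] FC1.F_0 FC1.F_mono[of 0 "int n"] FC1.FF'[OF f(2) Suc] in auto)
    ultimately show ?case by (simp add: add.commute)
  qed
  have "fls_nth g n \<in> lev FC (n - 1)" for n
    using nat[of "nat n"] sg[of n] FC1.F_0 by (cases "n \<ge> 0") auto
  then show "1 / f \<in> lev (lev FC) (-1)"
    by (simp add: lev_def[of "lev FC"] flip: g_def)
qed

lemma aff_combination:
  assumes "a \<noteq> 0"
  shows "pu (aff a c) - pv (aff b d) \<noteq> 0" "1 / (pu (aff a c) - pv (aff b d)) \<in> lev (lev FC) (-1)"
    and "pu (aff a c) + pv (aff b d) \<noteq> 0" "1 / (pu (aff a c) + pv (aff b d)) \<in> lev (lev FC) (-1)"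
proof -
  have "fls_const c - aff b d \<in> lev FC 1" "fls_const c + aff b d \<in> lev FC 1"
    by (auto simp: lev_FC aff_nth)
  then have 1: "fls_nth (pu (aff a c) - pv (aff b d)) 0 \<in> lev FC 1"
    "fls_nth (pu (aff a c) + pv (aff b d)) 0 \<in> lev FC 1"
    by (simp_all add: pu_def pv_def aff_nth)
  show "pu (aff a c) - pv (aff b d) \<noteq> 0" "1 / (pu (aff a c) - pv (aff b d)) \<in> lev (lev FC) (-1)"
    by (rule inverse_lev_aux[OF _ 1(1) _ assms]; simp add: pu_def pv_def aff_nth)+
  show "pu (aff a c) + pv (aff b d) \<noteq> 0" "1 / (pu (aff a c) + pv (aff b d)) \<in> lev (lev FC) (-1)"
    by (rule inverse_lev_aux[OF _ 1(2) _ assms]; simp add: pu_def pv_def aff_nth)+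
qed

subsection \<open>Substitution and the filtration\<close>

lemma kap_id: "kap fls_X_inv m l = (if l = m then 1 else 0)"
proof -
  have XI: "fls_X_inv = (inverse fls_X :: complex fls)"
    by (simp add: fls_inverse_X)
  have "fls_X_inv powi (- m) = (fls_X powi m :: complex fls)"
    unfolding XI power_int_inverse power_int_minus inverse_inverse_eq ..
  then show ?thesis by (auto simp: kap_def)
qed

text \<open>The diagonal entry is the leading coefficient of \<open>w\<close> to the power -m, so
  lower terms of \<open>w\<close> do not enter.\<close>

lemma kap_diag:
  assumes "fls_subdegree w = -1" "fls_subdegree w' = -1" "fls_nth w (-1) = fls_nth w' (-1)"
  shows "kap w m m = kap w' m m"
proof -
  have mult: "kap x (m + n) (m + n) = kap x m m * kap x n n" if "fls_subdegree x = -1" for x m n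
    using kap_add[OF that, of m m n n "m + n"] by simp
  have k0: "kap x 0 0 = 1" for x by (simp add: kap_def)
  have neg: "kap w (- int n) (- int n) = kap w' (- int n) (- int n)" for n
  proof (induction n)
    case (Suc n)
    have "kap x (- int (Suc n)) (- int (Suc n)) = kap x (- int n) (- int n) * fls_nth x (-1)"
      if "fls_subdegree x = -1" for x
    proof -
      have "- int (Suc n) = - int n + - 1" by simp
      then show ?thesis using mult[OF that, of "- int n" "-1"] by (simp only:) (simp add: kap_def)
    qed
    with Suc assms show ?case by simp
  qed (simp add: k0)
  show ?thesis
  proof (cases "m \<le> 0")
    case True
    then show ?thesis using neg[of "nat (- m)"] by simp
  next
    case False
    have "kap w m m * kap w (-m) (-m) = 1" "kap w' m m * kap w' (-m) (-m) = 1"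
      using mult[OF assms(1), of m "-m"] mult[OF assms(2), of m "-m"] by (simp_all add: k0)
    moreover have "kap w (-m) (-m) = kap w' (-m) (-m)"
      using neg[of "nat m"] False by simp
    ultimately show ?thesis by (metis mult_cancel_right mult_zero_right zero_neq_one)
  qed
qed

context scalar_embedding
begin

lemma sbst_id: "sbst e fls_X_inv F = F"
proof (rule fls_eqI)
  fix l
  have "fls_nth (sbst e fls_X_inv F) l = (\<Sum>m=fls_subdegree F..l. e (kap fls_X_inv m l) * fls_nth F m)"
    by (rule sbst_nth) simp_all
  also have "\<dots> = (\<Sum>m=fls_subdegree F..l. if l = m then fls_nth F m else 0)"
    by (rule sum.cong) (simp_all add: kap_id)
  also have "\<dots> = fls_nth F l"
    by (auto simp: not_le)
  finally show "fls_nth (sbst e fls_X_inv F) l = fls_nth F l" .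
qed

text \<open>The kernel of the composite is the matrix product of the two kernels, because
  substitution of \<open>w'\<close> commutes with integer powers of \<open>w\<close>.\<close>

lemma sbst_compose:
  assumes w: "fls_subdegree w = -1" and w': "fls_subdegree w' = -1"
  shows "sbst e w' (sbst e w F) = sbst e (sbst id w' w) F"
proof (rule fls_eqI)
  fix t
  let ?w = "sbst id w' w"
  interpret s: unital_hom "sbst id w'"
    by (rule idc.unital_hom_sbst[OF w'])
  define a where "a = fls_subdegree F"
  have powi: "sbst id w' (w powi k) = ?w powi k" for k
  proof -
    have inv: "sbst id w' (inverse x) = inverse (sbst id w' x)" if "x \<noteq> 0" for x
      using that s.hom_mult[of x "inverse x"] by (simp add: inverse_unique)
    have "w \<noteq> 0" using w by auto
    then show ?thesis
      by (simp add: power_int_def s.hom_power inv)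
  qed
  have kap': "kap ?w m t = (\<Sum>l=m..t. kap w m l * kap w' l t)" for m
  proof -
    have "kap ?w m t = fls_nth (sbst id w' (w powi (- m))) t"
      by (simp add: kap_def powi)
    also have "\<dots> = (\<Sum>l=m..t. kap w' l t * fls_nth (w powi (- m)) l)"
      by (subst idc.sbst_nth[OF w', of m]) (simp_all add: w)
    finally show ?thesis by (simp add: kap_def mult.commute)
  qed
  have sw: "fls_subdegree ?w = -1"
  proof (rule fls_subdegree_eqI)
    have nth: "fls_nth ?w n = (\<Sum>m=-1..n. kap w' m n * fls_nth w m)" for n
      by (subst idc.sbst_nth[OF w', of "-1"]) (simp_all add: w)
    show "fls_nth ?w (-1) \<noteq> 0"
      using nth_fls_subdegree_nonzero[of w] nth_fls_subdegree_nonzero[of w'] w w'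
      by (cases "w = 0"; cases "w' = 0") (simp_all add: nth kap_def)
    show "fls_nth ?w k = 0" if "k < -1" for k
      using that by (simp add: nth)
  qed
  have F0: "fls_nth F m = 0" if "m < a" for m using that by (simp add: a_def)
  have sF: "fls_nth (sbst e w F) l = (\<Sum>m=a..t. e (kap w m l) * fls_nth F m)" if "l \<le> t" for l
  proof -
    have "fls_nth (sbst e w F) l = (\<Sum>m=a..l. e (kap w m l) * fls_nth F m)"
      by (rule sbst_nth[OF w F0])
    also have "\<dots> = (\<Sum>m=a..t. e (kap w m l) * fls_nth F m)"
      by (rule sum.mono_neutral_left) (use that kap_eq_0[OF w] in auto)
    finally show ?thesis .
  qed
  have "fls_nth (sbst e w' (sbst e w F)) t = (\<Sum>l=a..t. e (kap w' l t) * fls_nth (sbst e w F) l)"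
    by (rule sbst_nth[OF w']) (simp add: sbst_nth[OF w, of a] F0)
  also have "\<dots> = (\<Sum>l=a..t. \<Sum>m=a..t. e (kap w m l * kap w' l t) * fls_nth F m)"
  proof (rule sum.cong[OF refl])
    fix l assume "l \<in> {a..t}"
    then have l: "fls_nth (sbst e w F) l = (\<Sum>m=a..t. e (kap w m l) * fls_nth F m)"
      by (intro sF) simp
    have "e c * (e d * x) = e (d * c) * x" for c d x
      by (simp only: mult.commute[of d c] hom_mult mult.assoc)
    then show "e (kap w' l t) * fls_nth (sbst e w F) l = (\<Sum>m=a..t. e (kap w m l * kap w' l t) * fls_nth F m)"
      by (simp only: l sum_distrib_left)
  qed
  also have "\<dots> = (\<Sum>m=a..t. \<Sum>l=a..t. e (kap w m l * kap w' l t) * fls_nth F m)"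
    by (rule sum.swap)
  also have "\<dots> = (\<Sum>m=a..t. e (kap ?w m t) * fls_nth F m)"
  proof (rule sum.cong[OF refl])
    fix m assume m: "m \<in> {a..t}"
    have "(\<Sum>l=m..t. kap w m l * kap w' l t) = (\<Sum>l=a..t. kap w m l * kap w' l t)"
      by (rule sum.mono_neutral_left) (use m kap_eq_0[OF w] in auto)
    then show "(\<Sum>l=a..t. e (kap w m l * kap w' l t) * fls_nth F m) = e (kap ?w m t) * fls_nth F m"
      by (simp add: kap' hom_sum sum_distrib_right)
  qed
  also have "\<dots> = fls_nth (sbst e ?w F) t"
    by (rule sbst_nth[OF sw F0, symmetric])
  finally show "fls_nth (sbst e w' (sbst e w F)) t = fls_nth (sbst e ?w F) t" .
qed

end

lemma sbst_aff_aff: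
  assumes "b \<noteq> 0"
  shows "sbst id (aff b d) (aff a c) = aff (a * b) (a * d + c)"
proof -
  interpret s: unital_hom "sbst id (aff b d)"
    by (rule idc.unital_hom_sbst) (simp add: assms)
  have "sbst id (aff b d) (aff a c) = fls_const a * fls_map id (aff b d) + fls_const c"
    unfolding aff_def[of a c] s.hom_add s.hom_mult
    by (simp add: idc.sbst_fls_const idc.sbst_fls_X_inv assms)
  also have "\<dots> = aff (a * b) (a * d + c)"
    by (rule fls_eqI) (simp add: aff_nth fls_nth_fls_map)
  finally show ?thesis .
qed

lemma (in filtered_pair) sbst_lev:
  assumes "scalar_embedding e" "\<And>c. e c \<in> F 0" and w: "fls_subdegree w = -1" and f: "f \<in> lev W k"
  shows "sbst e w f \<in> lev W k"
  unfolding lev_def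
proof clarify
  fix n
  have nth: "fls_nth (sbst e w f) n = (\<Sum>m=fls_subdegree f..n. e (kap w m n) * fls_nth f m)"
    by (rule scalar_embedding.sbst_nth[OF assms(1) w]) simp
  show "fls_nth (sbst e w f) n \<in> W (n + k)"
    unfolding nth by (intro W_sum FW'[OF assms(2), of _ "_ + k"]) (use f in \<open>auto simp: lev_def\<close>)
qed

text \<open>By \<open>kap_diag\<close> the diagonal parts of the two substitutions cancel, and every
  other term lands at a coefficient of u^-n with larger n than the one it came from. Constant shifts
  of the parameter are therefore invisible in leading terms.\<close>

lemma (in filtered_pair) sbst_lev_diff:
  assumes "scalar_embedding e" "\<And>c. e c \<in> F 0" and w: "fls_subdegree w = -1" "fls_subdegree w' = -1"
    and "fls_nth w (-1) = fls_nth w' (-1)" and f: "f \<in> lev W k"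
  shows "sbst e w f - sbst e w' f \<in> lev W (k - 1)"
  unfolding lev_def
proof clarify
  fix n
  let ?a = "min n (fls_subdegree f)"
  have nth: "fls_nth (sbst e x f) n = (\<Sum>m=?a..n. e (kap x m n) * fls_nth f m)"
    if "fls_subdegree x = -1" for x
    by (rule scalar_embedding.sbst_nth[OF assms(1) that]) simp
  have "fls_nth (sbst e w f - sbst e w' f) n =
      (\<Sum>m=?a..n. e (kap w m n) * fls_nth f m - e (kap w' m n) * fls_nth f m)"
    by (simp add: nth w sum_subtractf)
  also have "\<dots> = (\<Sum>m=?a..n - 1. e (kap w m n) * fls_nth f m - e (kap w' m n) * fls_nth f m)"
    by (rule sum.mono_neutral_right) (auto simp: kap_diag[OF w assms(5)] not_le antisym)
  also have "\<dots> \<in> W (n + (k - 1))"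
    by (intro W_sum W_diff FW'[OF assms(2), of _ "_ + k"]) (use f in \<open>auto simp: lev_def\<close>)
  finally show "fls_nth (sbst e w f - sbst e w' f) n \<in> W (n + (k - 1))" .
qed

lemma ents_map_sq:
  "A \<in> ents W k \<Longrightarrow> (\<And>x. x \<in> W k \<Longrightarrow> h x \<in> W' k') \<Longrightarrow> map_sq h A \<in> ents W' k'"
  by (simp add: ents_def)

lemma ents_tn:
  "0 \<in> W k \<Longrightarrow> A \<in> ents W k \<Longrightarrow> tn1 A \<in> ents W k" "0 \<in> W k \<Longrightarrow> A \<in> ents W k \<Longrightarrow> tn2 A \<in> ents W k"
  by (simp_all add: ents_def tn1_def tn2_def)

lemma ents_lift1: "0 \<in> W k \<Longrightarrow> A \<in> ents W k \<Longrightarrow> lift1 i A \<in> ents W k"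
  and ents_lift2: "0 \<in> W k \<Longrightarrow> B \<in> ents W k \<Longrightarrow> lift2 i j B \<in> ents W k"
  by (simp_all add: ents_def lift1_def lift2_def)

lemma ents_cst: "0 \<in> W k \<Longrightarrow> c \<in> W k \<Longrightarrow> cst c \<in> ents W k"
  by (simp add: ents_def ent_cst)

lemma iu_lev: "(\<And>k. 0 \<in> W k) \<Longrightarrow> f \<in> lev W k \<Longrightarrow> iu f \<in> lev (lev W) k"
  and iv_lev: "(\<And>k. 0 \<in> W k) \<Longrightarrow> f \<in> lev W k \<Longrightarrow> iv f \<in> lev (lev W) k"
  by (auto simp: lev_def)

lemma map_sq_tn1: "h 0 = 0 \<Longrightarrow> map_sq h (tn1 A) = tn1 (map_sq h A)"
  and map_sq_tn2: "h 0 = 0 \<Longrightarrow> map_sq h (tn2 A) = tn2 (map_sq h A)"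
  and map_sq_cst: "h 0 = 0 \<Longrightarrow> map_sq h (cst c) = cst (h c)"
  and map_sq_flip: "h 0 = 0 \<Longrightarrow> h 1 = 1 \<Longrightarrow> map_sq h flip_sq = flip_sq"
  by (auto intro!: sqm_eqI simp: tn1_def tn2_def cst_def flip_sq_def)

lemma map_sq_map_sq: "map_sq h (map_sq k A) = map_sq (\<lambda>x. h (k x)) A"
  by (rule sqm_eqI) simp

lemma tn1_add: "tn1 (A + B) = tn1 A + tn1 B" and tn2_add: "tn2 (A + B) = tn2 A + tn2 B"
  and tn1_diff: "tn1 (A - B) = tn1 A - tn1 B" and tn2_diff: "tn2 (A - B) = tn2 A - tn2 B"
  by (auto intro!: sqm_eqI simp: tn1_def tn2_def)

lemma flip_mult: "ent (flip_sq * A) p q = ent A (prod.swap p) q"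
  by (simp add: ent_mult flip_sq_def if_distrib[of "\<lambda>x. x * _"] cong: if_cong)

lemma mult_flip:
  fixes A :: "('a::ring_1, 'n::finite \<times> 'n) sqm"
  shows "ent (A * flip_sq) p q = ent A p (prod.swap q)"
proof -
  have "q = prod.swap r \<longleftrightarrow> r = prod.swap q" for r :: "'n \<times> 'n" by (metis swap_swap)
  then show ?thesis
    by (simp add: ent_mult flip_sq_def if_distrib[of "\<lambda>x. _ * x"] cong: if_cong)
qed

lemma flip_flip: "flip_sq * flip_sq = 1"
  by (rule sqm_eqI) (auto simp: flip_mult, auto simp: flip_sq_def ent_one)

lemma flip_tn1: "flip_sq * tn1 A = tn2 A * flip_sq" and flip_tn2: "flip_sq * tn2 A = tn1 A * flip_sq"
  by (rule sqm_eqI, simp add: flip_mult mult_flip, simp add: tn1_def tn2_def)+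

subsection \<open>The reflection defect\<close>

definition rdef ::
    "('a::ring_1, 'n::finite \<times> 'n) sqm \<Rightarrow> ('a, 'n \<times> 'n) sqm \<Rightarrow> ('a, 'n) sqm \<Rightarrow> ('a, 'n) sqm \<Rightarrow> ('a, 'n \<times> 'n) sqm"
  where "rdef Rm Rp M N = Rm * tn1 M * Rp * tn2 N - tn2 N * Rp * tn1 M * Rm"

definition R2s :: "complex fls fls \<Rightarrow> ('g free_alg fls fls, 'n::finite \<times> 'n) sqm"
  where "R2s c = 1 - cst (e2 (1 / c)) * flip_sq"

definition at_par :: "complex fls \<Rightarrow> ('g free_alg fls, 'n) sqm \<Rightarrow> ('g free_alg fls, 'n) sqm"
  where "at_par w = map_sq (sbst scal w)"

text \<open>The failure of the reflection equation for \<open>B\<close> at the parameters w(u) and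
  w'(v). For the generating matrix and \<open>fls_X_inv\<close> in both places its coefficients are
  the defining relations.\<close>

definition dB :: "complex fls \<Rightarrow> complex fls \<Rightarrow> ('g free_alg fls, ix2) sqm \<Rightarrow> ('g free_alg fls fls, ix2 \<times> ix2) sqm"
  where "dB w w' B = rdef (R2s (pu w - pv w')) (R2s (pu w + pv w')) (map_sq iu (at_par w B)) (map_sq iv (at_par w' B))"

definition Sub2 :: "complex fls \<Rightarrow> complex fls \<Rightarrow> 'g free_alg fls fls \<Rightarrow> 'g free_alg fls fls"
  where "Sub2 w w' f = sbst kc w (fls_map (sbst scal w') f)"

lemma at_par_id: "at_par fls_X_inv B = B"
  unfolding at_par_def by (rule sqm_eqI) (simp add: scal.sbst_id)

context
  fixes w w' :: "complex fls"
  assumes w: "fls_subdegree w = -1" "fls_subdegree w' = -1"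
begin

interpretation s: unital_hom "sbst scal w'"
  by (rule scal.unital_hom_sbst[OF w(2)])

interpretation s2: unital_hom "sbst kc w"
  by (rule kc.unital_hom_sbst[OF w(1)])

lemma unital_hom_Sub2: "unital_hom (Sub2 w w')"
  unfolding Sub2_def[abs_def]
  by (rule unital_hom_compose[OF s2.unital_hom_axioms unital_hom_fls_map[OF s.unital_hom_axioms]])

interpretation S: unital_hom "Sub2 w w'"
  by (rule unital_hom_Sub2)

lemma Sub2_iu: "Sub2 w w' (iu f) = iu (sbst scal w f)"
proof -
  have "fls_map (sbst scal w') (iu f) = iu f"
    by (rule fls_eqI) (simp add: fls_nth_fls_map scal.sbst_fls_const w)
  moreover have "iu (sbst scal w f) = sbst kc w (iu f)"
    unfolding iu_def
    by (rule fls_map_sbst[OF scal.scalar_embedding_axioms unital_hom_fls_const w(1) _ kc.scalar_embedding_axioms])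
       (simp add: kc_def)
  ultimately show ?thesis by (simp add: Sub2_def)
qed

lemma Sub2_iv: "Sub2 w w' (iv g) = iv (sbst scal w' g)"
  by (simp add: Sub2_def iv_def fls_map_fls_const kc.sbst_fls_const w)

lemma Sub2_e2_pu: "Sub2 w w' (e2 (pu fls_X_inv)) = e2 (pu w)"
  and Sub2_e2_pv: "Sub2 w w' (e2 (pv fls_X_inv)) = e2 (pv w')"
proof -
  have X: "e1 fls_X_inv = fls_X_inv" by (rule fls_eqI) simp
  show "Sub2 w w' (e2 (pu fls_X_inv)) = e2 (pu w)" "Sub2 w w' (e2 (pv fls_X_inv)) = e2 (pv w')"
    unfolding e2_pu e2_pv X Sub2_iu Sub2_iv scal.sbst_fls_X_inv[OF w(1)] scal.sbst_fls_X_inv[OF w(2)]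
    by (simp_all add: e1_def)
qed

text \<open>A homomorphism maps an inverse to an inverse; the infinite expansion of 1/c is never
  substituted into.\<close>

lemma Sub2_e2_inverse:
  assumes cd: "Sub2 w w' (e2 c) = (e2 d :: 'g free_alg fls fls)" "c \<noteq> 0" "d \<noteq> 0"
  shows "Sub2 w w' (e2 (1 / c)) = (e2 (1 / d) :: 'g free_alg fls fls)"
proof -
  define y where "y = Sub2 w w' (e2 (1 / c) :: 'g free_alg fls fls)"
  have "y * Sub2 w w' (e2 c) = Sub2 w w' (e2 (1 / c * c))"
    by (simp only: y_def S.hom_mult e2.hom_mult)
  also have "\<dots> = 1"
    using cd(2) by simp
  finally have "y * e2 d = 1"
    unfolding cd(1) .
  then have "y * e2 d * e2 (1 / d) = e2 (1 / d)" by simp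
  then show ?thesis
    using cd(3) by (simp add: mult.assoc y_def flip: e2.hom_mult)
qed

text \<open>Substitution is a homomorphism and moves the arguments of the R-matrices accordingly. A
  bound for the defect at (u, v) therefore gives one at all parameters that occur in the
  fusion.\<close>

lemma Sub2_dB:
  assumes "pu w - pv w' \<noteq> 0" "pu w + pv w' \<noteq> 0"
  shows "map_sq (Sub2 w w') (dB fls_X_inv fls_X_inv B) = dB w w' B"
proof -
  interpret m: unital_hom "map_sq (Sub2 w w') :: ('a free_alg fls fls, ix2 \<times> ix2) sqm \<Rightarrow> _"
    by (rule unital_hom_map_sq[OF unital_hom_Sub2])
  have 0: "Sub2 w w' 0 = 0" "Sub2 w w' 1 = 1" by (rule S.hom_0 S.hom_1)+
  have nz: "pu fls_X_inv - pv fls_X_inv \<noteq> 0" "pu fls_X_inv + pv fls_X_inv \<noteq> 0"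
    unfolding X_inv_aff by (rule aff_combination; simp)+
  have R: "map_sq (Sub2 w w') (R2s c) = (R2s d :: ('a free_alg fls fls, ix2 \<times> ix2) sqm)"
    if "Sub2 w w' (e2 c :: 'a free_alg fls fls) = e2 d" "c \<noteq> 0" "d \<noteq> 0" for c d
    unfolding R2s_def m.hom_diff m.hom_mult m.hom_1 map_sq_cst[of "Sub2 w w'", OF 0(1)] map_sq_flip[of "Sub2 w w'", OF 0]
      Sub2_e2_inverse[OF that] ..
  have "map_sq (Sub2 w w') (map_sq iu B) = map_sq iu (at_par w B)"
    "map_sq (Sub2 w w') (map_sq iv B) = map_sq iv (at_par w' B)"
    unfolding at_par_def map_sq_map_sq Sub2_iu Sub2_iv by (rule refl)+
  moreover have "map_sq (Sub2 w w') (R2s (pu fls_X_inv - pv fls_X_inv)) = (R2s (pu w - pv w') :: ('a free_alg fls fls, ix2 \<times> ix2) sqm)"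
    by (rule R[OF _ nz(1) assms(1)]) (simp only: e2.hom_diff S.hom_diff Sub2_e2_pu Sub2_e2_pv)
  moreover have "map_sq (Sub2 w w') (R2s (pu fls_X_inv + pv fls_X_inv)) = (R2s (pu w + pv w') :: ('a free_alg fls fls, ix2 \<times> ix2) sqm)"
    by (rule R[OF _ nz(2) assms(2)]) (simp only: e2.hom_add S.hom_add Sub2_e2_pu Sub2_e2_pv)
  ultimately show ?thesis
    unfolding dB_def rdef_def m.hom_diff m.hom_mult at_par_id
      map_sq_tn1[of "Sub2 w w'", OF 0(1)] map_sq_tn2[of "Sub2 w w'", OF 0(1)] by (simp only:)
qed

end

subsection \<open>The reflection defect with cleared denominators\<close>

text \<open>The numerators of the R-matrices in place of the R-matrices: (a^2 - b^2) times the
  defect, as \<open>pdef_dB\<close> shows. Only this form can be restricted to v = u, where 1/(u -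
  v) has a pole.\<close>

definition pdef ::
    "('a::ring_1, 'n::finite \<times> 'n) sqm \<Rightarrow> ('a, 'n \<times> 'n) sqm \<Rightarrow> ('a, 'n) sqm \<Rightarrow> ('a, 'n) sqm \<Rightarrow> ('a, 'n \<times> 'n) sqm"
  where "pdef a b M N = rdef (a - b - flip_sq) (a + b - flip_sq) M N"

text \<open>At b = a the outer numerator is -P. It turns the first copy of \<open>A\<close> into the
  second and commutes with the inner numerator, so the two sides coincide for every matrix, with no
  relation assumed.\<close>

lemma pdef_diagonal:
  assumes "central a" shows "pdef a a A A = 0"
proof -
  let ?P = flip_sq and ?M = "tn1 A" and ?N = "tn2 A"
  have N: "?N = ?P * ?M * ?P"
    by (metis flip_flip flip_tn1 mult.assoc mult.right_neutral)
  have comm: "?P * (a + a - ?P) = (a + a - ?P) * ?P"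
    using assms by (simp add: algebra_simps centralD)
  have PP: "?P * (?P * x) = x" for x
    by (simp add: flip_flip flip: mult.assoc)
  have "?N * (a + a - ?P) * ?M * ?P = ?P * ?M * (?P * (a + a - ?P)) * ?M * ?P"
    unfolding N by (simp only: mult.assoc)
  also have "\<dots> = ?P * ?M * (a + a - ?P) * (?P * ?M * ?P)"
    unfolding comm by (simp only: mult.assoc)
  finally show ?thesis
    by (simp add: pdef_def rdef_def N[symmetric])
qed

text \<open>As \<open>b\<close> is central it can be collected next to \<open>N\<close>. Each
  summand is then a product of an expression without b and N by a power of b times N, in one order
  or the other: the shape on which \<open>diag\<close> is multiplicative.\<close>

lemma pdef_split:
  fixes P :: "'r::ring_1"
  assumes "central b" and b: "\<And>x. b * x = x * b"
  shows "(a - b - P) * M * (a + b - P) * N - N * (a + b - P) * M * (a - b - P) =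
    ((a - P) * M * (a - P)) * N + ((a - P) * M - M * (a - P)) * (b * N) - M * (b * b * N)
    - (N * ((a - P) * M * (a - P)) + (b * N) * (M * (a - P) - (a - P) * M) - (b * b * N) * M)"
proof -
  define c where "c = a - P"
  have eq: "a - b - P = c - b" "a + b - P = c + b" by (simp_all add: c_def)
  have l: "x * (b * y) = b * (x * y)" for x y by (metis b mult.assoc)
  note comm = l[of c] l[of M] l[of N] b[symmetric, of c] b[symmetric, of M] b[symmetric, of N]
  have x: "(c - b) * M * (c + b) * N = c * M * c * N + (c * M - M * c) * (b * N) - M * (b * b * N)"
    by (simp add: algebra_simps comm)
  have y: "N * (c + b) * M * (c - b) = N * (c * M * c) + (b * N) * (M * c - c * M) - (b * b * N) * M"
    by (simp add: algebra_simps comm)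
  show ?thesis
    unfolding eq x y c_def[symmetric] by simp
qed

lemma diag_map_sq:
  fixes A B :: "('a::ring_1 fls, 'n::finite) sqm"
  assumes A: "\<And>i j n. n < -5 \<Longrightarrow> fls_nth (ent A i j) n = 0" and B: "\<And>i j n. n < -5 \<Longrightarrow> fls_nth (ent B i j) n = 0"
  shows "map_sq diag (map_sq iu A * map_sq iv B) = A * B" "map_sq diag (map_sq iv B * map_sq iu A) = B * A"
  by (rule sqm_eqI, simp add: ent_mult diag_sum iu_def iv_def diag_mult A B)+

lemma map_sq_diag_diff: "map_sq diag (A - B) = map_sq diag A - map_sq diag B"
  and map_sq_diag_add: "map_sq diag (A + B) = map_sq diag A + map_sq diag B"
  by (rule sqm_eqI, simp add: diag_diff diag_add)+

text \<open>Degree at most d in u for all entries, regardless of any filtration of the coefficients;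
  it keeps the restriction to v = u within its cut-off.\<close>

definition dgs :: "int \<Rightarrow> ('a::zero fls, 'n) sqm set"
  where "dgs d = {A. \<forall>i j n. n < - d \<longrightarrow> fls_nth (ent A i j) n = 0}"

lemma fls_mult_vanish:
  fixes f g :: "'a::ring_1 fls"
  assumes "\<And>n. n < - d \<Longrightarrow> fls_nth f n = 0" "\<And>n. n < - d' \<Longrightarrow> fls_nth g n = 0" "n < - (d + d')"
  shows "fls_nth (f * g) n = 0"
  using assms(3) by (subst fls_mult_nth[of "- d" f "- d'" g]) (use assms(1,2) in auto)

lemma dgs_mult: "A \<in> dgs d \<Longrightarrow> B \<in> dgs d' \<Longrightarrow> A * B \<in> (dgs (d + d') :: ('a::ring_1 fls, 'n::finite) sqm set)"
  by (auto simp: dgs_def ent_mult fls_nth_sum intro!: sum.neutral fls_mult_vanish[of d _ d'])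

lemma dgs_add: "A \<in> dgs d \<Longrightarrow> B \<in> dgs d \<Longrightarrow> A + B \<in> (dgs d :: ('a::ring_1 fls, 'n::finite) sqm set)"
  and dgs_diff: "A \<in> dgs d \<Longrightarrow> B \<in> dgs d \<Longrightarrow> A - B \<in> (dgs d :: ('a::ring_1 fls, 'n::finite) sqm set)"
  and dgs_mono: "d \<le> d' \<Longrightarrow> A \<in> dgs d \<Longrightarrow> A \<in> dgs d'"
  and dgs_tn1: "C \<in> dgs d \<Longrightarrow> tn1 C \<in> dgs d" and dgs_tn2: "C \<in> dgs d \<Longrightarrow> tn2 C \<in> dgs d"
  and dgs_flip: "flip_sq \<in> dgs 0"
  by (auto simp: dgs_def tn1_def tn2_def flip_sq_def)

lemma dgs_cst: "(\<And>n. n < - d \<Longrightarrow> fls_nth c n = 0) \<Longrightarrow> cst c \<in> dgs d"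
  by (auto simp: dgs_def ent_cst)

lemma diag_dgs:
  fixes A B :: "('a::ring_1 fls, 'n::finite) sqm"
  assumes "A \<in> dgs 5" "B \<in> dgs 5"
  shows "map_sq diag (map_sq iu A * map_sq iv B) = A * B" "map_sq diag (map_sq iv B * map_sq iu A) = B * A"
  using assms by (auto intro!: diag_map_sq simp: dgs_def)

text \<open>After \<open>pdef_split\<close> every summand is a series in u times one in v, of degree
  at most two in each parameter, and is restricted by \<open>diag_mult\<close>.\<close>

lemma diag_pdef:
  fixes x y :: "complex fls" and M N :: "('g free_alg fls, 'n::finite) sqm"
  assumes "fls_subdegree x = -1" "fls_subdegree y = -1" "M \<in> dgs 0" "N \<in> dgs 0"
  shows "map_sq diag (pdef (cst (e2 (pu x))) (cst (e2 (pv y))) (map_sq iu M) (map_sq iv N)) =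
    pdef (cst (e1 x)) (cst (e1 y)) M N"
proof -
  let ?U = "map_sq iu :: ('g free_alg fls, 'n \<times> 'n) sqm \<Rightarrow> _" and ?V = "map_sq iv :: ('g free_alg fls, 'n \<times> 'n) sqm \<Rightarrow> _"
  interpret U: unital_hom ?U by (rule unital_hom_map_sq[OF unital_hom_iu])
  interpret V: unital_hom ?V by (rule unital_hom_map_sq[OF unital_hom_iv])
  let ?a = "cst (e1 x) :: ('g free_alg fls, 'n \<times> 'n) sqm" and ?b = "cst (e1 y) :: ('g free_alg fls, 'n \<times> 'n) sqm"
  let ?M = "tn1 M" and ?N = "tn2 N" and ?P = "flip_sq :: ('g free_alg fls, 'n \<times> 'n) sqm"
  have cb: "central ?b" "central (cst (e2 (pv y)) :: ('g free_alg fls fls, 'n \<times> 'n) sqm)"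
    by (rule central_cst[OF central_e1] central_cst[OF central_e2])+
  have U: "?U ?P = flip_sq" "?V ?P = flip_sq" "?U ?a = cst (e2 (pu x))" "?V ?b = cst (e2 (pv y))"
    "?U ?M = tn1 (map_sq iu M)" "?V ?N = tn2 (map_sq iv N)"
    by (simp_all add: map_sq_flip map_sq_cst map_sq_tn1 map_sq_tn2 e2_pu e2_pv)
  have ab: "?a \<in> dgs 1" "?b \<in> dgs 1"
    using assms by (auto intro!: dgs_cst)
  have MN: "?M \<in> dgs 0" "?N \<in> dgs 0" "?P \<in> dgs 0"
    using assms by (auto intro: dgs_tn1 dgs_tn2 dgs_flip)
  have aP: "?a - ?P \<in> dgs 1" 
    by (rule dgs_diff[OF ab(1) dgs_mono[OF _ MN(3)]]) simp
  have 1: "(?a - ?P) * ?M * (?a - ?P) \<in> dgs 5"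
    by (rule dgs_mono[OF _ dgs_mult[OF dgs_mult[OF aP MN(1)] aP]]) simp
  have "(?a - ?P) * ?M \<in> dgs 5" "?M * (?a - ?P) \<in> dgs 5"
    by (rule dgs_mono[OF _ dgs_mult[OF aP MN(1)]] dgs_mono[OF _ dgs_mult[OF MN(1) aP]]; simp)+
  then have 2: "(?a - ?P) * ?M - ?M * (?a - ?P) \<in> dgs 5" "?M * (?a - ?P) - (?a - ?P) * ?M \<in> dgs 5"
    by (auto intro: dgs_diff)
  have 3: "?b * ?N \<in> dgs 5" "?b * ?b * ?N \<in> dgs 5" "?N \<in> dgs 5" "?M \<in> dgs 5"
    using dgs_mono[OF _ dgs_mult[OF ab(2) MN(2)], of 5] dgs_mono[OF _ dgs_mult[OF dgs_mult[OF ab(2) ab(2)] MN(2)], of 5]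
      dgs_mono[OF _ MN(2), of 5] dgs_mono[OF _ MN(1), of 5] by simp_all
  show ?thesis
    unfolding pdef_def rdef_def pdef_split[OF cb(1) centralD[OF cb(1)]] pdef_split[OF cb(2) centralD[OF cb(2)]]
    unfolding U[symmetric] U.hom_diff[symmetric] U.hom_mult[symmetric] V.hom_mult[symmetric]
    by (simp only: map_sq_diag_diff map_sq_diag_add diag_dgs 1 2 3)
qed

lemma pdef_dB:
  assumes "pu w - pv w' \<noteq> 0" "pu w + pv w' \<noteq> 0"
  shows "pdef (cst (e2 (pu w))) (cst (e2 (pv w'))) (map_sq iu (at_par w B)) (map_sq iv (at_par w' B)) =
    cst (e2 ((pu w - pv w') * (pu w + pv w'))) * dB w w' B"
proof -
  have R: "cst (e2 c) - flip_sq = cst (e2 c) * (R2s c :: ('a free_alg fls fls, ix2 \<times> ix2) sqm)" if "c \<noteq> 0" for c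
  proof -
    have "cst (e2 c) * (cst (e2 (1 / c)) * flip_sq) = (cst (e2 (c * (1 / c))) * flip_sq :: ('a free_alg fls fls, ix2 \<times> ix2) sqm)"
      by (simp only: e2.hom_mult cst.hom_mult mult.assoc)
    then show ?thesis using that by (simp add: R2s_def right_diff_distrib)
  qed
  have d: "cst (e2 (pu w)) - cst (e2 (pv w')) - flip_sq =
      cst (e2 (pu w - pv w')) * (R2s (pu w - pv w') :: ('a free_alg fls fls, ix2 \<times> ix2) sqm)"
    and s: "cst (e2 (pu w)) + cst (e2 (pv w')) - flip_sq =
      cst (e2 (pu w + pv w')) * (R2s (pu w + pv w') :: ('a free_alg fls fls, ix2 \<times> ix2) sqm)"
    using R[OF assms(1)] R[OF assms(2)] by (simp_all add: e2.hom_diff e2.hom_add cst.hom_diff cst.hom_add)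
  have l: "x * (cst (e2 c) * y) = cst (e2 c) * (x * y)" for x y :: "('a free_alg fls fls, ix2 \<times> ix2) sqm" and c
    by (rule central_left_commute[OF central_cst[OF central_e2]])
  have c: "cst (e2 (c * d)) * x = cst (e2 c) * (cst (e2 d) * x)" for c d and x :: "('a free_alg fls fls, ix2 \<times> ix2) sqm"
    by (simp only: e2.hom_mult cst.hom_mult mult.assoc)
  let ?c = "cst (e2 (pu w - pv w'))" and ?d = "cst (e2 (pu w + pv w'))"
  have "?c * Rm * M * (?d * Rp) * N - N * (?d * Rp) * M * (?c * Rm) = ?c * (?d * (Rm * M * Rp * N - N * Rp * M * Rm))"
    for Rm M Rp N :: "('a free_alg fls fls, ix2 \<times> ix2) sqm"
    by (simp only: mult.assoc right_diff_distrib l[of M "pu w + pv w'"] l[of Rm "pu w + pv w'"] l[of N "pu w + pv w'"]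
         l[of M "pu w - pv w'"] l[of Rp "pu w - pv w'"] l[of N "pu w - pv w'"] l[of ?d "pu w - pv w'"])
  then show ?thesis
    unfolding pdef_def rdef_def d s dB_def c by blast
qed

subsection \<open>Projected exchange relations\<close>

text \<open>Inserting the projector between all factors is free at the R-matrices, which respect it
  by \<open>ab\<close>. At \<open>A\<close> and \<open>C\<close> it costs exactly the corners
  \<open>Pa * A * (1 - Pa)\<close> and \<open>Pb * C * (1 - Pb)\<close>, that is, their failure to
  respect the symmetric square.\<close>

lemma projected_exchange:
  fixes A :: "'r::ring_1"
  assumes ex: "Rm * (A * Rp * C) = C * Rp * A * Rm + Z"
    and P: "Pa * Pa = Pa" "Pb * Pb = Pb" "Pb * Pa = Pa * Pb"
    and com: "C * Pa = Pa * C" "A * Pb = Pb * A"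
    and ab: "Pa * Pb * Rm = Pa * Pb * Rm * (Pa * Pb)" "Pa * Pb * Rp = Pa * Pb * Rp * (Pa * Pb)"
  defines "Q \<equiv> Pa * Pb"
  shows "Q * Rm * Q * A * Q * Rp * Q * C * Q - Q * C * Q * Rp * Q * A * Q * Rm * Q =
    Q * Z * Q - Q * Rm * (Pa * A * (1 - Pa)) * Pb * Rp * C * Q
    + Q * C * Q * Rp * (Pa * A * (1 - Pa)) * Pb * Rm * Q + (Pb * C * (1 - Pb)) * Pa * Rp * A * Rm * Q"
proof -
  have PP: "Pa * (Pa * x) = Pa * x" "Pb * (Pb * x) = Pb * x" "Pb * (Pa * x) = Pa * (Pb * x)" for x
    using P by (simp_all flip: mult.assoc)
  have com': "C * (Pa * x) = Pa * (C * x)" "A * (Pb * x) = Pb * (A * x)" for x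
    using com by (simp_all flip: mult.assoc)
  have Rm: "Q * (Rm * (Q * x)) = Q * (Rm * x)" and Rp: "Q * (Rp * (Q * x)) = Q * (Rp * x)" for x
    using ab unfolding Q_def by (metis mult.assoc)+
  have PP': "Pa * (Pb * x) = Pb * (Pa * x)" for x
    by (rule PP(3)[symmetric])
  have QA: "Q * (A * x) = Q * (A * (Q * x)) + Pa * (A * ((1 - Pa) * (Pb * x)))" for x
    by (simp add: Q_def algebra_simps PP(1,2) PP' com')
  have QC: "Q * (C * x) = Q * (C * (Q * x)) + Pb * (C * ((1 - Pb) * (Pa * x)))" for x
    by (simp add: Q_def algebra_simps PP com')
  have RA: "Q * (R * (A * y)) = Q * (R * (Q * (A * (Q * y)))) + Q * (R * (Pa * (A * ((1 - Pa) * (Pb * y)))))"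
    if "\<And>x. Q * (R * (Q * x)) = Q * (R * x)" for R y
    unfolding that[of "A * y", symmetric] QA[of y] distrib_left that[of "Pa * _"] ..
  have e: "Q * (Rm * (A * (Rp * (C * Q)))) = Q * (C * (Rp * (A * (Rm * Q)))) + Q * (Z * Q)"
    using arg_cong[OF ex, of "\<lambda>x. Q * x * Q"] by (simp add: algebra_simps)
  have l: "Q * (Rm * (A * (Rp * (C * Q)))) = Q * (Rm * (Q * (A * (Q * (Rp * (Q * (C * Q))))))) +
     Q * (Rm * (Pa * (A * ((1 - Pa) * (Pb * (Rp * (C * Q)))))))"
    unfolding RA[OF Rm, of "Rp * (C * Q)"] Rp[of "C * Q"] ..
  have r: "Q * (C * (Rp * (A * (Rm * Q)))) = Q * (C * (Q * (Rp * (Q * (A * (Q * (Rm * Q))))))) +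
     Q * (C * (Q * (Rp * (Pa * (A * ((1 - Pa) * (Pb * (Rm * Q)))))))) +
     Pb * (C * ((1 - Pb) * (Pa * (Rp * (A * (Rm * Q))))))"
    unfolding QC[of "Rp * (A * (Rm * Q))"] RA[OF Rp, of "Rm * Q"] distrib_left ..
  have move: "a - t = z - x + y + y'" if "a + x = t + y + y' + z" for a t x y y' z :: 'r
    using that by (simp add: algebra_simps)
  show ?thesis
    using move[OF e[unfolded l r]] by (simp only: mult.assoc)
qed

text \<open>If the R-matrices next to a corner are replaced by 1, the corner meets its own projector
  after commutations, and (1 - P) P = 0. Only the differences to 1 are left, and these have level
  -1; so the corners do not affect the leading term.\<close>

lemma (in filtered_pair) projected_exchange_error:
  assumes R: "Rm - 1 \<in> F (-1)" "Rp - 1 \<in> F (-1)" and AC: "A \<in> F 0" "C \<in> F 0"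
    and Pf: "Pa \<in> F 0" "Pb \<in> F 0"
    and d: "Pa * A * (1 - Pa) \<in> W k" "Pb * C * (1 - Pb) \<in> W k"
    and P: "Pa * Pa = Pa" "Pb * Pb = Pb" "Pb * Pa = Pa * Pb"
    and com: "C * Pa = Pa * C" "A * Pb = Pb * A"
  defines "Q \<equiv> Pa * Pb"
  shows "Q * Rm * (Pa * A * (1 - Pa)) * Pb * Rp * C * Q \<in> W (k - 1)"
    and "Q * C * Q * Rp * (Pa * A * (1 - Pa)) * Pb * Rm * Q \<in> W (k - 1)"
    and "(Pb * C * (1 - Pb)) * Pa * Rp * A * Rm * Q \<in> W (k - 1)"
proof -
  define da db where "da = Pa * A * (1 - Pa)" and "db = Pb * C * (1 - Pb)"
  have PP: "Pa * (Pa * x) = Pa * x" "Pb * (Pb * x) = Pb * x" "Pb * (Pa * x) = Pa * (Pb * x)" for x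
    using P by (simp_all flip: mult.assoc)
  have com': "C * (Pa * x) = Pa * (C * x)" "A * (Pb * x) = Pb * (A * x)" for x
    using com by (simp_all flip: mult.assoc)
  have da0: "da * (Pa * x) = 0" and db0: "db * (Pb * x) = 0" for x
    by (simp_all add: da_def db_def algebra_simps PP)
  have R0: "Rm \<in> F 0" "Rp \<in> F 0"
    using F_of_cong[of Rm 1 0] F_of_cong[of Rp 1 0] R F_one by simp_all
  have Q: "Q \<in> F 0" unfolding Q_def using FF'[OF Pf] by simp
  have dW: "da \<in> W k" "db \<in> W k" using d by (simp_all add: da_def db_def)
  have F0: "x * y \<in> F 0" if "x \<in> F 0" "y \<in> F 0" for x y using FF'[OF that] by simp
  have z: "da * Pb * C * Q = 0"
    by (simp add: Q_def mult.assoc com' PP da0)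
  have "Q * Rm * da * Pb * Rp * C * Q = (Q * Rm) * (da * (Pb * (Rp - 1) * C * Q)) + Q * Rm * (da * Pb * C * Q)"
    by (simp add: algebra_simps)
  also have "\<dots> = (Q * Rm) * (da * (Pb * (Rp - 1) * C * Q))"
    by (simp add: z)
  also have "\<dots> \<in> W (k - 1)"
    by (intro FW'[OF F0[OF Q R0(1)] WF'[OF dW(1) FF'[OF FF'[OF FF'[OF Pf(2) R(2) order_refl] AC(2) order_refl] Q order_refl] order_refl]])
       simp
  finally show "Q * Rm * (Pa * A * (1 - Pa)) * Pb * Rp * C * Q \<in> W (k - 1)"
    by (simp add: da_def)
  have z: "da * Pb * Q = 0"
    by (simp add: Q_def mult.assoc PP da0)
  have "Q * C * Q * Rp * da * Pb * Rm * Q = (Q * C * Q * Rp) * (da * (Pb * (Rm - 1) * Q)) + Q * C * Q * Rp * (da * Pb * Q)"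
    by (simp add: algebra_simps)
  also have "\<dots> = (Q * C * Q * Rp) * (da * (Pb * (Rm - 1) * Q))"
    by (simp add: z)
  also have "\<dots> \<in> W (k - 1)"
    by (intro FW'[OF F0[OF F0[OF F0[OF Q AC(2)] Q] R0(2)] WF'[OF dW(1) FF'[OF FF'[OF Pf(2) R(1) order_refl] Q order_refl] order_refl]])
       simp
  finally show "Q * C * Q * Rp * (Pa * A * (1 - Pa)) * Pb * Rm * Q \<in> W (k - 1)"
    by (simp add: da_def)
  have z: "db * Pa * A * Q = 0"
    by (simp add: Q_def mult.assoc com' PP(1,2) PP(3)[symmetric] P(3)[symmetric] com db0)
  have "db * Pa * Rp * A * Rm * Q = db * (Pa * (Rp - 1) * A * Rm * Q) + db * (Pa * A * (Rm - 1) * Q) + db * Pa * A * Q"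
    by (simp add: algebra_simps)
  also have "\<dots> = db * (Pa * (Rp - 1) * A * Rm * Q) + db * (Pa * A * (Rm - 1) * Q)"
    by (simp add: z)
  also have "\<dots> \<in> W (k - 1)"
    by (intro W_add WF'[OF dW(2) FF'[OF FF'[OF FF'[OF FF'[OF Pf(1) R(2) order_refl] AC(1) order_refl] R0(1) order_refl] Q order_refl]]
      WF'[OF dW(2) FF'[OF FF'[OF F0[OF Pf(1) AC(1)] R(1) order_refl] Q order_refl]]) simp_all
  finally show "(Pb * C * (1 - Pb)) * Pa * Rp * A * Rm * Q \<in> W (k - 1)"
    by (simp add: db_def)
qed

text \<open>The symmetrizer passes \<open>w\<close> to the other side, where the projector is
  absorbed because (1 + s) times the projector is 1 + s again.\<close>

lemma projector_absorb:
  fixes s :: "'r::ring_1"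
  assumes "(1 + s) * w = w' * (1 + s)" "s * s = 1" "central h" "h + h = 1"
  shows "h * (1 + s) * w = h * (1 + s) * w * (h * (1 + s))"
proof -
  have "(1 + s) * (h * (1 + s)) = h * ((1 + s) * (1 + s))"
    by (metis assms(3) central_left_commute)
  also have "(1 + s) * (1 + s) = (1 + s) + (1 + s)"
    by (simp add: algebra_simps assms(2))
  also have "h * ((1 + s) + (1 + s)) = 1 + s"
    using arg_cong[OF assms(4), of "\<lambda>x. x * (1 + s)"] by (simp add: algebra_simps)
  finally have p: "(1 + s) * (h * (1 + s)) = 1 + s" .
  have "h * (1 + s) * w * (h * (1 + s)) = h * (w' * ((1 + s) * (h * (1 + s))))"
    by (simp add: mult.assoc assms(1) flip: mult.assoc[of "1 + s" w])
  then show ?thesis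
    by (simp add: p mult.assoc assms(1))
qed

subsection \<open>R-matrices on four legs\<close>

definition Rl :: "leg \<Rightarrow> leg \<Rightarrow> complex fls fls \<Rightarrow> ('g free_alg fls fls, leg \<Rightarrow> ix2) sqm"
  where "Rl i j c = 1 - cst (e2 (1 / c)) * swp i j"

lemma Rl_sym: "Rl i j c = Rl j i c"
  by (simp add: Rl_def swp_sym[of i j])

lemma swp_sq: "swp i j * swp i j = 1"
  by (simp add: permop_mult transpose_comp_self permop_id)

lemma swp_braid:
  assumes "i \<noteq> j" "j \<noteq> k" "i \<noteq> k"
  shows "swp i j * swp i k = swp j k * swp i j"
  unfolding permop_mult
  by (rule arg_cong[of _ _ permop]) (use assms in \<open>auto simp: fun_eq_iff Transposition.transpose_def\<close>)

lemma central_cst_e2: "central (cst (e2 c))"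
  by (rule central_cst[OF central_e2])

lemma swp_yang_baxter:
  assumes "i \<noteq> j" "j \<noteq> k" "i \<noteq> k" "a * c = b * (a + c)"
  shows "(1 - cst (e2 a) * swp i j) * (1 - cst (e2 b) * swp i k) * (1 - cst (e2 c) * swp j k) =
    (1 - cst (e2 c) * swp j k) * (1 - cst (e2 b) * swp i k) * (1 - cst (e2 a) * swp i j)"
proof (rule yang_baxter)
  show "cst (e2 a) * cst (e2 c) = cst (e2 b) * (cst (e2 a) + cst (e2 c))"
    using assms(4) by (simp flip: cst.hom_add cst.hom_mult e2.hom_add e2.hom_mult)
  show "swp i j * swp i k = swp j k * swp i j" "swp i j * swp j k = swp i k * swp i j"
    "swp i k * swp i j = swp j k * swp i k" "swp j k * swp i j = swp i k * swp j k"
    "swp i k * swp j k = swp i j * swp i k" "swp j k * swp i k = swp i j * swp j k"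
    using assms(1-3) by (metis swp_braid swp_sym)+
qed (rule swp_sq centralD[OF central_cst_e2])+

lemma Rl_yang_baxter:
  assumes "i \<noteq> j" "j \<noteq> k" "i \<noteq> k" "\<gamma> = \<alpha> + \<beta>" "\<alpha> \<noteq> 0" "\<beta> \<noteq> 0" "\<gamma> \<noteq> 0"
  shows "Rl i j \<alpha> * Rl i k \<gamma> * Rl j k \<beta> = Rl j k \<beta> * Rl i k \<gamma> * Rl i j \<alpha>"
  unfolding Rl_def by (rule swp_yang_baxter) (use assms in \<open>simp_all add: field_simps\<close>)

text \<open>The Yang--Baxter equation at the special argument -1, where R = 1 + P is twice the
  projector onto symmetric tensors; the other arguments must then differ by one.\<close>

lemma swp_Rl_exchange:
  assumes "i \<noteq> j" "j \<noteq> k" "i \<noteq> k" "\<beta> \<noteq> 0" "\<beta> + 1 \<noteq> 0"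
  shows "(1 + swp i j) * (Rl i k \<beta> * Rl j k (\<beta> + 1)) = (Rl j k (\<beta> + 1) * Rl i k \<beta>) * (1 + swp i j)"
proof -
  have "- 1 * (1 / (\<beta> + 1)) = 1 / \<beta> * (- 1 + 1 / (\<beta> + 1))"
    using assms by (simp add: field_simps)
  from swp_yang_baxter[OF assms(1-3) this] show ?thesis
    by (simp add: Rl_def e2.hom_uminus cst.hom_uminus mult.assoc)
qed

lemma disjoint_swp: "{i, j} \<inter> {k, l} = {} \<Longrightarrow> swp i j * swp k l = swp k l * swp i j"
  unfolding permop_mult
  by (rule arg_cong[of _ _ permop]) (auto simp: fun_eq_iff Transposition.transpose_def)

lemma commute_Rl:
  assumes "x * swp i j = swp i j * x" shows "x * Rl i j c = Rl i j c * x"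
  using assms central_left_commute[OF central_cst_e2, of x "1 / c" "swp i j"]
  by (simp add: Rl_def algebra_simps)

lemma Rl_commute: "{i, j} \<inter> {k, l} = {} \<Longrightarrow> Rl i j c * Rl k l d = Rl k l d * Rl i j c"
  by (rule commute_Rl, rule sym, rule commute_Rl, rule disjoint_swp) auto

lemma lift1_Rl_commute: "k \<noteq> i \<Longrightarrow> k \<noteq> j \<Longrightarrow> lift1 k A * Rl i j c = Rl i j c * lift1 k A"
  by (rule commute_Rl) (rule swp_commute_lift1)

lemma lift2_R2s: "i \<noteq> j \<Longrightarrow> lift2 i j (R2s c) = Rl i j c"
proof -
  assume ij: "i \<noteq> j"
  interpret unital_hom "lift2 i j" by (rule unital_hom_lift2[OF ij])
  show ?thesis
    unfolding R2s_def Rl_def hom_diff hom_mult hom_1 lift2_cst[OF ij] lift2_flip[OF ij] ..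
qed

lemma lift2_dB:
  assumes "i \<noteq> j"
  shows "lift2 i j (dB w w' B) =
    Rl i j (pu w - pv w') * lift1 i (map_sq iu (at_par w B)) * Rl i j (pu w + pv w') * lift1 j (map_sq iv (at_par w' B))
    - lift1 j (map_sq iv (at_par w' B)) * Rl i j (pu w + pv w') * lift1 i (map_sq iu (at_par w B)) * Rl i j (pu w - pv w')"
proof -
  interpret unital_hom "lift2 i j" by (rule unital_hom_lift2[OF assms])
  show ?thesis
    unfolding dB_def rdef_def hom_diff hom_mult lift2_R2s[OF assms] lift2_tn1[OF assms] lift2_tn2[OF assms] ..
qed

subsection \<open>Bounds for the defect\<close>

lemma (in filtered_pair) filtered_pair_F: "filtered_pair F F"
  by standard (auto intro: F_0 F_add F_uminus F_mono F_one FF)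

locale alg_filt = filtered_pair F W for F W :: "int \<Rightarrow> 'g free_alg set" +
  assumes scal_F: "scal c \<in> F 0"
begin

sublocale f1: filtered_pair "lev F" "lev W"
  by (rule filtered_pair_lev)

sublocale f2: filtered_pair "lev (lev F)" "lev (lev W)"
  by (rule f1.filtered_pair_lev)

lemma alg_filt_F: "alg_filt F F"
  by (intro alg_filt.intro filtered_pair_F alg_filt_axioms.intro scal_F)

lemma e1_lev: "x \<in> lev FC k \<Longrightarrow> e1 x \<in> lev F k"
proof -
  assume x: "x \<in> lev FC k"
  have "scal (fls_nth x n) \<in> F (n + k)" for n
  proof (cases "n < - k")
    case True
    then show ?thesis using x F_0 by (simp add: lev_FC)
  next
    case False
    then show ?thesis using F_mono[OF _ scal_F, of "n + k"] by simp
  qed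
  then show ?thesis by (simp add: lev_def)
qed

lemma e2_lev: "y \<in> lev (lev FC) k \<Longrightarrow> e2 y \<in> lev (lev F) k"
  unfolding lev_def[of "lev FC"] lev_def[of "lev F"] by (auto intro: e1_lev)

lemma kc_lev: "kc c \<in> lev F 0"
  using e1_lev[of "fls_const c" 0] by (simp add: kc_def lev_FC)

lemma kc2_lev: "kc2 c \<in> lev (lev F) 0"
  using kc_lev f1.F_0 by (auto simp: kc2_def lev_def[of "lev F"])

lemma cst_lev1: "c \<in> lev F k \<Longrightarrow> cst c \<in> ents (lev F) k"
  by (rule ents_cst) (rule f1.F_0)

lemma cst_lev2: "c \<in> lev (lev F) k \<Longrightarrow> cst c \<in> ents (lev (lev F)) k"
  by (rule ents_cst) (rule f2.F_0)

lemma Sub2_lev: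
  assumes "fls_subdegree w = -1" "fls_subdegree w' = -1" "f \<in> lev (lev W) k"
  shows "Sub2 w w' f \<in> lev (lev W) k"
proof -
  interpret s: unital_hom "sbst scal w'" by (rule scal.unital_hom_sbst) fact
  have "fls_map (sbst scal w') f \<in> lev (lev W) k"
    using assms(3) sbst_lev[OF scal.scalar_embedding_axioms scal_F assms(2)]
    by (auto simp: lev_def[of "lev W"] fls_nth_fls_map)
  then show ?thesis
    unfolding Sub2_def by (rule f1.sbst_lev[OF kc.scalar_embedding_axioms kc_lev assms(1)])
qed

lemma Sub2_lev_diff:
  assumes "fls_subdegree w = -1" "fls_subdegree w' = -1" "fls_subdegree y = -1" "fls_subdegree y' = -1"
    and "fls_nth w (-1) = fls_nth y (-1)" "fls_nth w' (-1) = fls_nth y' (-1)" "f \<in> lev (lev W) k"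
  shows "Sub2 w w' f - Sub2 y y' f \<in> lev (lev W) (k - 1)"
proof -
  interpret sw: unital_hom "sbst scal w'" by (rule scal.unital_hom_sbst) fact
  interpret sy: unital_hom "sbst scal y'" by (rule scal.unital_hom_sbst) fact
  interpret s: unital_hom "sbst kc w" by (rule kc.unital_hom_sbst) fact
  let ?f = "fls_map (sbst scal w') f" and ?g = "fls_map (sbst scal y') f"
  have "?f - ?g \<in> lev (lev W) (k - 1)"
    unfolding lev_def[of "lev W"]
  proof clarify
    fix n
    have "fls_nth f n \<in> lev W (n + k)" using assms(7) unfolding lev_def[of "lev W"] by blast
    from sbst_lev_diff[OF scal.scalar_embedding_axioms scal_F assms(2,4,6) this]
    show "fls_nth (?f - ?g) n \<in> lev W (n + (k - 1))"
      by (simp add: fls_nth_fls_map algebra_simps)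
  qed
  then have 1: "sbst kc w (?f - ?g) \<in> lev (lev W) (k - 1)"
    by (rule f1.sbst_lev[OF kc.scalar_embedding_axioms kc_lev assms(1)])
  have "?g \<in> lev (lev W) k"
    using assms(7) sbst_lev[OF scal.scalar_embedding_axioms scal_F assms(4)]
    by (auto simp: lev_def[of "lev W"] fls_nth_fls_map)
  then have 2: "sbst kc w ?g - sbst kc y ?g \<in> lev (lev W) (k - 1)"
    by (rule f1.sbst_lev_diff[OF kc.scalar_embedding_axioms kc_lev assms(1,3,5)])
  have "Sub2 w w' f - Sub2 y y' f = sbst kc w (?f - ?g) + (sbst kc w ?g - sbst kc y ?g)"
    by (simp add: Sub2_def s.hom_diff)
  then show ?thesis using f2.W_add[OF 1 2] by simp
qed

lemma dB_lev:
  assumes "dB fls_X_inv fls_X_inv B \<in> ents (lev (lev W)) k" "a \<noteq> 0" "b \<noteq> 0"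
  shows "dB (aff a c) (aff b d) B \<in> ents (lev (lev W)) k"
  unfolding Sub2_dB[OF subdegree_aff[OF assms(2)] subdegree_aff[OF assms(3)] aff_combination(1,3)[OF assms(2)], symmetric]
  by (rule ents_map_sq[OF assms(1)]) (rule Sub2_lev; use assms in simp)

text \<open>A constant shift of the parameters changes the defect only below its level, by
  \<open>sbst_lev_diff\<close> in both variables. All defects in the fusion may thus be compared
  with the one at (2u, 2v).\<close>

lemma dB_lev_diff:
  assumes "dB fls_X_inv fls_X_inv B \<in> ents (lev (lev W)) k" "a \<noteq> 0"
  shows "dB (aff a c) (aff a d) B - dB (aff a c') (aff a d') B \<in> ents (lev (lev W)) (k - 1)"
proof -
  have eq: "dB (aff a c) (aff a d) B = map_sq (Sub2 (aff a c) (aff a d)) (dB fls_X_inv fls_X_inv B)" for c d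
    by (rule Sub2_dB[symmetric]) (use assms aff_combination in auto)
  show ?thesis
    unfolding eq using assms
    by (auto simp: ents_def aff_nth intro!: Sub2_lev_diff)
qed

end

lemma dgs_at_par: "fls_subdegree w = -1 \<Longrightarrow> B \<in> dgs 0 \<Longrightarrow> at_par w B \<in> dgs 0"
  by (auto simp: dgs_def at_par_def scal.sbst_nth[where a = 0])

text \<open>The two parameters of the fusion differ by -1, where R is twice a projector, and add up
  to 4u, the argument of the inner R-matrix; \<open>w0\<close> is their common leading part.\<close>

abbreviation "x1 \<equiv> aff 2 (- 1 / 2)"
abbreviation "x2 \<equiv> aff 2 (1 / 2)"
abbreviation "w0 \<equiv> aff 2 0"

section \<open>The fused matrix and its deviation from the symmetric square\<close>

definition fuse :: "('g free_alg fls, ix2) sqm \<Rightarrow> ('g free_alg fls, ix2 \<times> ix2) sqm"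
  where "fuse B = tn1 (at_par x1 B) * (1 - cst (e1 (1 / aff 4 0)) * flip_sq) * tn2 (at_par x2 B)"

definition hsym :: "('g free_alg fls, ix2 \<times> ix2) sqm"
  where "hsym = cst (kc (1/2)) * (1 + flip_sq)"

lemma one_diff_hsym: "(1 + flip_sq) * (1 - hsym) = (0 :: ('g free_alg fls, ix2 \<times> ix2) sqm)"
proof -
  have h: "central (cst (kc (1/2)) :: ('g free_alg fls, ix2 \<times> ix2) sqm)" by (rule central_cst[OF kc.central_e])
  have "(1 + flip_sq) * hsym = cst (kc (1/2)) * ((1 + flip_sq) * (1 + flip_sq) :: ('g free_alg fls, ix2 \<times> ix2) sqm)"
    unfolding hsym_def central_left_commute[OF h] ..
  also have "\<dots> = cst (kc (1/2)) * (1 + flip_sq) + cst (kc (1/2)) * (1 + flip_sq)"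
    by (simp add: algebra_simps flip_flip)
  also have "\<dots> = 1 + flip_sq"
    by (rule kc.half_half)
  finally show ?thesis by (simp only: right_diff_distrib mult_1_right diff_self)
qed

lemma aff_nonzero: "a \<noteq> 0 \<Longrightarrow> aff a c \<noteq> 0"
  using aff_nth[of a c "-1"] by auto

lemma cst_e1_mult_inverse: "c \<noteq> 0 \<Longrightarrow> cst (e1 (1 / c)) * (cst (e1 c) * A) = (A :: ('g free_alg fls, 'n::finite) sqm)"
  by (simp flip: mult.assoc cst.hom_mult e1.hom_mult)

text \<open>At these parameters the numerator of R at the difference is -1 - P. It annihilates 1 -
  \<open>hsym\<close> and so removes the second term of the cleared defect; the first term is the
  corner of the fused matrix times -8u.\<close>

lemma fuse_defect:
  "hsym * fuse B * (1 - hsym) =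
    cst (e1 (fls_const (- 1 / 2) * (1 / aff 4 0))) * (pdef (cst (e1 x1)) (cst (e1 x2)) (at_par x1 B) (at_par x2 B) * (1 - hsym))"
proof -
  let ?P = "flip_sq :: ('a free_alg fls, ix2 \<times> ix2) sqm"
  let ?a = "cst (e1 (aff 4 0)) :: ('a free_alg fls, ix2 \<times> ix2) sqm" and ?i = "cst (e1 (1 / aff 4 0)) :: ('a free_alg fls, ix2 \<times> ix2) sqm"
  let ?M = "tn1 (at_par x1 B)" and ?N = "tn2 (at_par x2 B)"
  have nz: "aff 4 0 \<noteq> 0" by (simp add: aff_nonzero)
  have m1: "aff 0 (- 1) = - 1" by (rule fls_eqI) (simp add: aff_nth)
  have d: "cst (e1 x1) - cst (e1 x2) = (- 1 :: ('a free_alg fls, ix2 \<times> ix2) sqm)"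
    and s: "cst (e1 x1) + cst (e1 x2) = ?a"
    by (simp_all add: aff_add aff_diff m1 e1.hom_uminus cst.hom_uminus flip: cst.hom_diff e1.hom_diff cst.hom_add e1.hom_add)
  have i: "?i * (?a * y) = y" for y by (rule cst_e1_mult_inverse[OF nz])
  have lc: "x * (?a * y) = ?a * (x * y)" for x y by (rule central_left_commute[OF central_cst[OF central_e1]])
  have aP: "?a - ?P = ?a * (1 - ?i * ?P)"
    using i[of ?P] lc[of ?i ?P] by (simp add: right_diff_distrib)
  have z: "(- 1 - ?P) * (1 - hsym) = 0"
  proof -
    have "- 1 - ?P = - (1 + ?P)" by simp
    then show ?thesis by (simp only: mult_minus_left one_diff_hsym minus_zero)
  qed
  have "pdef (cst (e1 x1)) (cst (e1 x2)) (at_par x1 B) (at_par x2 B) * (1 - hsym) =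
      (- 1 - ?P) * ?M * (?a - ?P) * ?N * (1 - hsym) - ?N * (?a - ?P) * ?M * ((- 1 - ?P) * (1 - hsym))"
    unfolding pdef_def rdef_def d s by (simp only: left_diff_distrib[of _ _ "1 - hsym"] mult.assoc)
  also have "\<dots> = (- 1 - ?P) * ?M * (?a - ?P) * ?N * (1 - hsym)"
    unfolding z by simp
  also have "\<dots> = - (?a * ((1 + ?P) * fuse B * (1 - hsym)))"
    unfolding aP fuse_def by (simp only: mult.assoc lc[of ?M] lc[of "- 1 - ?P"]) (simp add: algebra_simps)
  finally have D: "pdef (cst (e1 x1)) (cst (e1 x2)) (at_par x1 B) (at_par x2 B) * (1 - hsym) =
    - (?a * ((1 + ?P) * fuse B * (1 - hsym)))" .
  have "e1 (fls_const (- 1 / 2) * (1 / aff 4 0)) = - (kc (1/2) * e1 (1 / aff 4 0) :: 'a free_alg fls)"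
  proof -
    have "(fls_const (- 1 / 2) * (1 / aff 4 0)) = - (fls_const (1/2) * (1 / aff 4 0))"
      using fls_const_uminus[of "1 / 2 :: complex"] by simp
    then show ?thesis by (simp only: e1.hom_uminus e1.hom_mult e1_fls_const kc_def)
  qed
  then have cc: "cst (e1 (fls_const (- 1 / 2) * (1 / aff 4 0))) = - (cst (kc (1/2)) * ?i)"
    by (simp only: cst.hom_uminus cst.hom_mult)
  have hs: "hsym * z = cst (kc (1/2)) * ((1 + ?P) * z)" for z
    by (simp only: hsym_def mult.assoc)
  show ?thesis
    by (simp only: D cc minus_mult_minus mult.assoc i hs)
qed

context alg_filt
begin

text \<open>Clearing denominators raises the level by 2, and the division by 4u takes back only 1.
  The missing level comes from comparison with the parameters (2u, 2v): there the cleared defect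
  vanishes on the diagonal by \<open>pdef_diagonal\<close>, and the difference is one level lower
  since only constants in the parameters change.\<close>

lemma fuse_defect_lev:
  assumes D: "dB fls_X_inv fls_X_inv B \<in> ents (lev (lev W)) k" and B: "B \<in> dgs 0"
  shows "hsym * fuse B * (1 - hsym) \<in> ents (lev W) k"
proof -
  interpret M: filtered_pair "ents (lev (lev F))" "ents (lev (lev W)) :: int \<Rightarrow> ('g free_alg fls fls, ix2 \<times> ix2) sqm set"
    by (rule f2.filtered_pair_ents)
  interpret M1: filtered_pair "ents (lev F)" "ents (lev W) :: int \<Rightarrow> ('g free_alg fls, ix2 \<times> ix2) sqm set"
    by (rule f1.filtered_pair_ents)
  define s where "s w w' = (pu w - pv w') * (pu w + pv w')" for w w'
  define p2 where "p2 w w' = pdef (cst (e2 (pu w))) (cst (e2 (pv w'))) (map_sq iu (at_par w B)) (map_sq iv (at_par w' B))" for w w'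
  have p2: "p2 (aff 2 c) (aff 2 d) = cst (e2 (s (aff 2 c) (aff 2 d))) * dB (aff 2 c) (aff 2 d) B" for c d
    unfolding p2_def s_def by (rule pdef_dB) (use aff_combination in auto)
  have aff: "aff a c \<in> lev FC 1" "aff a c - aff a d \<in> lev FC 0" for a c d
    by (auto simp: lev_FC aff_nth)
  have cst_lev: "cst (e2 y) \<in> ents (lev (lev F)) j" if "y \<in> lev (lev FC) j" for y j
    by (rule cst_lev2[OF e2_lev[OF that]])
  have sum_lev: "pu (aff 2 c) + pv (aff 2 d) \<in> lev (lev FC) 1" "pu (aff 2 c) - pv (aff 2 d) \<in> lev (lev FC) 1" for c d
    using FC2.F_add FC2.F_diff pu_lev pv_lev aff(1) by auto
  have s2: "s (aff 2 c) (aff 2 d) \<in> lev (lev FC) 2" for c d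
    unfolding s_def using FC2.FF[OF sum_lev(2) sum_lev(1)] by simp
  have "s (aff 2 c) (aff 2 d) - s (aff 2 c') (aff 2 d') \<in> lev (lev FC) (1 + 1 - 1)" for c d c' d'
    unfolding s_def
  proof (rule FC2.F_cong_mult[OF _ _ sum_lev(2) sum_lev(1)])
    have 1: "pu (aff 2 c) - pu (aff 2 c') \<in> lev (lev FC) 0" "pv (aff 2 d) - pv (aff 2 d') \<in> lev (lev FC) 0"
      by (simp_all only: pu_lev pv_lev aff flip: pu_diff pv_diff)
    have eq: "pu (aff 2 c) - pv (aff 2 d) - (pu (aff 2 c') - pv (aff 2 d')) =
        (pu (aff 2 c) - pu (aff 2 c')) - (pv (aff 2 d) - pv (aff 2 d'))" by simp
    show "pu (aff 2 c) - pv (aff 2 d) - (pu (aff 2 c') - pv (aff 2 d')) \<in> lev (lev FC) (1 - 1)"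
      unfolding eq using FC2.F_diff[OF 1] by (simp only: diff_self)
    have eq: "pu (aff 2 c) + pv (aff 2 d) - (pu (aff 2 c') + pv (aff 2 d')) =
        (pu (aff 2 c) - pu (aff 2 c')) + (pv (aff 2 d) - pv (aff 2 d'))" by simp
    show "pu (aff 2 c) + pv (aff 2 d) - (pu (aff 2 c') + pv (aff 2 d')) \<in> lev (lev FC) (1 - 1)"
      unfolding eq using FC2.F_add[OF 1] by (simp only: diff_self)
  qed
  then have s1: "s (aff 2 c) (aff 2 d) - s (aff 2 c') (aff 2 d') \<in> lev (lev FC) 1" for c d c' d' by simp
  have "p2 x1 x2 - p2 w0 w0 = cst (e2 (s x1 x2)) * (dB x1 x2 B - dB w0 w0 B) + cst (e2 (s x1 x2 - s w0 w0)) * dB w0 w0 B"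
    unfolding p2 by (simp add: e2.hom_diff cst.hom_diff algebra_simps)
  also have "\<dots> \<in> ents (lev (lev W)) (k + 1)"
    by (intro M.W_add M.FW'[OF cst_lev[OF s2] dB_lev_diff[OF D]] M.FW'[OF cst_lev[OF s1] dB_lev[OF D]]) simp_all
  finally have "map_sq diag (p2 x1 x2 - p2 w0 w0) \<in> ents (lev W) (k + 1)"
    by (rule ents_map_sq) (rule diag_lev)
  moreover have "map_sq diag (p2 w0 w0) = 0"
    unfolding p2_def by (subst diag_pdef) (simp_all add: B dgs_at_par pdef_diagonal central_cst central_e1)
  moreover have "map_sq diag (p2 x1 x2) = pdef (cst (e1 x1)) (cst (e1 x2)) (at_par x1 B) (at_par x2 B)"
    unfolding p2_def by (rule diag_pdef) (simp_all add: B dgs_at_par)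
  ultimately have p: "pdef (cst (e1 x1)) (cst (e1 x2)) (at_par x1 B) (at_par x2 B) \<in> ents (lev W) (k + 1)"
    by (simp add: map_sq_diag_diff)
  have flip: "flip_sq \<in> ents (lev F) 0"
    using f1.F_one f1.F_0 by (simp add: ents_def flip_sq_def)
  have h: "1 - hsym \<in> ents (lev F) 0"
    unfolding hsym_def
    by (intro M1.F_diff M1.F_one M1.FF'[OF cst_lev1[OF kc_lev] M1.F_add[OF M1.F_one flip]]) simp
  have "fls_const (- 1 / 2) * (1 / aff 4 0) \<in> lev FC (- 1)"
    by (rule FC1.FF'[OF _ inverse_aff_lev, of _ 0]) (simp_all add: lev_FC)
  from e1_lev[OF this] show ?thesis
    unfolding fuse_defect by (intro M1.FW'[OF cst_lev1 M1.WF'[OF p h order_refl]]) auto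
qed

end

subsection \<open>Fusion of the reflection equation\<close>

context scalar_embedding
begin

definition cmp :: "('a, ix2 \<times> ix2) sqm \<Rightarrow> ('a, ix3) sqm"
  where "cmp A = Mk (\<lambda>a b. \<Sum>p\<in>UNIV. \<Sum>q\<in>UNIV. e (jv a (fst p) (snd p) * jv b (fst q) (snd q)) * ent A p q)"

lemma jv_orthonormal': "(\<Sum>p\<in>UNIV. jv a (fst p) (snd p) * jv b (fst p) (snd p)) = (if a = b then 1 else 0)"
  unfolding sum_UNIV_prod fst_conv snd_conv by (rule jv_orthonormal)

lemma lift2_legs:
  "ent (lift2 L1 L2 A) (legs p q) (legs p' q') = (if q = q' then ent A p p' else 0)"
  "ent (lift2 L3 L4 A) (legs p q) (legs p' q') = (if p = p' then ent A q q' else 0)"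
proof -
  have all: "(\<forall>k. P k) \<longleftrightarrow> P L1 \<and> P L2 \<and> P L3 \<and> P L4" for P
    by (metis leg.exhaust)
  show "ent (lift2 L1 L2 A) (legs p q) (legs p' q') = (if q = q' then ent A p p' else 0)"
    "ent (lift2 L3 L4 A) (legs p q) (legs p' q') = (if p = p' then ent A q q' else 0)"
    by (simp_all add: lift2_def all prod_eq_iff)
qed

text \<open>The pair of legs that the operator leaves alone contributes the inner product of two
  basis vectors of V.\<close>

lemma psi_lift2:
  "psi (lift2 L1 L2 A) = tn1 (cmp A)" "psi (lift2 L3 L4 A) = tn2 (cmp A)"
proof -
  have *: "e (x * y * (z * t)) * w = e (x * z) * w * e (y * t)" for x y z t w
  proof -
    have "x * y * (z * t) = y * t * (x * z)" by simp
    then have "e (x * y * (z * t)) * w = e (y * t) * (e (x * z) * w)"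
      by (simp only: hom_mult mult.assoc)
    also have "\<dots> = e (x * z) * w * e (y * t)"
      by (rule centralD[OF central_e])
    finally show ?thesis .
  qed
  have d: "x * (if P then y else 0) * z = (if P then x * y * z else 0)" for x y z :: 'a and P
    by simp
  show "psi (lift2 L1 L2 A) = tn1 (cmp A)"
  proof (rule sqm_eqI)
    fix a b :: "ix3 \<times> ix3"
    have "ent (psi (lift2 L1 L2 A)) a b = (\<Sum>p\<in>UNIV. \<Sum>q\<in>UNIV. \<Sum>p'\<in>UNIV.
       e (jv (fst a) (fst p) (snd p) * jv (fst b) (fst p') (snd p')) * ent A p p' *
       e (jv (snd a) (fst q) (snd q) * jv (snd b) (fst q) (snd q)))"
      unfolding psi_def ent_Mk sum_legs Jv_def lift2_legs legs_simps * d by simp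
    also have "\<dots> = (\<Sum>p\<in>UNIV. \<Sum>p'\<in>UNIV. \<Sum>q\<in>UNIV.
       e (jv (fst a) (fst p) (snd p) * jv (fst b) (fst p') (snd p')) * ent A p p' *
       e (jv (snd a) (fst q) (snd q) * jv (snd b) (fst q) (snd q)))"
      by (rule sum.cong[OF refl], rule sum.swap)
    also have "\<dots> = (\<Sum>p\<in>UNIV. \<Sum>p'\<in>UNIV.
       e (jv (fst a) (fst p) (snd p) * jv (fst b) (fst p') (snd p')) * ent A p p' * e (if snd a = snd b then 1 else 0))"
      unfolding jv_orthonormal'[symmetric] hom_sum sum_distrib_left ..
    also have "\<dots> = ent (tn1 (cmp A)) a b"
      by (simp add: tn1_def cmp_def e_if)
    finally show "ent (psi (lift2 L1 L2 A)) a b = ent (tn1 (cmp A)) a b" .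
  qed
  show "psi (lift2 L3 L4 A) = tn2 (cmp A)"
  proof (rule sqm_eqI)
    fix a b :: "ix3 \<times> ix3"
    have **: "e (y * x * (t * z)) * w = e (x * z) * w * e (y * t)" for x y z t w
      using *[of x y z t w] by (simp only: mult.commute[of y x] mult.commute[of t z])
    have d2: "(\<Sum>p'\<in>UNIV. \<Sum>q'\<in>UNIV. if p = p' then h p' q' else 0) = (\<Sum>q'\<in>UNIV. h p q')"
      for p :: "ix2 \<times> ix2" and h :: "ix2 \<times> ix2 \<Rightarrow> ix2 \<times> ix2 \<Rightarrow> 'a"
      by (subst sum.swap) simp
    have "ent (psi (lift2 L3 L4 A)) a b = (\<Sum>p\<in>UNIV. \<Sum>q\<in>UNIV. \<Sum>q'\<in>UNIV.
       e (jv (snd a) (fst q) (snd q) * jv (snd b) (fst q') (snd q')) * ent A q q' *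
       e (jv (fst a) (fst p) (snd p) * jv (fst b) (fst p) (snd p)))"
      unfolding psi_def ent_Mk sum_legs Jv_def lift2_legs legs_simps ** d d2 ..
    also have "\<dots> = (\<Sum>q\<in>UNIV. \<Sum>p\<in>UNIV. \<Sum>q'\<in>UNIV.
       e (jv (snd a) (fst q) (snd q) * jv (snd b) (fst q') (snd q')) * ent A q q' *
       e (jv (fst a) (fst p) (snd p) * jv (fst b) (fst p) (snd p)))"
      by (rule sum.swap)
    also have "\<dots> = (\<Sum>q\<in>UNIV. \<Sum>q'\<in>UNIV. \<Sum>p\<in>UNIV.
       e (jv (snd a) (fst q) (snd q) * jv (snd b) (fst q') (snd q')) * ent A q q' *
       e (jv (fst a) (fst p) (snd p) * jv (fst b) (fst p) (snd p)))"
      by (rule sum.cong[OF refl], rule sum.swap)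
    also have "\<dots> = (\<Sum>q\<in>UNIV. \<Sum>q'\<in>UNIV.
       e (jv (snd a) (fst q) (snd q) * jv (snd b) (fst q') (snd q')) * ent A q q' * e (if fst a = fst b then 1 else 0))"
      unfolding jv_orthonormal'[symmetric] hom_sum sum_distrib_left ..
    also have "\<dots> = ent (tn2 (cmp A)) a b"
      by (simp add: tn2_def cmp_def e_if)
    finally show "ent (psi (lift2 L3 L4 A)) a b = ent (tn2 (cmp A)) a b" .
  qed
qed

end

context filtered_pair
begin

text \<open>Congruence modulo level -1 to an element of level 0. It is multiplicative, so leading
  parts of long words are found factor by factor.\<close>

definition apx :: "'a \<Rightarrow> 'a \<Rightarrow> bool"
  where "apx x y \<longleftrightarrow> x - y \<in> F (-1) \<and> y \<in> F 0"

lemma apx_mult: "apx x x' \<Longrightarrow> apx y y' \<Longrightarrow> apx (x * y) (x' * y')"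
  unfolding apx_def using F_cong_mult[of x x' 0 y y' 0] F_of_cong[of y y' 0] FF[of x' 0 y' 0] by simp

lemma apx_F0: "apx x y \<Longrightarrow> x \<in> F 0"
  unfolding apx_def using F_of_cong[of x y 0] by simp

lemma apx_lead:
  assumes "w \<in> W j" "w - w' \<in> W (j - 1)" "apx x x'" "apx y y'"
  shows "x * w * y - x' * w' * y' \<in> W (j - 1)"
proof -
  have "x * w * y - x' * w * y' \<in> W (j - 1)"
    using assms W_lead unfolding apx_def by blast
  moreover have "x' * (w - w') * y' \<in> W (j - 1)"
    using assms unfolding apx_def by (intro WF'[OF FW'[of x' 0 "w - w'" "j - 1" "j - 1"]]) auto
  ultimately have "x * w * y - x' * w * y' + x' * (w - w') * y' \<in> W (j - 1)"
    by (rule W_add)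
  then show ?thesis by (simp add: algebra_simps)
qed

end

definition R3s :: "complex fls fls \<Rightarrow> ('g free_alg fls fls, ix3 \<times> ix3) sqm"
  where "R3s c = 1 - cst (e2 (1 / c)) * flip_sq + cst (e2 (1 / (c - 1/2))) * Qs"

text \<open>Here t is twice the difference of the orthogonal parameters, and the four factors of the
  fused R-matrix have arguments t - 1, t, t, t + 1. By \<open>psi_fused\<close> and
  \<open>psi_swp_13\<close> the coefficients of 1, P and Q are 1 - \<alpha>/2, \<gamma> - \<alpha>/2
  and \<alpha>/2; the identities say that this is (t - 1)/(t + 1) times the orthogonal R-matrix at
  t/2.\<close>

lemma fused_scalars:
  fixes t :: "'k::field_char_0"
  assumes t: "t \<noteq> 0" "t \<noteq> 1" "t \<noteq> -1"
  defines "a \<equiv> 1 / (t - 1)" and "b \<equiv> 1 / t" and "c \<equiv> 1 / (t + 1)"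
  defines "\<alpha> \<equiv> (a + b + b + c) - (a * b + a * b + b * c + b * c) + (a * b * b + b * b * c)"
    and "\<gamma> \<equiv> a * c + b * b - (a * b * c + a * b * c) + a * b * b * c"
  shows "\<alpha> / 2 = 2 / (t + 1)" "1 - \<alpha> / 2 = (t - 1) / (t + 1)" "\<gamma> - \<alpha> / 2 = - ((t - 1) / (t + 1)) * (2 / t)"
proof -
  have nz: "t - 1 \<noteq> 0" "t + 1 \<noteq> 0" "t \<noteq> 0" using t eq_neg_iff_add_eq_0[of t 1] by auto
  show *: "\<alpha> / 2 = 2 / (t + 1)"
    unfolding \<alpha>_def a_def b_def c_def using nz by (simp add: divide_simps) (simp add: algebra_simps)
  show "1 - \<alpha> / 2 = (t - 1) / (t + 1)"
    unfolding * using nz by (simp add: field_simps)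
  show "\<gamma> - \<alpha> / 2 = - ((t - 1) / (t + 1)) * (2 / t)"
    unfolding * \<gamma>_def a_def b_def c_def using nz by (simp add: divide_simps) (simp add: algebra_simps)
qed

lemma kc2_e2: "kc2 c = e2 (fls_const (fls_const c))"
  by (rule fls_eqI) (simp add: kc2_def kc_def)

lemma e2_half: "kc2 (1/2) = e2 (1/2)"
proof -
  have "fls_const (fls_const (1/2 :: complex)) * 2 = 1"
    by (simp flip: fls_const_numeral)
  then have "fls_const (fls_const (1/2 :: complex)) = 1/2"
    by (simp add: eq_divide_eq)
  then show ?thesis by (simp only: kc2_e2)
qed

lemma psi_Rm:
  assumes "t \<noteq> 0" "t \<noteq> 1" "t \<noteq> -1"
  shows "kc2.psi (Rl L1 L4 (t - 1) * Rl L2 L4 t * Rl L1 L3 t * Rl L2 L3 (t + 1)) =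
    cst (e2 ((t - 1) / (t + 1))) * (R3s (t / 2) :: ('g free_alg fls fls, ix3 \<times> ix3) sqm)" (is "?l = _")
proof -
  note f = fused_scalars[OF assms]
  define a b c where "a = 1 / (t - 1)" and "b = 1 / t" and "c = 1 / (t + 1)"
  define \<alpha> \<gamma> where "\<alpha> = (a + b + b + c) - (a * b + a * b + b * c + b * c) + (a * b * b + b * b * c)"
    and "\<gamma> = a * c + b * b - (a * b * c + a * b * c) + a * b * b * c"
  note f = f[folded a_def b_def c_def, folded \<alpha>_def \<gamma>_def]
  have "?l = 1 - cst (e2 \<alpha>) * (cst (e2 (1/2)) * (1 + flip_sq - Qs)) + cst (e2 \<gamma>) * flip_sq"
    unfolding Rl_def a_def[symmetric] b_def[symmetric] c_def[symmetric]
      kc2.psi_fused[OF central_e2 central_e2 central_e2] kc2.psi_swp_13 e2_half \<alpha>_def \<gamma>_def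
    by (simp only: e2.hom_add e2.hom_diff e2.hom_mult)
  also have "\<dots> = cst (e2 (1 - \<alpha> / 2)) + cst (e2 (\<gamma> - \<alpha> / 2)) * flip_sq + cst (e2 (\<alpha> / 2)) * Qs"
  proof -
    have h: "cst (e2 \<alpha>) * (cst (e2 (1/2)) * x) = cst (e2 (\<alpha> / 2)) * x" for x :: "('g free_alg fls fls, ix3 \<times> ix3) sqm"
      by (simp flip: mult.assoc cst.hom_mult e2.hom_mult)
    show ?thesis
      unfolding h by (simp add: e2.hom_diff cst.hom_diff algebra_simps)
  qed
  also have "\<dots> = cst (e2 ((t - 1) / (t + 1))) * R3s (t / 2)"
  proof -
    have "t - 1 \<noteq> 0" using assms by simp
    then have g: "(t - 1) / (t + 1) * (1 / (t / 2 - 1 / 2)) = 2 / (t + 1)"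
      by (simp add: divide_simps)
    have m: "cst (e2 x) * (cst (e2 y) * z) = cst (e2 (x * y)) * z" for x y and z :: "('g free_alg fls fls, ix3 \<times> ix3) sqm"
      by (simp only: mult.assoc cst.hom_mult e2.hom_mult)
    have neg: "- ((t - 1) / (t + 1)) * (2 / t) = - ((t - 1) / (t + 1) * (1 / (t / 2)))" by simp
    show ?thesis
      unfolding f(2,3) unfolding f(1) R3s_def distrib_left right_diff_distrib m g mult_1_right neg
      by (simp only: e2.hom_uminus cst.hom_uminus) simp
  qed
  finally show ?thesis .
qed

text \<open>Conjugation with (34), which \<open>psi\<close> ignores, exchanges legs 3 and 4 and
  reduces this product to the one in \<open>psi_Rm\<close>.\<close>

lemma psi_Rp:
  assumes "t \<noteq> 0" "t \<noteq> 1" "t \<noteq> -1"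
  shows "kc2.psi (Rl L1 L3 (t - 1) * Rl L2 L3 t * Rl L1 L4 t * Rl L2 L4 (t + 1)) =
    cst (e2 ((t - 1) / (t + 1))) * (R3s (t / 2) :: ('g free_alg fls fls, ix3 \<times> ix3) sqm)"
proof -
  let ?s = "swp L3 L4 :: ('g free_alg fls fls, leg \<Rightarrow> ix2) sqm"
  have ss: "?s * (?s * x) = x" for x
    by (simp add: swp_sq flip: mult.assoc)
  have conj: "?s * Rl i L4 c = Rl i L3 c * ?s" "?s * Rl i L3 c = Rl i L4 c * ?s" if "i \<in> {L1, L2}" for i c
  proof -
    have 1: "?s * swp i L4 = swp i L3 * ?s" "?s * swp i L3 = swp i L4 * ?s"
      using that unfolding permop_mult
      by (intro arg_cong[of _ _ permop], auto simp: fun_eq_iff Transposition.transpose_def)+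
    show "?s * Rl i L4 c = Rl i L3 c * ?s" "?s * Rl i L3 c = Rl i L4 c * ?s"
      unfolding Rl_def right_diff_distrib left_diff_distrib central_left_commute[OF central_cst_e2] 1
      by (simp_all add: mult.assoc)
  qed
  have "?s * (Rl L1 L4 (t - 1) * Rl L2 L4 t * Rl L1 L3 t * Rl L2 L3 (t + 1)) =
     Rl L1 L3 (t - 1) * Rl L2 L3 t * Rl L1 L4 t * Rl L2 L4 (t + 1) * ?s"
    by (simp add: conj mult.assoc flip: mult.assoc[of ?s])
  then show ?thesis
    using psi_Rm[OF assms] kc2.psi_swp(2)[of "Rl L1 L4 (t - 1) * Rl L2 L4 t * Rl L1 L3 t * Rl L2 L3 (t + 1)"]
    by (metis kc2.psi_swp(4))
qed

lemma projector_idem: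
  fixes s :: "'r::ring_1"
  assumes "s * s = 1" "central h" "h + h = 1"
  shows "h * (1 + s) * (h * (1 + s)) = h * (1 + s)"
  using projector_absorb[of s 1 1 h] assms by simp

lemma absorb_mult:
  fixes P :: "'r::ring_1"
  assumes "P * v = P * v * P" "P * w = P * w * P" shows "P * (v * w) = P * (v * w) * P"
  by (metis assms mult.assoc)

lemma absorb_both:
  fixes P :: "'r::ring_1"
  assumes "P * w = P * w * P" "R * w = R * w * R" "R * P = P * R"
  shows "P * R * w = P * R * w * (P * R)"
proof -
  have "P * R * w = P * (R * w * R)" by (metis assms(2) mult.assoc)
  also have "\<dots> = R * (P * w) * R" by (metis assms(3) mult.assoc)
  also have "\<dots> = R * (P * w * P) * R" using assms(1) by simp
  also have "\<dots> = P * R * w * (P * R)" by (metis assms(3) mult.assoc)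
  finally show ?thesis .
qed

section \<open>The exchange relation of the fused matrix to leading order\<close>

definition diagc :: "(ix2 \<Rightarrow> complex) \<Rightarrow> ('g free_alg fls, ix2) sqm"
  where "diagc g = Mk (\<lambda>i j. if i = j then kc (g i) else 0)"

definition diagc2 :: "(ix2 \<Rightarrow> complex) \<Rightarrow> ('g free_alg fls fls, ix2) sqm"
  where "diagc2 g = Mk (\<lambda>i j. if i = j then kc2 (g i) else 0)"

lemma iu_kc: "iu (kc c) = kc2 c" and iv_kc: "iv (kc c) = kc2 c"
  by (rule fls_eqI, simp add: kc_def kc2_def)+

text \<open>No reflection equation is assumed of \<open>B\<close>: its failure is what gets measured
  in \<open>W\<close>. So the locale applies both to the generators of the reflection algebra and to
  the matrix \<beta> solved from \<open>S\<close>.\<close>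

locale refl_data = alg_filt F W for F W :: "int \<Rightarrow> 'g free_alg set" +
  fixes B :: "('g free_alg fls, ix2) sqm" and g :: "ix2 \<Rightarrow> complex"
  assumes B_dgs: "B \<in> dgs 0" and B_lead: "B - diagc g \<in> ents (lev F) (-1)"
begin

lemma at_par_lead: "a \<noteq> 0 \<Longrightarrow> at_par (aff a c) B - diagc g \<in> ents (lev F) (-1)"
proof -
  assume a: "a \<noteq> 0"
  interpret FF: alg_filt F F by (rule alg_filt_F)
  interpret s: unital_hom "sbst scal (aff a c)" by (rule scal.unital_hom_sbst) (simp add: a)
  have k: "sbst scal (aff a c) (kc x) = kc x" for x
    by (simp add: kc_def scal.sbst_fls_const a)
  have "at_par (aff a c) B - diagc g = map_sq (sbst scal (aff a c)) (B - diagc g)"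
    by (rule sqm_eqI) (simp add: at_par_def s.hom_diff diagc_def k)
  also have "\<dots> \<in> ents (lev F) (-1)"
    by (rule ents_map_sq[OF B_lead]) (rule FF.sbst_lev[OF scal.scalar_embedding_axioms scal_F], simp add: a)
  finally show ?thesis .
qed

lemma iu_lead: "a \<noteq> 0 \<Longrightarrow> map_sq iu (at_par (aff a c) B) - diagc2 g \<in> ents (lev (lev F)) (-1)"
  and iv_lead: "a \<noteq> 0 \<Longrightarrow> map_sq iv (at_par (aff a c) B) - diagc2 g \<in> ents (lev (lev F)) (-1)"
proof -
  assume a: "a \<noteq> 0"
  have "map_sq iu (at_par (aff a c) B) - diagc2 g = map_sq iu (at_par (aff a c) B - diagc g)"
    "map_sq iv (at_par (aff a c) B) - diagc2 g = map_sq iv (at_par (aff a c) B - diagc g)"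
    by (rule sqm_eqI, simp add: iu.hom_diff iv.hom_diff diagc_def diagc2_def iu_kc iv_kc)+
  then show "map_sq iu (at_par (aff a c) B) - diagc2 g \<in> ents (lev (lev F)) (-1)"
    "map_sq iv (at_par (aff a c) B) - diagc2 g \<in> ents (lev (lev F)) (-1)"
    using at_par_lead[OF a, of c] by (auto intro: ents_map_sq iu_lev iv_lev F_0)
qed

end

text \<open>The error of \<open>reflection_fusion\<close> with every R-matrix replaced by 1, every
  matrix by its constant term and every defect by the one at (2u, 2v): one summand for each pair of
  a u-leg and a v-leg.\<close>

definition leadterm :: "('g free_alg fls, ix2) sqm \<Rightarrow> (ix2 \<Rightarrow> complex) \<Rightarrow> ('g free_alg fls fls, leg \<Rightarrow> ix2) sqm"
  where "leadterm B g = (let G = \<lambda>i. lift1 i (diagc2 g); D = \<lambda>i j. lift2 i j (dB w0 w0 B)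
    in G L1 * D L2 L3 * G L4 + D L1 L3 * (G L2 * G L4) + G L3 * G L1 * D L2 L4 + G L3 * D L1 L4 * G L2)"

lemma commute_Pi:
  assumes "x * s = s * x" "central h" shows "x * (h * (1 + s)) = h * (1 + s) * (x :: 'r::ring_1)"
proof -
  have "x * (h * (1 + s)) = h * (x * (1 + s))"
    by (rule central_left_commute[OF assms(2)])
  also have "x * (1 + s) = (1 + s) * x"
    by (simp add: assms(1) algebra_simps)
  finally show ?thesis by (simp add: mult.assoc)
qed

lemma pu_half:
  "pu x1 = pu w0 - fls_const (fls_const (1/2))" "pu x2 = pu w0 + fls_const (fls_const (1/2))"
  "pv x1 = pv w0 - fls_const (fls_const (1/2))" "pv x2 = pv w0 + fls_const (fls_const (1/2))"
proof -
  have h: "x1 = w0 - fls_const (1/2)" "x2 = w0 + fls_const (1/2)"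
    by (rule fls_eqI, simp add: aff_nth)+
  have k: "pu (fls_const c) = fls_const (fls_const c)" "pv (fls_const c) = fls_const (fls_const c)" for c
    by (rule fls_eqI, simp add: pu_def pv_def)+
  show "pu x1 = pu w0 - fls_const (fls_const (1/2))" "pu x2 = pu w0 + fls_const (fls_const (1/2))"
    "pv x1 = pv w0 - fls_const (fls_const (1/2))" "pv x2 = pv w0 + fls_const (fls_const (1/2))"
    unfolding h pu_diff pu_add pv_diff pv_add k by simp_all
qed

lemma half_plus_half: "fls_const (fls_const (1/2)) + fls_const (fls_const (1/2)) = (1 :: complex fls fls)"
  by (simp add: fls_plus_const)

text \<open>Legs 1, 2, 3, 4 carry 2u - 1/2, 2u + 1/2, 2v - 1/2, 2v + 1/2. With t = 2u - 2v and s =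
  2u + 2v the mixed differences and sums are t - 1, t, t + 1 and s - 1, s, s + 1.\<close>

lemma param_sums:
  defines "t \<equiv> pu w0 - pv w0" and "s \<equiv> pu w0 + pv w0"
  shows "pu x1 - pv x1 = t" "pu x1 - pv x2 = t - 1" "pu x2 - pv x1 = t + 1" "pu x2 - pv x2 = t"
    "pu x1 + pv x1 = s - 1" "pu x1 + pv x2 = s" "pu x2 + pv x1 = s" "pu x2 + pv x2 = s + 1"
    "pu (aff 4 0) = pu x1 + pu x2" "pv (aff 4 0) = pv x1 + pv x2"
    "t \<noteq> 0" "t - 1 \<noteq> 0" "t + 1 \<noteq> 0" "s \<noteq> 0" "s - 1 \<noteq> 0" "s + 1 \<noteq> 0"
    "pu (aff 4 0) \<noteq> 0" "pv (aff 4 0) \<noteq> 0"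
proof -
  define h :: "complex fls fls" where "h = fls_const (fls_const (1/2))"
  have h: "h + h = 1" unfolding h_def by (rule half_plus_half)
  note p = pu_half[folded h_def]
  have one: "1 = h + h" using h by simp
  show e: "pu x1 - pv x1 = t" "pu x1 - pv x2 = t - 1" "pu x2 - pv x1 = t + 1" "pu x2 - pv x2 = t"
    "pu x1 + pv x1 = s - 1" "pu x1 + pv x2 = s" "pu x2 + pv x1 = s" "pu x2 + pv x2 = s + 1"
    unfolding p t_def s_def one by (simp_all add: algebra_simps)
  show "pu (aff 4 0) = pu x1 + pu x2" "pv (aff 4 0) = pv x1 + pv x2"
    by (simp_all add: aff_add flip: pu_add pv_add)
  show "t \<noteq> 0" "s \<noteq> 0" unfolding t_def s_def by (rule aff_combination, simp)+
  show "t - 1 \<noteq> 0" "t + 1 \<noteq> 0" "s - 1 \<noteq> 0" "s + 1 \<noteq> 0"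
    unfolding e(2,3,5,8)[symmetric] by (rule aff_combination, simp)+
  have "fls_nth (pu (aff 4 0)) (-1) \<noteq> 0" "fls_nth (fls_nth (pv (aff 4 0)) 0) (-1) \<noteq> 0"
    by (simp_all add: pu_def pv_def aff_nth)
  then show "pu (aff 4 0) \<noteq> 0" "pv (aff 4 0) \<noteq> 0" by auto
qed

lemma lift2_fuse:
  fixes B :: "('g free_alg fls, ix2) sqm"
  shows "lift2 L1 L2 (map_sq iu (fuse B)) =
    lift1 L1 (map_sq iu (at_par x1 B)) * Rl L1 L2 (pu (aff 4 0)) * lift1 L2 (map_sq iu (at_par x2 B))" (is ?U)
  "lift2 L3 L4 (map_sq iv (fuse B)) =
    lift1 L3 (map_sq iv (at_par x1 B)) * Rl L3 L4 (pv (aff 4 0)) * lift1 L4 (map_sq iv (at_par x2 B))" (is ?V)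
  and lift2_hsym: "lift2 L1 L2 (map_sq iu (hsym :: ('g free_alg fls, _) sqm)) = kc2.Pi12" (is ?HU) "lift2 L3 L4 (map_sq iv (hsym :: ('g free_alg fls, _) sqm)) = kc2.Pi34" (is ?HV)
proof -
  interpret U: unital_hom "map_sq iu :: ('g free_alg fls, ix2 \<times> ix2) sqm \<Rightarrow> _" by (rule unital_hom_map_sq[OF unital_hom_iu])
  interpret V: unital_hom "map_sq iv :: ('g free_alg fls, ix2 \<times> ix2) sqm \<Rightarrow> _" by (rule unital_hom_map_sq[OF unital_hom_iv])
  interpret L12: unital_hom "lift2 L1 L2 :: ('g free_alg fls fls, ix2 \<times> ix2) sqm \<Rightarrow> _" by (rule unital_hom_lift2) simp
  interpret L34: unital_hom "lift2 L3 L4 :: ('g free_alg fls fls, ix2 \<times> ix2) sqm \<Rightarrow> _" by (rule unital_hom_lift2) simp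
  have inv: "pu (1 / x) = 1 / pu x" "pv (1 / x) = 1 / pv x" if "x \<noteq> 0" for x
  proof -
    have "pu (1 / x) * pu x = 1" "pv (1 / x) * pv x = 1"
      using that by (simp_all add: pu_def pv_def flip: iu.hom_mult iv.hom_mult)
    then show "pu (1 / x) = 1 / pu x" "pv (1 / x) = 1 / pv x"
      by (metis eq_divide_eq mult_zero_right zero_neq_one)+
  qed
  have c: "iu (e1 (1 / aff 4 0)) = (e2 (1 / pu (aff 4 0)) :: 'g free_alg fls fls)"
    "iv (e1 (1 / aff 4 0)) = (e2 (1 / pv (aff 4 0)) :: 'g free_alg fls fls)"
    by (simp_all add: aff_nonzero flip: e2_pu e2_pv inv)
  show ?U
    unfolding fuse_def U.hom_mult L12.hom_mult U.hom_diff L12.hom_diff U.hom_1 L12.hom_1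
      map_sq_tn1[of iu, OF iu.hom_0] map_sq_tn2[of iu, OF iu.hom_0] map_sq_cst[of iu, OF iu.hom_0] map_sq_flip[of iu, OF iu.hom_0 iu.hom_1] c
    by (simp add: lift2_tn1 lift2_tn2 lift2_cst lift2_flip Rl_def)
  show ?V
    unfolding fuse_def V.hom_mult L34.hom_mult V.hom_diff L34.hom_diff V.hom_1 L34.hom_1
      map_sq_tn1[of iv, OF iv.hom_0] map_sq_tn2[of iv, OF iv.hom_0] map_sq_cst[of iv, OF iv.hom_0] map_sq_flip[of iv, OF iv.hom_0 iv.hom_1] c
    by (simp add: lift2_tn1 lift2_tn2 lift2_cst lift2_flip Rl_def)
  show ?HU
    unfolding hsym_def U.hom_mult L12.hom_mult U.hom_add L12.hom_add U.hom_1 L12.hom_1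
      map_sq_cst[of iu, OF iu.hom_0] map_sq_flip[of iu, OF iu.hom_0 iu.hom_1] iu_kc
    by (simp add: lift2_cst lift2_flip kc2.Pi12_def)
  show ?HV
    unfolding hsym_def V.hom_mult L34.hom_mult V.hom_add L34.hom_add V.hom_1 L34.hom_1
      map_sq_cst[of iv, OF iv.hom_0] map_sq_flip[of iv, OF iv.hom_0 iv.hom_1] iv_kc
    by (simp add: lift2_cst lift2_flip kc2.Pi34_def)
qed

context refl_data
begin

text \<open>\<open>reflection_fusion\<close> is projected to V (x) V. The corners of the fused
  matrices and the non-leading parts of the four error words fall one level below the defect, so
  \<open>leadterm\<close> is all that remains.\<close>

theorem exchange:
  fixes k :: int
  assumes D: "dB fls_X_inv fls_X_inv B \<in> ents (lev (lev W)) k"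
  defines "t \<equiv> pu w0 - pv w0" and "s \<equiv> pu w0 + pv w0"
  defines "A \<equiv> lift2 L1 L2 (map_sq iu (fuse B))" and "C \<equiv> lift2 L3 L4 (map_sq iv (fuse B))"
  defines "Rm \<equiv> Rl L1 L4 (t - 1) * Rl L2 L4 t * Rl L1 L3 t * Rl L2 L3 (t + 1)"
    and "Rp \<equiv> Rl L1 L3 (s - 1) * Rl L2 L3 s * Rl L1 L4 s * Rl L2 L4 (s + 1)"
  shows "kc2.psi Rm * kc2.psi A * kc2.psi Rp * kc2.psi C - kc2.psi C * kc2.psi Rp * kc2.psi A * kc2.psi Rm
    - kc2.psi (leadterm B g) \<in> ents (lev (lev W)) (k - 1)"
proof -
  interpret M: filtered_pair "ents (lev (lev F))" "ents (lev (lev W)) :: int \<Rightarrow> ('g free_alg fls fls, leg \<Rightarrow> ix2) sqm set"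
    by (rule f2.filtered_pair_ents)
  interpret f2M3: filtered_pair "ents (lev (lev F))" "ents (lev (lev W)) :: int \<Rightarrow> ('g free_alg fls fls, ix3 \<times> ix3) sqm set"
    by (rule f2.filtered_pair_ents)
  note par = param_sums[folded t_def s_def]
  \<comment> \<open>The inner arguments 4u and 4v are t + s and s - t; this makes the arguments of
    every Yang--Baxter triple below additive.\<close>
  have q: "pu (aff 4 0) = t + s" "pv (aff 4 0) = s - t"
  proof -
    have "pu (aff 4 0) = pu w0 + pu w0" "pv (aff 4 0) = pv w0 + pv w0"
      by (simp_all add: aff_add flip: pu_add pv_add)
    then show "pu (aff 4 0) = t + s" "pv (aff 4 0) = s - t"
      by (simp_all add: t_def s_def)
  qed
  define b1 where "b1 = lift1 L1 (map_sq iu (at_par x1 B))"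
  define b2 where "b2 = lift1 L2 (map_sq iu (at_par x2 B))"
  define b3 where "b3 = lift1 L3 (map_sq iv (at_par x1 B))"
  define b4 where "b4 = lift1 L4 (map_sq iv (at_par x2 B))"
  note b_defs = b1_def b2_def b3_def b4_def
  define G where "G i = lift1 i (diagc2 g :: ('g free_alg fls fls, ix2) sqm)" for i
  let ?R = "Rl :: leg \<Rightarrow> leg \<Rightarrow> complex fls fls \<Rightarrow> ('g free_alg fls fls, leg \<Rightarrow> ix2) sqm"
  let ?p12 = "?R L1 L2 (pu (aff 4 0))" and ?p34 = "?R L3 L4 (pv (aff 4 0))"
  let ?p13 = "?R L1 L3 (s - 1)" and ?p14 = "?R L1 L4 s" and ?p23 = "?R L2 L3 s" and ?p24 = "?R L2 L4 (s + 1)"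
  let ?r13 = "?R L1 L3 t" and ?r14 = "?R L1 L4 (t - 1)" and ?r23 = "?R L2 L3 (t + 1)" and ?r24 = "?R L2 L4 t"
  define D23 where "D23 = lift2 L2 L3 (dB x2 x1 B)"
  define D13 where "D13 = lift2 L1 L3 (dB x1 x1 B)"
  define D24 where "D24 = lift2 L2 L4 (dB x2 x2 B)"
  define D14 where "D14 = lift2 L1 L4 (dB x1 x2 B)"
  note D_defs = D23_def D13_def D24_def D14_def
  have A: "A = b1 * ?p12 * b2" and C: "C = b3 * ?p34 * b4"
    unfolding A_def C_def b_defs lift2_fuse by simp_all
  define Z where "Z = ?r14 * ?r24 * ?r13 * (b1 * ?p13 * ?p12 * ?p14 * D23 * (?p24 * ?p34 * b4))
       + ?r14 * ?r24 * (D13 * (?p12 * ?p14 * ?p23 * ?p34 * b2 * ?p24 * b4)) * ?r23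
       + ?r14 * (b3 * ?p13 * b1 * ?p34 * ?p23 * ?p14 * ?p12 * D24) * ?r13 * ?r23
       + b3 * ?p34 * ?p13 * ?p23 * D14 * (?p12 * ?p24 * b2) * ?r24 * ?r13 * ?r23"
  have com: "x * ?R i j c = ?R i j c * x" if "x = lift1 l M'" "l \<noteq> i" "l \<noteq> j" for x i j c l M'
    unfolding that(1) by (rule lift1_Rl_commute[OF that(2,3)])
  have yb: "?R i j \<alpha> * ?R i l \<gamma> * ?R j l \<beta> = ?R j l \<beta> * ?R i l \<gamma> * ?R i j \<alpha>"
    if "i \<noteq> j" "j \<noteq> l" "i \<noteq> l" "\<gamma> = \<alpha> + \<beta>" "\<alpha> \<noteq> 0" "\<beta> \<noteq> 0" "\<gamma> \<noteq> 0" for i j l \<alpha> \<beta> \<gamma>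
    by (rule Rl_yang_baxter) (use that in auto)
  have ex: "Rm * (A * Rp * C) = C * Rp * A * Rm + Z"
    unfolding Rm_def Rp_def A C Z_def
  proof (rule reflection_fusion)
    show "?p23 * ?p14 = ?p14 * ?p23" "?p12 * ?p34 = ?p34 * ?p12" "?r23 * ?p14 = ?p14 * ?r23"
      "?r14 * ?p23 = ?p23 * ?r14" "?r13 * ?p24 = ?p24 * ?r13" "?r24 * ?p13 = ?p13 * ?r24"
      by (rule Rl_commute, simp)+
    show "b1 * ?p23 = ?p23 * b1" "b1 * ?p34 = ?p34 * b1" "b2 * ?p13 = ?p13 * b2"
      "b2 * ?p14 = ?p14 * b2" "b2 * ?p34 = ?p34 * b2" "b3 * ?p12 = ?p12 * b3" "b3 * ?p14 = ?p14 * b3"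
      "b3 * ?p24 = ?p24 * b3" "b4 * ?p12 = ?p12 * b4" "b4 * ?p13 = ?p13 * b4" "b4 * ?p23 = ?p23 * b4" "b1 * ?p24 = ?p24 * b1"
      "b1 * ?r23 = ?r23 * b1" "b1 * ?r24 = ?r24 * b1" "b2 * ?r13 = ?r13 * b2" "b2 * ?r14 = ?r14 * b2"
      "b3 * ?r24 = ?r24 * b3" "b3 * ?r14 = ?r14 * b3" "b4 * ?r13 = ?r13 * b4" "b4 * ?r23 = ?r23 * b4"
      unfolding b_defs by (rule com, rule refl, simp, simp)+
    show "?r23 * ?p12 * ?p13 = ?p13 * ?p12 * ?r23"
      using yb[of L2 L3 L1 "pu (aff 4 0)" "t + 1" "s - 1"] par(11-18) q by (simp add: Rl_sym[of L2 L1] Rl_sym[of L3 L1])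
    show "?r23 * ?p24 * ?p34 = ?p34 * ?p24 * ?r23"
      using yb[of L2 L3 L4 "s + 1" "t + 1" "pv (aff 4 0)"] par(11-18) q by (simp)
    show "?r13 * ?p12 * ?p23 = ?p23 * ?p12 * ?r13"
      using yb[of L1 L3 L2 "pu (aff 4 0)" "t" "s"] par(11-18) q by (simp add: Rl_sym[of L3 L2])
    show "?r13 * ?p14 * ?p34 = ?p34 * ?p14 * ?r13"
      using yb[of L1 L3 L4 "s" "t" "pv (aff 4 0)"] par(11-18) q by (simp)
    show "?r24 * ?p23 * ?p34 = ?p34 * ?p23 * ?r24"
      using yb[of L2 L4 L3 "s" "t" "pv (aff 4 0)"] par(11-18) q by (simp add: Rl_sym[of L4 L3])
    show "?r24 * ?p12 * ?p14 = ?p14 * ?p12 * ?r24"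
      using yb[of L2 L4 L1 "pu (aff 4 0)" "t" "s"] par(11-18) q by (simp add: Rl_sym[of L2 L1] Rl_sym[of L4 L1])
    show "?r14 * ?p13 * ?p34 = ?p34 * ?p13 * ?r14"
      using yb[of L1 L4 L3 "s - 1" "t - 1" "pv (aff 4 0)"] par(11-18) q by (simp add: Rl_sym[of L4 L3])
    show "?r14 * ?p12 * ?p24 = ?p24 * ?p12 * ?r14"
      using yb[of L1 L4 L2 "pu (aff 4 0)" "t - 1" "s + 1"] par(11-18) q by (simp add: Rl_sym[of L4 L2])
    show "?r23 * (b2 * ?p23 * b3) = b3 * ?p23 * b2 * ?r23 + D23"
      unfolding b_defs D_defs by (subst lift2_dB, simp, unfold par, simp add: mult.assoc)
    show "?r13 * (b1 * ?p13 * b3) = b3 * ?p13 * b1 * ?r13 + D13"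
      unfolding b_defs D_defs by (subst lift2_dB, simp, unfold par, simp add: mult.assoc)
    show "?r24 * (b2 * ?p24 * b4) = b4 * ?p24 * b2 * ?r24 + D24"
      unfolding b_defs D_defs by (subst lift2_dB, simp, unfold par, simp add: mult.assoc)
    show "?r14 * (b1 * ?p14 * b4) = b4 * ?p14 * b1 * ?r14 + D14"
      unfolding b_defs D_defs by (subst lift2_dB, simp, unfold par, simp add: mult.assoc)
  qed
  let ?h = "cst (kc2 (1/2)) :: ('g free_alg fls fls, leg \<Rightarrow> ix2) sqm"
  have h: "central ?h" "?h + ?h = 1"
    using central_cst[OF kc2.central_e] kc2.half_half[of "1 :: ('g free_alg fls fls, leg \<Rightarrow> ix2) sqm"] by simp_all
  define Pa Pb :: "('g free_alg fls fls, leg \<Rightarrow> ix2) sqm" where "Pa = kc2.Pi12" and "Pb = kc2.Pi34"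
  have Pd: "Pa = ?h * (1 + swp L1 L2)" "Pb = ?h * (1 + swp L3 L4)"
    by (simp_all add: Pa_def Pb_def kc2.Pi12_def kc2.Pi34_def)
  have comP: "x * Pa = Pa * x" if "x * swp L1 L2 = swp L1 L2 * x" for x
    unfolding Pd by (rule commute_Pi[OF that h(1)])
  have comP': "x * Pb = Pb * x" if "x * swp L3 L4 = swp L3 L4 * x" for x
    unfolding Pd by (rule commute_Pi[OF that h(1)])
  have P: "Pa * Pa = Pa" "Pb * Pb = Pb" "Pb * Pa = Pa * Pb"
  proof -
    show "Pa * Pa = Pa" "Pb * Pb = Pb"
      unfolding Pd by (rule projector_idem[OF swp_sq h])+
    have "swp L1 L2 * Pb = Pb * (swp L1 L2 :: ('g free_alg fls fls, leg \<Rightarrow> ix2) sqm)"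
      by (rule comP') (rule disjoint_swp, simp)
    from comP[OF this[symmetric]] show "Pb * Pa = Pa * Pb" .
  qed
  have sw: "x * y * swp i j = swp i j * (x * y)" if "x * swp i j = swp i j * x" "y * swp i j = swp i j * y" for x y i j
    by (metis mult.assoc that)
  have Rsw: "?R i j c * swp l m = swp l m * ?R i j c" if "{i, j} \<inter> {l, m} = {}" for i j c l m
    by (rule sym, rule commute_Rl, rule disjoint_swp) (use that in auto)
  have com': "C * Pa = Pa * C" "A * Pb = Pb * A"
    unfolding A C b_defs
    by (rule comP comP', intro sw swp_commute_lift1 Rsw; simp)+
  \<comment> \<open>Two R-matrices that join legs 1, 2 to a common leg, with arguments differing by
    one, respect the symmetrizer by \<open>swp_Rl_exchange\<close>.\<close>
  have abs12: "Pa * (?R L1 j \<beta> * ?R L2 j \<gamma>) = Pa * (?R L1 j \<beta> * ?R L2 j \<gamma>) * Pa"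
    if "j \<in> {L3, L4}" "\<beta> \<noteq> 0" "\<gamma> \<noteq> 0" "\<gamma> = \<beta> + 1" for j \<beta> \<gamma>
    unfolding Pd that(4) by (rule projector_absorb[OF swp_Rl_exchange swp_sq h]) (use that in auto)
  have abs34: "Pb * (?R j L3 \<beta> * ?R j L4 \<gamma>) = Pb * (?R j L3 \<beta> * ?R j L4 \<gamma>) * Pb"
    if "j \<in> {L1, L2}" "\<beta> \<noteq> 0" "\<gamma> \<noteq> 0" "\<gamma> = \<beta> + 1" for j \<beta> \<gamma>
    unfolding Pd that(4) Rl_sym[of j]
    by (rule projector_absorb[OF swp_Rl_exchange swp_sq h]) (use that in auto)
  have abs43: "Pb * (?R j L4 \<beta> * ?R j L3 \<gamma>) = Pb * (?R j L4 \<beta> * ?R j L3 \<gamma>) * Pb"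
    if "j \<in> {L1, L2}" "\<beta> \<noteq> 0" "\<gamma> \<noteq> 0" "\<gamma> = \<beta> + 1" for j \<beta> \<gamma>
    unfolding Pd that(4) Rl_sym[of j] swp_sym[of L3 L4]
    by (rule projector_absorb[OF swp_Rl_exchange swp_sq h]) (use that in auto)
  \<comment> \<open>The middle factors act on disjoint legs, so each product can be grouped by legs
    3, 4 or by legs 1, 2; the former grouping suits \<open>Pa\<close>, the latter
    \<open>Pb\<close>.\<close>
  have Rm1: "Rm = (?r14 * ?r24) * (?r13 * ?r23)" and Rp1: "Rp = (?p13 * ?p23) * (?p14 * ?p24)"
    by (simp_all add: Rm_def Rp_def mult.assoc)
  have mid: "v * w * x * y = (v * x) * (w * y)" if "w * x = x * w"
    for v w x y :: "('g free_alg fls fls, leg \<Rightarrow> ix2) sqm"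
    using arg_cong[OF that, of "\<lambda>z. v * z * y"] by (simp only: mult.assoc)
  have Rm2: "Rm = (?r14 * ?r13) * (?r24 * ?r23)"
    unfolding Rm_def by (rule mid, rule Rl_commute) simp
  have Rp2: "Rp = (?p13 * ?p14) * (?p23 * ?p24)"
    unfolding Rp_def by (rule mid, rule Rl_commute) simp
  have Pa_abs: "Pa * Rm = Pa * Rm * Pa" "Pa * Rp = Pa * Rp * Pa"
    unfolding Rm1 Rp1 by (rule absorb_mult; rule abs12; use par(11-16) in simp)+
  have Pb_abs: "Pb * Rm = Pb * Rm * Pb" "Pb * Rp = Pb * Rp * Pb"
    unfolding Rm2 Rp2 by (rule absorb_mult; rule abs43 abs34; use par(11-16) in simp)+
  have ab: "Pa * Pb * Rm = Pa * Pb * Rm * (Pa * Pb)" "Pa * Pb * Rp = Pa * Pb * Rp * (Pa * Pb)"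
    by (rule absorb_both[OF Pa_abs(1) Pb_abs(1) P(3)], rule absorb_both[OF Pa_abs(2) Pb_abs(2) P(3)])
  note main = projected_exchange[OF ex P com' ab]
  have inv4: "1 / pu (aff 4 0) \<in> lev (lev FC) (-1)" "1 / pv (aff 4 0) \<in> lev (lev FC) (-1)"
  proof -
    have "pu (1 / aff 4 0) * pu (aff 4 0) = 1" "pv (1 / aff 4 0) * pv (aff 4 0) = 1"
      by (simp_all add: pu_def pv_def aff_nonzero flip: iu.hom_mult iv.hom_mult)
    then have "1 / pu (aff 4 0) = pu (1 / aff 4 0)" "1 / pv (aff 4 0) = pv (1 / aff 4 0)"
      using par(17,18) by (simp_all add: divide_eq_eq)
    then show "1 / pu (aff 4 0) \<in> lev (lev FC) (-1)" "1 / pv (aff 4 0) \<in> lev (lev FC) (-1)"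
      using pu_lev pv_lev inverse_aff_lev[of 4 0] by simp_all
  qed
  have invs: "1 / t \<in> lev (lev FC) (-1)" "1 / (t - 1) \<in> lev (lev FC) (-1)" "1 / (t + 1) \<in> lev (lev FC) (-1)"
    "1 / s \<in> lev (lev FC) (-1)" "1 / (s - 1) \<in> lev (lev FC) (-1)" "1 / (s + 1) \<in> lev (lev FC) (-1)"
  proof -
    have "1 / (pu x2 - pv x2) \<in> lev (lev FC) (-1)" "1 / (pu x1 - pv x2) \<in> lev (lev FC) (-1)"
      "1 / (pu x2 - pv x1) \<in> lev (lev FC) (-1)" "1 / (pu x1 + pv x2) \<in> lev (lev FC) (-1)"
      "1 / (pu x1 + pv x1) \<in> lev (lev FC) (-1)" "1 / (pu x2 + pv x2) \<in> lev (lev FC) (-1)"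
      by (rule aff_combination, simp)+
    then show "1 / t \<in> lev (lev FC) (-1)" "1 / (t - 1) \<in> lev (lev FC) (-1)" "1 / (t + 1) \<in> lev (lev FC) (-1)"
      "1 / s \<in> lev (lev FC) (-1)" "1 / (s - 1) \<in> lev (lev FC) (-1)" "1 / (s + 1) \<in> lev (lev FC) (-1)"
      unfolding par(1-8) by simp_all
  qed
  have swpF: "swp i j \<in> ents (lev (lev F)) 0" for i j
    using f2.F_one f2.F_0 by (simp add: ents_def permop_def)
  have apxR: "M.apx (?R i j c) 1" if "1 / c \<in> lev (lev FC) (-1)" for i j c
  proof -
    have "?R i j c - 1 = - (cst (e2 (1 / c)) * swp i j)" by (simp add: Rl_def)
    also have "\<dots> \<in> ents (lev (lev F)) (-1)"
      by (intro M.F_uminus M.FF'[OF cst_lev2[OF e2_lev[OF that]] swpF]) simp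
    finally show ?thesis by (simp add: M.apx_def M.F_one)
  qed
  note apR = apxR[OF invs(1)] apxR[OF invs(2)] apxR[OF invs(3)] apxR[OF invs(4)] apxR[OF invs(5)] apxR[OF invs(6)]
    apxR[OF inv4(1)] apxR[OF inv4(2)]
  have GF: "diagc2 g \<in> ents (lev (lev F)) 0"
    using kc2_lev f2.F_0 by (simp add: ents_def diagc2_def)
  have apl: "M.apx (lift1 i N) (G i)" if "N - diagc2 g \<in> ents (lev (lev F)) (-1)" for i N
  proof -
    have "lift1 i N - G i = lift1 i (N - diagc2 g)"
      unfolding G_def by (rule sqm_eqI) (auto simp: lift1_def)
    then show ?thesis
      using ents_lift1[OF f2.F_0 that, of i] ents_lift1[OF f2.F_0 GF, of i] by (simp add: M.apx_def G_def)
  qed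
  have apb: "M.apx b1 (G L1)" "M.apx b2 (G L2)" "M.apx b3 (G L3)" "M.apx b4 (G L4)"
    unfolding b_defs by (intro apl iu_lead iv_lead; simp)+
  have apm: "M.apx (x * y) (x' * y')" if "M.apx x x'" "M.apx y y'" for x y x' y'
    by (rule M.apx_mult[OF that])
  note ap = apR apb
  have D0: "lift2 i j (dB (aff 2 c) (aff 2 d) B) \<in> ents (lev (lev W)) k" for i j c d
    by (rule ents_lift2[OF f2.W_0 dB_lev[OF D]]) simp_all
  have D1: "lift2 i j (dB (aff 2 c) (aff 2 d) B) - lift2 i j (dB w0 w0 B) \<in> ents (lev (lev W)) (k - 1)" if "i \<noteq> j" for i j c d
  proof -
    interpret L: unital_hom "lift2 i j :: ('g free_alg fls fls, ix2 \<times> ix2) sqm \<Rightarrow> _" by (rule unital_hom_lift2[OF that])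
    show ?thesis
      unfolding L.hom_diff[symmetric] by (rule ents_lift2[OF f2.W_0 dB_lev_diff[OF D]]) simp
  qed
  \<comment> \<open>In each of the four error words the defect stands in the middle. The R-matrices
    around it have leading part 1 and the matrices have leading part \<open>G\<close>, so
    \<open>apx_lead\<close> applies to each word.\<close>
  have Z_lead: "Z - leadterm B g \<in> ents (lev (lev W)) (k - 1)"
  proof -
    let ?D = "\<lambda>i j. lift2 i j (dB w0 w0 B)"
    have 1: "?r14 * ?r24 * ?r13 * (b1 * ?p13 * ?p12 * ?p14) * D23 * (?p24 * ?p34 * b4) -
        1 * 1 * 1 * (G L1 * 1 * 1 * 1) * ?D L2 L3 * (1 * 1 * G L4) \<in> ents (lev (lev W)) (k - 1)"
      unfolding D_defs by (rule M.apx_lead[OF D0 D1]) (simp, (intro apm ap)+)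
    have 2: "?r14 * ?r24 * D13 * (?p12 * ?p14 * ?p23 * ?p34 * b2 * ?p24 * b4 * ?r23) -
        1 * 1 * ?D L1 L3 * (1 * 1 * 1 * 1 * G L2 * 1 * G L4 * 1) \<in> ents (lev (lev W)) (k - 1)"
      unfolding D_defs by (rule M.apx_lead[OF D0 D1]) (simp, (intro apm ap)+)
    have 3: "?r14 * (b3 * ?p13 * b1 * ?p34 * ?p23 * ?p14 * ?p12) * D24 * (?r13 * ?r23) -
        1 * (G L3 * 1 * G L1 * 1 * 1 * 1 * 1) * ?D L2 L4 * (1 * 1) \<in> ents (lev (lev W)) (k - 1)"
      unfolding D_defs by (rule M.apx_lead[OF D0 D1]) (simp, (intro apm ap)+)
    have 4: "b3 * ?p34 * ?p13 * ?p23 * D14 * (?p12 * ?p24 * b2 * ?r24 * ?r13 * ?r23) -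
        G L3 * 1 * 1 * 1 * ?D L1 L4 * (1 * 1 * G L2 * 1 * 1 * 1) \<in> ents (lev (lev W)) (k - 1)"
      unfolding D_defs by (rule M.apx_lead[OF D0 D1]) (simp, (intro apm ap)+)
    have eq: "x1' - y1' + (x2' - y2') + (x3' - y3') + (x4' - y4') = x1' + x2' + x3' + x4' - (y1' + y2' + y3' + y4')"
      for x1' x2' x3' x4' y1' y2' y3' y4' :: "('g free_alg fls fls, leg \<Rightarrow> ix2) sqm"
      by (simp add: algebra_simps)
    show ?thesis
      using M.W_add[OF M.W_add[OF M.W_add[OF 1 2] 3] 4]
      unfolding eq Z_def leadterm_def Let_def G_def[symmetric] mult_1_left mult_1_right by (simp only: mult.assoc)
  qed
  have F0: "M.apx x y \<Longrightarrow> x \<in> ents (lev (lev F)) 0" for x y by (rule M.apx_F0)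
  have AC: "A \<in> ents (lev (lev F)) 0" "C \<in> ents (lev (lev F)) 0"
    unfolding A C using F0[OF apm[OF apm[OF apb(1) apR(7)] apb(2)]] F0[OF apm[OF apm[OF apb(3) apR(8)] apb(4)]] by simp_all
  have RF: "Rm - 1 \<in> ents (lev (lev F)) (-1)" "Rp - 1 \<in> ents (lev (lev F)) (-1)"
  proof -
    have "M.apx Rm (1 * 1 * 1 * 1)" "M.apx Rp (1 * 1 * 1 * 1)"
      unfolding Rm_def Rp_def by (intro apm ap)+
    then show "Rm - 1 \<in> ents (lev (lev F)) (-1)" "Rp - 1 \<in> ents (lev (lev F)) (-1)"
      by (simp_all add: M.apx_def)
  qed
  have PF: "Pa \<in> ents (lev (lev F)) 0" "Pb \<in> ents (lev (lev F)) 0"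
    unfolding Pd by (rule M.FF'[OF cst_lev2[OF kc2_lev] M.F_add[OF M.F_one swpF]], simp)+
  \<comment> \<open>Both corners come from the same fused matrix, placed at u on legs 1, 2 and at v
    on legs 3, 4; so \<open>fuse_defect_lev\<close> bounds them both.\<close>
  have dA: "Pa * A * (1 - Pa) = lift2 L1 L2 (map_sq iu (hsym * fuse B * (1 - hsym)))"
    and dC: "Pb * C * (1 - Pb) = lift2 L3 L4 (map_sq iv (hsym * fuse B * (1 - hsym)))"
  proof -
    interpret U: unital_hom "map_sq iu :: ('g free_alg fls, ix2 \<times> ix2) sqm \<Rightarrow> _" by (rule unital_hom_map_sq[OF unital_hom_iu])
    interpret V: unital_hom "map_sq iv :: ('g free_alg fls, ix2 \<times> ix2) sqm \<Rightarrow> _" by (rule unital_hom_map_sq[OF unital_hom_iv])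
    interpret L12: unital_hom "lift2 L1 L2 :: ('g free_alg fls fls, ix2 \<times> ix2) sqm \<Rightarrow> _" by (rule unital_hom_lift2) simp
    interpret L34: unital_hom "lift2 L3 L4 :: ('g free_alg fls fls, ix2 \<times> ix2) sqm \<Rightarrow> _" by (rule unital_hom_lift2) simp
    show "Pa * A * (1 - Pa) = lift2 L1 L2 (map_sq iu (hsym * fuse B * (1 - hsym)))"
      unfolding U.hom_mult U.hom_diff U.hom_1 L12.hom_mult L12.hom_diff L12.hom_1 lift2_hsym A_def Pa_def ..
    show "Pb * C * (1 - Pb) = lift2 L3 L4 (map_sq iv (hsym * fuse B * (1 - hsym)))"
      unfolding V.hom_mult V.hom_diff V.hom_1 L34.hom_mult L34.hom_diff L34.hom_1 lift2_hsym C_def Pb_def ..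
  qed
  have dW: "Pa * A * (1 - Pa) \<in> ents (lev (lev W)) k" "Pb * C * (1 - Pb) \<in> ents (lev (lev W)) k"
    unfolding dA dC
    by (intro ents_lift2[OF f2.W_0] ents_map_sq[OF fuse_defect_lev[OF D B_dgs]] iu_lev iv_lev W_0; assumption)+
  note err = M.projected_exchange_error[OF RF AC PF dW P com']
  let ?Q = "Pa * Pb"
  have psiW: "kc2.psi x \<in> ents (lev (lev W)) j" if "x \<in> ents (lev (lev W)) j" for x j
    using that unfolding kc2.psi_def ents_def mem_Collect_eq ent_Mk
    by (intro allI f2.W_sum f2.FW'[OF kc2_lev]) auto
  have psiQ: "kc2.psi (?Q * x) = kc2.psi x" "kc2.psi (x * ?Q) = kc2.psi x" for x
  proof -
    show "kc2.psi (?Q * x) = kc2.psi x"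
      by (simp only: Pa_def Pb_def mult.assoc kc2.psi_Pi)
    show "kc2.psi (x * ?Q) = kc2.psi x"
      by (simp only: Pa_def Pb_def mult.assoc[symmetric] kc2.psi_Pi)
  qed
  have m: "kc2.psi x * kc2.psi y = kc2.psi (x * ?Q * y)" for x y
    unfolding Pa_def Pb_def by (rule kc2.psi_mult)
  have "kc2.psi Rm * kc2.psi A * kc2.psi Rp * kc2.psi C - kc2.psi C * kc2.psi Rp * kc2.psi A * kc2.psi Rm =
     kc2.psi (?Q * (Rm * ?Q * A * ?Q * Rp * ?Q * C) * ?Q) - kc2.psi (?Q * (C * ?Q * Rp * ?Q * A * ?Q * Rm) * ?Q)"
    unfolding m psiQ ..
  also have "\<dots> = kc2.psi (?Q * Rm * ?Q * A * ?Q * Rp * ?Q * C * ?Q - ?Q * C * ?Q * Rp * ?Q * A * ?Q * Rm * ?Q)"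
    unfolding kc2.psi_diff by (simp only: mult.assoc)
  finally have fin: "kc2.psi Rm * kc2.psi A * kc2.psi Rp * kc2.psi C - kc2.psi C * kc2.psi Rp * kc2.psi A * kc2.psi Rm
      - kc2.psi (leadterm B g) =
    kc2.psi (Z - leadterm B g) - kc2.psi (?Q * Rm * (Pa * A * (1 - Pa)) * Pb * Rp * C * ?Q)
    + kc2.psi (?Q * C * ?Q * Rp * (Pa * A * (1 - Pa)) * Pb * Rm * ?Q)
    + kc2.psi ((Pb * C * (1 - Pb)) * Pa * Rp * A * Rm * ?Q)"
    unfolding main kc2.psi_add kc2.psi_diff psiQ by simp
  show ?thesis
    unfolding fin by (intro f2M3.W_add f2M3.W_diff psiW Z_lead err)
qed

end

section \<open>The leading term and its matrix entries\<close>

lemma permop_conj_lift2: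
  assumes "\<sigma> \<circ> \<sigma> = id" "i \<noteq> j"
  shows "permop \<sigma> * lift2 i j A * permop \<sigma> = lift2 (\<sigma> i) (\<sigma> j) A"
proof (rule sqm_eqI)
  fix f h :: "leg \<Rightarrow> ix2"
  have s: "\<sigma> (\<sigma> k) = k" for k using assms(1) by (metis comp_apply id_apply)
  have "(\<forall>k. k \<noteq> i \<longrightarrow> k \<noteq> j \<longrightarrow> (f \<circ> \<sigma>) k = (h \<circ> \<sigma>) k) \<longleftrightarrow> (\<forall>k. k \<noteq> \<sigma> i \<longrightarrow> k \<noteq> \<sigma> j \<longrightarrow> f k = h k)"
    by (metis comp_apply s)
  then show "ent (permop \<sigma> * lift2 i j A * permop \<sigma>) f h = ent (lift2 (\<sigma> i) (\<sigma> j) A) f h"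
    by (simp only: ent_mult_permop[OF assms(1)] ent_permop_mult lift2_def ent_Mk comp_apply)
qed

lemma permop_conj_lift1:
  assumes "\<sigma> \<circ> \<sigma> = id"
  shows "permop \<sigma> * lift1 i A * permop \<sigma> = lift1 (\<sigma> i) A"
proof (rule sqm_eqI)
  fix f h :: "leg \<Rightarrow> ix2"
  have s: "\<sigma> (\<sigma> k) = k" for k using assms(1) by (metis comp_apply id_apply)
  have "(\<forall>k. k \<noteq> i \<longrightarrow> (f \<circ> \<sigma>) k = (h \<circ> \<sigma>) k) \<longleftrightarrow> (\<forall>k. k \<noteq> \<sigma> i \<longrightarrow> f k = h k)"
    by (metis comp_apply s)
  then show "ent (permop \<sigma> * lift1 i A * permop \<sigma>) f h = ent (lift1 (\<sigma> i) A) f h"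
    by (simp only: ent_mult_permop[OF assms] ent_permop_mult lift1_def ent_Mk comp_apply)
qed

lemma ent_lift1_diag: "ent (lift1 i (diagc2 g)) f h = (if h = f then kc2 (g (f i)) else 0)"
proof -
  have "(\<forall>k. k \<noteq> i \<longrightarrow> f k = h k) \<and> f i = h i \<longleftrightarrow> h = f" by (auto simp: fun_eq_iff) metis
  then show ?thesis by (simp only: lift1_def diagc2_def ent_Mk if_if_conj)
qed

lemma ent_diag_mult:
  "ent (lift1 i (diagc2 g) * A) f h = kc2 (g (f i)) * ent A f h"
  "ent (A * lift1 i (diagc2 g)) f h = ent A f h * kc2 (g (h i))"
proof -
  show "ent (lift1 i (diagc2 g) * A) f h = kc2 (g (f i)) * ent A f h"
    by (simp add: ent_mult ent_lift1_diag if_distrib[of "\<lambda>x. x * _"] cong: if_cong)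
  have d: "x * (if h = k then kc2 (g (k i)) else 0) = (if h = k then x * kc2 (g (h i)) else 0)" for x k
    by simp
  show "ent (A * lift1 i (diagc2 g)) f h = ent A f h * kc2 (g (h i))"
    unfolding ent_mult ent_lift1_diag d by simp
qed

lemma diag_lift2_commute:
  assumes "l \<noteq> i" "l \<noteq> j"
  shows "lift1 l (diagc2 g) * lift2 i j A = lift2 i j A * lift1 l (diagc2 g)"
proof (rule sqm_eqI)
  fix f h :: "leg \<Rightarrow> ix2"
  show "ent (lift1 l (diagc2 g) * lift2 i j A) f h = ent (lift2 i j A * lift1 l (diagc2 g)) f h"
    unfolding ent_diag_mult using assms by (auto simp: lift2_def centralD[OF kc2.central_e])
qed

lemma diag_diag_commute: "lift1 i (diagc2 g) * lift1 j (diagc2 g) = lift1 j (diagc2 g) * lift1 i (diagc2 g)"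
proof (rule sqm_eqI)
  fix f h :: "leg \<Rightarrow> ix2"
  show "ent (lift1 i (diagc2 g) * lift1 j (diagc2 g)) f h = ent (lift1 j (diagc2 g) * lift1 i (diagc2 g)) f h"
    by (simp add: ent_diag_mult(1) ent_lift1_diag mult.commute flip: kc2.hom_mult)
qed

definition lead1 :: "('g free_alg fls fls, ix2 \<times> ix2) sqm \<Rightarrow> (ix2 \<Rightarrow> complex) \<Rightarrow> ('g free_alg fls fls, ix3 \<times> ix3) sqm"
  where "lead1 A g = kc2.psi (lift2 L1 L3 A * (lift1 L2 (diagc2 g) * lift1 L4 (diagc2 g)))"

text \<open>Conjugation with (12) and (34) is invisible to \<open>psi\<close> and carries each pair
  of legs to the pair 1, 3. Constant diagonal matrices commute with each other and with operators on
  other legs, so the four summands become equal.\<close>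

lemma psi_leadterm:
  fixes B :: "('g free_alg fls, ix2) sqm" and g :: "ix2 \<Rightarrow> complex"
  defines "N \<equiv> lead1 (dB w0 w0 B) g"
  shows "kc2.psi (leadterm B g) = N + N + N + N"
proof -
  let ?G = "\<lambda>i. lift1 i (diagc2 g) :: ('g free_alg fls fls, leg \<Rightarrow> ix2) sqm" and ?D = "\<lambda>i j. lift2 i j (dB w0 w0 B)"
  let ?s = "swp L1 L2 :: ('g free_alg fls fls, leg \<Rightarrow> ix2) sqm" and ?t = "swp L3 L4 :: ('g free_alg fls fls, leg \<Rightarrow> ix2) sqm"
  have inv: "Transposition.transpose i j \<circ> Transposition.transpose i j = id" for i j :: leg
    by (rule transpose_comp_self)
  have s: "?s * (x * y * z) * ?s = (?s * x * ?s) * (?s * y * ?s) * (?s * z * ?s)" for x y z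
  proof -
    have "?s * (?s * u) = u" for u by (simp add: swp_sq flip: mult.assoc)
    then show ?thesis by (simp add: mult.assoc)
  qed
  have t: "?t * (x * y * z) * ?t = (?t * x * ?t) * (?t * y * ?t) * (?t * z * ?t)" for x y z
  proof -
    have "?t * (?t * u) = u" for u by (simp add: swp_sq flip: mult.assoc)
    then show ?thesis by (simp add: mult.assoc)
  qed
  have conj: "kc2.psi x = kc2.psi (?s * x * ?s)" "kc2.psi x = kc2.psi (?t * x * ?t)" for x
    by simp_all
  have GD: "?G L2 * ?D L1 L3 = ?D L1 L3 * ?G L2" "?G L4 * ?D L1 L3 = ?D L1 L3 * ?G L4"
    by (rule diag_lift2_commute; simp)+
  have GG: "?G L4 * ?G L2 = ?G L2 * ?G L4" by (rule diag_diag_commute)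
  have "kc2.psi (?G L1 * ?D L2 L3 * ?G L4) = kc2.psi (?G L2 * ?D L1 L3 * ?G L4)"
    by (subst conj(1)) (simp add: s permop_conj_lift1[OF inv] permop_conj_lift2[OF inv] Transposition.transpose_def)
  also have "\<dots> = N" unfolding N_def lead1_def GD by (simp only: mult.assoc)
  finally have 1: "kc2.psi (?G L1 * ?D L2 L3 * ?G L4) = N" .
  have a: "kc2.psi (?G L3 * ?D L1 L4 * ?G L2) = N"
  proof -
    have "kc2.psi (?G L3 * ?D L1 L4 * ?G L2) = kc2.psi (?G L4 * ?D L1 L3 * ?G L2)"
      by (subst conj(2)) (simp add: t permop_conj_lift1[OF inv] permop_conj_lift2[OF inv] Transposition.transpose_def)
    also have "\<dots> = N" unfolding N_def lead1_def GD mult.assoc GG ..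
    finally show ?thesis .
  qed
  have "kc2.psi (?G L3 * ?G L1 * ?D L2 L4) = kc2.psi (?G L3 * ?G L2 * ?D L1 L4)"
    by (subst conj(1)) (simp add: s permop_conj_lift1[OF inv] permop_conj_lift2[OF inv] Transposition.transpose_def)
  also have "\<dots> = kc2.psi (?G L4 * ?G L2 * ?D L1 L3)"
    by (subst conj(2)) (simp add: t permop_conj_lift1[OF inv] permop_conj_lift2[OF inv] Transposition.transpose_def)
  also have "\<dots> = N"
  proof -
    have "?G L4 * ?G L2 * ?D L1 L3 = ?G L4 * (?D L1 L3 * ?G L2)"
      by (simp only: mult.assoc GD(1))
    also have "\<dots> = ?D L1 L3 * ?G L4 * ?G L2"
      by (simp only: mult.assoc[symmetric] GD(2))
    also have "\<dots> = ?D L1 L3 * (?G L2 * ?G L4)"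
      by (simp only: mult.assoc GG)
    finally have "?G L4 * ?G L2 * ?D L1 L3 = ?D L1 L3 * (?G L2 * ?G L4)" .
    then show ?thesis by (simp only: N_def lead1_def)
  qed
  finally have b: "kc2.psi (?G L3 * ?G L1 * ?D L2 L4) = N" .
  show ?thesis
    unfolding leadterm_def Let_def kc2.psi_add 1 a b by (simp only: N_def lead1_def)
qed

text \<open>The matrix element of E_pp' (x) diag(g) between v_a and v_b: the coefficients with which
  a 2x2 matrix enters the compression to first order, on one of the two legs.\<close>

definition dl :: "(ix2 \<Rightarrow> complex) \<Rightarrow> ix3 \<Rightarrow> ix3 \<Rightarrow> ix2 \<Rightarrow> ix2 \<Rightarrow> complex"
  where "dl g a b p p' = (\<Sum>r\<in>UNIV. jv a p r * jv b p' r * g r)"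

lemma sum_if_const: "(\<Sum>x\<in>A. if P then f x else 0) = (if P then \<Sum>x\<in>A. f x else 0)"
  by simp

lemma sum_rotate3: "(\<Sum>x\<in>A. \<Sum>y\<in>B. \<Sum>z\<in>C. T x y z) = (\<Sum>y\<in>B. \<Sum>z\<in>C. \<Sum>x\<in>A. T x y z)"
proof -
  have "(\<Sum>x\<in>A. \<Sum>y\<in>B. \<Sum>z\<in>C. T x y z) = (\<Sum>y\<in>B. \<Sum>x\<in>A. \<Sum>z\<in>C. T x y z)"
    by (rule sum.swap)
  also have "\<dots> = (\<Sum>y\<in>B. \<Sum>z\<in>C. \<Sum>x\<in>A. T x y z)"
    by (rule sum.cong[OF refl], rule sum.swap)
  finally show ?thesis .
qed

lemma sum_rotate4:
  "(\<Sum>x\<in>A. \<Sum>y\<in>B. \<Sum>z\<in>C. \<Sum>w\<in>D. T x y z w) = (\<Sum>z\<in>C. \<Sum>w\<in>D. \<Sum>x\<in>A. \<Sum>y\<in>B. T x y z w)"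
proof -
  have "(\<Sum>x\<in>A. \<Sum>y\<in>B. \<Sum>z\<in>C. \<Sum>w\<in>D. T x y z w) = (\<Sum>x\<in>A. \<Sum>z\<in>C. \<Sum>w\<in>D. \<Sum>y\<in>B. T x y z w)"
    by (rule sum.cong[OF refl], rule sum_rotate3)
  also have "\<dots> = (\<Sum>z\<in>C. \<Sum>w\<in>D. \<Sum>x\<in>A. \<Sum>y\<in>B. T x y z w)"
    by (rule sum_rotate3)
  finally show ?thesis .
qed

lemma lead1_entry:
  fixes A :: "('g free_alg fls fls, ix2 \<times> ix2) sqm"
  shows "ent (lead1 A g) (a, c) (b, d) = (\<Sum>p\<in>UNIV. \<Sum>q\<in>UNIV. \<Sum>p'\<in>UNIV. \<Sum>q'\<in>UNIV.
    kc2 (dl g a b p p' * dl g c d q q') * ent A (p, q) (p', q'))"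
proof -
  have all: "(\<forall>k. P k) \<longleftrightarrow> P L1 \<and> P L2 \<and> P L3 \<and> P L4" for P
    by (metis leg.exhaust)
  have l13: "ent (lift2 L1 L3 A) (legs p q) (legs p' q') =
      (if snd p = snd p' then if snd q = snd q' then ent A (fst p, fst q) (fst p', fst q') else 0 else 0)" for p q p' q'
    by (simp add: lift2_def all)
  have m: "kc2 x * (y * (kc2 z * kc2 w)) = kc2 (x * z * w) * y" for x z w and y :: "'g free_alg fls fls"
  proof -
    have "y * (kc2 z * kc2 w) = kc2 (z * w) * y"
      unfolding kc2.hom_mult[symmetric] by (rule centralD[OF kc2.central_e, symmetric])
    then show ?thesis by (simp only: kc2.hom_mult mult.assoc)
  qed
  have d: "x * (if P then y else 0) = (if P then x * y else 0)" for x y :: "'g free_alg fls fls" and P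
    by simp
  have entry: "ent (lift2 L1 L3 A * (lift1 L2 (diagc2 g) * lift1 L4 (diagc2 g))) f h =
      ent (lift2 L1 L3 A) f h * (kc2 (g (h L2)) * kc2 (g (h L4)))" for f h
    by (simp only: mult.assoc[symmetric] ent_diag_mult(2))
  have "ent (lead1 A g) (a, c) (b, d) =
    (\<Sum>p1\<in>UNIV. \<Sum>p2\<in>UNIV. \<Sum>q1\<in>UNIV. \<Sum>q2\<in>UNIV. \<Sum>p1'\<in>UNIV. \<Sum>p2'\<in>UNIV. \<Sum>q1'\<in>UNIV. \<Sum>q2'\<in>UNIV.
      if p2 = p2' then if q2 = q2' then kc2 (jv a p1 p2 * jv c q1 q2 * (jv b p1' p2' * jv d q1' q2') * g p2' * g q2') *
        ent A (p1, q1) (p1', q1') else 0 else 0)"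
    unfolding lead1_def kc2.psi_def ent_Mk entry m Jv_def sum_legs l13 sum_UNIV_prod legs_simps fst_conv snd_conv d ..
  also have "\<dots> = (\<Sum>p1\<in>UNIV. \<Sum>p2\<in>UNIV. \<Sum>q1\<in>UNIV. \<Sum>q2\<in>UNIV. \<Sum>p1'\<in>UNIV. \<Sum>q1'\<in>UNIV.
      kc2 (jv a p1 p2 * jv c q1 q2 * (jv b p1' p2 * jv d q1' q2) * g p2 * g q2) * ent A (p1, q1) (p1', q1'))"
    by (simp add: sum_if_const)
  also have "\<dots> = (\<Sum>p1\<in>UNIV. \<Sum>q1\<in>UNIV. \<Sum>p1'\<in>UNIV. \<Sum>q1'\<in>UNIV. \<Sum>p2\<in>UNIV. \<Sum>q2\<in>UNIV.
      kc2 (jv a p1 p2 * jv c q1 q2 * (jv b p1' p2 * jv d q1' q2) * g p2 * g q2) * ent A (p1, q1) (p1', q1'))"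
  proof (rule sum.cong[OF refl])
    fix p1
    let ?T = "\<lambda>p2 q1 q2 p1' q1'. kc2 (jv a p1 p2 * jv c q1 q2 * (jv b p1' p2 * jv d q1' q2) * g p2 * g q2) * ent A (p1, q1) (p1', q1')"
    have "(\<Sum>p2\<in>UNIV. \<Sum>q1\<in>UNIV. \<Sum>q2\<in>UNIV. \<Sum>p1'\<in>UNIV. \<Sum>q1'\<in>UNIV. ?T p2 q1 q2 p1' q1') =
      (\<Sum>q1\<in>UNIV. \<Sum>p2\<in>UNIV. \<Sum>q2\<in>UNIV. \<Sum>p1'\<in>UNIV. \<Sum>q1'\<in>UNIV. ?T p2 q1 q2 p1' q1')"
      by (rule sum.swap)
    also have "\<dots> = (\<Sum>q1\<in>UNIV. \<Sum>p1'\<in>UNIV. \<Sum>q1'\<in>UNIV. \<Sum>p2\<in>UNIV. \<Sum>q2\<in>UNIV. ?T p2 q1 q2 p1' q1')"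
      by (rule sum.cong[OF refl], rule sum_rotate4)
    finally show "(\<Sum>p2\<in>UNIV. \<Sum>q1\<in>UNIV. \<Sum>q2\<in>UNIV. \<Sum>p1'\<in>UNIV. \<Sum>q1'\<in>UNIV. ?T p2 q1 q2 p1' q1') = \<dots>" .
  qed
  also have "\<dots> = (\<Sum>p\<in>UNIV. \<Sum>q\<in>UNIV. \<Sum>p'\<in>UNIV. \<Sum>q'\<in>UNIV.
    kc2 (dl g a b p p' * dl g c d q q') * ent A (p, q) (p', q'))"
    unfolding dl_def sum_product unfolding kc2.hom_sum sum_distrib_right
    by (intro sum.cong refl) (simp add: mult_ac)
  finally show ?thesis .
qed

lemma dl_simps:
  "dl g Neg3 Neg3 p p' = (if p = Neg2 \<and> p' = Neg2 then g Neg2 else 0)"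
  "dl g Neg3 Zero3 p p' = (if p = Neg2 \<and> p' = Pos2 then g Neg2 / of_real (sqrt 2) else 0)"
  "dl g Zero3 Neg3 p p' = (if p = Pos2 \<and> p' = Neg2 then g Neg2 / of_real (sqrt 2) else 0)"
  "dl g Pos3 Pos3 p p' = (if p = Pos2 \<and> p' = Pos2 then g Pos2 else 0)"
  by (cases p; cases p'; simp add: dl_def UNIV_ix2 jv_simps)+

text \<open>For each p, q an entry of the 3x3 matrix to which E_pq alone contributes to first order,
  by \<open>dl_pos3\<close>. These are the four entries that determine \<beta>.\<close>

fun pos3 :: "ix2 \<Rightarrow> ix2 \<Rightarrow> ix3 \<times> ix3" where
  "pos3 Neg2 Neg2 = (Neg3, Neg3)" | "pos3 Neg2 Pos2 = (Neg3, Zero3)"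
| "pos3 Pos2 Neg2 = (Zero3, Neg3)" | "pos3 Pos2 Pos2 = (Pos3, Pos3)"

lemma dl_pos3:
  assumes "g Neg2 \<noteq> 0" "g Pos2 \<noteq> 0"
  obtains c where "c \<noteq> 0" "\<And>p p'. dl g (fst (pos3 r s)) (snd (pos3 r s)) p p' = (if p = r \<and> p' = s then c else 0)"
  by (rule that[of "dl g (fst (pos3 r s)) (snd (pos3 r s)) r s"]; cases r; cases s) (use assms in \<open>simp_all add: dl_simps\<close>)

text \<open>At these positions the fourfold sum of \<open>lead1_entry\<close> has a single summand,
  so every entry of \<open>A\<close> can be recovered from \<open>lead1 A g\<close>.\<close>

lemma ent_lead1_extract:
  fixes A :: "('g free_alg fls fls, ix2 \<times> ix2) sqm"
  assumes "g Neg2 \<noteq> 0" "g Pos2 \<noteq> 0"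
  obtains c where "c \<noteq> 0"
    "ent (lead1 A g) (fst (pos3 p p'), fst (pos3 q q')) (snd (pos3 p p'), snd (pos3 q q')) = kc2 c * ent A (p, q) (p', q')"
proof -
  obtain c where c: "c \<noteq> 0" "\<And>r s. dl g (fst (pos3 p p')) (snd (pos3 p p')) r s = (if r = p \<and> s = p' then c else 0)"
    using dl_pos3[OF assms] by metis
  obtain d where d: "d \<noteq> 0" "\<And>r s. dl g (fst (pos3 q q')) (snd (pos3 q q')) r s = (if r = q \<and> s = q' then d else 0)"
    using dl_pos3[OF assms] by metis
  have "ent (lead1 A g) (fst (pos3 p p'), fst (pos3 q q')) (snd (pos3 p p'), snd (pos3 q q')) =
    (\<Sum>r\<in>UNIV. \<Sum>s\<in>UNIV. \<Sum>r'\<in>UNIV. \<Sum>s'\<in>UNIV.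
      if r = p then if r' = p' then if s = q then if s' = q' then kc2 (c * d) * ent A (r, s) (r', s') else 0 else 0 else 0 else 0)"
    unfolding lead1_entry c d by (intro sum.cong refl) simp
  also have "\<dots> = kc2 (c * d) * ent A (p, q) (p', q')"
    by (cases p; cases p'; cases q; cases q') (simp_all add: UNIV_ix2)
  finally show ?thesis
    by (rule that[of "c * d", rotated]) (use c(1) d(1) in simp)
qed

section \<open>The orthogonal relation for a fused matrix\<close>

definition fusedS :: "('g free_alg fls, ix2) sqm \<Rightarrow> ('g free_alg fls, ix3) sqm"
  where "fusedS B = cst (e1 (aff 4 0 / aff 4 (-1))) * kc.cmp (fuse B)"

definition RE3 :: "('g free_alg fls, ix3) sqm \<Rightarrow> ('g free_alg fls fls, ix3 \<times> ix3) sqm"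
  where "RE3 S = rdef (R3s (par_u - par_v)) (R3s (par_u + par_v)) (map_sq iu S) (map_sq iv S)"

lemma map_sq_cmp: "map_sq iu (kc.cmp A) = kc2.cmp (map_sq iu A)" "map_sq iv (kc.cmp A) = kc2.cmp (map_sq iv A)"
  by (rule sqm_eqI, simp add: kc.cmp_def kc2.cmp_def iu.hom_sum iu.hom_mult iv.hom_sum iv.hom_mult iu_kc iv_kc)+

lemma tn_cst_mult: "tn1 (cst c * A) = cst c * tn1 A" "tn2 (cst c * A) = cst c * tn2 A"
  by (rule sqm_eqI, simp add: tn1_def tn2_def)+

context refl_data
begin

lemma leadterm_lev:
  assumes D: "dB fls_X_inv fls_X_inv B \<in> ents (lev (lev W)) k"
  shows "kc2.psi (leadterm B g) \<in> ents (lev (lev W)) k"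
proof -
  have 1: "lead1 (dB w0 w0 B) g \<in> ents (lev (lev W)) k"
    using dB_lev[OF D, of 2 2 0 0] unfolding ents_def mem_Collect_eq
    by (auto simp: lead1_entry intro!: f2.W_sum f2.FW'[OF kc2_lev])
  interpret M: filtered_pair "ents (lev (lev F))" "ents (lev (lev W)) :: int \<Rightarrow> ('g free_alg fls fls, ix3 \<times> ix3) sqm set"
    by (rule f2.filtered_pair_ents)
  show ?thesis unfolding psi_leadterm by (intro M.W_add 1)
qed

text \<open>\<open>exchange\<close> with the fused R-matrices recognised as multiples of the
  orthogonal ones. With an exact reflection equation it yields the relations of the fused matrix; in
  the descent it isolates the leading part of the defect of \<open>B\<close>.\<close>

theorem RE3_fusedS:
  assumes D: "dB fls_X_inv fls_X_inv B \<in> ents (lev (lev W)) k"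
  shows "RE3 (fusedS B) - kc2.psi (leadterm B g) \<in> ents (lev (lev W)) (k - 1)"
proof -
  interpret M: filtered_pair "ents (lev (lev F))" "ents (lev (lev W)) :: int \<Rightarrow> ('g free_alg fls fls, ix3 \<times> ix3) sqm set"
    by (rule f2.filtered_pair_ents)
  define t s where "t = pu w0 - pv w0" and "s = pu w0 + pv w0"
  note par = param_sums[folded t_def s_def]
  have w0: "pu w0 = pu fls_X_inv + pu fls_X_inv" "pv w0 = pv fls_X_inv + pv fls_X_inv"
    by (simp_all add: X_inv_aff aff_add flip: pu_add pv_add)
  have half: "t / 2 = par_u - par_v" "s / 2 = par_u + par_v"
    by (simp_all add: t_def s_def w0 par_u_eq par_v_eq)
  have tn: "t \<noteq> 0" "t \<noteq> 1" "t \<noteq> - 1" and sn: "s \<noteq> 0" "s \<noteq> 1" "s \<noteq> - 1"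
    using par(11-16) by (auto simp: eq_neg_iff_add_eq_0)
  define gt gs where "gt = (t - 1) / (t + 1)" and "gs = (s - 1) / (s + 1)"
  define cu where "cu = aff 4 0 / aff 4 (-1)"
  \<comment> \<open>The normalising factors of both copies of \<open>fusedS\<close>, divided by the
    scalars of the two fused R-matrices. It is 1 modulo level -1 and hence does not touch the
    leading term.\<close>
  define \<kappa> where "\<kappa> = pu cu * pv cu * (1 / gt) * (1 / gs)"
  let ?M = "tn1 (map_sq iu (kc.cmp (fuse B)))" and ?N = "tn2 (map_sq iv (kc.cmp (fuse B)))"
  let ?A = "lift2 L1 L2 (map_sq iu (fuse B))" and ?C = "lift2 L3 L4 (map_sq iv (fuse B))"
  let ?Rm = "Rl L1 L4 (t - 1) * Rl L2 L4 t * Rl L1 L3 t * Rl L2 L3 (t + 1) :: ('g free_alg fls fls, leg \<Rightarrow> ix2) sqm"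
  let ?Rp = "Rl L1 L3 (s - 1) * Rl L2 L3 s * Rl L1 L4 s * Rl L2 L4 (s + 1) :: ('g free_alg fls fls, leg \<Rightarrow> ix2) sqm"
  let ?c = "\<lambda>x. cst (e2 x) :: ('g free_alg fls fls, ix3 \<times> ix3) sqm"
  let ?rm = "R3s (par_u - par_v) :: ('g free_alg fls fls, ix3 \<times> ix3) sqm" and ?rp = "R3s (par_u + par_v) :: ('g free_alg fls fls, ix3 \<times> ix3) sqm"
  define XX where "XX = kc2.psi ?Rm * kc2.psi ?A * kc2.psi ?Rp * kc2.psi ?C - kc2.psi ?C * kc2.psi ?Rp * kc2.psi ?A * kc2.psi ?Rm"
  have psi: "kc2.psi ?Rm = ?c gt * ?rm" "kc2.psi ?Rp = ?c gs * ?rp" "kc2.psi ?A = ?M" "kc2.psi ?C = ?N"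
    unfolding psi_Rm[OF tn] psi_Rp[OF sn] half gt_def gs_def kc2.psi_lift2 map_sq_cmp by simp_all
  have lc: "x * (?c y * z) = ?c y * (x * z)" for x y z
    by (rule central_left_commute[OF central_cst_e2])
  have cc: "?c x * (?c y * z) = ?c (x * y) * z" for x y z
    by (simp only: mult.assoc cst.hom_mult e2.hom_mult)
  have XX: "XX = ?c (gt * gs) * rdef ?rm ?rp (map_sq iu (kc.cmp (fuse B))) (map_sq iv (kc.cmp (fuse B)))"
    unfolding XX_def psi rdef_def right_diff_distrib
    by (simp only: mult.assoc lc[of ?rm] lc[of ?M] lc[of ?rp] lc[of ?N] cc mult.commute[of gs gt])
  have S: "map_sq iu (fusedS B) = cst (e2 (pu cu)) * map_sq iu (kc.cmp (fuse B))"
    "map_sq iv (fusedS B) = cst (e2 (pv cu)) * map_sq iv (kc.cmp (fuse B))"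
    by (rule sqm_eqI, simp add: fusedS_def cu_def iu.hom_mult iv.hom_mult e2_pu e2_pv)+
  have "RE3 (fusedS B) = ?c (pu cu * pv cu) * rdef ?rm ?rp (map_sq iu (kc.cmp (fuse B))) (map_sq iv (kc.cmp (fuse B)))"
    unfolding RE3_def S rdef_def tn_cst_mult right_diff_distrib
    by (simp only: mult.assoc lc[of ?rm] lc[of ?M] lc[of ?rp] lc[of ?N] cc mult.commute[of "pv cu" "pu cu"])
  also have "\<dots> = ?c \<kappa> * XX"
  proof -
    have "gt \<noteq> 0" "gs \<noteq> 0" using tn sn par(11-16) by (auto simp: gt_def gs_def)
    then have "\<kappa> * (gt * gs) = pu cu * pv cu" by (simp add: \<kappa>_def)
    then show ?thesis unfolding XX cc by simp
  qed
  finally have R: "RE3 (fusedS B) = ?c \<kappa> * XX" .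
  have X1: "XX - kc2.psi (leadterm B g) \<in> ents (lev (lev W)) (k - 1)"
    unfolding XX_def t_def s_def by (rule exchange[OF D])
  have Xk: "XX \<in> ents (lev (lev W)) k"
    using M.W_add[OF M.W_mono[OF _ X1, of k] leadterm_lev[OF D]] by simp
  have \<kappa>: "\<kappa> - 1 \<in> lev (lev FC) (-1)"
  proof -
    have one: "(1 :: complex fls fls) \<in> lev (lev FC) 0" by (rule FC2.F_one)
    have i4: "1 / aff 4 (-1) \<in> lev FC (-1)" by (rule inverse_aff_lev) simp
    have "aff 4 0 = aff 4 (-1) + 1" by (rule fls_eqI) (simp add: aff_nth)
    then have "cu - 1 = 1 / aff 4 (-1)"
      using aff_nonzero[of 4 "-1"] by (simp add: cu_def add_divide_distrib)
    then have "pu cu - 1 = pu (1 / aff 4 (-1))" "pv cu - 1 = pv (1 / aff 4 (-1))"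
      by (metis iu.hom_1 iv.hom_1 iu.hom_diff iv.hom_diff pu_def pv_def)+
    then have c: "FC2.apx (pu cu) 1" "FC2.apx (pv cu) 1"
      using pu_lev[OF i4] pv_lev[OF i4] one by (simp_all add: FC2.apx_def)
    have inv: "1 / (t - 1) \<in> lev (lev FC) (-1)" "1 / (s - 1) \<in> lev (lev FC) (-1)"
      unfolding par(2,5)[symmetric] by (rule aff_combination, simp)+
    have "1 / gt - 1 = 1 / (t - 1) + 1 / (t - 1)" "1 / gs - 1 = 1 / (s - 1) + 1 / (s - 1)"
      using tn sn by (simp_all add: gt_def gs_def field_simps)
    then have "FC2.apx (1 / gt) 1" "FC2.apx (1 / gs) 1"
      using FC2.F_add[OF inv(1) inv(1)] FC2.F_add[OF inv(2) inv(2)] one by (simp_all add: FC2.apx_def)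
    then have "FC2.apx \<kappa> (1 * 1 * 1 * 1)"
      unfolding \<kappa>_def by (intro FC2.apx_mult c)
    then show ?thesis by (simp add: FC2.apx_def)
  qed
  have "?c (\<kappa> - 1) * XX \<in> ents (lev (lev W)) (k - 1)"
    by (rule M.FW'[OF cst_lev2[OF e2_lev[OF \<kappa>]] Xk]) simp
  from M.W_add[OF this X1] show ?thesis
    unfolding R by (simp add: e2.hom_diff cst.hom_diff algebra_simps)
qed

end

subsection \<open>The defect of the orthogonal generators\<close>

definition diag3 :: "(ix3 \<Rightarrow> complex) \<Rightarrow> ('g free_alg fls, ix3) sqm"
  where "diag3 h = Mk (\<lambda>i j. if i = j then kc (h i) else 0)"

definition diag32 :: "(ix3 \<Rightarrow> complex) \<Rightarrow> ('g free_alg fls fls, ix3) sqm"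
  where "diag32 h = Mk (\<lambda>i j. if i = j then kc2 (h i) else 0)"

text \<open>The diagonal of diag(g) (x) diag(g) in the basis v_-1, v_0, v_1. For g = (1, (-1)^q) it
  is the prescribed constant term of the orthogonal generating matrix.\<close>

fun fused_diag :: "(ix2 \<Rightarrow> complex) \<Rightarrow> ix3 \<Rightarrow> complex" where
  "fused_diag g Neg3 = g Neg2 * g Neg2"
| "fused_diag g Zero3 = g Neg2 * g Pos2"
| "fused_diag g Pos3 = g Pos2 * g Pos2"

lemma fused_diag_sum:
  "(\<Sum>p\<in>UNIV. jv a (fst p) (snd p) * jv b (fst p) (snd p) * (g (fst p) * g (snd p))) = (if a = b then fused_diag g a else 0)"
  by (cases a; cases b) (simp_all add: sum_UNIV_prod UNIV_ix2 jv_simps field_simps)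

lemma cmp_diagc: "kc.cmp (tn1 (diagc g) * tn2 (diagc g)) = diag3 (fused_diag g)"
proof (rule sqm_eqI)
  fix a b :: ix3
  have e: "ent (tn1 (diagc g) * tn2 (diagc g)) p q = (if p = q then kc (g (fst p) * g (snd p)) else 0)" for p q :: "ix2 \<times> ix2"
  proof -
    obtain p1 p2 q1 q2 where "p = (p1, p2)" "q = (q1, q2)" by fastforce
    then show ?thesis
      by (cases p1; cases p2; cases q1; cases q2)
         (simp_all add: ent_mult tn1_def tn2_def diagc_def sum_UNIV_prod UNIV_ix2 kc.hom_mult)
  qed
  have "ent (kc.cmp (tn1 (diagc g) * tn2 (diagc g))) a b =
    (\<Sum>p\<in>UNIV. \<Sum>q\<in>UNIV. if p = q then kc (jv a (fst p) (snd p) * jv b (fst p) (snd p) * (g (fst p) * g (snd p))) else 0)"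
    unfolding kc.cmp_def ent_Mk e by (intro sum.cong refl) (simp add: kc.hom_mult)
  also have "\<dots> = kc (\<Sum>p\<in>UNIV. jv a (fst p) (snd p) * jv b (fst p) (snd p) * (g (fst p) * g (snd p)))"
    by (simp add: kc.hom_sum)
  also have "\<dots> = ent (diag3 (fused_diag g)) a b"
    unfolding fused_diag_sum by (simp add: diag3_def)
  finally show "ent (kc.cmp (tn1 (diagc g) * tn2 (diagc g))) a b = ent (diag3 (fused_diag g)) a b" .
qed

lemma cmp_diff: "kc.cmp (A - B) = kc.cmp A - kc.cmp B"
  by (rule sqm_eqI) (simp add: kc.cmp_def algebra_simps sum_subtractf)

lemma fls_nth_kc_mult: "fls_nth (kc c * f) n = scal c * fls_nth f n"
  by (simp add: kc_def)

lemma cmp_dgs: "A \<in> dgs d \<Longrightarrow> kc.cmp A \<in> dgs d"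
  by (auto simp: dgs_def kc.cmp_def fls_nth_sum fls_nth_kc_mult intro!: sum.neutral)

lemma e1_dgs: "x \<in> lev FC d \<Longrightarrow> cst (e1 x) \<in> dgs d"
  by (rule dgs_cst) (simp add: lev_FC)

lemma aff_quotient_lev: "aff 4 0 / aff 4 (-1) - 1 \<in> lev FC (-1)" "aff 4 0 / aff 4 (-1) \<in> lev FC 0"
proof -
  have i4: "1 / aff 4 (-1) \<in> lev FC (-1)" by (rule inverse_aff_lev) simp
  have "aff 4 0 = aff 4 (-1) + 1" by (rule fls_eqI) (simp add: aff_nth)
  then have "aff 4 0 / aff 4 (-1) - 1 = 1 / aff 4 (-1)"
    using aff_nonzero[of 4 "-1"] by (simp add: add_divide_distrib)
  then show 1: "aff 4 0 / aff 4 (-1) - 1 \<in> lev FC (-1)" using i4 by simp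
  show "aff 4 0 / aff 4 (-1) \<in> lev FC 0"
    using FC1.F_of_cong[of _ 1 0] 1 FC1.F_one by simp
qed

lemma fusedS_dgs:
  assumes "B \<in> dgs 0" shows "fusedS B \<in> dgs 0"
proof -
  have "1 / aff 4 0 \<in> lev FC 0"
    by (rule FC1.F_mono[OF _ inverse_aff_lev[of 4 0]]) simp_all
  from dgs_mult[OF e1_dgs[OF this] dgs_flip]
  have i: "cst (e1 (1 / aff 4 0)) * flip_sq \<in> (dgs 0 :: ('a free_alg fls, ix2 \<times> ix2) sqm set)" by simp
  have one: "1 \<in> (dgs 0 :: ('a free_alg fls, ix2 \<times> ix2) sqm set)"
    by (auto simp: dgs_def ent_one)
  have B: "at_par x1 B \<in> dgs 0" "at_par x2 B \<in> dgs 0"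
    using assms by (auto intro!: dgs_at_par)
  have "fuse B \<in> dgs 0"
    unfolding fuse_def
    using dgs_mult[OF dgs_mult[OF dgs_tn1[OF B(1)] dgs_diff[OF one i]] dgs_tn2[OF B(2)]] by simp
  then show ?thesis
    unfolding fusedS_def using dgs_mult[OF e1_dgs[OF aff_quotient_lev(2)] cmp_dgs] by fastforce
qed

context alg_filt
begin

lemma cmp_lev: "A \<in> ents (lev W) k \<Longrightarrow> kc.cmp A \<in> ents (lev W) k"
  by (auto simp: ents_def kc.cmp_def intro!: f1.W_sum f1.FW'[OF kc_lev])

lemma diag3_lev: "diag3 h \<in> ents (lev F) 0"
  by (auto simp: ents_def diag3_def kc_lev f1.F_0)

lemma diag32_lev: "diag32 h \<in> ents (lev (lev F)) 0"
  by (auto simp: ents_def diag32_def kc2_lev f2.F_0)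

end

lemma (in refl_data) fusedS_lead: "fusedS B - diag3 (fused_diag g) \<in> ents (lev F) (-1)"
proof -
  interpret M: filtered_pair "ents (lev F)" "ents (lev W) :: int \<Rightarrow> ('g free_alg fls, ix2 \<times> ix2) sqm set"
    by (rule f1.filtered_pair_ents)
  interpret M3: filtered_pair "ents (lev F)" "ents (lev W) :: int \<Rightarrow> ('g free_alg fls, ix3) sqm set"
    by (rule f1.filtered_pair_ents)
  interpret FF: alg_filt F F by (rule alg_filt_F)
  have dg: "diagc g \<in> ents (lev F) 0"
    by (auto simp: ents_def diagc_def kc_lev f1.F_0)
  have t: "M.apx (tn1 (at_par x1 B)) (tn1 (diagc g))" "M.apx (tn2 (at_par x2 B)) (tn2 (diagc g))"
    unfolding M.apx_def tn1_diff[symmetric] tn2_diff[symmetric]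
    by (intro conjI ents_tn f1.F_0 at_par_lead dg; simp)+
  have flip: "flip_sq \<in> ents (lev F) 0"
    using f1.F_one f1.F_0 by (simp add: ents_def flip_sq_def)
  have i4: "1 / aff 4 0 \<in> lev FC (-1)" by (rule inverse_aff_lev) simp
  have "M.apx (1 - cst (e1 (1 / aff 4 0)) * flip_sq) 1"
    using M.F_uminus[OF M.FF'[OF cst_lev1[OF e1_lev[OF i4]] flip, of "-1"]] M.F_one by (simp add: M.apx_def)
  from M.apx_mult[OF M.apx_mult[OF t(1) this] t(2)]
  have "fuse B - tn1 (diagc g) * tn2 (diagc g) \<in> ents (lev F) (-1)"
    by (simp add: M.apx_def fuse_def)
  then have c: "kc.cmp (fuse B) - diag3 (fused_diag g) \<in> ents (lev F) (-1)"
    unfolding cmp_diagc[symmetric] cmp_diff[symmetric] by (rule FF.cmp_lev)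
  have 1: "M3.apx (kc.cmp (fuse B)) (diag3 (fused_diag g))"
    using c diag3_lev by (simp add: M3.apx_def)
  have 2: "M3.apx (cst (e1 (aff 4 0 / aff 4 (-1)))) 1"
    using cst_lev1[OF e1_lev[OF aff_quotient_lev(1)]] M3.F_one by (simp add: M3.apx_def e1.hom_diff cst.hom_diff)
  from M3.apx_mult[OF 2 1] show ?thesis by (simp add: M3.apx_def fusedS_def)
qed

context filtered_pair
begin

text \<open>The result is needed two levels below \<open>e\<close>, so the R-matrices are expanded
  to first order. The products \<open>e * Y\<close> and \<open>Y * e\<close> keep the full
  \<open>Y\<close>, for they will vanish as a whole at v = u.\<close>

lemma expand_products:
  assumes R: "Rm - (1 + rm) \<in> F (-2)" "Rp - (1 + rp) \<in> F (-2)" and r: "rm \<in> F (-1)" "rp \<in> F (-1)"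
    and Y: "Y - H \<in> F (-1)" "H \<in> F 0" and e: "e \<in> W (j + 2)"
  shows "Rm * e * Rp * Y - (e * Y + rm * e * H + e * rp * H) \<in> W j"
    and "Rm * Y * Rp * e - (Y * e + rm * H * e + H * rp * e) \<in> W j"
    and "e * Rp * Y * Rm - (e * Y + e * H * rm + e * rp * H) \<in> W j"
    and "Y * Rp * e * Rm - (Y * e + H * e * rm + H * rp * e) \<in> W j"
proof -
  have R1: "P - 1 \<in> F (-1)" "P \<in> F 0" if "P - (1 + p) \<in> F (-2)" "p \<in> F (-1)" for P p
  proof -
    have "P - 1 = (P - (1 + p)) + p" by simp
    then show 1: "P - 1 \<in> F (-1)" using F_add[OF F_mono[OF _ that(1), of "-1"] that(2)] by simp
    show "P \<in> F 0" using F_of_cong[of P 1 0] 1 F_one by simp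
  qed
  note Rm = R1[OF R(1) r(1)] and Rp = R1[OF R(2) r(2)]
  have Y0: "Y \<in> F 0" using F_of_cong[of Y H 0] Y by simp
  have RpY: "Rp * Y - H \<in> F (-1)" "Y * Rp - H \<in> F (-1)"
    using F_cong_mult[of Rp 1 0 Y H 0] F_cong_mult[of Y H 0 Rp 1 0] Rp Y Y0 F_one by simp_all
  have 2: "Rp * Y - (Y + rp * H) \<in> F (-2)" "Y * Rp - (Y + H * rp) \<in> F (-2)"
  proof -
    have "Rp * Y - (Y + rp * H) = (Rp - (1 + rp)) * Y + rp * (Y - H)"
      "Y * Rp - (Y + H * rp) = Y * (Rp - (1 + rp)) + (Y - H) * rp" by (simp_all add: algebra_simps)
    then show "Rp * Y - (Y + rp * H) \<in> F (-2)" "Y * Rp - (Y + H * rp) \<in> F (-2)"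
      using F_add[OF FF'[OF R(2) Y0, of "-2"] FF'[OF r(2) Y(1), of "-2"]]
        F_add[OF FF'[OF Y0 R(2), of "-2"] FF'[OF Y(1) r(2), of "-2"]] by simp_all
  qed
  have RpY0: "Rp * Y \<in> F 0" "Y * Rp \<in> F 0" using FF[OF Rp(2) Y0] FF[OF Y0 Rp(2)] by simp_all
  have "Rm * e * Rp * Y - (e * Y + rm * e * H + e * rp * H) =
      (Rm - (1 + rm)) * (e * (Rp * Y)) + rm * (e * (Rp * Y - H)) + e * (Rp * Y - (Y + rp * H))"
    by (simp add: algebra_simps)
  moreover have "\<dots> \<in> W j"
    by (intro W_add FW'[OF R(1) WF'[OF e RpY0(1) order_refl]] FW'[OF r(1) WF'[OF e RpY(1) order_refl]] WF'[OF e 2(1)]) simp_all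
  ultimately show "Rm * e * Rp * Y - (e * Y + rm * e * H + e * rp * H) \<in> W j" by simp
  have "Rm * Y * Rp * e - (Y * e + rm * H * e + H * rp * e) =
      (Rm - (1 + rm)) * (Y * Rp * e) + rm * ((Y * Rp - H) * e) + (Y * Rp - (Y + H * rp)) * e"
    by (simp add: algebra_simps)
  moreover have "\<dots> \<in> W j"
    by (intro W_add FW'[OF R(1) FW'[OF RpY0(2) e order_refl]] FW'[OF r(1) FW'[OF RpY(2) e order_refl]] FW'[OF 2(2) e]) simp_all
  ultimately show "Rm * Y * Rp * e - (Y * e + rm * H * e + H * rp * e) \<in> W j" by simp
  have "e * Rp * Y * Rm - (e * Y + e * H * rm + e * rp * H) =
      e * (Rp * Y) * (Rm - (1 + rm)) + e * (Rp * Y - H) * rm + e * (Rp * Y - (Y + rp * H))"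
    by (simp add: algebra_simps)
  moreover have "\<dots> \<in> W j"
    by (intro W_add WF'[OF WF'[OF e RpY0(1) order_refl] R(1)] WF'[OF WF'[OF e RpY(1) order_refl] r(1)] WF'[OF e 2(1)]) simp_all
  ultimately show "e * Rp * Y * Rm - (e * Y + e * H * rm + e * rp * H) \<in> W j" by simp
  have "Y * Rp * e * Rm - (Y * e + H * e * rm + H * rp * e) =
      Y * Rp * e * (Rm - (1 + rm)) + (Y * Rp - H) * e * rm + (Y * Rp - (Y + H * rp)) * e"
    by (simp add: algebra_simps)
  moreover have "\<dots> \<in> W j"
    by (intro W_add WF'[OF FW'[OF RpY0(2) e order_refl] R(1)] WF'[OF FW'[OF RpY(2) e order_refl] r(1)] FW'[OF 2(2) e]) simp_all
  ultimately show "Y * Rp * e * Rm - (Y * e + H * e * rm + H * rp * e) \<in> W j" by simp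
qed

end

lemma ent_tn1_tn2:
  fixes A C :: "('a::ring_1, 'n::finite) sqm"
  shows "ent (tn1 A * tn2 C) (a, b) (c, d) = ent A a c * ent C b d"
    and "ent (tn2 C * tn1 A) (a, b) (c, d) = ent C b d * ent A a c"
proof -
  have "ent (tn1 A * tn2 C) (a, b) (c, d) = (\<Sum>x\<in>UNIV. \<Sum>y\<in>UNIV. if y = b then if x = c then ent A a x * ent C y d else 0 else 0)"
    unfolding ent_mult sum_UNIV_prod by (intro sum.cong refl) (auto simp: tn1_def tn2_def)
  then show "ent (tn1 A * tn2 C) (a, b) (c, d) = ent A a c * ent C b d" by simp
  have "ent (tn2 C * tn1 A) (a, b) (c, d) = (\<Sum>x\<in>UNIV. \<Sum>y\<in>UNIV. if y = d then if x = a then ent C b y * ent A x c else 0 else 0)"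
    unfolding ent_mult sum_UNIV_prod by (intro sum.cong refl) (auto simp: tn1_def tn2_def)
  then show "ent (tn2 C * tn1 A) (a, b) (c, d) = ent C b d * ent A a c" by simp
qed

lemma rdef_diff:
  "rdef Rm Rp M N - rdef Rm Rp M' N' =
    (Rm * tn1 (M - M') * Rp * tn2 N + Rm * tn1 M' * Rp * tn2 (N - N')) -
    (tn2 (N - N') * Rp * tn1 M * Rm + tn2 N' * Rp * tn1 (M - M') * Rm)"
  by (simp add: rdef_def tn1_diff tn2_diff algebra_simps)

lemma diag_kc2_mult: "diag (kc2 c * f) = kc c * diag f"
  by (rule fls_eqI) (simp add: diag_nth kc2_def kc_def sum_distrib_left)

text \<open>At v = u the factors u - v and u^2 - v^2 vanish while u + v doubles. The parameters are
  absorbed into the series in u or in v, after which \<open>diag\<close> is multiplicative.\<close>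

lemma diag_param_product:
  fixes A C :: "('g free_alg fls, 'n::finite) sqm"
  assumes w: "fls_subdegree w = -1" and A: "A \<in> dgs 0" and C: "C \<in> dgs 0"
  defines "x \<equiv> cst (e1 w) :: ('g free_alg fls, 'n) sqm"
  defines "xu \<equiv> cst (e2 (pu w)) :: ('g free_alg fls fls, 'n) sqm" and "xv \<equiv> cst (e2 (pv w))"
  shows "map_sq diag ((xu * xu - xv * xv) * (map_sq iu A * map_sq iv C)) = 0"
    and "map_sq diag ((xu * xu - xv * xv) * (map_sq iv C * map_sq iu A)) = 0"
    and "map_sq diag ((xu - xv) * (map_sq iu A * map_sq iv C)) = 0"
    and "map_sq diag ((xu - xv) * (map_sq iv C * map_sq iu A)) = 0"
    and "map_sq diag ((xu + xv) * (map_sq iu A * map_sq iv C)) = (x + x) * (A * C)"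
    and "map_sq diag ((xu + xv) * (map_sq iv C * map_sq iu A)) = (x + x) * (C * A)"
proof -
  let ?U = "map_sq iu :: ('g free_alg fls, 'n) sqm \<Rightarrow> _" and ?V = "map_sq iv :: ('g free_alg fls, 'n) sqm \<Rightarrow> _"
  interpret U: unital_hom ?U by (rule unital_hom_map_sq[OF unital_hom_iu])
  interpret V: unital_hom ?V by (rule unital_hom_map_sq[OF unital_hom_iv])
  have x: "x \<in> dgs 1" using w by (auto simp: x_def intro!: dgs_cst)
  have d: "A \<in> dgs 5" "C \<in> dgs 5" "x * A \<in> dgs 5" "x * C \<in> dgs 5" "x * (x * A) \<in> dgs 5" "x * (x * C) \<in> dgs 5"
    using dgs_mono[OF _ A, of 5] dgs_mono[OF _ C, of 5] dgs_mono[OF _ dgs_mult[OF x A], of 5] dgs_mono[OF _ dgs_mult[OF x C], of 5]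
      dgs_mono[OF _ dgs_mult[OF x dgs_mult[OF x A]], of 5] dgs_mono[OF _ dgs_mult[OF x dgs_mult[OF x C]], of 5] by simp_all
  have u: "xu = ?U x" "xv = ?V x"
    by (simp_all add: xu_def xv_def x_def map_sq_cst e2_pu e2_pv)
  have cx: "y * (x * z) = x * (y * z)" for y z
    unfolding x_def by (rule central_left_commute[OF central_cst[OF central_e1]])
  have cu: "y * (xu * z) = xu * (y * z)" and cv: "y * (xv * z) = xv * (y * z)" for y z
    unfolding xu_def xv_def by (rule central_left_commute[OF central_cst[OF central_e2]])+
  have 1: "xu * (?U Y * Z) = ?U (x * Y) * Z" "xv * (?V Y * Z) = ?V (x * Y) * Z"
    "xv * (Z * ?V Y) = Z * ?V (x * Y)" "xu * (Z * ?U Y) = Z * ?U (x * Y)" for Y Z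
    by (simp_all only: U.hom_mult V.hom_mult u[symmetric] mult.assoc cu[of Z] cv[of Z])
  note s = distrib_right left_diff_distrib mult.assoc map_sq_diag_diff map_sq_diag_add
  show "map_sq diag ((xu * xu - xv * xv) * (?U A * ?V C)) = 0"
    "map_sq diag ((xu * xu - xv * xv) * (?V C * ?U A)) = 0"
    "map_sq diag ((xu - xv) * (?U A * ?V C)) = 0" "map_sq diag ((xu - xv) * (?V C * ?U A)) = 0"
    "map_sq diag ((xu + xv) * (?U A * ?V C)) = (x + x) * (A * C)"
    "map_sq diag ((xu + xv) * (?V C * ?U A)) = (x + x) * (C * A)"
    by (simp_all only: s 1 diag_dgs d) (simp_all only: mult.assoc cx[of A] cx[of C] diff_self)
qed

text \<open>The entries of \<open>lead1\<close> are constant combinations of entries of the defect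
  at (2u, 2v), so they inherit the vanishing of the cleared defect on the diagonal.\<close>

lemma diag_leadterm:
  fixes B :: "('g free_alg fls, ix2) sqm"
  assumes B: "B \<in> dgs 0"
  shows "map_sq diag (cst (e2 ((pu w0 - pv w0) * (pu w0 + pv w0))) * kc2.psi (leadterm B g)) = 0"
proof -
  let ?s = "(pu w0 - pv w0) * (pu w0 + pv w0)"
  have "cst (e2 ?s) * dB w0 w0 B = pdef (cst (e2 (pu w0))) (cst (e2 (pv w0))) (map_sq iu (at_par w0 B)) (map_sq iv (at_par w0 B))"
    by (rule pdef_dB[symmetric]) (use aff_combination in auto)
  moreover have "map_sq diag (pdef (cst (e2 (pu w0))) (cst (e2 (pv w0))) (map_sq iu (at_par w0 B)) (map_sq iv (at_par w0 B))) = 0"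
    by (subst diag_pdef) (simp_all add: B dgs_at_par pdef_diagonal central_cst central_e1)
  ultimately have "map_sq diag (cst (e2 ?s) * dB w0 w0 B) = 0" by simp
  from arg_cong[OF this, of ent] have d: "diag (e2 ?s * ent (dB w0 w0 B) p q) = 0" for p q
    by (cases p; cases q) (simp add: fun_eq_iff)
  have c: "e2 ?s * (kc2 c * y) = kc2 c * (e2 ?s * y)" for c and y :: "'g free_alg fls fls"
    by (rule central_left_commute[OF kc2.central_e])
  have "map_sq diag (cst (e2 ?s) * lead1 (dB w0 w0 B) g) = 0"
  proof (rule sqm_eqI)
    fix a b :: "ix3 \<times> ix3"
    have "diag (e2 ?s * ent (lead1 (dB w0 w0 B) g) (fst a, snd a) (fst b, snd b)) = 0"
      unfolding lead1_entry sum_distrib_left diag_sum c diag_kc2_mult d by simp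
    then show "ent (map_sq diag (cst (e2 ?s) * lead1 (dB w0 w0 B) g)) a b = ent 0 a b" by simp
  qed
  then show ?thesis by (simp only: psi_leadterm distrib_left map_sq_diag_add) simp
qed

context alg_filt
begin

lemma Qs_lev: "Qs \<in> ents (lev (lev F)) 0" and flip3_lev: "flip_sq \<in> ents (lev (lev F)) 0"
  using f2.F_one f2.F_0 by (simp_all add: ents_def Qs_def flip_sq_def)

text \<open>P and Q come with 1/c and 1/(c - 1/2); the difference of these is half their product and
  has total degree -2. To first order the R-matrix depends only on Q - P.\<close>

lemma R3s_expand:
  assumes "c \<in> {par_u - par_v, par_u + par_v}"
  shows "R3s c - (1 + cst (e2 (1 / c)) * (Qs - flip_sq)) \<in> ents (lev (lev F)) (-2)"
    and "cst (e2 (1 / c)) * (Qs - flip_sq) \<in> ents (lev (lev F)) (-1)"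
proof -
  interpret M: filtered_pair "ents (lev (lev F))" "ents (lev (lev W)) :: int \<Rightarrow> ('g free_alg fls fls, ix3 \<times> ix3) sqm set"
    by (rule f2.filtered_pair_ents)
  let ?h = "fls_const (fls_const (1/2)) :: complex fls fls"
  have h: "1 / 2 = ?h"
    using half_plus_half by (simp add: field_simps)
  define y where "y = pu (aff 1 (- 1 / 2))"
  have sh: "y = par_u - ?h"
  proof -
    have "aff 1 (- 1 / 2) = fls_X_inv - fls_const (1/2)" by (rule fls_eqI) (simp add: aff_nth)
    moreover have "pu (fls_const (1/2)) = ?h" by (rule fls_eqI) (simp add: pu_def)
    ultimately show ?thesis unfolding y_def by (simp only: pu_diff par_u_eq)
  qed
  have v: "par_u = pu (aff 1 0)" "par_v = pv (aff 1 0)" by (simp_all add: par_u_eq par_v_eq X_inv_aff)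
  have c1: "c \<noteq> 0" "1 / c \<in> lev (lev FC) (-1)"
    using assms aff_combination[of 1 0 1 0] by (auto simp: v)
  have "c - 1/2 \<in> {y - pv (aff 1 0), y + pv (aff 1 0)}"
    using assms by (auto simp: h sh v)
  moreover have "z \<noteq> 0 \<and> 1 / z \<in> lev (lev FC) (-1)" if "z \<in> {y - pv (aff 1 0), y + pv (aff 1 0)}" for z
    using that aff_combination[of 1 "- 1 / 2" 1 0, folded y_def] by auto
  ultimately have c2: "c - 1/2 \<noteq> 0" "1 / (c - 1/2) \<in> lev (lev FC) (-1)"
    by blast+
  have "?h \<in> lev (lev FC) 0" unfolding lev_def[of "lev FC"] by (auto simp: lev_FC)
  from FC2.FF'[OF this FC2.FF'[OF c1(2) c2(2) order_refl] order_refl]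
  have "1/2 * (1 / c * (1 / (c - 1/2))) \<in> lev (lev FC) (-2)" by (simp add: h)
  moreover have "1 / (c - 1/2) - 1 / c = 1/2 * (1 / c * (1 / (c - 1/2)))"
    using c1 c2 by (simp add: divide_simps)
  ultimately have d: "1 / (c - 1/2) - 1 / c \<in> lev (lev FC) (-2)" by simp
  have "R3s c - (1 + cst (e2 (1 / c)) * (Qs - flip_sq)) = cst (e2 (1 / (c - 1/2) - 1 / c)) * (Qs :: ('g free_alg fls fls, ix3 \<times> ix3) sqm)"
    by (simp only: R3s_def e2.hom_diff cst.hom_diff) (simp add: algebra_simps)
  then show "R3s c - (1 + cst (e2 (1 / c)) * (Qs - flip_sq)) \<in> ents (lev (lev F)) (-2)"
    using M.FF'[OF cst_lev2[OF e2_lev[OF d]] Qs_lev] by simp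
  show "cst (e2 (1 / c)) * (Qs - flip_sq) \<in> ents (lev (lev F)) (-1)"
    using M.FF'[OF cst_lev2[OF e2_lev[OF c1(2)]] M.F_diff[OF Qs_lev flip3_lev]] by simp
qed

end

lemma map_sq_Qs: "h 0 = 0 \<Longrightarrow> h 1 = 1 \<Longrightarrow> map_sq h Qs = Qs"
  by (rule sqm_eqI) (simp add: Qs_def)

section \<open>The descent of both defects\<close>

text \<open>The situation of the descent: \<open>S\<close> generates the orthogonal algebra and
  \<open>B\<close> is solved from four of its entries. The assumption \<open>S_rel\<close> at every
  level expresses that the relations lie in an ideal contained in each \<open>W k\<close>.\<close>

locale fused_data = refl_data F W B g for F W :: "int \<Rightarrow> 'g free_alg set" and B g +
  fixes S :: "('g free_alg fls, ix3) sqm"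
  assumes g_nz: "g Neg2 \<noteq> 0" "g Pos2 \<noteq> 0" and S_dgs: "S \<in> dgs 0"
    and S_lead: "S - diag3 (fused_diag g) \<in> ents (lev F) (-1)"
    and S_rel: "\<And>j. RE3 S \<in> ents (lev (lev W)) j"
    and S_norm: "\<And>p q. ent (S - fusedS B) (fst (pos3 p q)) (snd (pos3 p q)) = 0"
begin

text \<open>The relations of \<open>S\<close> and of \<open>fusedS B\<close> are subtracted. The
  defect of \<open>B\<close> contributes \<open>leadterm\<close>, which disappears after
  multiplication by u^2 - v^2 and restriction to v = u. Of the terms with \<open>E\<close> only
  those with the first-order part of R(u - v) survive this, because of its pole at v = u.\<close>

lemma symmetric_defect:
  assumes D: "dB fls_X_inv fls_X_inv B \<in> ents (lev (lev W)) k"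
  defines "E \<equiv> S - fusedS B"
  defines "T \<equiv> Qs - flip_sq" and "h \<equiv> diag3 (fused_diag g)"
  assumes E: "E \<in> ents (lev W) (k + 1)"
  shows "T * (tn1 E * tn2 h + tn1 h * tn2 E) - (tn2 E * tn1 h + tn2 h * tn1 E) * T \<in> ents (lev W) k"
proof -
  interpret M: filtered_pair "ents (lev (lev F))" "ents (lev (lev W)) :: int \<Rightarrow> ('g free_alg fls fls, ix3 \<times> ix3) sqm set"
    by (rule f2.filtered_pair_ents)
  interpret M1: filtered_pair "ents (lev F)" "ents (lev W) :: int \<Rightarrow> ('g free_alg fls, ix3 \<times> ix3) sqm set"
    by (rule f1.filtered_pair_ents)
  let ?U = "map_sq iu :: ('g free_alg fls, ix3 \<times> ix3) sqm \<Rightarrow> _" and ?V = "map_sq iv :: ('g free_alg fls, ix3 \<times> ix3) sqm \<Rightarrow> _"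
  interpret U: unital_hom ?U by (rule unital_hom_map_sq[OF unital_hom_iu])
  interpret V: unital_hom ?V by (rule unital_hom_map_sq[OF unital_hom_iv])
  define S0 where "S0 = fusedS B"
  have E_def': "E = S - S0" by (simp add: E_def S0_def)
  let ?c = "\<lambda>y. cst (e2 y) :: ('g free_alg fls fls, ix3 \<times> ix3) sqm"
  define T2 where "T2 = (Qs - flip_sq :: ('g free_alg fls fls, ix3 \<times> ix3) sqm)"
  define a b where "a = 1 / (par_u - par_v)" and "b = 1 / (par_u + par_v)"
  define rm rp where "rm = ?c a * T2" and "rp = ?c b * T2"
  let ?Rm = "R3s (par_u - par_v) :: ('g free_alg fls fls, ix3 \<times> ix3) sqm" and ?Rp = "R3s (par_u + par_v) :: ('g free_alg fls fls, ix3 \<times> ix3) sqm"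
  define t1 t2 H1 H2 where "t1 = ?U (tn1 E)" and "t2 = ?V (tn2 E)" and "H1 = ?U (tn1 h)" and "H2 = ?V (tn2 h)"
  define m m0 n n0 where "m = ?U (tn1 S)" and "m0 = ?U (tn1 S0)" and "n = ?V (tn2 S)" and "n0 = ?V (tn2 S0)"
  note R = R3s_expand[of "par_u - par_v", folded T2_def a_def, folded rm_def] R3s_expand[of "par_u + par_v", folded T2_def b_def, folded rp_def]
  have tU: "?U (tn1 A) = tn1 (map_sq iu A)" "?V (tn2 A) = tn2 (map_sq iv A)" for A :: "('g free_alg fls, ix3) sqm"
    by (simp_all add: map_sq_tn1 map_sq_tn2)
  have S0_lead: "S0 - h \<in> ents (lev F) (-1)" unfolding S0_def h_def by (rule fusedS_lead)
  have lead: "?U (tn1 A) - H1 \<in> ents (lev (lev F)) (-1)" "?V (tn2 A) - H2 \<in> ents (lev (lev F)) (-1)"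
    if "A - h \<in> ents (lev F) (-1)" for A
  proof -
    have "?U (tn1 A) - H1 = ?U (tn1 (A - h))" "?V (tn2 A) - H2 = ?V (tn2 (A - h))"
      by (simp_all only: H1_def H2_def tn1_diff tn2_diff U.hom_diff V.hom_diff)
    then show "?U (tn1 A) - H1 \<in> ents (lev (lev F)) (-1)" "?V (tn2 A) - H2 \<in> ents (lev (lev F)) (-1)"
      by (auto intro!: ents_map_sq[OF ents_tn(1)[OF f1.F_0 that]] ents_map_sq[OF ents_tn(2)[OF f1.F_0 that]] iu_lev iv_lev F_0)
  qed
  have h0: "h \<in> ents (lev F) 0" unfolding h_def by (rule diag3_lev)
  have H: "H1 \<in> ents (lev (lev F)) 0" "H2 \<in> ents (lev (lev F)) 0"
    unfolding H1_def H2_def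
    by (auto intro!: ents_map_sq[OF ents_tn(1)[OF f1.F_0 h0]] ents_map_sq[OF ents_tn(2)[OF f1.F_0 h0]] iu_lev iv_lev F_0)
  have t: "t1 \<in> ents (lev (lev W)) (k - 1 + 2)" "t2 \<in> ents (lev (lev W)) (k - 1 + 2)"
  proof -
    have E': "E \<in> ents (lev W) (k - 1 + 2)" using E by (simp add: algebra_simps)
    show "t1 \<in> ents (lev (lev W)) (k - 1 + 2)"
      unfolding t1_def by (rule ents_map_sq[OF ents_tn(1)[OF f1.W_0 E']]) (rule iu_lev[OF W_0])
    show "t2 \<in> ents (lev (lev W)) (k - 1 + 2)"
      unfolding t2_def by (rule ents_map_sq[OF ents_tn(2)[OF f1.W_0 E']]) (rule iv_lev[OF W_0])
  qed
  define I1 I2 I3 I4 where "I1 = ?Rm * t1 * ?Rp * n - (t1 * n + rm * t1 * H2 + t1 * rp * H2)"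
    and "I2 = ?Rm * m0 * ?Rp * t2 - (m0 * t2 + rm * H1 * t2 + H1 * rp * t2)"
    and "I3 = t2 * ?Rp * m * ?Rm - (t2 * m + t2 * H1 * rm + t2 * rp * H1)"
    and "I4 = n0 * ?Rp * t1 * ?Rm - (n0 * t1 + H2 * t1 * rm + H2 * rp * t1)"
  have I: "I1 \<in> ents (lev (lev W)) (k - 1)" "I2 \<in> ents (lev (lev W)) (k - 1)" "I3 \<in> ents (lev (lev W)) (k - 1)" "I4 \<in> ents (lev (lev W)) (k - 1)"
    unfolding I1_def I2_def I3_def I4_def m_def m0_def n_def n0_def
    by (rule M.expand_products(1)[OF R(1,3,2,4) lead(2)[OF S_lead[folded h_def]] H(2) t(1)]
        M.expand_products(2)[OF R(1,3,2,4) lead(1)[OF S0_lead] H(1) t(2)]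
        M.expand_products(3)[OF R(1,3,2,4) lead(1)[OF S_lead[folded h_def]] H(1) t(2)]
        M.expand_products(4)[OF R(1,3,2,4) lead(2)[OF S0_lead] H(2) t(1)]; simp)+
  define L where "L = (t1 * n + rm * t1 * H2 + t1 * rp * H2) + (m0 * t2 + rm * H1 * t2 + H1 * rp * t2)
    - (t2 * m + t2 * H1 * rm + t2 * rp * H1) - (n0 * t1 + H2 * t1 * rm + H2 * rp * t1)"
  define \<psi> where "\<psi> = kc2.psi (leadterm B g)"
  have UE: "map_sq iu S - map_sq iu S0 = map_sq iu E" "map_sq iv S - map_sq iv S0 = map_sq iv E"
    by (rule sqm_eqI, simp add: E_def' iu.hom_diff iv.hom_diff)+
  have "RE3 S - RE3 S0 = (?Rm * t1 * ?Rp * n + ?Rm * m0 * ?Rp * t2) - (t2 * ?Rp * m * ?Rm + n0 * ?Rp * t1 * ?Rm)"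
    unfolding RE3_def rdef_diff UE by (simp only: t1_def t2_def m_def m0_def n_def n0_def tU)
  then have eq: "L + \<psi> = RE3 S - (RE3 S0 - \<psi>) - (I1 + I2 - (I3 + I4))"
    by (simp add: L_def I1_def I2_def I3_def I4_def algebra_simps)
  have "RE3 S - (RE3 S0 - \<psi>) - (I1 + I2 - (I3 + I4)) \<in> ents (lev (lev W)) (k - 1)"
    unfolding S0_def \<psi>_def
    by (rule M.W_diff[OF M.W_diff[OF S_rel RE3_fusedS[OF D]] M.W_diff[OF M.W_add[OF I(1,2)] M.W_add[OF I(3,4)]]])
  then have L: "L + \<psi> \<in> ents (lev (lev W)) (k - 1)" unfolding eq .
  \<comment> \<open>\<open>s\<close> is 4(u^2 - v^2) and raises the level by 2. Since
    \<open>s * a\<close> is 4(u + v) and \<open>s * b\<close> is 4(u - v), the diagonal keeps the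
    terms with \<open>rm\<close> and kills those with \<open>rp\<close>, just as \<open>s\<close>
    itself kills the products of zeroth order.\<close>
  define s where "s = (pu w0 - pv w0) * (pu w0 + pv w0)"
  have s: "s \<in> lev (lev FC) 2"
    unfolding s_def by (rule FC2.FF'[where i = 1 and j = 1]) (auto intro!: FC2.F_diff FC2.F_add pu_lev pv_lev aff_lev)
  have sL: "?c s * (L + \<psi>) \<in> ents (lev (lev W)) (k + 1)"
    by (rule M.FW'[OF cst_lev2[OF e2_lev[OF s]] L]) simp
  have diagL: "map_sq diag (?c s * (L + \<psi>)) \<in> ents (lev W) (k + 1)"
    by (rule ents_map_sq[OF sL]) (rule diag_lev)
  define x where "x = (cst (e1 w0) :: ('g free_alg fls, ix3 \<times> ix3) sqm)"
  let ?xu = "?c (pu w0)" and ?xv = "?c (pv w0)"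
  have w2: "pu w0 = par_u + par_u" "pv w0 = par_v + par_v"
    by (simp_all add: par_u_eq par_v_eq X_inv_aff aff_add flip: pu_add pv_add)
  have nz: "par_u - par_v \<noteq> 0" "par_u + par_v \<noteq> 0"
    using aff_combination(1,3)[of 1 0 1 0] by (simp_all add: par_u_eq par_v_eq X_inv_aff)
  have sab: "s * a = (pu w0 + pv w0) + (pu w0 + pv w0)" "s * b = (pu w0 - pv w0) + (pu w0 - pv w0)"
    unfolding s_def a_def b_def w2 using nz by (simp_all add: field_simps)
  have lc: "z * (?c y * w) = ?c y * (z * w)" for y z w by (rule central_left_commute[OF central_cst_e2])
  have cc: "?c y * (?c z * w) = ?c (y * z) * w" for y z w by (simp only: mult.assoc cst.hom_mult e2.hom_mult)
  define T3 where "T3 = T + T"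
  have T3: "T2 + T2 = ?U T3" "T2 + T2 = ?V T3"
    by (simp_all only: T3_def T_def T2_def U.hom_add V.hom_add U.hom_diff V.hom_diff
          map_sq_flip[of iu, OF iu.hom_0 iu.hom_1] map_sq_flip[of iv, OF iv.hom_0 iv.hom_1]
          map_sq_Qs[of iu, OF iu.hom_0 iu.hom_1] map_sq_Qs[of iv, OF iv.hom_0 iv.hom_1])
  have dbl: "?c (y + y) * (z * (T2 * w)) = ?c y * (z * (?U T3 * w))" "?c (y + y) * (z * T2) = ?c y * (z * ?U T3)"
    "?c (y + y) * (T2 * w) = ?c y * (?U T3 * w)" for y z w
    unfolding T3(1)[symmetric] by (simp_all only: e2.hom_add cst.hom_add distrib_left distrib_right)
  have rm: "?c s * (rm * w) = (?xu + ?xv) * (?U T3 * w)" "?c s * (z * (rm * w)) = (?xu + ?xv) * (z * (?U T3 * w))"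
    "?c s * (z * rm) = (?xu + ?xv) * (z * ?U T3)" for z w
    unfolding rm_def mult.assoc lc[of z] cc sab dbl by (simp_all only: e2.hom_add cst.hom_add dbl flip: lc[of z])
  have rp: "?c s * (rp * w) = (?xu - ?xv) * (?U T3 * w)" "?c s * (z * (rp * w)) = (?xu - ?xv) * (z * (?U T3 * w))"
    "?c s * (z * rp) = (?xu - ?xv) * (z * ?U T3)" for z w
    unfolding rp_def mult.assoc lc[of z] cc sab dbl by (simp_all only: e2.hom_diff cst.hom_diff dbl flip: lc[of z])
  have xc: "?xv * ?xu = ?xu * ?xv" by (rule centralD[OF central_cst_e2])
  note rm = rm rm(3)[of "z * z'" for z z', unfolded mult.assoc]
  have cs: "?c s = ?xu * ?xu - ?xv * ?xv"
    unfolding s_def by (simp only: e2.hom_mult cst.hom_mult e2.hom_diff cst.hom_diff e2.hom_add cst.hom_add)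
       (simp add: algebra_simps xc)
  have dg: "tn1 E \<in> dgs 0" "tn2 E \<in> dgs 0" "tn1 h \<in> dgs 0" "tn2 h \<in> dgs 0" "tn1 S \<in> dgs 0" "tn1 S0 \<in> dgs 0" "tn2 S \<in> dgs 0" "tn2 S0 \<in> dgs 0" "T3 \<in> dgs 0"
    using S_dgs fusedS_dgs[OF B_dgs]
    by (auto simp: E_def' S0_def h_def T3_def T_def intro!: dgs_tn1 dgs_tn2 dgs_diff dgs_add dgs_flip)
       (auto simp: dgs_def diag3_def kc_def Qs_def)
  have n24: "(2 :: complex) \<noteq> 0" "(4 :: complex) \<noteq> 0" by simp_all
  note d = diag_param_product[OF subdegree_aff[OF n24(1), of 0]]
  have dd: "map_sq diag (?c s * (t1 * n)) = 0" "map_sq diag (?c s * (m0 * t2)) = 0"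
    "map_sq diag (?c s * (t2 * m)) = 0" "map_sq diag (?c s * (n0 * t1)) = 0"
    "map_sq diag (?c s * (rm * t1 * H2)) = (x + x) * (T3 * (tn1 E * tn2 h))"
    "map_sq diag (?c s * (rm * H1 * t2)) = (x + x) * (T3 * (tn1 h * tn2 E))"
    "map_sq diag (?c s * (t2 * H1 * rm)) = (x + x) * (tn2 E * tn1 h * T3)"
    "map_sq diag (?c s * (H2 * t1 * rm)) = (x + x) * (tn2 h * tn1 E * T3)"
    "map_sq diag (?c s * (t1 * rp * H2)) = 0" "map_sq diag (?c s * (H1 * rp * t2)) = 0"
    "map_sq diag (?c s * (t2 * rp * H1)) = 0" "map_sq diag (?c s * (H2 * rp * t1)) = 0"
  proof -
    note a = dgs_mult[of _ 0 _ 0, unfolded add_0_right]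
    show "map_sq diag (?c s * (t1 * n)) = 0" "map_sq diag (?c s * (m0 * t2)) = 0"
      "map_sq diag (?c s * (t2 * m)) = 0" "map_sq diag (?c s * (n0 * t1)) = 0"
      unfolding cs t1_def t2_def m_def m0_def n_def n0_def by (rule d; rule dg)+
    show "map_sq diag (?c s * (rm * t1 * H2)) = (x + x) * (T3 * (tn1 E * tn2 h))"
      using d(5)[OF a[OF dg(9,1)] dg(4)] by (simp only: x_def mult.assoc rm t1_def H2_def U.hom_mult)
    show "map_sq diag (?c s * (rm * H1 * t2)) = (x + x) * (T3 * (tn1 h * tn2 E))"
      using d(5)[OF a[OF dg(9,3)] dg(2)] by (simp only: x_def mult.assoc rm t2_def H1_def U.hom_mult)
    show "map_sq diag (?c s * (t2 * H1 * rm)) = (x + x) * (tn2 E * tn1 h * T3)"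
      using d(6)[OF a[OF dg(3,9)] dg(2)] by (simp only: x_def mult.assoc rm t2_def H1_def U.hom_mult)
    show "map_sq diag (?c s * (H2 * t1 * rm)) = (x + x) * (tn2 h * tn1 E * T3)"
      using d(6)[OF a[OF dg(1,9)] dg(4)] by (simp only: x_def mult.assoc rm t1_def H2_def U.hom_mult)
    show "map_sq diag (?c s * (t1 * rp * H2)) = 0"
      using d(3)[OF a[OF dg(1,9)] dg(4)] by (simp only: mult.assoc rp t1_def H2_def U.hom_mult)
    show "map_sq diag (?c s * (H1 * rp * t2)) = 0"
      using d(3)[OF a[OF dg(3,9)] dg(2)] by (simp only: mult.assoc rp t2_def H1_def U.hom_mult)
    show "map_sq diag (?c s * (t2 * rp * H1)) = 0"
      using d(4)[OF a[OF dg(9,3)] dg(2)] by (simp only: mult.assoc rp t2_def H1_def U.hom_mult)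
    show "map_sq diag (?c s * (H2 * rp * t1)) = 0"
      using d(4)[OF a[OF dg(9,1)] dg(4)] by (simp only: mult.assoc rp t1_def H2_def U.hom_mult)
  qed
  have d\<psi>: "map_sq diag (?c s * \<psi>) = 0"
    unfolding s_def \<psi>_def by (rule diag_leadterm[OF B_dgs])
  let ?Y = "tn1 E * tn2 h + tn1 h * tn2 E" and ?Y' = "tn2 E * tn1 h + tn2 h * tn1 E"
  have "map_sq diag (?c s * (L + \<psi>)) = (x + x) * (T3 * ?Y - ?Y' * T3)"
    unfolding L_def distrib_left[of "?c s"] right_diff_distrib[of "?c s"] map_sq_diag_add map_sq_diag_diff dd d\<psi>
    by (simp add: algebra_simps)
  \<comment> \<open>A factor 4u is left over; dividing by it brings the level from k + 1 down to
    k.\<close>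
  also have "x + x = cst (e1 (aff 4 0))"
    by (simp add: x_def aff_add flip: cst.hom_add e1.hom_add)
  finally have "T3 * ?Y - ?Y' * T3 = cst (e1 (1 / aff 4 0)) * map_sq diag (?c s * (L + \<psi>))"
    by (simp only: cst_e1_mult_inverse[OF aff_nonzero[OF n24(2)]])
  moreover have "1 / aff 4 0 \<in> lev FC (-1)" by (rule inverse_aff_lev) simp
  ultimately have Z: "T3 * ?Y - ?Y' * T3 \<in> ents (lev W) k"
    using M1.FW'[OF cst_lev1[OF e1_lev] diagL, of _ "-1" k] by simp
  define Z where "Z = T * ?Y - ?Y' * T"
  have "T3 * ?Y - ?Y' * T3 = Z + Z" by (simp add: T3_def Z_def algebra_simps)
  then have "cst (kc (1/2)) * (Z + Z) \<in> ents (lev W) k"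
    using M1.FW'[OF cst_lev1[OF kc_lev] Z, of k] by simp
  then show ?thesis unfolding distrib_left kc.half_half Z_def .
qed

lemma kc_mult_cancel:
  assumes "kc c * x \<in> lev W k" "c \<noteq> 0" shows "x \<in> lev W k"
proof -
  have "kc (1 / c) * (kc c * x) = x"
    using assms(2) by (simp flip: mult.assoc kc.hom_mult)
  then show ?thesis using f1.FW'[OF kc_lev assms(1), of k "1 / c"] by simp
qed

lemma kc2_mult_cancel:
  assumes "kc2 c * x \<in> lev (lev W) k" "c \<noteq> 0" shows "x \<in> lev (lev W) k"
proof -
  have "kc2 (1 / c) * (kc2 c * x) = x"
    using assms(2) by (simp flip: mult.assoc kc2.hom_mult)
  then show ?thesis using f2.FW'[OF kc2_lev assms(1), of k "1 / c"] by simp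
qed

text \<open>Four of the nine entries of \<open>E\<close> vanish by \<open>S_norm\<close>. The
  relation with Q determines the other five, since the entries of the constant diagonal matrix are
  nonzero.\<close>

lemma defect_entries:
  defines "E \<equiv> S - fusedS B" and "h \<equiv> diag3 (fused_diag g)"
  assumes Z: "Qs * (tn1 E * tn2 h + tn1 h * tn2 E) - (tn2 E * tn1 h + tn2 h * tn1 E) * Qs \<in> ents (lev W) k"
  shows "E \<in> ents (lev W) k"
proof -
  define Y where "Y = Qs * (tn1 E * tn2 h + tn1 h * tn2 E) - (tn2 E * tn1 h + tn2 h * tn1 E) * Qs"
  have Y: "ent Y p q \<in> lev W k" for p q using Z unfolding Y_def ents_def mem_Collect_eq by blast
  have z: "ent E Neg3 Neg3 = 0" "ent E Neg3 Zero3 = 0" "ent E Zero3 Neg3 = 0" "ent E Pos3 Pos3 = 0"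
    using S_norm[of Neg2 Neg2] S_norm[of Neg2 Pos2] S_norm[of Pos2 Neg2] S_norm[of Pos2 Pos2] by (simp_all add: E_def)
  have c: "x * kc c = kc c * x" for x c by (rule centralD[OF kc.central_e, symmetric])
  have dbl: "kc c * x + kc c * x = kc (2 * c) * x" for c x
    by (simp only: distrib_right[symmetric] kc.hom_add[symmetric] mult_2)
  note s = Y_def ent_mult sum_UNIV_prod UNIV_ix3 Qs_def tn1_def tn2_def h_def diag3_def z c
  let ?g = "fused_diag g"
  \<comment> \<open>Positions in the row or the column (0, 0) of V (x) V at which, given the four
    vanishing entries, a single entry of \<open>E\<close> is left.\<close>
  have "ent Y (Zero3, Zero3) (Neg3, Neg3) = kc (2 * ?g Neg3) * ent E Pos3 Neg3"
    "ent Y (Zero3, Zero3) (Pos3, Pos3) = kc (2 * ?g Pos3) * ent E Neg3 Pos3"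
    "ent Y (Zero3, Zero3) (Zero3, Neg3) = kc (?g Neg3) * ent E Pos3 Zero3"
    "ent Y (Zero3, Zero3) (Pos3, Zero3) = kc (?g Zero3) * ent E Zero3 Pos3"
    "ent Y (Neg3, Pos3) (Zero3, Zero3) = kc (2 * ?g Zero3) * ent E Zero3 Zero3"
    unfolding dbl[symmetric] by (simp_all add: s)
  then have "ent E Pos3 Neg3 \<in> lev W k" "ent E Neg3 Pos3 \<in> lev W k" "ent E Pos3 Zero3 \<in> lev W k"
    "ent E Zero3 Pos3 \<in> lev W k" "ent E Zero3 Zero3 \<in> lev W k"
    by (metis (no_types) Y kc_mult_cancel g_nz mult_eq_0_iff zero_neq_numeral fused_diag.simps)+
  then have "ent E a b \<in> lev W k" for a b
    by (cases a; cases b) (simp_all add: z f1.W_0)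
  then show ?thesis by (simp add: ents_def)
qed

text \<open>P intertwines the two symmetric expressions identically, so only Q remains of Q - P in
  \<open>symmetric_defect\<close>.\<close>

lemma defect_step:
  assumes D: "dB fls_X_inv fls_X_inv B \<in> ents (lev (lev W)) k"
    and E: "S - fusedS B \<in> ents (lev W) (k + 1)"
  shows "S - fusedS B \<in> ents (lev W) k"
proof (rule defect_entries)
  let ?E = "S - fusedS B" and ?h = "diag3 (fused_diag g)"
  let ?Y = "tn1 ?E * tn2 ?h + tn1 ?h * tn2 ?E" and ?Y' = "tn2 ?E * tn1 ?h + tn2 ?h * tn1 ?E"
  have f: "flip_sq * (tn1 A * tn2 C) = tn2 A * tn1 C * flip_sq" for A C :: "('g free_alg fls, ix3) sqm"
    by (metis flip_tn1 flip_tn2 mult.assoc)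
  have "flip_sq * ?Y = ?Y' * flip_sq"
    by (simp only: distrib_left distrib_right f)
  then have "Qs * ?Y - ?Y' * Qs = (Qs - flip_sq) * ?Y - ?Y' * (Qs - flip_sq)"
    by (simp add: left_diff_distrib right_diff_distrib)
  then show "Qs * ?Y - ?Y' * Qs \<in> ents (lev W) k"
    using symmetric_defect[OF D E] by simp
qed

end

text \<open>The two substitutions act on different variables and commute; in each variable they
  compose to the identity by \<open>sbst_compose\<close>.\<close>

lemma Sub2_cancel:
  fixes f :: "'g free_alg fls fls"
  assumes w: "fls_subdegree w = -1" "fls_subdegree w' = -1" and id: "sbst id w' w = fls_X_inv"
  shows "Sub2 w' w' (Sub2 w w f) = f"
proof -
  interpret s: unital_hom "sbst scal w'" by (rule scal.unital_hom_sbst) fact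
  have "fls_map (sbst scal w') (sbst kc w F) = sbst kc w (fls_map (sbst scal w') F)" for F :: "'g free_alg fls fls"
    by (rule fls_map_sbst[OF kc.scalar_embedding_axioms s.unital_hom_axioms w(1) _ kc.scalar_embedding_axioms])
       (simp add: kc_def scal.sbst_fls_const w)
  moreover have "fls_map (sbst scal w') (fls_map (sbst scal w) F) = F" for F :: "'g free_alg fls fls"
    using w by (intro fls_eqI) (simp add: fls_nth_fls_map scal.unital_hom_sbst[THEN unital_hom.hom_0] scal.sbst_compose id scal.sbst_id)
  ultimately show ?thesis
    using w by (simp add: Sub2_def kc.sbst_compose id kc.sbst_id)
qed

lemma Sub2_inverse: "Sub2 (aff (1/2) 0) (aff (1/2) 0) (Sub2 w0 w0 f) = f"
  by (rule Sub2_cancel) (simp_all add: sbst_aff_aff X_inv_aff)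

context fused_data
begin

text \<open>With \<open>E\<close> already in level k it no longer shows in level k of the relation:
  its leading terms cancel. The leading term of the defect of \<open>B\<close> must then lie in
  level k - 1 as well, and every entry of the defect can be extracted from it.\<close>

lemma reflection_step:
  assumes D: "dB fls_X_inv fls_X_inv B \<in> ents (lev (lev W)) k"
    and E: "S - fusedS B \<in> ents (lev W) k"
  shows "dB fls_X_inv fls_X_inv B \<in> ents (lev (lev W)) (k - 1)"
proof -
  interpret M: filtered_pair "ents (lev (lev F))" "ents (lev (lev W)) :: int \<Rightarrow> ('g free_alg fls fls, ix3 \<times> ix3) sqm set"
    by (rule f2.filtered_pair_ents)
  let ?h = "fused_diag g" and ?S0 = "fusedS B"
  define t1 t2 where "t1 = tn1 (map_sq iu (S - fusedS B))" and "t2 = tn2 (map_sq iv (S - fusedS B))"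
  let ?Rm = "R3s (par_u - par_v) :: ('g free_alg fls fls, ix3 \<times> ix3) sqm" and ?Rp = "R3s (par_u + par_v) :: ('g free_alg fls fls, ix3 \<times> ix3) sqm"
  let ?H1 = "tn1 (diag32 ?h) :: ('g free_alg fls fls, ix3 \<times> ix3) sqm" and ?H2 = "tn2 (diag32 ?h) :: ('g free_alg fls fls, ix3 \<times> ix3) sqm"
  have t: "t1 \<in> ents (lev (lev W)) k" "t2 \<in> ents (lev (lev W)) k"
    unfolding t1_def t2_def using ents_map_sq[OF E iu_lev[OF W_0]] ents_map_sq[OF E iv_lev[OF W_0]]
    by (auto intro: ents_tn f2.W_0)
  have R: "M.apx ?Rm 1" "M.apx ?Rp 1"
  proof -
    have "M.apx (R3s c) 1" if "c \<in> {par_u - par_v, par_u + par_v}" for c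
      using M.F_add[OF M.F_mono[OF _ R3s_expand(1)[OF that], of "-1"] R3s_expand(2)[OF that]] M.F_one
      by (simp add: M.apx_def)
    then show "M.apx ?Rm 1" "M.apx ?Rp 1" by simp_all
  qed
  have H: "M.apx (tn1 (map_sq iu A)) ?H1" "M.apx (tn2 (map_sq iv A)) ?H2" if "A - diag3 ?h \<in> ents (lev F) (-1)" for A
  proof -
    have "tn1 (map_sq iu A) - ?H1 = tn1 (map_sq iu (A - diag3 ?h))" "tn2 (map_sq iv A) - ?H2 = tn2 (map_sq iv (A - diag3 ?h))"
      by (rule sqm_eqI, simp add: tn1_def tn2_def iu.hom_diff iv.hom_diff diag3_def diag32_def iu_kc iv_kc)+
    then show "M.apx (tn1 (map_sq iu A)) ?H1" "M.apx (tn2 (map_sq iv A)) ?H2"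
      using ents_map_sq[OF that iu_lev[OF F_0]] ents_map_sq[OF that iv_lev[OF F_0]] diag32_lev
      by (auto simp: M.apx_def intro: ents_tn f2.F_0)
  qed
  note m = H(1)[OF S_lead] and n = H(2)[OF S_lead] and m0 = H(1)[OF fusedS_lead] and n0 = H(2)[OF fusedS_lead]
  have one: "M.apx 1 1" using M.F_one M.F_0 by (simp add: M.apx_def)
  have z: "w - w \<in> ents (lev (lev W)) (k - 1)" for w :: "('g free_alg fls fls, ix3 \<times> ix3) sqm"
    using M.W_0 by simp
  note I = M.apx_lead[OF t(1) z R(1) M.apx_mult[OF R(2) n]]
    M.apx_lead[OF t(2) z M.apx_mult[OF M.apx_mult[OF R(1) m0] R(2)] one]
    M.apx_lead[OF t(2) z one M.apx_mult[OF M.apx_mult[OF R(2) m] R(1)]]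
    M.apx_lead[OF t(1) z M.apx_mult[OF n0 R(2)] R(1)]
  \<comment> \<open>A constant diagonal matrix on one tensor factor commutes with \<open>E\<close>
    on the other; this cancels the four leading terms in pairs.\<close>
  have comm: "t1 * ?H2 = ?H2 * t1" "?H1 * t2 = t2 * ?H1"
  proof -
    have "y * kc2 c = kc2 c * y" for y :: "'g free_alg fls fls" and c by (rule centralD[OF kc2.central_e, symmetric])
    then show "t1 * ?H2 = ?H2 * t1" "?H1 * t2 = t2 * ?H1"
      by (intro sqm_eqI, clarify, simp add: t1_def t2_def ent_tn1_tn2 diag32_def)+
  qed
  have UE: "map_sq iu S - map_sq iu ?S0 = map_sq iu (S - ?S0)" "map_sq iv S - map_sq iv ?S0 = map_sq iv (S - ?S0)"
    by (rule sqm_eqI, simp add: iu.hom_diff iv.hom_diff)+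
  have "RE3 S - RE3 ?S0 \<in> ents (lev (lev W)) (k - 1)"
  proof -
    note M.W_diff[OF M.W_add[OF I(1,2)] M.W_add[OF I(3,4)]]
    then show ?thesis
      unfolding RE3_def rdef_diff UE t1_def[symmetric] t2_def[symmetric]
      by (simp add: comm mult.assoc)
  qed
  from M.W_diff[OF M.W_diff[OF S_rel this] RE3_fusedS[OF D]]
  have \<psi>: "kc2.psi (leadterm B g) \<in> ents (lev (lev W)) (k - 1)" by simp
  have "ent (dB w0 w0 B) (p, q) (p', q') \<in> lev (lev W) (k - 1)" for p q p' q'
  proof -
    define N where "N = ent (lead1 (dB w0 w0 B) g) (fst (pos3 p p'), fst (pos3 q q')) (snd (pos3 p p'), snd (pos3 q q'))"
    have four: "kc2 4 = (1 + 1 + 1 + 1 :: 'g free_alg fls fls)"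
      unfolding kc2.hom_1[symmetric] kc2.hom_add[symmetric] by simp
    have "ent (kc2.psi (leadterm B g)) r s \<in> lev (lev W) (k - 1)" for r s
      using \<psi> unfolding ents_def mem_Collect_eq by blast
    then have "N + N + N + N \<in> lev (lev W) (k - 1)"
      unfolding psi_leadterm N_def by (simp only: ent_simps)
    then have "kc2 4 * N \<in> lev (lev W) (k - 1)"
      by (simp only: four distrib_right mult_1_left)
    then have "N \<in> lev (lev W) (k - 1)" by (rule kc2_mult_cancel) simp
    moreover obtain c where "c \<noteq> 0" "N = kc2 c * ent (dB w0 w0 B) (p, q) (p', q')"
      using ent_lead1_extract[OF g_nz] unfolding N_def by metis
    ultimately show ?thesis using kc2_mult_cancel by metis
  qed
  then have w0: "dB w0 w0 B \<in> ents (lev (lev W)) (k - 1)"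
    by (simp add: ents_def)
  \<comment> \<open>The bound was found at (2u, 2v); substituting u/2 and v/2 returns it to (u,
    v).\<close>
  have "dB w0 w0 B = map_sq (Sub2 w0 w0) (dB fls_X_inv fls_X_inv B)"
    by (rule Sub2_dB[symmetric]) (use aff_combination in auto)
  then have eq: "map_sq (Sub2 (aff (1/2) 0) (aff (1/2) 0)) (dB w0 w0 B) = dB fls_X_inv fls_X_inv B"
    by (simp only: map_sq_map_sq Sub2_inverse) (rule sqm_eqI, simp)
  show ?thesis
    unfolding eq[symmetric] by (rule ents_map_sq[OF w0]) (rule Sub2_lev; simp)
qed

text \<open>\<open>defect_step\<close> and \<open>reflection_step\<close> alternate. The start is
  free of relations: the defect of \<open>B\<close> has level 0 because all its factors do, and
  \<open>E\<close> has level -1 because both matrices share the constant term.\<close>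

theorem relations_descend:
  assumes FW_sub: "\<And>i. F i \<subseteq> W i"
  shows "dB fls_X_inv fls_X_inv B \<in> ents (lev (lev W)) (- int n)" and "S - fusedS B \<in> ents (lev W) (- int n)"
proof -
  have sub: "lev F i \<subseteq> lev W i" "lev (lev F) i \<subseteq> lev (lev W) i" for i
    using FW_sub unfolding lev_def by blast+
  have D0: "dB fls_X_inv fls_X_inv B \<in> ents (lev (lev W)) 0"
  proof -
    interpret M: filtered_pair "ents (lev (lev F))" "ents (lev (lev W)) :: int \<Rightarrow> ('g free_alg fls fls, ix2 \<times> ix2) sqm set"
      by (rule f2.filtered_pair_ents)
    interpret M0: filtered_pair "ents (lev (lev F))" "ents (lev (lev W)) :: int \<Rightarrow> ('g free_alg fls fls, ix2) sqm set"
      by (rule f2.filtered_pair_ents)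
    have c: "pu fls_X_inv - pv fls_X_inv \<noteq> 0" "1 / (pu fls_X_inv - pv fls_X_inv) \<in> lev (lev FC) (-1)"
      "pu fls_X_inv + pv fls_X_inv \<noteq> 0" "1 / (pu fls_X_inv + pv fls_X_inv) \<in> lev (lev FC) (-1)"
      unfolding X_inv_aff by (rule aff_combination; simp)+
    have flip: "flip_sq \<in> ents (lev (lev F)) 0"
      using f2.F_one f2.F_0 by (simp add: ents_def flip_sq_def)
    have R: "(R2s y :: ('g free_alg fls fls, ix2 \<times> ix2) sqm) \<in> ents (lev (lev F)) 0" if "1 / y \<in> lev (lev FC) (-1)" for y
      unfolding R2s_def by (rule M.F_diff[OF M.F_one M.FF'[OF cst_lev2[OF e2_lev[OF that]] flip]]) simp
    have d2: "diagc2 g \<in> ents (lev (lev F)) 0" by (auto simp: ents_def diagc2_def kc2_lev f2.F_0)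
    have B: "map_sq iu B \<in> ents (lev (lev F)) 0" "map_sq iv B \<in> ents (lev (lev F)) 0"
      using M0.F_of_cong[of _ _ 0, simplified, OF iu_lead[of 1 0, simplified] d2] M0.F_of_cong[of _ _ 0, simplified, OF iv_lead[of 1 0, simplified] d2]
      by (simp_all add: at_par_id flip: X_inv_aff)
    have "dB fls_X_inv fls_X_inv B \<in> ents (lev (lev F)) 0"
      unfolding dB_def rdef_def at_par_id
      by (intro M.F_diff M.FF'[where i = 0 and j = 0 and k = 0] R c ents_tn f2.F_0 B) simp_all
    then show ?thesis using sub(2)[of 0] unfolding ents_def mem_Collect_eq by blast
  qed
  have E0: "S - fusedS B \<in> ents (lev W) (0 + 1)"
  proof -
    interpret M3: filtered_pair "ents (lev F)" "ents (lev W) :: int \<Rightarrow> ('g free_alg fls, ix3) sqm set"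
      by (rule f1.filtered_pair_ents)
    have "S - fusedS B \<in> ents (lev F) (-1)"
      using M3.F_diff[OF S_lead fusedS_lead] by simp
    from M3.F_mono[OF _ this, of "0 + 1"] show ?thesis using sub(1)[of "0 + 1"] unfolding ents_def mem_Collect_eq by simp blast
  qed
  have "dB fls_X_inv fls_X_inv B \<in> ents (lev (lev W)) (- int n) \<and> S - fusedS B \<in> ents (lev W) (- int n)"
  proof (induction n)
    case 0
    show ?case using D0 defect_step[OF D0 E0] by simp
  next
    case (Suc n)
    have k: "- int (Suc n) = - int n - 1" by simp
    have D: "dB fls_X_inv fls_X_inv B \<in> ents (lev (lev W)) (- int (Suc n))"
      unfolding k using Suc reflection_step by blast
    moreover have "S - fusedS B \<in> ents (lev W) (- int (Suc n) + 1)" using Suc by simp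
    ultimately show ?case using defect_step by blast
  qed
  then show "dB fls_X_inv fls_X_inv B \<in> ents (lev (lev W)) (- int n)" "S - fusedS B \<in> ents (lev W) (- int n)"
    by simp_all
qed

end

subsection \<open>Solving for the two-dimensional generators\<close>

text \<open>Everything from degree 0 on: the levels of series then bound only the order in u^-1.
  With this filtration the leading-term estimates compute power series coefficient by
  coefficient.\<close>

definition F0 :: "int \<Rightarrow> 'a::zero set"
  where "F0 d = (if 0 \<le> d then UNIV else {0})"

lemma lev_F0: "f \<in> lev F0 k \<longleftrightarrow> (\<forall>n. n < - k \<longrightarrow> fls_nth f n = 0)"
proof -
  have "fls_nth f n \<in> F0 (n + k) \<longleftrightarrow> (n < - k \<longrightarrow> fls_nth f n = 0)" for n
    by (cases "n < - k") (auto simp: F0_def)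
  then show ?thesis by (simp add: lev_def)
qed

lemma alg_filt_F0: "alg_filt (F0 :: int \<Rightarrow> 'g free_alg set) F0"
  by unfold_locales (auto simp: F0_def split: if_splits)

lemma refl_data_F0:
  assumes "B - diagc g \<in> ents (lev F0) (-1)"
  shows "refl_data F0 F0 B g"
proof -
  interpret alg_filt "F0 :: int \<Rightarrow> 'a free_alg set" F0 by (rule alg_filt_F0)
  have "B \<in> dgs 0"
    using assms by (force simp: dgs_def ents_def lev_F0 diagc_def kc_def split: if_splits)
  then show ?thesis using assms by unfold_locales
qed

lemma kap_nonzero: "fls_subdegree w = -1 \<Longrightarrow> kap w m m \<noteq> 0"
proof -
  assume "fls_subdegree w = -1"
  from kap_add[OF this, of m m "- m" "- m" 0] have "kap w m m * kap w (-m) (-m) = 1"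
    by (simp add: kap_def)
  then show ?thesis by auto
qed

text \<open>The factor with which the coefficient of u^-r in entry (p, q) of the 2x2 matrix enters
  that of the fused matrix at \<open>pos3 p q\<close>: 2 for the two tensor factors, the only
  nonzero value of \<open>dl\<close>, and the scaling of u^-r under u := 2u.\<close>

definition pivot :: "(ix2 \<Rightarrow> complex) \<Rightarrow> ix2 \<Rightarrow> ix2 \<Rightarrow> nat \<Rightarrow> complex"
  where "pivot g p q r = 2 * dl g (fst (pos3 p q)) (snd (pos3 p q)) p q * kap w0 (int r) (int r)"

lemma pivot_nonzero:
  assumes "g Neg2 \<noteq> 0" "g Pos2 \<noteq> 0" shows "pivot g p q r \<noteq> 0"
proof -
  obtain c where "c \<noteq> 0" "\<And>p' q'. dl g (fst (pos3 p q)) (snd (pos3 p q)) p' q' = (if p' = p \<and> q' = q then c else 0)"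
    using dl_pos3[OF assms] by metis
  then show ?thesis using kap_nonzero[of w0 "int r"] by (simp add: pivot_def)
qed

lemma cmp_add: "kc.cmp (A + B) = kc.cmp A + kc.cmp B"
  by (rule sqm_eqI) (simp add: kc.cmp_def algebra_simps sum.distrib)

text \<open>To first order \<open>D\<close> stands in either tensor factor; the v_a are symmetric
  tensors, so both contributions agree.\<close>

lemma cmp_linear_part:
  fixes D :: "('g free_alg fls, ix2) sqm"
  shows "ent (kc.cmp (tn1 D * tn2 (diagc g) + tn1 (diagc g) * tn2 D)) a b =
    (\<Sum>p\<in>UNIV. \<Sum>q\<in>UNIV. kc (dl g a b p q) * ent D p q) + (\<Sum>p\<in>UNIV. \<Sum>q\<in>UNIV. kc (dl g a b p q) * ent D p q)"
proof -
  have c: "x * kc c = kc c * x" for x :: "'g free_alg fls" and c by (rule centralD[OF kc.central_e, symmetric])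
  have lc: "x * (kc c * y) = kc c * (x * y)" for x y :: "'g free_alg fls" and c by (rule central_left_commute[OF kc.central_e])
  have e: "ent (tn1 D * tn2 (diagc g) + tn1 (diagc g) * tn2 D) (p, r) (q, s) =
    (if r = s then kc (g r) * ent D p q else 0) + (if p = q then kc (g p) * ent D r s else 0)" for p q r s
    by (simp add: ent_tn1_tn2 diagc_def c)
  show ?thesis
    unfolding kc.cmp_def ent_Mk sum_UNIV_prod e fst_conv snd_conv
    by (cases a; cases b)
       (simp_all add: UNIV_ix2 jv_simps dl_def distrib_left lc add_ac flip: mult.assoc kc.hom_mult)
qed

text \<open>If two matrices agree below order r, then in order r the fused matrices differ by the
  linear part only, since the other factors may be replaced by constants, the R-matrix by 1 and both
  parameters by 2u. At \<open>pos3 p q\<close> the linear part involves one entry.\<close>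

lemma triangular:
  fixes C C' :: "('g free_alg fls, ix2) sqm"
  assumes g: "g Neg2 \<noteq> 0" "g Pos2 \<noteq> 0"
    and C: "C - diagc g \<in> ents (lev F0) (-1)" "C' - diagc g \<in> ents (lev F0) (-1)"
    and diff: "C - C' \<in> ents (lev F0) (- int r)"
  shows "fusedS C - fusedS C' \<in> ents (lev F0) (- int r)"
    and "fls_nth (ent (fusedS C - fusedS C') (fst (pos3 p q)) (snd (pos3 p q))) (int r) =
      scal (pivot g p q r) * fls_nth (ent (C - C') p q) (int r)"
proof -
  interpret C: refl_data F0 F0 C g by (rule refl_data_F0[OF C(1)])
  interpret C': refl_data F0 F0 C' g by (rule refl_data_F0[OF C(2)])
  interpret M: filtered_pair "ents (lev F0)" "ents (lev F0) :: int \<Rightarrow> ('g free_alg fls, ix2 \<times> ix2) sqm set"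
    by (rule C.f1.filtered_pair_ents)
  interpret M3: filtered_pair "ents (lev F0)" "ents (lev F0) :: int \<Rightarrow> ('g free_alg fls, ix3) sqm set"
    by (rule C.f1.filtered_pair_ents)
  define E where "E = C - C'"
  let ?k = "- int r"
  have E: "E \<in> ents (lev F0) ?k" using diff by (simp add: E_def)
  let ?D = "at_par w0 E"
  have at_diff: "at_par y C - at_par y C' = at_par y E" if "fls_subdegree y = -1" for y
  proof -
    interpret s: unital_hom "sbst scal y" by (rule scal.unital_hom_sbst) fact
    show ?thesis by (rule sqm_eqI) (simp add: at_par_def E_def s.hom_diff)
  qed
  have at_lev: "at_par (aff 2 c) E \<in> ents (lev F0) ?k" for c
    unfolding at_par_def
    by (rule ents_map_sq[OF E]) (rule C.sbst_lev[OF scal.scalar_embedding_axioms C.scal_F], simp)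
  have at_close: "at_par (aff 2 c) E - ?D \<in> ents (lev F0) (?k - 1)" for c
    using E by (auto simp: ents_def at_par_def aff_nth intro!: C.sbst_lev_diff[OF scal.scalar_embedding_axioms C.scal_F])
  have flip: "(flip_sq :: ('g free_alg fls, ix2 \<times> ix2) sqm) \<in> ents (lev F0) 0"
    using C.f1.F_one C.f1.F_0 by (simp add: ents_def flip_sq_def)
  have i4: "1 / aff 4 0 \<in> lev FC (-1)" by (rule inverse_aff_lev) simp
  let ?R = "1 - cst (e1 (1 / aff 4 0)) * flip_sq :: ('g free_alg fls, ix2 \<times> ix2) sqm"
  have R: "M.apx ?R 1"
    using M.F_uminus[OF M.FF'[OF C.cst_lev1[OF C.e1_lev[OF i4]] flip, of "-1"]] M.F_one by (simp add: M.apx_def)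
  have one: "M.apx 1 1" using M.F_one M.F_0 by (simp add: M.apx_def)
  have dg: "(diagc g :: ('g free_alg fls, ix2) sqm) \<in> ents (lev F0) 0"
    using C.kc_lev C.f1.F_0 by (auto simp: ents_def diagc_def)
  have T2: "M.apx (tn2 (at_par x2 C)) (tn2 (diagc g))" and T1: "M.apx (tn1 (at_par x1 C')) (tn1 (diagc g))"
    unfolding M.apx_def tn1_diff[symmetric] tn2_diff[symmetric]
    by (intro conjI ents_tn C.f1.F_0 C.at_par_lead C'.at_par_lead dg; simp)+
  have t1: "tn1 (at_par x1 E) \<in> ents (lev F0) ?k" "tn1 (at_par x1 E) - tn1 ?D \<in> ents (lev F0) (?k - 1)"
    and t2: "tn2 (at_par x2 E) \<in> ents (lev F0) ?k" "tn2 (at_par x2 E) - tn2 ?D \<in> ents (lev F0) (?k - 1)"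
    unfolding tn1_diff[symmetric] tn2_diff[symmetric] by (intro ents_tn C.f1.F_0 at_lev at_close)+
  have "fuse C - fuse C' = 1 * tn1 (at_par x1 E) * (?R * tn2 (at_par x2 C)) + tn1 (at_par x1 C') * ?R * tn2 (at_par x2 E) * 1"
    unfolding fuse_def by (simp add: algebra_simps tn1_diff tn2_diff flip: at_diff)
  note fd = this
  have "fuse C - fuse C' - (tn1 ?D * tn2 (diagc g) + tn1 (diagc g) * tn2 ?D) \<in> ents (lev F0) (?k - 1)"
    using M.W_add[OF M.apx_lead[OF t1 one M.apx_mult[OF R T2]] M.apx_lead[OF t2 M.apx_mult[OF T1 R] one]]
    unfolding fd by (simp only: mult_1_left mult_1_right add_diff_add)
  from C.cmp_lev[OF this]
  have c: "kc.cmp (fuse C - fuse C') - kc.cmp (tn1 ?D * tn2 (diagc g) + tn1 (diagc g) * tn2 ?D) \<in> ents (lev F0) (?k - 1)"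
    by (simp only: cmp_diff)
  have "fuse C - fuse C' \<in> ents (lev F0) ?k"
  proof -
    have "tn1 (at_par x1 E) * (?R * tn2 (at_par x2 C)) \<in> ents (lev F0) ?k"
      "tn1 (at_par x1 C') * ?R * tn2 (at_par x2 E) \<in> ents (lev F0) ?k"
      by (rule M.WF'[OF t1(1) M.apx_F0[OF M.apx_mult[OF R T2]]] M.FW'[OF M.apx_F0[OF M.apx_mult[OF T1 R]] t2(1)]; simp)+
    then show ?thesis
      unfolding fd mult_1_left mult_1_right by (rule M.W_add)
  qed
  then have ck: "kc.cmp (fuse C - fuse C') \<in> ents (lev F0) ?k" by (rule C.cmp_lev)
  let ?q = "cst (e1 (aff 4 0 / aff 4 (-1))) :: ('g free_alg fls, ix3) sqm"
  have q: "M3.apx ?q 1"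
    using C.cst_lev1[OF C.e1_lev[OF aff_quotient_lev(1)]] M3.F_one by (simp add: M3.apx_def e1.hom_diff cst.hom_diff)
  have f: "fusedS C - fusedS C' = ?q * kc.cmp (fuse C - fuse C')"
    by (simp add: fusedS_def cmp_diff right_diff_distrib)
  show "fusedS C - fusedS C' \<in> ents (lev F0) ?k"
    unfolding f by (rule M3.FW'[OF M3.apx_F0[OF q] ck]) simp
  have one3: "M3.apx 1 1" using M3.F_one M3.F_0 by (simp add: M3.apx_def)
  have "fusedS C - fusedS C' - kc.cmp (tn1 ?D * tn2 (diagc g) + tn1 (diagc g) * tn2 ?D) \<in> ents (lev F0) (?k - 1)"
    using M3.apx_lead[OF ck c q one3] by (simp add: f)
  then have "fls_nth (ent (fusedS C - fusedS C') a b) (int r) =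
      fls_nth (ent (kc.cmp (tn1 ?D * tn2 (diagc g) + tn1 (diagc g) * tn2 ?D)) a b) (int r)" for a b
    by (simp add: ents_def lev_F0)
  then have 1: "fls_nth (ent (fusedS C - fusedS C') (fst (pos3 p q)) (snd (pos3 p q))) (int r) =
      fls_nth ((\<Sum>p'\<in>UNIV. \<Sum>q'\<in>UNIV. kc (dl g (fst (pos3 p q)) (snd (pos3 p q)) p' q') * ent ?D p' q')
        + (\<Sum>p'\<in>UNIV. \<Sum>q'\<in>UNIV. kc (dl g (fst (pos3 p q)) (snd (pos3 p q)) p' q') * ent ?D p' q')) (int r)"
    by (simp only: cmp_linear_part)
  obtain c where cc: "c \<noteq> 0" "\<And>p' q'. dl g (fst (pos3 p q)) (snd (pos3 p q)) p' q' = (if p' = p \<and> q' = q then c else 0)"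
    using dl_pos3[OF g] by metis
  have "(\<Sum>p'\<in>UNIV. \<Sum>q'\<in>UNIV. kc (dl g (fst (pos3 p q)) (snd (pos3 p q)) p' q') * ent ?D p' q') = kc c * ent ?D p q"
    unfolding cc by (cases p; cases q) (simp_all add: UNIV_ix2)
  moreover have "kc c * x + kc c * x = kc (2 * c) * x" for x :: "'g free_alg fls"
    by (simp only: distrib_right[symmetric] kc.hom_add[symmetric] mult_2)
  moreover have "fls_nth (ent ?D p q) (int r) = scal (kap w0 (int r) (int r)) * fls_nth (ent E p q) (int r)"
    using E by (subst at_par_def) (simp add: ents_def lev_F0 scal.sbst_nth[of w0 "int r"])
  ultimately show "fls_nth (ent (fusedS C - fusedS C') (fst (pos3 p q)) (snd (pos3 p q))) (int r) =
      scal (pivot g p q r) * fls_nth (ent (C - C') p q) (int r)"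
    unfolding 1 pivot_def cc E_def[symmetric] by (simp add: fls_nth_kc_mult scal_mult mult.assoc)
qed

section \<open>Successive approximation\<close>

definition mono_fls :: "nat \<Rightarrow> 'a::zero \<Rightarrow> 'a fls"
  where "mono_fls r a = fps_to_fls (Abs_fps (\<lambda>n. if n = r then a else 0))"

lemma nth_mono_fls: "fls_nth (mono_fls r a) n = (if n = int r then a else 0)"
  by (auto simp: mono_fls_def)

text \<open>Step r + 1 adds in order r + 1 the current mismatch of the four entries divided by the
  pivots, and leaves lower orders alone.\<close>

fun approx_sol :: "(ix2 \<Rightarrow> complex) \<Rightarrow> ('g free_alg fls, ix3) sqm \<Rightarrow> nat \<Rightarrow> ('g free_alg fls, ix2) sqm" where
  "approx_sol g S 0 = diagc g"
| "approx_sol g S (Suc r) = approx_sol g S r + Mk (\<lambda>p q. mono_fls (Suc r)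
    (scal (1 / pivot g p q (Suc r)) *
      fls_nth (ent (S - fusedS (approx_sol g S r)) (fst (pos3 p q)) (snd (pos3 p q))) (int (Suc r))))"

text \<open>The limit: coefficient n no longer changes from the n-th approximation on.\<close>

definition sol :: "(ix2 \<Rightarrow> complex) \<Rightarrow> ('g free_alg fls, ix3) sqm \<Rightarrow> ('g free_alg fls, ix2) sqm"
  where "sol g S = Mk (\<lambda>p q. fps_to_fls (Abs_fps (\<lambda>n. fls_nth (ent (approx_sol g S n) p q) (int n))))"

lemma (in alg_filt) refl_data_FF:
  assumes "B \<in> dgs 0" "B - diagc g \<in> ents (lev F) (-1)"
  shows "refl_data F F B g"
  by (intro refl_data.intro alg_filt_F refl_data_axioms.intro assms)

text \<open>The bound \<open>lead0\<close> on the order drives the approximation. The bound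
  \<open>lead\<close> on the degree is carried along, so that the solution can enter the
  descent.\<close>

locale sol_data = alg_filt F W for F W :: "int \<Rightarrow> 'g free_alg set" +
  fixes S :: "('g free_alg fls, ix3) sqm" and g :: "ix2 \<Rightarrow> complex"
  assumes g: "g Neg2 \<noteq> 0" "g Pos2 \<noteq> 0" and lead: "S - diag3 (fused_diag g) \<in> ents (lev F) (-1)"
    and lead0: "S - diag3 (fused_diag g) \<in> ents (lev F0) (-1)"
begin

text \<open>By \<open>triangular\<close> a correction in order r + 1 leaves the four entries
  unchanged up to order r and alters order r + 1 by the correction times the pivot, which is exactly
  the mismatch. Degrees are kept, as the mismatch obeys the same bound.\<close>

lemma approx_sol:
  "approx_sol g S r - diagc g \<in> ents (lev F) (-1)"
  "approx_sol g S r - diagc g \<in> ents (lev F0) (-1)"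
  "\<And>n p q. n \<le> int r \<Longrightarrow> fls_nth (ent (S - fusedS (approx_sol g S r)) (fst (pos3 p q)) (snd (pos3 p q))) n = 0"
proof -
  let ?A = "\<lambda>r. approx_sol g S r - diagc g \<in> ents (lev F) (-1)"
    and ?B = "\<lambda>r. approx_sol g S r - diagc g \<in> ents (lev F0) (-1)"
    and ?C = "\<lambda>r n p q. fls_nth (ent (S - fusedS (approx_sol g S r)) (fst (pos3 p q)) (snd (pos3 p q))) n = 0"
  interpret G: alg_filt "F0 :: int \<Rightarrow> 'g free_alg set" F0 by (rule alg_filt_F0)
  interpret M: filtered_pair "ents (lev F)" "ents (lev W) :: int \<Rightarrow> ('g free_alg fls, ix2) sqm set"
    by (rule f1.filtered_pair_ents)
  interpret M0: filtered_pair "ents (lev F0)" "ents (lev F0) :: int \<Rightarrow> ('g free_alg fls, ix2) sqm set"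
    by (rule G.f1.filtered_pair_ents)
  interpret M3: filtered_pair "ents (lev F)" "ents (lev W) :: int \<Rightarrow> ('g free_alg fls, ix3) sqm set"
    by (rule f1.filtered_pair_ents)
  interpret M30: filtered_pair "ents (lev F0)" "ents (lev F0) :: int \<Rightarrow> ('g free_alg fls, ix3) sqm set"
    by (rule G.f1.filtered_pair_ents)
  note approx_sol.simps(2) [simp del]
  have tele: "a - d = (a - t) + (t - d)" for a t d :: "('g free_alg fls, ix2) sqm" by simp
  have dgs: "B \<in> dgs 0" if "B - diagc g \<in> ents (lev F0) (-1)" for B
    using refl_data.B_dgs[OF refl_data_F0[OF that]] .
  have "?A r \<and> ?B r \<and> (\<forall>n p q. n \<le> int r \<longrightarrow> ?C r n p q)"
  proof (induction r)
    case 0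
    have d: "(diagc g - diagc g :: ('g free_alg fls, ix2) sqm) \<in> ents (lev F0) (-1)" using M0.F_0 by simp
    from M30.F_diff[OF lead0 refl_data.fusedS_lead[OF refl_data_F0[OF d]]]
    have "S - fusedS (diagc g) \<in> ents (lev F0) (-1)" by simp
    then show ?case using M.F_0 M0.F_0 by (simp add: ents_def lev_F0)
  next
    case (Suc r)
    let ?T = "approx_sol g S r" and ?T' = "approx_sol g S (Suc r)"
    let ?c = "\<lambda>p q. fls_nth (ent (S - fusedS ?T) (fst (pos3 p q)) (snd (pos3 p q))) (int (Suc r))"
    have A: "?A r" and B: "?B r" using Suc by auto
    have C: "?C r n p q" if "n \<le> int r" for n p q using Suc that by auto
    have d: "?T' - ?T = Mk (\<lambda>p q. mono_fls (Suc r) (scal (1 / pivot g p q (Suc r)) * ?c p q))"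
      by (simp add: approx_sol.simps(2))
    have "S - fusedS ?T \<in> ents (lev F) (-1)"
      using M3.F_diff[OF lead refl_data.fusedS_lead[OF refl_data_FF[OF dgs[OF B] A]]] by simp
    then have "ent (S - fusedS ?T) a b \<in> lev F (-1)" for a b unfolding ents_def mem_Collect_eq by blast
    then have "?c p q \<in> F (int (Suc r) + (-1))" for p q unfolding lev_def by blast
    then have "scal (1 / pivot g p q (Suc r)) * ?c p q \<in> F (int (Suc r) + (-1))" for p q
      by (rule FF'[OF scal_F]) simp
    then have "?T' - ?T \<in> ents (lev F) (-1)"
      unfolding d by (simp add: ents_def lev_def nth_mono_fls F_0)
    from M.F_add[OF this A] have A': "?A (Suc r)" by (simp only: tele[of ?T' "diagc g" ?T])
    have d0: "?T' - ?T \<in> ents (lev F0) (- int (Suc r))"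
      unfolding d by (simp add: ents_def lev_F0 nth_mono_fls)
    have "?T' - ?T \<in> ents (lev F0) (-1)" by (rule M0.F_mono[OF _ d0]) simp
    from M0.F_add[OF this B] have B': "?B (Suc r)" by (simp only: tele[of ?T' "diagc g" ?T])
    note t = triangular[where g = g, OF g B' B d0]
    have "?C (Suc r) n p q" if n: "n \<le> int (Suc r)" for n p q
    proof -
      have eq: "S - fusedS ?T' = (S - fusedS ?T) - (fusedS ?T' - fusedS ?T)" by simp
      show ?thesis
      proof (cases "n = int (Suc r)")
        case True
        have "fls_nth (ent (?T' - ?T) p q) (int (Suc r)) = scal (1 / pivot g p q (Suc r)) * ?c p q"
          unfolding d by (simp add: nth_mono_fls)
        then have "fls_nth (ent (fusedS ?T' - fusedS ?T) (fst (pos3 p q)) (snd (pos3 p q))) (int (Suc r)) = ?c p q"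
          unfolding t(2) using pivot_nonzero[OF g, of p q "Suc r"] by (simp flip: mult.assoc scal_mult)
        then show ?thesis unfolding eq True ent_simps fls_minus_nth by simp
      next
        case False
        then have "fls_nth (ent (fusedS ?T' - fusedS ?T) a b) n = 0" for a b
          using t(1) n by (simp add: ents_def lev_F0)
        then show ?thesis using C[of n p q] False n unfolding eq ent_simps fls_minus_nth by simp
      qed
    qed
    then show ?case using A' B' by blast
  qed
  then show "?A r" "?B r" "\<And>n p q. n \<le> int r \<Longrightarrow> ?C r n p q" by blast+
qed

lemma approx_sol_stable:
  "n \<le> int r \<Longrightarrow> fls_nth (ent (approx_sol g S (r + m)) p q) n = fls_nth (ent (approx_sol g S r) p q) n"
  by (induction m) (auto simp: nth_mono_fls)

lemma nth_sol:
  "n \<le> int r \<Longrightarrow> fls_nth (ent (sol g S) p q) n = fls_nth (ent (approx_sol g S r) p q) n"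
proof -
  assume n: "n \<le> int r"
  have dgs: "approx_sol g S r \<in> dgs 0"
    using refl_data.B_dgs[OF refl_data_F0[OF approx_sol(2)]] .
  show ?thesis
  proof (cases "n < 0")
    case True
    then show ?thesis using dgs by (simp add: sol_def dgs_def)
  next
    case False
    then have "nat n + (r - nat n) = r" using n by simp
    then show ?thesis
      using approx_sol_stable[of n "nat n" "r - nat n" p q] False by (simp add: sol_def)
  qed
qed

lemma sol_lead: "sol g S - diagc g \<in> ents (lev F) (-1)" and sol_lead0: "sol g S - diagc g \<in> ents (lev F0) (-1)"
proof -
  have eq: "fls_nth (ent (sol g S - diagc g) p q) n = fls_nth (ent (approx_sol g S (nat n) - diagc g) p q) n" for p q n
    by (simp add: nth_sol[of n "nat n"])
  have "ent (approx_sol g S r - diagc g) p q \<in> lev F (-1)" "ent (approx_sol g S r - diagc g) p q \<in> lev F0 (-1)" for r p q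
    using approx_sol(1,2) unfolding ents_def mem_Collect_eq by blast+
  then show "sol g S - diagc g \<in> ents (lev F) (-1)" "sol g S - diagc g \<in> ents (lev F0) (-1)"
    unfolding ents_def lev_def mem_Collect_eq eq by blast+
qed

text \<open>By \<open>triangular\<close> the coefficients of the fused matrix up to order n depend
  only on those of its argument up to order n, so the limit inherits the equations of the
  approximations.\<close>

lemma fusedS_sol: "ent (S - fusedS (sol g S)) (fst (pos3 p q)) (snd (pos3 p q)) = 0"
proof (rule fls_eqI)
  fix n
  let ?r = "nat n" and ?T = "approx_sol g S (nat n)"
  interpret G: alg_filt "F0 :: int \<Rightarrow> 'g free_alg set" F0 by (rule alg_filt_F0)
  have "sol g S - ?T \<in> ents (lev F0) (- int (Suc ?r))"
    by (simp add: ents_def lev_F0 nth_sol[of _ ?r])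
  from triangular(1)[where g = g, OF g sol_lead0 approx_sol(2) this]
  have "fls_nth (ent (fusedS (sol g S) - fusedS ?T) a b) n = 0" for a b
    by (simp add: ents_def lev_F0)
  then show "fls_nth (ent (S - fusedS (sol g S)) (fst (pos3 p q)) (snd (pos3 p q))) n = fls_nth 0 n"
    using approx_sol(3)[of n ?r p q] by simp
qed

end

text \<open>The first coefficient in which \<open>C\<close> and \<open>C'\<close> differ would
  appear, times a nonzero pivot, in the same order of one of the four entries.\<close>

lemma fusedS_inj:
  assumes g: "g Neg2 \<noteq> 0" "g Pos2 \<noteq> 0"
    and C: "C - diagc g \<in> ents (lev F0) (-1)" "C' - diagc g \<in> ents (lev F0) (-1)"
    and eq: "\<And>p q. ent (fusedS C - fusedS C') (fst (pos3 p q)) (snd (pos3 p q)) = 0"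
  shows "C = (C' :: ('g free_alg fls, ix2) sqm)"
proof -
  interpret G: alg_filt "F0 :: int \<Rightarrow> 'g free_alg set" F0 by (rule alg_filt_F0)
  interpret M0: filtered_pair "ents (lev F0)" "ents (lev F0) :: int \<Rightarrow> ('g free_alg fls, ix2) sqm set"
    by (rule G.f1.filtered_pair_ents)
  have *: "C - C' \<in> ents (lev F0) (- int (Suc r))" for r
  proof (induction r)
    case 0
    show ?case using M0.F_diff[OF C] by simp
  next
    case (Suc r)
    have "fls_nth (ent (C - C') p q) (int (Suc r)) = 0" for p q
    proof -
      have "scal (pivot g p q (Suc r)) * fls_nth (ent (C - C') p q) (int (Suc r)) = 0"
        using triangular(2)[where g = g, OF g C Suc] eq by simp
      then have "scal (1 / pivot g p q (Suc r)) * (scal (pivot g p q (Suc r)) * fls_nth (ent (C - C') p q) (int (Suc r))) = 0"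
        by simp
      then show ?thesis using pivot_nonzero[OF g, of p q "Suc r"] by (simp flip: mult.assoc scal_mult)
    qed
    then have "fls_nth (ent (C - C') p q) n = 0" if "n < int (Suc (Suc r))" for p q n
      using Suc that by (cases "n = int (Suc r)") (simp_all add: ents_def lev_F0)
    then show ?case unfolding ents_def lev_F0 mem_Collect_eq by simp
  qed
  show ?thesis
  proof (intro sqm_eqI fls_eqI)
    fix p q n
    show "fls_nth (ent C p q) n = fls_nth (ent C' p q) n"
      using *[of "nat n"] by (simp add: ents_def lev_F0)
  qed
qed

subsection \<open>The degree filtration\<close>

text \<open>The generator attached to u^-(r+1) counts r. This shift by one puts the generating
  matrix minus its constant term into level -1.\<close>

definition wdeg :: "('n \<times> 'n \<times> nat) list \<Rightarrow> nat"
  where "wdeg w = sum_list (map (\<lambda>x. snd (snd x)) w)"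

definition Fdeg :: "int \<Rightarrow> ('n \<times> 'n \<times> nat) free_alg set"
  where "Fdeg d = {p. \<forall>w\<in>Poly_Mapping.keys p. int (wdeg w) \<le> d}"

definition Wdeg :: "('n \<times> 'n \<times> nat) free_alg set \<Rightarrow> int \<Rightarrow> ('n \<times> 'n \<times> nat) free_alg set"
  where "Wdeg rels d = {x + y | x y. x \<in> rel_ideal rels \<and> y \<in> Fdeg d}"

lemma Fdeg_mult: "p \<in> Fdeg i \<Longrightarrow> q \<in> Fdeg j \<Longrightarrow> p * q \<in> Fdeg (i + j)"
proof -
  assume pq: "p \<in> Fdeg i" "q \<in> Fdeg j"
  have "int (wdeg w) \<le> i + j" if w: "w \<in> Poly_Mapping.keys (p * q)" for w
  proof -
    from w keys_mult[of p q] obtain a b where ab: "w = a @ b" "a \<in> Poly_Mapping.keys p" "b \<in> Poly_Mapping.keys q"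
      by auto
    have "int (wdeg w) = int (wdeg a) + int (wdeg b)" by (simp add: ab wdeg_def)
    then show ?thesis using pq ab by (fastforce simp: Fdeg_def)
  qed
  then show ?thesis by (simp add: Fdeg_def)
qed

lemma Fdeg_add: "p \<in> Fdeg d \<Longrightarrow> q \<in> Fdeg d \<Longrightarrow> p + q \<in> Fdeg d"
  using Poly_Mapping.keys_add[of p q] by (fastforce simp: Fdeg_def)

lemma Fdeg_basic: "0 \<in> Fdeg d" "p \<in> Fdeg d \<Longrightarrow> - p \<in> Fdeg d" "i \<le> j \<Longrightarrow> p \<in> Fdeg i \<Longrightarrow> p \<in> Fdeg j"
  "scal c \<in> Fdeg 0" "gen (i', j', k) \<in> Fdeg (int k)"
  by (auto simp: Fdeg_def scal_def gen_def wdeg_def)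

lemma Fdeg_negative: "d < 0 \<Longrightarrow> Fdeg d = {0}"
  by (auto simp: Fdeg_def)

lemma alg_filt_deg: "alg_filt Fdeg (Wdeg rels)"
proof
  fix k i j :: int and x y :: "('a \<times> 'a \<times> nat) free_alg"
  show "1 \<in> (Fdeg 0 :: ('a \<times> 'a \<times> nat) free_alg set)" using Fdeg_basic(4)[of 1] by simp
  show "0 \<in> Wdeg rels k" unfolding Wdeg_def using Fdeg_basic(1) by force
  show "x + y \<in> Wdeg rels k" if "x \<in> Wdeg rels k" "y \<in> Wdeg rels k"
  proof -
    from that obtain a b c d where "x = a + b" "y = c + d" "a \<in> rel_ideal rels" "b \<in> Fdeg k" "c \<in> rel_ideal rels" "d \<in> Fdeg k"
      unfolding Wdeg_def by auto
    moreover from this have "x + y = (a + c) + (b + d)" by simp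
    ultimately show ?thesis unfolding Wdeg_def using rel_ideal_add Fdeg_add by blast
  qed
  show "- x \<in> Wdeg rels k" if "x \<in> Wdeg rels k"
  proof -
    from that obtain a b where "x = a + b" "a \<in> rel_ideal rels" "b \<in> Fdeg k" unfolding Wdeg_def by auto
    moreover from this have "- x = - a + - b" by simp
    ultimately show ?thesis unfolding Wdeg_def using rel_ideal_uminus Fdeg_basic(2) by blast
  qed
  show "x \<in> Wdeg rels j" if "i \<le> j" "x \<in> Wdeg rels i"
    using that Fdeg_basic(3) unfolding Wdeg_def by blast
  show "x * y \<in> Wdeg rels (i + j)" if "x \<in> Fdeg i" "y \<in> Wdeg rels j"
  proof -
    from that obtain a b where "y = a + b" "a \<in> rel_ideal rels" "b \<in> Fdeg j" unfolding Wdeg_def by auto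
    moreover from this have "x * y = x * a + x * b" by (simp add: distrib_left)
    ultimately show ?thesis unfolding Wdeg_def using rel_ideal_mult_left Fdeg_mult that by blast
  qed
  show "x * y \<in> Wdeg rels (i + j)" if "x \<in> Wdeg rels i" "y \<in> Fdeg j"
  proof -
    from that obtain a b where "x = a + b" "a \<in> rel_ideal rels" "b \<in> Fdeg i" unfolding Wdeg_def by auto
    moreover from this have "x * y = a * y + b * y" by (simp add: distrib_right)
    ultimately show ?thesis unfolding Wdeg_def using rel_ideal_mult_right Fdeg_mult that by blast
  qed
qed (auto intro: Fdeg_basic Fdeg_add Fdeg_mult)

lemma Fdeg_sub_Wdeg: "Fdeg d \<subseteq> Wdeg rels d"
  unfolding Wdeg_def using rel_ideal_zero by force

text \<open>No word has negative degree, so here a degree bound becomes membership in the ideal: the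
  end of the descent.\<close>

lemma Wdeg_negative: "d < 0 \<Longrightarrow> Wdeg rels d = rel_ideal rels"
  by (simp add: Wdeg_def Fdeg_negative)

text \<open>With constant filtrations levels carry no information, and every estimate turns into a
  congruence modulo the ideal.\<close>

lemma alg_filt_ideal: "alg_filt (\<lambda>_. UNIV) (\<lambda>_. rel_ideal rels)"
  by unfold_locales (auto intro: rel_ideal_add rel_ideal_uminus rel_ideal_mult_left rel_ideal_mult_right)

subsection \<open>The presentations\<close>

definition genm :: "complex^'n^'n \<Rightarrow> (('n \<times> 'n \<times> nat) free_alg fls, 'n) sqm"
  where "genm G = map_sq fps_to_fls (sq (gen_mat G))"

lemma nth_genm: "fls_nth (ent (genm G) i j) n = (if n < 0 then 0 else if n = 0 then scal (G $ i $ j) else gen (i, j, nat n - 1))"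
proof (cases "nat n")
  case (Suc k)
  then show ?thesis by (auto simp: genm_def gen_mat_def)
qed (auto simp: genm_def gen_mat_def)

lemma genm_lead:
  "genm G - Mk (\<lambda>i j. kc (G $ i $ j)) \<in> ents (lev Fdeg) (-1)" "genm G - Mk (\<lambda>i j. kc (G $ i $ j)) \<in> ents (lev F0) (-1)"
proof -
  have "fls_nth (ent (genm G) i j - kc (G $ i $ j)) n \<in> Fdeg (n + -1)" for i j n
    using Fdeg_basic(5)[of i j "nat n - 1"] Fdeg_basic(1) by (auto simp: nth_genm kc_def nat_diff_distrib')
  then show "genm G - Mk (\<lambda>i j. kc (G $ i $ j)) \<in> ents (lev Fdeg) (-1)"
    by (simp add: ents_def lev_def)
  show "genm G - Mk (\<lambda>i j. kc (G $ i $ j)) \<in> ents (lev F0) (-1)"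
    by (auto simp: ents_def lev_F0 nth_genm kc_def)
qed

lemma sq_scale: "sq (scale c A) = cst c * sq A"
  by (rule sqm_eqI) (simp add: scale_def map_mat_def)

lemma map_sq_R2: "map_sq e2 (sq (R2 c)) = (R2s c :: ('g free_alg fls fls, ix2 \<times> ix2) sqm)"
proof -
  interpret m: unital_hom "map_sq e2 :: (complex fls fls, ix2 \<times> ix2) sqm \<Rightarrow> ('g free_alg fls fls, ix2 \<times> ix2) sqm"
    by (rule unital_hom_map_sq[OF unital_hom_e2])
  show ?thesis
    unfolding R2_def R2s_def sq_simps sq_scale sq_Pmat m.hom_diff m.hom_mult m.hom_1
      map_sq_cst[of e2, OF e2.hom_0] map_sq_flip[of e2, OF e2.hom_0 e2.hom_1] ..
qed

lemma map_sq_R3: "map_sq e2 (sq (R3 c)) = (R3s c :: ('g free_alg fls fls, ix3 \<times> ix3) sqm)"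
proof -
  interpret m: unital_hom "map_sq e2 :: (complex fls fls, ix3 \<times> ix3) sqm \<Rightarrow> ('g free_alg fls fls, ix3 \<times> ix3) sqm"
    by (rule unital_hom_map_sq[OF unital_hom_e2])
  show ?thesis
    unfolding R3_def R3s_def sq_simps sq_scale sq_Pmat sq_Qmat3 m.hom_diff m.hom_add m.hom_mult m.hom_1
      map_sq_cst[of e2, OF e2.hom_0] map_sq_flip[of e2, OF e2.hom_0 e2.hom_1] map_sq_Qs[of e2, OF e2.hom_0 e2.hom_1] ..
qed

lemma refl_rels_eq:
  "refl_rels Rm Rp G = {fls_nth (fls_nth (ent (rdef (map_sq e2 (sq Rm)) (map_sq e2 (sq Rp))
      (map_sq iu (genm G)) (map_sq iv (genm G))) \<alpha> \<beta>) m) n | \<alpha> \<beta> m n. True}"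
proof -
  have e: "map_mat (fls_map (fls_map scal)) = map_mat e2"
    by (simp add: e2_def[abs_def] e1_def[abs_def])
  have S: "sq (map_mat in_u (gen_mat G)) = map_sq iu (genm G)" "sq (map_mat in_v (gen_mat G)) = map_sq iv (genm G)"
    by (rule sqm_eqI, simp add: map_mat_def genm_def in_u_def in_v_def iu_def iv_def)+
  have "sq (map_mat e2 Rm ** tens1 (map_mat in_u (gen_mat G)) ** map_mat e2 Rp ** tens2 (map_mat in_v (gen_mat G))
     - tens2 (map_mat in_v (gen_mat G)) ** map_mat e2 Rp ** tens1 (map_mat in_u (gen_mat G)) ** map_mat e2 Rm) =
     rdef (map_sq e2 (sq Rm)) (map_sq e2 (sq Rp)) (map_sq iu (genm G)) (map_sq iv (genm G))"
    by (simp only: sq_simps sq_tens1 sq_tens2 sq_map_mat[of e2] S rdef_def)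
  then show ?thesis
    by (simp only: refl_rels_def Let_def e ent_sq[symmetric, of "_ - _"])
qed

lemma B_rels_eq: "B_rels q = {fls_nth (fls_nth (ent (dB fls_X_inv fls_X_inv (genm (B_lead q))) \<alpha> \<beta>) m) n | \<alpha> \<beta> m n. True}"
  unfolding B_rels_def refl_rels_eq dB_def at_par_id map_sq_R2 par_u_eq par_v_eq ..

lemma X_rels_eq: "X_rels q = {fls_nth (fls_nth (ent (RE3 (genm (X_lead q))) \<alpha> \<beta>) m) n | \<alpha> \<beta> m n. True}"
  unfolding X_rels_def refl_rels_eq RE3_def map_sq_R3 ..

lemma X_rel_mem: "fls_nth (fls_nth (ent (RE3 (genm (X_lead q))) \<alpha> \<beta>) m) n \<in> rel_ideal (X_rels q)"
  by (rule rel_ideal_base) (unfold X_rels_eq, blast)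

lemma B_rel_mem: "fls_nth (fls_nth (ent (dB fls_X_inv fls_X_inv (genm (B_lead q))) \<alpha> \<beta>) m) n \<in> rel_ideal (B_rels q)"
  by (rule rel_ideal_base) (unfold B_rels_eq, blast)

lemma rel_ideal_sub_Wdeg: "x \<in> rel_ideal rels \<Longrightarrow> x \<in> Wdeg rels d"
  unfolding Wdeg_def mem_Collect_eq by (rule exI[of _ x], rule exI[of _ 0]) (simp add: Fdeg_basic)

definition bl :: "nat \<Rightarrow> ix2 \<Rightarrow> complex"
  where "bl q i = (case i of Neg2 \<Rightarrow> 1 | Pos2 \<Rightarrow> (-1) ^ q)"

lemma bl_simps [simp]: "bl q Neg2 = 1" "bl q Pos2 = (-1) ^ q"
  by (simp_all add: bl_def)

lemma B_lead_bl: "Mk (\<lambda>i j. kc (B_lead q $ i $ j)) = diagc (bl q)"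
proof (rule sqm_eqI)
  fix i j show "ent (Mk (\<lambda>i j. kc (B_lead q $ i $ j))) i j = ent (diagc (bl q)) i j"
    by (cases i; cases j) (simp_all add: B_lead_def munit_def scale_def map_mat_def diagc_def)
qed

lemma X_lead_bl: "q \<in> {0, 1} \<Longrightarrow> Mk (\<lambda>i j. kc (X_lead q $ i $ j)) = diag3 (fused_diag (bl q))"
proof (rule sqm_eqI)
  fix i j assume "q \<in> {0, 1}"
  then show "ent (Mk (\<lambda>i j. kc (X_lead q $ i $ j))) i j = ent (diag3 (fused_diag (bl q))) i j"
    by (cases i; cases j) (auto simp: X_lead_def diag_mat_def mat_def diag3_def)
qed

section \<open>Transport along homomorphisms over the scalars\<close>

text \<open>A homomorphism that fixes the scalars commutes with substitution of parameters, fusion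
  and all relation defects; the images of relations are therefore the same expressions in the images
  of the generating matrices.\<close>

locale scalar_hom = unital_hom h for h :: "'g free_alg \<Rightarrow> 'h free_alg" +
  assumes h_scal [simp]: "h (scal c) = scal c"
begin

sublocale h1: unital_hom "fls_map h" by (rule unital_hom_fls_map) (rule unital_hom_axioms)
sublocale h2: unital_hom "fls_map (fls_map h)" by (rule unital_hom_fls_map) (rule h1.unital_hom_axioms)

lemma nth_h1 [simp]: "fls_nth (fls_map h f) n = h (fls_nth f n)"
  and nth_h2 [simp]: "fls_nth (fls_map (fls_map h) F) n = fls_map h (fls_nth F n)"
  by (simp_all add: fls_nth_fls_map)

lemma h_scalars: "fls_map h (kc c) = kc c" "fls_map h (e1 x) = e1 x" "fls_map (fls_map h) (e2 y) = e2 y"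
    "fls_map (fls_map h) (iu f) = iu (fls_map h f)" "fls_map (fls_map h) (iv f) = iv (fls_map h f)"
proof -
  show "fls_map h (kc c) = kc c" and *: "fls_map h (e1 x) = e1 x" for c x
    by (rule fls_eqI, simp add: kc_def)+
  show "fls_map (fls_map h) (e2 y) = e2 y" by (rule fls_eqI) (simp add: *)
  show "fls_map (fls_map h) (iu f) = iu (fls_map h f)" by (rule fls_eqI, rule fls_eqI) simp
  show "fls_map (fls_map h) (iv f) = iv (fls_map h f)" by (rule fls_eqI) simp
qed

lemma map_at_par: "fls_subdegree w = -1 \<Longrightarrow> map_sq (fls_map h) (at_par w A) = at_par w (map_sq (fls_map h) A)"
  by (rule sqm_eqI) (simp add: at_par_def fls_map_sbst[OF scal.scalar_embedding_axioms unital_hom_axioms _ _ scal.scalar_embedding_axioms])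

lemma map_cmp: "map_sq (fls_map h) (kc.cmp A) = kc.cmp (map_sq (fls_map h) A)"
  by (rule sqm_eqI) (simp add: kc.cmp_def h1.hom_sum h1.hom_mult h_scalars)

lemma map_fusedS: "map_sq (fls_map h) (fusedS B) = fusedS (map_sq (fls_map h) B)"
proof -
  interpret m2: unital_hom "map_sq (fls_map h) :: ('g free_alg fls, ix2 \<times> ix2) sqm \<Rightarrow> _" by (rule unital_hom_map_sq) (rule h1.unital_hom_axioms)
  interpret m3: unital_hom "map_sq (fls_map h) :: ('g free_alg fls, ix3) sqm \<Rightarrow> _" by (rule unital_hom_map_sq) (rule h1.unital_hom_axioms)
  have z: "fls_map h 0 = 0" "fls_map h 1 = 1" by (rule h1.hom_0 h1.hom_1)+
  have "map_sq (fls_map h) (fuse B) = fuse (map_sq (fls_map h) B)"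
    unfolding fuse_def m2.hom_mult m2.hom_diff m2.hom_1 map_sq_tn1[of "fls_map h", OF z(1)] map_sq_tn2[of "fls_map h", OF z(1)]
      map_sq_flip[of "fls_map h", OF z] map_sq_cst[of "fls_map h", OF z(1)] h_scalars
    by (simp add: map_at_par)
  then show ?thesis
    unfolding fusedS_def m3.hom_mult map_cmp map_sq_cst[of "fls_map h", OF z(1)] h_scalars by simp
qed

lemma map_rdef: "map_sq (fls_map (fls_map h)) (rdef Rm Rp M N) =
    rdef (map_sq (fls_map (fls_map h)) Rm) (map_sq (fls_map (fls_map h)) Rp) (map_sq (fls_map (fls_map h)) M) (map_sq (fls_map (fls_map h)) N)"
  for M :: "('g free_alg fls fls, 'n::finite) sqm"
proof -
  interpret m: unital_hom "map_sq (fls_map (fls_map h)) :: ('g free_alg fls fls, 'n \<times> 'n) sqm \<Rightarrow> _" by (rule unital_hom_map_sq) (rule h2.unital_hom_axioms)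
  have z: "fls_map (fls_map h) 0 = 0" by (rule h2.hom_0)
  show ?thesis
    unfolding rdef_def m.hom_mult m.hom_diff map_sq_tn1[of "fls_map (fls_map h)", OF z] map_sq_tn2[of "fls_map (fls_map h)", OF z] ..
qed

lemma map_iu_iv: "map_sq (fls_map (fls_map h)) (map_sq iu A) = map_sq iu (map_sq (fls_map h) A)"
    "map_sq (fls_map (fls_map h)) (map_sq iv A) = map_sq iv (map_sq (fls_map h) A)"
  by (rule sqm_eqI, simp add: h_scalars)+

lemma map_R: "map_sq (fls_map (fls_map h)) (R2s c :: ('g free_alg fls fls, 'n::finite \<times> 'n) sqm) = R2s c" "map_sq (fls_map (fls_map h)) (R3s c) = R3s c"
proof -
  interpret m: unital_hom "map_sq (fls_map (fls_map h)) :: ('g free_alg fls fls, 'n \<times> 'n) sqm \<Rightarrow> _" by (rule unital_hom_map_sq) (rule h2.unital_hom_axioms)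
  interpret m3: unital_hom "map_sq (fls_map (fls_map h)) :: ('g free_alg fls fls, ix3 \<times> ix3) sqm \<Rightarrow> _" by (rule unital_hom_map_sq) (rule h2.unital_hom_axioms)
  note z = h2.hom_0 h2.hom_1
  show "map_sq (fls_map (fls_map h)) (R2s c :: ('g free_alg fls fls, 'n::finite \<times> 'n) sqm) = R2s c"
    unfolding R2s_def m.hom_diff m.hom_mult m.hom_1 map_sq_cst[of "fls_map (fls_map h)", OF z(1)]
      map_sq_flip[of "fls_map (fls_map h)", OF z] h_scalars ..
  show "map_sq (fls_map (fls_map h)) (R3s c) = R3s c"
    unfolding R3s_def m3.hom_diff m3.hom_add m3.hom_mult m3.hom_1 map_sq_cst[of "fls_map (fls_map h)", OF z(1)]
      map_sq_flip[of "fls_map (fls_map h)", OF z] map_sq_Qs[of "fls_map (fls_map h)", OF z] h_scalars ..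
qed

lemma map_dB: "map_sq (fls_map (fls_map h)) (dB fls_X_inv fls_X_inv B) = dB fls_X_inv fls_X_inv (map_sq (fls_map h) B)"
  and map_RE3: "map_sq (fls_map (fls_map h)) (RE3 S) = RE3 (map_sq (fls_map h) S)"
  unfolding dB_def RE3_def at_par_id map_rdef map_iu_iv map_R by (rule refl)+

end

lemma scalar_hom_fext: "scalar_hom (fext f)"
  by unfold_locales (simp_all add: fext_add fext_mult)

text \<open>The values on generators for which the generating matrix goes to \<open>A\<close>; by
  \<open>map_genm\<close> this works when \<open>A\<close> has the right constant term.\<close>

definition from_matrix :: "('h free_alg fls, 'n) sqm \<Rightarrow> 'n \<times> 'n \<times> nat \<Rightarrow> 'h free_alg"
  where "from_matrix A x = fls_nth (ent A (fst x) (fst (snd x))) (int (Suc (snd (snd x))))"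

lemma map_genm:
  assumes "A - Mk (\<lambda>i j. kc (G $ i $ j)) \<in> ents (lev F0) (-1)"
  shows "map_sq (fls_map (fext (from_matrix A))) (genm G) = A"
proof (rule sqm_eqI, rule fls_eqI)
  fix i j n
  interpret scalar_hom "fext (from_matrix A)" by (rule scalar_hom_fext)
  have "fls_nth (ent (A - Mk (\<lambda>i j. kc (G $ i $ j))) i j) n = 0" if "n < 1"
    using assms that by (simp add: ents_def lev_F0)
  then have "fls_nth (ent A i j) n = (if n = 0 then scal (G $ i $ j) else 0)" if "n < 1"
    using that by (auto simp: kc_def)
  then show "fls_nth (ent (map_sq (fls_map (fext (from_matrix A))) (genm G)) i j) n = fls_nth (ent A i j) n"
    by (auto simp: nth_genm from_matrix_def)
qed

lemma gen_nth: "gen z = fls_nth (ent (genm G) (fst z) (fst (snd z))) (int (Suc (snd (snd z))))"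
  for z :: "'n::finite \<times> 'n \<times> nat"
  by (simp add: nth_genm del: of_nat_Suc)

lemma lev_lev_ideal: "f \<in> lev (lev (\<lambda>_. J)) k \<longleftrightarrow> (\<forall>m n. fls_nth (fls_nth f m) n \<in> J)"
  by (simp add: lev_def)

text \<open>\<open>f\<close> sends the generating matrix of the orthogonal algebra to the fused
  matrix of \<open>B\<close>, and \<open>f'\<close> sends \<open>B\<close> to the solution \<beta>.
  The first claim is fusion, the second and third are the two halves of the descent, and the fourth
  is uniqueness of the solution.\<close>

theorem X_B_substitutions:
  assumes q: "q \<in> {0, 1}"
  defines "f \<equiv> from_matrix (fusedS (genm (B_lead q)))" and "f' \<equiv> from_matrix (sol (bl q) (genm (X_lead q)))"
  shows "x \<in> X_rels q \<Longrightarrow> fext f x \<in> rel_ideal (B_rels q)"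
    and "y \<in> B_rels q \<Longrightarrow> fext f' y \<in> rel_ideal (X_rels q)"
    and "fext f' (f z) - gen z \<in> rel_ideal (X_rels q)"
    and "fext f (f' w) - gen w \<in> rel_ideal (B_rels q)"
    and "map_sq (fls_map (fext f)) (genm (X_lead q)) = fusedS (genm (B_lead q))"
proof -
  let ?S = "genm (X_lead q)" and ?B = "genm (B_lead q)" and ?g = "bl q"
  define \<beta> where "\<beta> = sol ?g ?S"
  have g: "?g Neg2 \<noteq> 0" "?g Pos2 \<noteq> 0" by simp_all
  note Sl = genm_lead[of "X_lead q", unfolded X_lead_bl[OF q]] and Bl = genm_lead[of "B_lead q", unfolded B_lead_bl]
  interpret A: alg_filt Fdeg "Wdeg (X_rels q)" by (rule alg_filt_deg)
  interpret sd: sol_data Fdeg "Wdeg (X_rels q)" ?S ?g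
    by unfold_locales (use g Sl in simp_all)
  note \<beta>l = sd.sol_lead[folded \<beta>_def] sd.sol_lead0[folded \<beta>_def]
  have \<beta>dgs: "\<beta> \<in> dgs 0" by (rule refl_data.B_dgs[OF refl_data_F0[OF \<beta>l(2)]])
  have Bdgs: "?B \<in> dgs 0" by (rule refl_data.B_dgs[OF refl_data_F0[OF Bl(2)]])
  have Sdgs: "?S \<in> dgs 0" by (auto simp: dgs_def nth_genm)
  interpret hf: scalar_hom "fext f" by (rule scalar_hom_fext)
  interpret hf': scalar_hom "fext f'" by (rule scalar_hom_fext)
  interpret fd: fused_data Fdeg "Wdeg (X_rels q)" \<beta> ?g ?S
  proof unfold_locales
    show "RE3 ?S \<in> ents (lev (lev (Wdeg (X_rels q)))) j" for j
      unfolding ents_def lev_def mem_Collect_eq by (intro allI rel_ideal_sub_Wdeg X_rel_mem)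
    show "ent (?S - fusedS \<beta>) (fst (pos3 p r)) (snd (pos3 p r)) = 0" for p r
      unfolding \<beta>_def by (rule sd.fusedS_sol)
  qed (rule \<beta>dgs \<beta>l(1) Sdgs Sl(1) g)+
  have map_f: "map_sq (fls_map (fext f)) ?S = fusedS ?B"
    unfolding f_def by (rule map_genm, unfold X_lead_bl[OF q]) (rule refl_data.fusedS_lead[OF refl_data_F0[OF Bl(2)]])
  have map_f': "map_sq (fls_map (fext f')) ?B = \<beta>"
    unfolding f'_def \<beta>_def[symmetric] by (rule map_genm, unfold B_lead_bl) (rule \<beta>l(2))
  show "map_sq (fls_map (fext f)) ?S = fusedS ?B" by (rule map_f)
  show "fext f x \<in> rel_ideal (B_rels q)" if x: "x \<in> X_rels q"
  proof -
    \<comment> \<open>Modulo the ideal of the reflection relations the defect of \<open>B\<close> is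
      zero in every level. \<open>RE3_fusedS\<close> then says that the fused matrix satisfies the
      orthogonal relations modulo this ideal.\<close>
    interpret Bf: alg_filt "\<lambda>_. UNIV" "\<lambda>_. rel_ideal (B_rels q)" by (rule alg_filt_ideal)
    interpret Br: refl_data "\<lambda>_. UNIV" "\<lambda>_. rel_ideal (B_rels q)" ?B ?g
      by unfold_locales (use Bdgs in \<open>simp_all add: ents_def lev_def\<close>)
    have D: "dB fls_X_inv fls_X_inv ?B \<in> ents (lev (lev (\<lambda>_. rel_ideal (B_rels q)))) 0"
      unfolding ents_def lev_def mem_Collect_eq by (intro allI B_rel_mem)
    have "fls_nth (fls_nth (ent (RE3 (fusedS ?B)) \<alpha> \<beta>) m) n \<in> rel_ideal (B_rels q)" for \<alpha> \<beta> m n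
    proof -
      have "fls_nth (fls_nth (ent (RE3 (fusedS ?B) - kc2.psi (leadterm ?B ?g)) \<alpha> \<beta>) m) n \<in> rel_ideal (B_rels q)"
        "fls_nth (fls_nth (ent (kc2.psi (leadterm ?B ?g)) \<alpha> \<beta>) m) n \<in> rel_ideal (B_rels q)"
        using Br.RE3_fusedS[OF D] Br.leadterm_lev[OF D] unfolding ents_def mem_Collect_eq lev_lev_ideal by blast+
      from rel_ideal_add[OF this] show ?thesis by simp
    qed
    moreover obtain \<alpha> \<beta> m n where "x = fls_nth (fls_nth (ent (RE3 ?S) \<alpha> \<beta>) m) n"
      using x unfolding X_rels_eq by blast
    then have "fext f x = fls_nth (fls_nth (ent (map_sq (fls_map (fls_map (fext f))) (RE3 ?S)) \<alpha> \<beta>) m) n"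
      by simp
    ultimately show ?thesis unfolding hf.map_RE3 map_f by simp
  qed
  show "fext f' y \<in> rel_ideal (X_rels q)" if y: "y \<in> B_rels q"
  proof -
    obtain \<alpha> \<gamma> m n where "y = fls_nth (fls_nth (ent (dB fls_X_inv fls_X_inv ?B) \<alpha> \<gamma>) m) n"
      using y unfolding B_rels_eq by blast
    then have "fext f' y = fls_nth (fls_nth (ent (map_sq (fls_map (fls_map (fext f'))) (dB fls_X_inv fls_X_inv ?B)) \<alpha> \<gamma>) m) n"
      by simp
    then have eq: "fext f' y = fls_nth (fls_nth (ent (dB fls_X_inv fls_X_inv \<beta>) \<alpha> \<gamma>) m) n"
      unfolding hf'.map_dB map_f' .
    \<comment> \<open>Enough rounds of descent for the bound n + m - N on the degree of this
      coefficient to be negative.\<close>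
    define N where "N = nat (\<bar>n\<bar> + \<bar>m\<bar> + 1)"
    have "fext f' y \<in> Wdeg (X_rels q) (n + (m + - int N))"
      using fd.relations_descend(1)[OF Fdeg_sub_Wdeg, of N] unfolding eq ents_def lev_def by blast
    moreover have "n + (m + - int N) < 0" by (simp add: N_def)
    ultimately show ?thesis by (simp add: Wdeg_negative)
  qed
  have E: "fls_nth (ent (?S - fusedS \<beta>) i j) n \<in> rel_ideal (X_rels q)" for i j n
  proof -
    define N where "N = nat (\<bar>n\<bar> + 1)"
    have "fls_nth (ent (?S - fusedS \<beta>) i j) n \<in> Wdeg (X_rels q) (n + - int N)"
      using fd.relations_descend(2)[OF Fdeg_sub_Wdeg, of N] unfolding ents_def lev_def by blast
    moreover have "n + - int N < 0" by (simp add: N_def)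
    ultimately show ?thesis by (simp add: Wdeg_negative)
  qed
  show "fext f' (f z) - gen z \<in> rel_ideal (X_rels q)"
  proof -
    have "fext f' (f z) = fls_nth (ent (map_sq (fls_map (fext f')) (fusedS ?B)) (fst z) (fst (snd z))) (int (Suc (snd (snd z))))"
      by (simp add: f_def from_matrix_def)
    also have "\<dots> = fls_nth (ent (fusedS \<beta>) (fst z) (fst (snd z))) (int (Suc (snd (snd z))))"
      unfolding hf'.map_fusedS map_f' ..
    finally have "fext f' (f z) - gen z = - fls_nth (ent (?S - fusedS \<beta>) (fst z) (fst (snd z))) (int (Suc (snd (snd z))))"
      by (simp add: gen_nth[of z "X_lead q"])
    then show ?thesis using E rel_ideal_uminus by metis
  qed
  \<comment> \<open>The image of \<beta> under \<open>f\<close> has, in the four entries, the same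
    fused matrix as the generating matrix \<open>B\<close>, because \<open>f\<close> maps
    \<open>S\<close> to \<open>fusedS B\<close>. By uniqueness it equals \<open>B\<close>, even
    before passing to the quotient.\<close>
  define \<beta>' where "\<beta>' = map_sq (fls_map (fext f)) \<beta>"
  have "\<beta>' = ?B"
  proof (rule fusedS_inj[where g = ?g, OF g])
    show "?B - diagc ?g \<in> ents (lev F0) (-1)" by (rule Bl(2))
    have "\<beta>' - diagc ?g = map_sq (fls_map (fext f)) (\<beta> - diagc ?g)"
      by (rule sqm_eqI) (simp add: \<beta>'_def hf.h1.hom_diff diagc_def hf.h_scalars)
    also have "\<dots> \<in> ents (lev F0) (-1)"
      using \<beta>l(2) by (simp add: ents_def lev_F0)
    finally show "\<beta>' - diagc ?g \<in> ents (lev F0) (-1)" .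
    fix p r
    have "ent (map_sq (fls_map (fext f)) (?S - fusedS \<beta>)) (fst (pos3 p r)) (snd (pos3 p r)) = 0"
      using sd.fusedS_sol[of p r] by (simp add: \<beta>_def)
    moreover have "map_sq (fls_map (fext f)) (?S - fusedS \<beta>) = fusedS ?B - fusedS \<beta>'"
      unfolding \<beta>'_def hf.map_fusedS[symmetric] map_f[symmetric] by (rule sqm_eqI) (simp add: hf.h1.hom_diff)
    ultimately show "ent (fusedS \<beta>' - fusedS ?B) (fst (pos3 p r)) (snd (pos3 p r)) = 0" by simp
  qed
  then show "fext f (f' w) - gen w \<in> rel_ideal (B_rels q)"
  proof -
    have "fext f (f' w) = fls_nth (ent \<beta>' (fst w) (fst (snd w))) (int (Suc (snd (snd w))))"
      by (simp add: f'_def from_matrix_def \<beta>'_def \<beta>_def)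
    then show ?thesis using gen_nth[of w "B_lead q"] \<open>\<beta>' = ?B\<close> by simp
  qed
qed

subsection \<open>The assignments\<close>

text \<open>Composition with the power series 1/w uses the coefficients of its powers, and these are
  the values of \<open>kap\<close>; scalars are central, so the side on which they are written does
  not matter.\<close>

lemma subst_param_eq:
  assumes w: "fls_subdegree w = -1"
  shows "subst_param F w = sbst scal w (fps_to_fls F)"
proof (rule fls_eqI)
  fix l
  have w0: "w \<noteq> 0" using w by auto
  let ?r = "fls_regpart (fls_map scal (1 / w))"
  have nn: "fls_nth (1 / w) n = 0" if "n < 0" for n
    using that w w0 by (intro fls_eq0_below_subdegree) (simp add: fls_divide_subdegree)
  have rp: "fps_to_fls ?r = e1 (1 / w)"
    by (rule fls_eqI) (simp add: nn flip: e1_def)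
  have pow: "fps_nth (?r ^ i) n = scal (kap w (int i) (int n))" for i n
  proof -
    have "fps_to_fls (?r ^ i) = e1 ((1 / w) ^ i)"
      by (simp add: fps_to_fls_power rp e1.hom_power)
    from arg_cong[OF this, of "\<lambda>F. fls_nth F (int n)"]
    have "fps_nth (?r ^ i) n = scal (fls_nth ((1 / w) ^ i) (int n))" by simp
    moreover have "(1 / w) ^ i = w powi (- int i)"
      by (simp add: power_int_minus power_one_over inverse_eq_divide)
    ultimately show ?thesis by (simp add: kap_def)
  qed
  show "fls_nth (subst_param F w) l = fls_nth (sbst scal w (fps_to_fls F)) l"
  proof (cases "l < 0")
    case True
    then show ?thesis by (simp add: subst_param_def scal.sbst_nth[OF w, of 0])
  next
    case False
    then obtain n where l: "l = int n" by (metis nonneg_int_cases not_less)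
    have "fls_nth (sbst scal w (fps_to_fls F)) l = (\<Sum>m=0..int n. scal (kap w m (int n)) * fls_nth (fps_to_fls F) m)"
      unfolding l by (rule scal.sbst_nth[OF w]) simp
    also have "\<dots> = (\<Sum>i=0..n. scal (kap w (int i) (int n)) * fps_nth F i)"
      by (rule sum.reindex_bij_witness[of _ int nat]) auto
    finally show ?thesis
      unfolding l by (simp add: subst_param_def fps_compose_nth pow scal_central)
  qed
qed

lemma sq_at_param: "fls_subdegree w = -1 \<Longrightarrow> sq (at_param (gen_mat G) w) = at_par w (genm G)"
  by (rule sqm_eqI) (simp add: at_param_def map_mat_def at_par_def genm_def subst_param_eq)

lemma sq_emb1: "sq (emb1 A) = map_sq e1 (sq A)"
  by (rule sqm_eqI) (simp add: emb1_def map_mat_def e1_def)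

lemma sq_compress: "sq (compress A) = kc.cmp (sq A)"
proof (rule sqm_eqI)
  fix i j
  have "fls_const (scal a) * x * fls_const (scal b) = kc (a * b) * x" for a b and x :: "'a free_alg fls"
  proof -
    have "kc a * x * kc b = kc b * (kc a * x)" by (rule centralD[OF kc.central_e, symmetric])
    then show ?thesis by (simp only: kc_def[symmetric] mult.assoc[symmetric] kc.hom_mult[symmetric] mult.commute)
  qed
  then show "ent (sq (compress A)) i j = ent (kc.cmp (sq A)) i j"
    by (simp add: compress_def kc.cmp_def jv_def)
qed

lemma cmp_cst: "central c \<Longrightarrow> kc.cmp (cst c * A) = cst c * kc.cmp A"
  by (rule sqm_eqI) (simp add: kc.cmp_def sum_distrib_left central_left_commute[of c])

lemma cmp_flip: "kc.cmp (flip_sq * A) = kc.cmp A"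
proof (rule sqm_eqI)
  fix a b
  have "(\<Sum>p\<in>UNIV. \<Sum>q\<in>UNIV. kc (jv a (fst p) (snd p) * jv b (fst q) (snd q)) * ent A (prod.swap p) q) =
    (\<Sum>p\<in>UNIV. \<Sum>q\<in>UNIV. kc (jv a (fst p) (snd p) * jv b (fst q) (snd q)) * ent A p q)"
    by (rule sum.reindex_bij_witness[of _ prod.swap prod.swap]) (simp_all add: jv_sym)
  then show "ent (kc.cmp (flip_sq * A)) a b = ent (kc.cmp A) a b"
    by (simp add: kc.cmp_def flip_mult)
qed

text \<open>The compression pairs with symmetric tensors from the left, so the projector in front of
  both assignments has no effect.\<close>

lemma cmp_hsym: "kc.cmp (hsym * A) = kc.cmp A"
proof -
  have "kc.cmp (hsym * A) = cst (kc (1/2)) * (kc.cmp A + kc.cmp A)"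
    unfolding hsym_def mult.assoc cmp_cst[OF kc.central_e] by (simp add: distrib_right cmp_add cmp_flip)
  then show ?thesis unfolding distrib_left kc.half_half .
qed

lemma map_sq_e1_R2: "map_sq e1 (sq (R2 c)) = (1 - cst (e1 (1 / c)) * flip_sq :: ('g free_alg fls, ix2 \<times> ix2) sqm)"
proof -
  interpret m: unital_hom "map_sq e1 :: (complex fls, ix2 \<times> ix2) sqm \<Rightarrow> ('g free_alg fls, ix2 \<times> ix2) sqm"
    by (rule unital_hom_map_sq[OF unital_hom_e1])
  show ?thesis
    unfolding R2_def sq_simps sq_scale sq_Pmat m.hom_diff m.hom_mult m.hom_1
      map_sq_cst[of e1, OF e1.hom_0] map_sq_flip[of e1, OF e1.hom_0 e1.hom_1] ..
qed

lemma map_sq_e1_mult: "map_sq e1 (A * B) = (map_sq e1 A * map_sq e1 B :: ('g free_alg fls, 'n::finite) sqm)"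
proof -
  interpret m: unital_hom "map_sq e1 :: (complex fls, 'n) sqm \<Rightarrow> ('g free_alg fls, 'n) sqm"
    by (rule unital_hom_map_sq[OF unital_hom_e1])
  show ?thesis by (rule m.hom_mult)
qed

lemma params:
  "2 * fls_X_inv = w0" "4 * fls_X_inv = aff 4 0" "w0 - 1 / 2 = x1" "w0 + 1 / 2 = x2" "aff 4 0 - 1 = aff 4 (-1)"
  "w0 - 1 = aff 2 (-1)" "- 4 * fls_X_inv + 1 = - aff 4 (-1)" "1 - (- aff 4 (-1)) = aff 4 0" "- aff 4 (-1) - 1 = - aff 4 0"
proof -
  have h: "(1 / 2 :: complex fls) = fls_const (1 / 2)"
    using fls_const_divide_const[of 1 "2 :: complex"] by simp
  show "2 * fls_X_inv = w0" "4 * fls_X_inv = aff 4 0"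
    by (simp_all add: aff_def)
  have 4: "fls_nth (- 4 * fls_X_inv) n = (if n = -1 then - 4 else 0 :: complex)" for n
    using aff_nth[of 4 0 n] by (auto simp: aff_def)
  show "w0 - 1 / 2 = x1" "w0 + 1 / 2 = x2"
    unfolding h by (rule fls_eqI, simp add: aff_nth)+
  show "aff 4 0 - 1 = aff 4 (-1)" "w0 - 1 = aff 2 (-1)"
    "- 4 * fls_X_inv + 1 = - aff 4 (-1)" "1 - (- aff 4 (-1)) = aff 4 0" "- aff 4 (-1) - 1 = - aff 4 0"
    by (rule fls_eqI, simp add: aff_nth 4)+
qed

lemma half_hsym: "map_sq e1 (sq (scale (1/2) (R2 (-1)))) = (hsym :: ('g free_alg fls, ix2 \<times> ix2) sqm)"
proof -
  have h: "(1 / 2 :: complex fls) = fls_const (1 / 2)"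
    using fls_const_divide_const[of 1 "2 :: complex"] by simp
  show ?thesis
    unfolding sq_scale map_sq_e1_mult map_sq_cst[of e1, OF e1.hom_0] map_sq_e1_R2 h e1_fls_const hsym_def kc_def
    by (simp add: cst.hom_uminus e1.hom_uminus)
qed

lemma sq_phi_B: "sq (phi_B q) = fusedS (genm (B_lead q))"
  unfolding phi_B_def Let_def sq_compress sq_mult sq_emb1 sq_tens1 sq_tens2 params sq_scale[of "aff 4 0 / _"] map_sq_e1_mult
    half_hsym map_sq_cst[of e1, OF e1.hom_0] map_sq_e1_R2
  by (simp add: sq_at_param cmp_cst central_e1 cmp_hsym mult.assoc fusedS_def fuse_def)

lemma iso_valuesI:
  fixes A :: "'h free_alg fls^ix3^ix3" and f :: "ix3 \<times> ix3 \<times> nat \<Rightarrow> 'h free_alg"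
  assumes "algebra_iso (X_rels q) rels \<phi>" "\<And>a. \<phi> (cls (X_rels q) a) = cls rels (h a)"
    and h0: "h 0 = 0" and "map_sq (fls_map h) (genm (X_lead q)) = sq A"
  shows "iso_with_values (X_rels q) rels (X_gen_mat q) A \<phi>"
proof -
  have "h (fls_nth (X_gen_mat q $ i $ j) n) = fls_nth (A $ i $ j) n" for i j n
  proof -
    have "fls_nth (A $ i $ j) n = fls_nth (ent (map_sq (fls_map h) (genm (X_lead q))) i j) n"
      unfolding assms(4) by simp
    then show ?thesis by (simp add: fls_nth_fls_map h0 genm_def X_gen_mat_def map_mat_def)
  qed
  then show ?thesis using assms(1,2) by (simp add: iso_with_values_def)
qed

lemma algebra_iso_trans:
  assumes "algebra_iso rels rels' \<phi>" "algebra_iso rels' rels'' \<phi>'"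
  shows "algebra_iso rels rels'' (\<phi>' \<circ> \<phi>)"
proof -
  have "\<phi> x \<in> carrier (presented_alg rels')" if "x \<in> carrier (presented_alg rels)" for x
    using assms(1) that by (auto simp: algebra_iso_def ring_iso_def ring_hom_def)
  then show ?thesis
    using assms ring_iso_set_trans[of \<phi> "presented_alg rels" "presented_alg rels'" \<phi>' "presented_alg rels''"]
    by (simp add: algebra_iso_def)
qed

subsection \<open>Twisted Yangians as reflection algebras\<close>

text \<open>diag(1, (-1)^q) over an arbitrary ring: the identity for q = 0 and -K for q = 1, and
  also the constant term of the reflection generators.\<close>

definition twist :: "nat \<Rightarrow> ('a::ring_1, ix2) sqm"
  where "twist q = Mk (\<lambda>i j. if i = j then (case i of Neg2 \<Rightarrow> 1 | Pos2 \<Rightarrow> (-1) ^ q) else 0)"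

lemma map_twist: "unital_hom h \<Longrightarrow> map_sq h (twist q) = twist q"
proof -
  assume "unital_hom h"
  then interpret unital_hom h .
  show ?thesis
    by (rule sqm_eqI) (simp add: twist_def hom_power hom_uminus hom_1 split: ix2.split)
qed

lemma twist_twist: "twist q * twist q = (1 :: ('a::ring_1, ix2) sqm)"
proof -
  have "(-1 :: 'a) ^ q * (-1) ^ q = 1"
    by (cases "even q") simp_all
  then show ?thesis
    by (intro sqm_eqI, rename_tac i j, case_tac i; case_tac j) (simp_all add: ent_mult ent_one UNIV_ix2 twist_def)
qed

lemma twist_diagc: "twist q = diagc (bl q)"
proof (rule sqm_eqI)
  have *: "kc ((-1) ^ q) = (-1) ^ q" by (simp add: kc.hom_power kc.hom_uminus kc.hom_1)
  fix i j show "ent (twist q) i j = ent (diagc (bl q)) i j"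
    by (cases i; cases j) (simp_all add: twist_def diagc_def * kc.hom_1)
qed

lemma tn_mult: "tn1 (A * B) = tn1 A * (tn1 B :: ('a::ring_1, 'n::finite \<times> 'n) sqm)" "tn2 (A * B) = tn2 A * (tn2 B :: ('a, 'n \<times> 'n) sqm)"
proof -
  have 1: "ent (tn1 A * tn1 B) (a, b) (c, d) = (\<Sum>x\<in>UNIV. \<Sum>y\<in>UNIV. if y = b then if b = d then ent A a x * ent B x c else 0 else 0)" for a b c d
    unfolding ent_mult sum_UNIV_prod by (intro sum.cong refl) (auto simp: tn1_def)
  have 2: "ent (tn2 A * tn2 B) (a, b) (c, d) = (\<Sum>x\<in>UNIV. \<Sum>y\<in>UNIV. if x = a then if a = c then ent A b y * ent B y d else 0 else 0)" for a b c d
    unfolding ent_mult sum_UNIV_prod by (intro sum.cong refl) (auto simp: tn2_def)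
  have 3: "(\<Sum>x\<in>UNIV. \<Sum>y\<in>UNIV. if x = a then f y else 0) = (\<Sum>y\<in>UNIV. f y)" for a :: 'n and f :: "'n \<Rightarrow> 'a"
    by (subst sum.swap) simp
  show "tn1 (A * B) = tn1 A * tn1 B"
    by (rule sqm_eqI, clarify, unfold 1) (simp add: tn1_def ent_mult)
  show "tn2 (A * B) = tn2 A * tn2 B"
    by (rule sqm_eqI, clarify, unfold 2 3) (simp add: tn2_def ent_mult)
qed

lemma tn_one: "tn1 1 = (1 :: ('a::ring_1, 'n::finite \<times> 'n) sqm)" "tn2 1 = (1 :: ('a, 'n \<times> 'n) sqm)"
  by (rule sqm_eqI, auto simp: tn1_def tn2_def ent_one)+

lemma twist_tn:
  fixes q :: nat
  defines "l1 \<equiv> tn1 (twist q) :: ('a::ring_1, ix2 \<times> ix2) sqm" and "l2 \<equiv> tn2 (twist q)"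
  shows "l1 * l1 = 1" "l2 * l2 = 1" "l1 * l2 = l2 * l1" "l1 * l2 * flip_sq = flip_sq * (l1 * l2)"
    and "tn1 A * l2 = l2 * tn1 A" "l1 * tn2 A = tn2 A * l1"
proof -
  show "l1 * l1 = 1" "l2 * l2 = 1"
    by (simp_all only: l1_def l2_def tn_mult[symmetric] twist_twist tn_one)
  have m: "(-1) ^ q * x = x * (-1 :: 'a) ^ q" for x
    by (cases "even q") simp_all
  show c: "tn1 A * l2 = l2 * tn1 A" "l1 * tn2 A = tn2 A * l1" for A
    unfolding l1_def l2_def
    by (intro sqm_eqI, clarify, simp add: ent_tn1_tn2 twist_def m split: ix2.split)+
  show ll: "l1 * l2 = l2 * l1" unfolding l1_def by (rule c)
  show "l1 * l2 * flip_sq = flip_sq * (l1 * l2)"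
  proof -
    have "flip_sq * (l1 * l2) = l2 * (l1 * flip_sq)"
      unfolding l1_def l2_def by (metis flip_tn1 flip_tn2 mult.assoc)
    then show ?thesis by (metis ll mult.assoc)
  qed
qed

text \<open>All twists can be collected on the right: \<open>l1 * l2\<close> passes
  \<open>R'\<close>, each of \<open>l1\<close>, \<open>l2\<close> passes the matrix on the other
  leg, and the remaining pairs cancel.\<close>

lemma twisted_products:
  fixes R' :: "'r::ring_1"
  assumes l: "l1 * l1 = 1" "l2 * l2 = 1" "l1 * l2 = l2 * l1" and R': "l1 * l2 * R' = R' * (l1 * l2)"
    and a: "a * l2 = l2 * a" "l1 * b = b * l1"
  shows "a * l1 * (l2 * R' * l2) * (b * l2) = a * R' * b * (l1 * l2)"
    and "b * l2 * (l2 * R' * l2) * (a * l1) = b * R' * a * (l1 * l2)"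
proof -
  have "a * l1 * (l2 * R' * l2) * (b * l2) = a * (l1 * l2 * R') * l2 * b * l2" by (simp only: mult.assoc)
  also have "\<dots> = a * R' * (l1 * (l2 * l2)) * b * l2" unfolding R' by (simp only: mult.assoc)
  also have "\<dots> = a * R' * (l1 * b) * l2" unfolding l by (simp only: mult_1_right mult.assoc)
  finally show "a * l1 * (l2 * R' * l2) * (b * l2) = a * R' * b * (l1 * l2)" unfolding a(2) by (simp only: mult.assoc)
  have "b * l2 * (l2 * R' * l2) * (a * l1) = b * (l2 * l2) * R' * (l2 * a) * l1" by (simp only: mult.assoc)
  also have "\<dots> = b * R' * a * (l2 * l1)" unfolding l(2) a(1)[symmetric] by (simp only: mult_1_right mult.assoc)
  finally show "b * l2 * (l2 * R' * l2) * (a * l1) = b * R' * a * (l1 * l2)" unfolding l(3) .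
qed

text \<open>In dimension two Q^\<plusminus> = 1 - T_2 P T_2 with T = \<open>twist q\<close> for the
  matching sign. Hence 1 - Q^\<plusminus>/w is (w - 1)/w times the conjugate of R(1 - w):
  transposition becomes a change of argument, which turns the twisted relation into a reflection
  equation.\<close>

lemma ptrans_R2:
  fixes w :: "'k::field"
  assumes w: "w \<noteq> 0" "1 - w \<noteq> 0" and q: "q \<in> {0, 1}" and \<epsilon>: "\<epsilon> = (if q = 0 then TMinus else TPlus)"
  shows "sq (ptrans \<epsilon> (R2 w)) = cst ((w - 1) / w) * (tn2 (twist q) * sq (R2 (1 - w)) * tn2 (twist q))"
proof (rule sqm_eqI, clarify)
  have R: "R2 c $ p $ p' = (if p' = p then 1 else 0) - 1 / c * (if p' = prod.swap p then 1 else 0)" for c :: 'k and p p'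
  proof -
    have "R2 c $ p $ p' = ent (sq (R2 c)) p p'" by simp
    also have "\<dots> = (if p' = p then 1 else 0) - 1 / c * (if p' = prod.swap p then 1 else 0)"
      unfolding R2_def sq_simps sq_scale sq_Pmat by (auto simp: ent_one flip_sq_def simp del: ent_sq)
    finally show ?thesis .
  qed
  have t: "ent (tn2 (twist q) * M * tn2 (twist q)) (a, b) (c, d) =
     (case b of Neg2 \<Rightarrow> 1 | Pos2 \<Rightarrow> (-1) ^ q) * ent M (a, b) (c, d) * (case d of Neg2 \<Rightarrow> 1 | Pos2 \<Rightarrow> (-1) ^ q)"
    for M :: "('k, ix2 \<times> ix2) sqm" and a b c d
    by (cases a; cases b; cases c; cases d) (simp_all add: ent_mult sum_UNIV_prod UNIV_ix2 tn2_def twist_def)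
  fix a b c d
  show "ent (sq (ptrans \<epsilon> (R2 w))) (a, b) (c, d) =
    ent (cst ((w - 1) / w) * (tn2 (twist q) * sq (R2 (1 - w)) * tn2 (twist q))) (a, b) (c, d)"
    unfolding ent_cst_mult t ent_sq ptrans_def
    using q w by (cases a; cases b; cases c; cases d; auto simp: R \<epsilon> tr_coeff_def field_simps)
qed

abbreviation "yp \<equiv> aff 1 (1 / 2)"
abbreviation "ym \<equiv> aff 1 (- 1 / 2)"

lemma involution_product:
  fixes s t :: "'r::ring_1"
  assumes "s * s = 1" "t * t = 1" "s * t = t * s"
  shows "s * t * (s * t) = 1"
proof -
  have "s * t * (s * t) = s * (t * s) * t" by (simp only: mult.assoc)
  also have "\<dots> = s * (s * t) * t" unfolding assms(3)[symmetric] ..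
  also have "\<dots> = (s * s) * (t * t)" by (simp only: mult.assoc)
  finally show ?thesis by (simp add: assms)
qed

text \<open>\<open>twS\<close> is B(u + 1/2) times the twist and \<open>twB\<close> its inverse, S(u
  - 1/2) times the twist; the twist is constant and squares to 1.\<close>

definition twS :: "nat \<Rightarrow> ('g free_alg fls, ix2) sqm \<Rightarrow> ('g free_alg fls, ix2) sqm"
  where "twS q B = at_par yp B * twist q"

definition twB :: "nat \<Rightarrow> ('g free_alg fls, ix2) sqm \<Rightarrow> ('g free_alg fls, ix2) sqm"
  where "twB q S = at_par ym S * twist q"

lemma at_par_twist:
  assumes "a \<noteq> 0" "b \<noteq> 0"
  shows "at_par (aff b d) (at_par (aff a c) A * twist q) = at_par (aff (a * b) (a * d + c)) A * twist q"
proof -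
  have s: "unital_hom (sbst scal (aff b d))" by (rule scal.unital_hom_sbst) (simp add: assms)
  interpret m: unital_hom "map_sq (sbst scal (aff b d)) :: ('a free_alg fls, ix2) sqm \<Rightarrow> _"
    by (rule unital_hom_map_sq[OF s])
  show ?thesis
    unfolding at_par_def m.hom_mult map_twist[OF s] map_sq_map_sq
    using assms by (simp add: scal.sbst_compose sbst_aff_aff)
qed

lemma twist_cancel: "A * twist q * twist q = (A :: ('a::ring_1, ix2) sqm)"
  by (simp add: mult.assoc twist_twist)

lemma at_par_id': "at_par (aff 1 0) A = A"
  using at_par_id[of A] by (simp add: X_inv_aff)

lemma twS_twB: "twS q (twB q S) = S" and twB_twS: "twB q (twS q B) = B"
  by (simp_all add: twS_def twB_def at_par_twist at_par_id' twist_cancel)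

text \<open>The defect of the twisted relation with the transposed R-matrix rewritten by
  \<open>ptrans_R2\<close> at w = -u - v, so that 1 - w = u + v + 1.\<close>

definition YE :: "nat \<Rightarrow> ('g free_alg fls, ix2) sqm \<Rightarrow> ('g free_alg fls fls, ix2 \<times> ix2) sqm"
  where "YE q S = rdef (R2s (par_u - par_v))
    (cst (e2 ((par_u + par_v + 1) / (par_u + par_v))) * (tn2 (twist q) * R2s (par_u + par_v + 1) * tn2 (twist q)))
    (map_sq iu S) (map_sq iv S)"

lemma sum_nonzero: "par_u + par_v \<noteq> 0" "par_u + par_v + 1 \<noteq> 0"
  and yp_sum: "pu yp + pv yp = par_u + par_v + 1" "pu yp - pv yp = par_u - par_v"
proof -
  have "yp = fls_X_inv + fls_const (1/2)" by (rule fls_eqI) (simp add: aff_nth)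
  moreover have "pu (fls_const c) = fls_const (fls_const c)" "pv (fls_const c) = fls_const (fls_const c)" for c
    by (rule fls_eqI, simp add: pu_def pv_def)+
  ultimately have p: "pu yp = par_u + fls_const (fls_const (1/2))" "pv yp = par_v + fls_const (fls_const (1/2))"
    by (simp_all add: pu_add pv_add par_u_eq par_v_eq)
  have e: "(a + h) + (b + h) = a + b + (h + h)" for a b h :: "complex fls fls" by simp
  show "pu yp + pv yp = par_u + par_v + 1"
    unfolding p e half_plus_half ..
  then show "par_u + par_v + 1 \<noteq> 0" using aff_combination(3)[of 1 "1/2" 1 "1/2"] by auto
  show "pu yp - pv yp = par_u - par_v" unfolding p by simp
  show "par_u + par_v \<noteq> 0" using aff_combination(3)[of 1 0 1 0] by (simp add: par_u_eq par_v_eq X_inv_aff)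
qed

text \<open>The shift by 1/2 in both parameters turns u + v into u + v + 1 and keeps u - v. Up to an
  invertible scalar and an invertible constant matrix the twisted relation is then the reflection
  equation at the shifted parameters.\<close>

lemma YE_twS:
  "YE q (twS q B) = cst (e2 ((par_u + par_v + 1) / (par_u + par_v))) * (dB yp yp B * (tn1 (twist q) * tn2 (twist q)))"
proof -
  let ?c = "cst (e2 ((par_u + par_v + 1) / (par_u + par_v))) :: ('a free_alg fls fls, ix2 \<times> ix2) sqm"
  let ?l1 = "tn1 (twist q) :: ('a free_alg fls fls, ix2 \<times> ix2) sqm" and ?l2 = "tn2 (twist q) :: ('a free_alg fls fls, ix2 \<times> ix2) sqm"
  let ?R = "R2s (par_u - par_v) :: ('a free_alg fls fls, ix2 \<times> ix2) sqm" and ?R' = "R2s (par_u + par_v + 1) :: ('a free_alg fls fls, ix2 \<times> ix2) sqm"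
  let ?a = "tn1 (map_sq iu (at_par yp B))" and ?b = "tn2 (map_sq iv (at_par yp B))"
  interpret U: unital_hom "map_sq iu :: ('a free_alg fls, ix2) sqm \<Rightarrow> _" by (rule unital_hom_map_sq[OF unital_hom_iu])
  interpret V: unital_hom "map_sq iv :: ('a free_alg fls, ix2) sqm \<Rightarrow> _" by (rule unital_hom_map_sq[OF unital_hom_iv])
  have S: "tn1 (map_sq iu (twS q B)) = ?a * ?l1" "tn2 (map_sq iv (twS q B)) = ?b * ?l2"
    unfolding twS_def U.hom_mult V.hom_mult map_twist[OF unital_hom_iu] map_twist[OF unital_hom_iv] tn_mult by (rule refl)+
  have lc: "x * (?c * y) = ?c * (x * y)" for x y by (rule central_left_commute[OF central_cst_e2])
  have R: "?l1 * ?l2 * R2s c = R2s c * (?l1 * ?l2)" for c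
    unfolding R2s_def right_diff_distrib left_diff_distrib central_left_commute[OF central_cst_e2]
    by (simp add: twist_tn(4) mult.assoc[of "cst (e2 _)"])
  note t = twisted_products[OF twist_tn(1-3) R twist_tn(5,6)]
  have 1: "?R * (?a * ?l1) * (?c * (?l2 * ?R' * ?l2)) * (?b * ?l2) = ?c * (?R * (?a * ?l1 * (?l2 * ?R' * ?l2) * (?b * ?l2)))"
    by (simp only: mult.assoc lc[of ?l1] lc[of ?a] lc[of ?R])
  have 2: "?b * ?l2 * (?c * (?l2 * ?R' * ?l2)) * (?a * ?l1) * ?R = ?c * (?b * ?l2 * (?l2 * ?R' * ?l2) * (?a * ?l1) * ?R)"
    by (simp only: mult.assoc lc[of ?l2] lc[of ?b])
  have "YE q (twS q B) = ?c * (?R * (?a * ?R' * ?b * (?l1 * ?l2)) - ?b * ?R' * ?a * (?l1 * ?l2) * ?R)"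
    unfolding YE_def rdef_def S 1 2 t right_diff_distrib[symmetric] ..
  also have "?b * ?R' * ?a * (?l1 * ?l2) * ?R = ?b * ?R' * ?a * ?R * (?l1 * ?l2)"
    by (simp only: mult.assoc R[unfolded mult.assoc])
  also have "?R * (?a * ?R' * ?b * (?l1 * ?l2)) - ?b * ?R' * ?a * ?R * (?l1 * ?l2) = dB yp yp B * (?l1 * ?l2)"
    unfolding dB_def rdef_def yp_sum left_diff_distrib by (simp only: mult.assoc)
  finally show ?thesis .
qed

lemma Y_rels_eq:
  assumes "q \<in> {0, 1}" "\<epsilon> = (if q = 0 then TMinus else TPlus)"
  shows "Y_rels \<epsilon> = {fls_nth (fls_nth (ent (YE q (genm (mat 1))) \<alpha> \<beta>) m) n | \<alpha> \<beta> m n. True}"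
proof -
  interpret m: unital_hom "map_sq e2 :: (complex fls fls, ix2 \<times> ix2) sqm \<Rightarrow> ((ix2 \<times> ix2 \<times> nat) free_alg fls fls, ix2 \<times> ix2) sqm"
    by (rule unital_hom_map_sq[OF unital_hom_e2])
  let ?s = "par_u + par_v"
  have w: "- par_u - par_v = - ?s" "1 - (- ?s) = ?s + 1" "(- ?s - 1) / (- ?s) = (?s + 1) / ?s"
    using minus_divide_divide[of "?s + 1" ?s] by simp_all
  have nz: "- ?s \<noteq> 0" "1 - (- ?s) \<noteq> 0" by (simp_all only: w(2) neg_equal_0_iff_equal sum_nonzero not_False_eq_True)
  have "map_sq e2 (sq (ptrans \<epsilon> (R2 (- par_u - par_v)))) = cst (e2 ((?s + 1) / ?s)) *
      (tn2 (twist q) * (R2s (?s + 1) :: ((ix2 \<times> ix2 \<times> nat) free_alg fls fls, ix2 \<times> ix2) sqm) * tn2 (twist q))"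
    unfolding w(1) ptrans_R2[OF nz assms] w(2,3) m.hom_mult map_sq_cst[of e2, OF e2.hom_0]
      map_sq_tn2[of e2, OF e2.hom_0] map_twist[OF unital_hom_e2] map_sq_R2 ..
  then show ?thesis
    unfolding Y_rels_def refl_rels_eq YE_def map_sq_R2 by simp
qed

context scalar_hom
begin

lemma map_YE: "map_sq (fls_map (fls_map h)) (YE q S) = YE q (map_sq (fls_map h) S)"
proof -
  interpret m: unital_hom "map_sq (fls_map (fls_map h)) :: ('g free_alg fls fls, ix2 \<times> ix2) sqm \<Rightarrow> _"
    by (rule unital_hom_map_sq) (rule h2.unital_hom_axioms)
  show ?thesis
    unfolding YE_def map_rdef map_iu_iv map_R m.hom_mult map_sq_cst[of "fls_map (fls_map h)", OF h2.hom_0] h_scalars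
      map_sq_tn2[of "fls_map (fls_map h)", OF h2.hom_0] map_twist[OF h2.unital_hom_axioms] ..
qed

lemma map_tw: "map_sq (fls_map h) (twS q A) = twS q (map_sq (fls_map h) A)" "map_sq (fls_map h) (twB q A) = twB q (map_sq (fls_map h) A)"
proof -
  interpret m: unital_hom "map_sq (fls_map h) :: ('g free_alg fls, ix2) sqm \<Rightarrow> _"
    by (rule unital_hom_map_sq) (rule h1.unital_hom_axioms)
  show "map_sq (fls_map h) (twS q A) = twS q (map_sq (fls_map h) A)" "map_sq (fls_map h) (twB q A) = twB q (map_sq (fls_map h) A)"
    unfolding twS_def twB_def m.hom_mult map_twist[OF h1.unital_hom_axioms] by (simp_all add: map_at_par)
qed

end

lemma tw_lead:
  "twB q (genm (mat 1)) - Mk (\<lambda>i j. kc (B_lead q $ i $ j)) \<in> ents (lev F0) (-1)"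
  "twS q (genm (B_lead q)) - Mk (\<lambda>i j. kc (mat 1 $ i $ j)) \<in> ents (lev F0) (-1)"
proof -
  have 0: "at_par (aff 1 c) A * twist q - D * twist q \<in> ents (lev F0) (-1)"
    if A: "A - D \<in> ents (lev F0) (-1)" and D: "\<And>w. fls_subdegree w = -1 \<Longrightarrow> at_par w D = D"
    for c and A D :: "((ix2 \<times> ix2 \<times> nat) free_alg fls, ix2) sqm"
  proof -
    interpret G: alg_filt "F0 :: int \<Rightarrow> (ix2 \<times> ix2 \<times> nat) free_alg set" F0 by (rule alg_filt_F0)
    interpret M: filtered_pair "ents (lev F0)" "ents (lev F0) :: int \<Rightarrow> ((ix2 \<times> ix2 \<times> nat) free_alg fls, ix2) sqm set"
      by (rule G.f1.filtered_pair_ents)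
    interpret s: unital_hom "sbst scal (aff 1 c)" by (rule scal.unital_hom_sbst) simp
    interpret m: unital_hom "map_sq (sbst scal (aff 1 c)) :: ((ix2 \<times> ix2 \<times> nat) free_alg fls, ix2) sqm \<Rightarrow> _"
      by (rule unital_hom_map_sq) (rule s.unital_hom_axioms)
    have "at_par (aff 1 c) A - D = map_sq (sbst scal (aff 1 c)) (A - D)"
      unfolding m.hom_diff using D[of "aff 1 c"] by (simp add: at_par_def)
    also have "\<dots> \<in> ents (lev F0) (-1)"
      by (rule ents_map_sq[OF A]) (rule G.sbst_lev[OF scal.scalar_embedding_axioms G.scal_F], simp)
    finally have 1: "at_par (aff 1 c) A - D \<in> ents (lev F0) (-1)" .
    have 2: "(twist q :: ((ix2 \<times> ix2 \<times> nat) free_alg fls, ix2) sqm) \<in> ents (lev F0) 0"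
      using G.kc_lev G.f1.F_0 by (auto simp: twist_diagc ents_def diagc_def)
    show ?thesis using M.FF'[OF 1 2, of "-1"] by (simp add: left_diff_distrib)
  qed
  have k: "sbst scal w (kc x) = kc x" if "fls_subdegree w = -1" for x w
    using that by (simp add: kc_def scal.sbst_fls_const)
  have one: "Mk (\<lambda>i j. kc ((mat 1 :: complex^ix2^ix2) $ i $ j)) = (1 :: ((ix2 \<times> ix2 \<times> nat) free_alg fls, ix2) sqm)"
    by (rule sqm_eqI) (simp add: mat_def ent_one)
  have B: "Mk (\<lambda>i j. kc (B_lead q $ i $ j)) = (twist q :: ((ix2 \<times> ix2 \<times> nat) free_alg fls, ix2) sqm)"
    unfolding B_lead_bl twist_diagc ..
  have D: "at_par w (1 :: ((ix2 \<times> ix2 \<times> nat) free_alg fls, ix2) sqm) = 1"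
    "at_par w (twist q :: ((ix2 \<times> ix2 \<times> nat) free_alg fls, ix2) sqm) = twist q" if "fls_subdegree w = -1" for w
    unfolding at_par_def
    by (rule unital_hom.hom_1[OF unital_hom_map_sq[OF scal.unital_hom_sbst[OF that]]]
             map_twist[OF scal.unital_hom_sbst[OF that]])+
  have gl: "genm (mat 1) - (1 :: ((ix2 \<times> ix2 \<times> nat) free_alg fls, ix2) sqm) \<in> ents (lev F0) (-1)"
    "genm (B_lead q) - twist q \<in> ents (lev F0) (-1)"
    unfolding one[symmetric] B[symmetric] by (rule genm_lead)+
  show "twB q (genm (mat 1)) - Mk (\<lambda>i j. kc (B_lead q $ i $ j)) \<in> ents (lev F0) (-1)"
    using 0[OF gl(1) D(1)] unfolding B twB_def by simp
  show "twS q (genm (B_lead q)) - Mk (\<lambda>i j. kc (mat 1 $ i $ j)) \<in> ents (lev F0) (-1)"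
    using 0[OF gl(2) D(2)] unfolding one twS_def by (simp add: twist_twist)
qed

text \<open>\<open>twS\<close> and \<open>twB\<close> are mutually inverse on matrices, hence so are
  the substitutions read off from them. Each set of relations goes to the other because the factors
  in \<open>YE_twS\<close> and the shift of parameters can be undone.\<close>

theorem B_Y_iso:
  assumes q: "q \<in> {0, 1}" "\<epsilon> = (if q = 0 then TMinus else TPlus)"
  defines "f \<equiv> from_matrix (twB q (genm (mat 1)))"
  shows "\<exists>\<phi>. algebra_iso (B_rels q) (Y_rels \<epsilon>) \<phi> \<and> (\<forall>a. \<phi> (cls (B_rels q) a) = cls (Y_rels \<epsilon>) (fext f a))"
    and "map_sq (fls_map (fext f)) (genm (B_lead q)) = twB q (genm (mat 1))"
proof -
  define f' where "f' = from_matrix (twS q (genm (B_lead q)))"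
  let ?S = "genm (mat 1) :: ((ix2 \<times> ix2 \<times> nat) free_alg fls, ix2) sqm" and ?B = "genm (B_lead q)"
  interpret hf: scalar_hom "fext f" by (rule scalar_hom_fext)
  interpret hf': scalar_hom "fext f'" by (rule scalar_hom_fext)
  have mf: "map_sq (fls_map (fext f)) ?B = twB q ?S" and mf': "map_sq (fls_map (fext f')) ?S = twS q ?B"
    unfolding f_def f'_def by (rule map_genm, rule tw_lead)+
  show "map_sq (fls_map (fext f)) ?B = twB q ?S" by (rule mf)
  let ?s = "par_u + par_v" and ?l = "tn1 (twist q) * tn2 (twist q) :: ((ix2 \<times> ix2 \<times> nat) free_alg fls fls, ix2 \<times> ix2) sqm"
  have ll: "?l * ?l = 1"
    by (rule involution_product[OF twist_tn(1-3)])
  have lev: "T \<in> ents (lev (lev (\<lambda>_. J))) k \<longleftrightarrow> (\<forall>\<alpha> \<beta> m n. fls_nth (fls_nth (ent T \<alpha> \<beta>) m) n \<in> J)"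
    for T :: "((ix2 \<times> ix2 \<times> nat) free_alg fls fls, ix2 \<times> ix2) sqm" and J k
    by (simp add: ents_def lev_def)
  have F: "T \<in> ents (lev (lev (\<lambda>_. UNIV))) k" for T :: "((ix2 \<times> ix2 \<times> nat) free_alg fls fls, ix2 \<times> ix2) sqm" and k
    by (simp add: ents_def lev_def)
  show "\<exists>\<phi>. algebra_iso (B_rels q) (Y_rels \<epsilon>) \<phi> \<and> (\<forall>a. \<phi> (cls (B_rels q) a) = cls (Y_rels \<epsilon>) (fext f a))"
  proof (rule algebra_iso_from_substitutions)
    fix x assume x: "x \<in> B_rels q"
    interpret A: alg_filt "\<lambda>_. UNIV" "\<lambda>_. rel_ideal (Y_rels \<epsilon>)" by (rule alg_filt_ideal)
    interpret M: filtered_pair "ents (lev (lev (\<lambda>_. UNIV)))" "ents (lev (lev (\<lambda>_. rel_ideal (Y_rels \<epsilon>)))) :: int \<Rightarrow> ((ix2 \<times> ix2 \<times> nat) free_alg fls fls, ix2 \<times> ix2) sqm set"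
      by (rule A.f2.filtered_pair_ents)
    have "YE q ?S \<in> ents (lev (lev (\<lambda>_. rel_ideal (Y_rels \<epsilon>)))) 0"
      unfolding lev by (intro allI rel_ideal_base) (unfold Y_rels_eq[OF q], blast)
    \<comment> \<open>Multiplication by the inverse scalar and by the twists, which square to 1,
      exposes the shifted defect in \<open>YE_twS\<close>.\<close>
    then have "cst (e2 (?s / (?s + 1))) * (YE q (twS q (twB q ?S)) * ?l) \<in> ents (lev (lev (\<lambda>_. rel_ideal (Y_rels \<epsilon>)))) 0"
      unfolding twS_twB by (rule M.FW'[OF F M.WF'[OF _ F order_refl], of _ 0 0 0]) simp
    moreover have "cst (e2 (?s / (?s + 1))) * (YE q (twS q (twB q ?S)) * ?l) = dB yp yp (twB q ?S)"
    proof -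
      have "cst (e2 (?s / (?s + 1))) * (cst (e2 ((?s + 1) / ?s)) * y) = y" for y :: "((ix2 \<times> ix2 \<times> nat) free_alg fls fls, ix2 \<times> ix2) sqm"
        using sum_nonzero by (simp flip: mult.assoc cst.hom_mult e2.hom_mult)
      moreover have "y * ?l * ?l = y" for y by (simp only: mult.assoc[of y] ll mult_1_right)
      ultimately show ?thesis unfolding YE_twS by (simp only: mult.assoc[of "cst _"])
    qed
    ultimately have d: "dB yp yp (twB q ?S) \<in> ents (lev (lev (\<lambda>_. rel_ideal (Y_rels \<epsilon>)))) 0" by simp
    have yy: "sbst id ym yp = fls_X_inv"
      using sbst_aff_aff[of 1 "- 1 / 2" 1 "1 / 2"] by (simp add: X_inv_aff)
    have "dB yp yp (twB q ?S) = map_sq (Sub2 yp yp) (dB fls_X_inv fls_X_inv (twB q ?S))"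
      by (rule Sub2_dB[symmetric]) (use aff_combination in auto)
    moreover have "Sub2 ym ym (Sub2 yp yp y) = y" for y :: "(ix2 \<times> ix2 \<times> nat) free_alg fls fls"
      by (rule Sub2_cancel[OF _ _ yy]) simp_all
    ultimately have "map_sq (Sub2 ym ym) (dB yp yp (twB q ?S)) = dB fls_X_inv fls_X_inv (twB q ?S)"
      by (simp only: map_sq_map_sq) (rule sqm_eqI, simp)
    moreover have "map_sq (Sub2 ym ym) (dB yp yp (twB q ?S)) \<in> ents (lev (lev (\<lambda>_. rel_ideal (Y_rels \<epsilon>)))) 0"
      by (rule ents_map_sq[OF d]) (rule A.Sub2_lev; simp)
    ultimately have D: "dB fls_X_inv fls_X_inv (twB q ?S) \<in> ents (lev (lev (\<lambda>_. rel_ideal (Y_rels \<epsilon>)))) 0" by simp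
    obtain \<alpha> \<beta> m n where "x = fls_nth (fls_nth (ent (dB fls_X_inv fls_X_inv ?B) \<alpha> \<beta>) m) n"
      using x unfolding B_rels_eq by blast
    then have "fext f x = fls_nth (fls_nth (ent (map_sq (fls_map (fls_map (fext f))) (dB fls_X_inv fls_X_inv ?B)) \<alpha> \<beta>) m) n"
      by simp
    then show "fext f x \<in> rel_ideal (Y_rels \<epsilon>)"
      using D unfolding hf.map_dB mf lev by (simp only: simp_thms)
  next
    fix y assume y: "y \<in> Y_rels \<epsilon>"
    interpret A: alg_filt "\<lambda>_. UNIV" "\<lambda>_. rel_ideal (B_rels q)" by (rule alg_filt_ideal)
    interpret M: filtered_pair "ents (lev (lev (\<lambda>_. UNIV)))" "ents (lev (lev (\<lambda>_. rel_ideal (B_rels q)))) :: int \<Rightarrow> ((ix2 \<times> ix2 \<times> nat) free_alg fls fls, ix2 \<times> ix2) sqm set"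
      by (rule A.f2.filtered_pair_ents)
    have "dB fls_X_inv fls_X_inv ?B \<in> ents (lev (lev (\<lambda>_. rel_ideal (B_rels q)))) 0"
      unfolding lev by (intro allI B_rel_mem)
    then have "dB yp yp ?B \<in> ents (lev (lev (\<lambda>_. rel_ideal (B_rels q)))) 0"
      by (rule A.dB_lev) simp_all
    then have "YE q (twS q ?B) \<in> ents (lev (lev (\<lambda>_. rel_ideal (B_rels q)))) 0"
      unfolding YE_twS by (rule M.FW'[OF F M.WF'[OF _ F order_refl], of _ 0 0 0]) simp
    moreover obtain \<alpha> \<beta> m n where "y = fls_nth (fls_nth (ent (YE q ?S) \<alpha> \<beta>) m) n"
      using y unfolding Y_rels_eq[OF q] by blast
    then have "fext f' y = fls_nth (fls_nth (ent (map_sq (fls_map (fls_map (fext f'))) (YE q ?S)) \<alpha> \<beta>) m) n"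
      by simp
    ultimately show "fext f' y \<in> rel_ideal (B_rels q)"
      unfolding hf'.map_YE mf' lev by (simp only: simp_thms)
  next
    fix z :: "ix2 \<times> ix2 \<times> nat"
    have "fext f' (f z) = fls_nth (ent (map_sq (fls_map (fext f')) (twB q ?S)) (fst z) (fst (snd z))) (int (Suc (snd (snd z))))"
      by (simp add: f_def from_matrix_def)
    then show "fext f' (f z) - gen z \<in> rel_ideal (B_rels q)"
      unfolding hf'.map_tw mf' twB_twS gen_nth[of z "B_lead q"] by simp
    have "fext f (f' z) = fls_nth (ent (map_sq (fls_map (fext f)) (twS q ?B)) (fst z) (fst (snd z))) (int (Suc (snd (snd z))))"
      by (simp add: f'_def from_matrix_def)
    then show "fext f (f' z) - gen z \<in> rel_ideal (Y_rels \<epsilon>)"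
      unfolding hf.map_tw mf twS_twB gen_nth[of z "mat 1"] by simp
  qed
qed

text \<open>K is the negative of the twist for q = 1; the two signs cancel in K_1 K_2.\<close>

lemma K1K2_twist: "q \<in> {0, 1} \<Longrightarrow> sq (((\<lambda>M. M ** K1K2) ^^ q) (mat 1)) = tn1 (twist q) * tn2 (twist q)"
proof -
  assume q: "q \<in> {0, 1}"
  have "sq (munit Pos2 Pos2 - munit Neg2 Neg2) = - (twist 1 :: (complex fls, ix2) sqm)"
  proof (rule sqm_eqI)
    fix i j show "ent (sq (munit Pos2 Pos2 - munit Neg2 Neg2)) i j = ent (- twist 1 :: (complex fls, ix2) sqm) i j"
      by (cases i; cases j) (simp_all add: munit_def twist_def)
  qed
  moreover have "tn1 (- A) = - tn1 A" "tn2 (- A) = - tn2 A" for A :: "(complex fls, ix2) sqm"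
    by (rule sqm_eqI, simp add: tn1_def tn2_def)+
  ultimately have "sq K1K2 = tn1 (twist 1) * tn2 (twist 1)"
    unfolding K1K2_def Let_def sq_mult sq_tens1 sq_tens2 by simp
  moreover have "twist 0 = (1 :: (complex fls, ix2) sqm)"
    by (rule sqm_eqI) (simp add: twist_def ent_one split: ix2.split)
  ultimately show ?thesis using q by (auto simp: sq_mult sq_mat_1 tn_one)
qed

text \<open>With w = -4u + 1 the scalar (w - 1)/w of \<open>ptrans_R2\<close> is 4u/(4u - 1), the
  explicit prefactor of the other assignment, and 1 - w = 4u. The parameters 2u - 1 and 2u are those
  of the fusion shifted by 1/2, and the twists cancel against the power of K_1 K_2.\<close>

lemma sq_phi_Y:
  assumes q: "q \<in> {0, 1}" "\<epsilon> = (if q = 0 then TMinus else TPlus)"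
  shows "sq (phi_Y q \<epsilon>) = fusedS (twB q (genm (mat 1)))"
proof -
  let ?S = "genm (mat 1) :: ((ix2 \<times> ix2 \<times> nat) free_alg fls, ix2) sqm"
  let ?A1 = "tn1 (at_par x1 (twB q ?S))" and ?A2 = "tn2 (at_par x2 (twB q ?S))"
  let ?l1 = "tn1 (twist q) :: ((ix2 \<times> ix2 \<times> nat) free_alg fls, ix2 \<times> ix2) sqm" and ?l2 = "tn2 (twist q) :: ((ix2 \<times> ix2 \<times> nat) free_alg fls, ix2 \<times> ix2) sqm"
  let ?R = "1 - cst (e1 (1 / aff 4 0)) * flip_sq :: ((ix2 \<times> ix2 \<times> nat) free_alg fls, ix2 \<times> ix2) sqm"
  let ?c = "cst (e1 (aff 4 0 / aff 4 (-1))) :: ((ix2 \<times> ix2 \<times> nat) free_alg fls, ix2 \<times> ix2) sqm"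
  have S: "tn1 (at_par (aff 2 (-1)) ?S) = ?A1 * ?l1" "tn2 (at_par w0 ?S) = ?A2 * ?l2"
    unfolding tn_mult[symmetric] by (simp_all add: twB_def at_par_twist twist_cancel)
  have nz: "- aff 4 (-1) \<noteq> 0" "1 - (- aff 4 (-1)) \<noteq> 0"
    using aff_nonzero[of 4] params(8) by simp_all
  have w: "(- aff 4 (-1) - 1) / (- aff 4 (-1)) = aff 4 0 / aff 4 (-1)"
    unfolding params(9) by simp
  have p: "map_sq e1 (sq (ptrans \<epsilon> (R2 (- 4 * fls_X_inv + 1)))) = ?c * (?l2 * ?R * ?l2)"
    unfolding params(7) ptrans_R2[OF nz q] w params(8) map_sq_e1_mult map_sq_cst[of e1, OF e1.hom_0]
      map_sq_tn2[of e1, OF e1.hom_0] map_twist[OF unital_hom_e1] map_sq_e1_R2 ..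
  have k: "map_sq e1 (sq (((\<lambda>M. M ** K1K2) ^^ q) (mat 1))) = ?l1 * ?l2"
    unfolding K1K2_twist[OF q(1)] map_sq_e1_mult map_sq_tn2[of e1, OF e1.hom_0] map_sq_tn1[of e1, OF e1.hom_0] map_twist[OF unital_hom_e1] ..
  have lc: "x * (?c * y) = ?c * (x * y)" for x y by (rule central_left_commute[OF central_cst[OF central_e1]])
  have R: "?l1 * ?l2 * ?R = ?R * (?l1 * ?l2)"
    unfolding right_diff_distrib left_diff_distrib central_left_commute[OF central_cst[OF central_e1]]
    by (simp add: twist_tn(4) mult.assoc[of "cst (e1 _)"])
  have ll: "?l1 * ?l2 * (?l1 * ?l2) = 1"
    by (rule involution_product[OF twist_tn(1-3)])
  have "?A1 * ?l1 * (?c * (?l2 * ?R * ?l2)) * (?A2 * ?l2) * (?l1 * ?l2) =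
      ?c * (?A1 * ?l1 * (?l2 * ?R * ?l2) * (?A2 * ?l2) * (?l1 * ?l2))"
    by (simp only: mult.assoc lc[of ?l1] lc[of ?A1])
  also have "\<dots> = ?c * (?A1 * ?R * ?A2)"
    unfolding twisted_products(1)[OF twist_tn(1-3) R twist_tn(5,6)] mult.assoc[of _ "?l1 * ?l2"] ll by simp
  finally have e: "?A1 * ?l1 * (?c * (?l2 * ?R * ?l2)) * (?A2 * ?l2) * (?l1 * ?l2) = ?c * fuse (twB q ?S)"
    by (simp only: fuse_def)
  have "sq (phi_Y q \<epsilon>) = kc.cmp (hsym * (?A1 * ?l1 * (?c * (?l2 * ?R * ?l2)) * (?A2 * ?l2) * (?l1 * ?l2)))"
    unfolding phi_Y_def Let_def sq_compress sq_mult sq_emb1 sq_tens1 sq_tens2 half_hsym p k params(1,6)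
    by (simp add: sq_at_param S mult.assoc)
  also have "\<dots> = fusedS (twB q ?S)"
    unfolding e cmp_hsym cmp_cst[OF central_e1] fusedS_def ..
  finally show ?thesis .
qed

theorem proposition4p7:
  fixes q :: nat and \<epsilon> :: tsign
  assumes "q \<in> {0, 1}"
    and "\<epsilon> = (if q = 0 then TMinus else TPlus)"
  shows "(\<exists>\<phi>. iso_with_values (X_rels q) (B_rels q) (X_gen_mat q) (phi_B q) \<phi>) \<and>
         (\<exists>\<phi>'. iso_with_values (X_rels q) (Y_rels \<epsilon>) (X_gen_mat q) (phi_Y q \<epsilon>) \<phi>')"
proof -
  define f where "f = from_matrix (fusedS (genm (B_lead q)))"
  define t where "t = from_matrix (twB q (genm (mat 1)))"
  note s = X_B_substitutions[OF assms(1), folded f_def]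
  note t = B_Y_iso[OF assms, folded t_def]
  interpret hf: scalar_hom "fext f" by (rule scalar_hom_fext)
  interpret ht: scalar_hom "fext t" by (rule scalar_hom_fext)
  obtain \<phi> where \<phi>: "algebra_iso (X_rels q) (B_rels q) \<phi>" "\<And>a. \<phi> (cls (X_rels q) a) = cls (B_rels q) (fext f a)"
    using algebra_iso_from_substitutions[OF s(1-4)] by blast
  obtain \<psi> where \<psi>: "algebra_iso (B_rels q) (Y_rels \<epsilon>) \<psi>" "\<And>a. \<psi> (cls (B_rels q) a) = cls (Y_rels \<epsilon>) (fext t a)"
    using t(1) by blast
  have "iso_with_values (X_rels q) (B_rels q) (X_gen_mat q) (phi_B q) \<phi>"
    by (rule iso_valuesI[OF \<phi>]) (simp_all add: s(5) sq_phi_B)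
  moreover have "iso_with_values (X_rels q) (Y_rels \<epsilon>) (X_gen_mat q) (phi_Y q \<epsilon>) (\<psi> \<circ> \<phi>)"
  proof (rule iso_valuesI[OF algebra_iso_trans[OF \<phi>(1) \<psi>(1)]])
    show "(\<psi> \<circ> \<phi>) (cls (X_rels q) a) = cls (Y_rels \<epsilon>) ((fext t \<circ> fext f) a)" for a
      by (simp add: \<phi>(2) \<psi>(2))
    have "map_sq (fls_map (fext t \<circ> fext f)) (genm (X_lead q)) = map_sq (fls_map (fext t)) (map_sq (fls_map (fext f)) (genm (X_lead q)))"
      by (rule sqm_eqI, rule fls_eqI) (simp add: fls_nth_fls_map)
    also have "\<dots> = sq (phi_Y q \<epsilon>)"
      unfolding s(5) ht.map_fusedS t(2) sq_phi_Y[OF assms] ..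
    finally show "map_sq (fls_map (fext t \<circ> fext f)) (genm (X_lead q)) = sq (phi_Y q \<epsilon>)" .
  qed simp
  ultimately show ?thesis by blast
qed

end
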